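(* Assume that $\nu_0$ is non-lattice a.s., that $\mathbb{E}|\mu_0|^\varepsilon<\infty$ for some $\varepsilon>0$, that $\mathbb{E}\sigma_0^2\in(0,\infty)$, and that $\mathbb{E}\frac{N}{m_0}(\log^+N)^\beta<\infty$ for some $\beta>\frac32$. Then for all real $a<b$, $$b_n\frac{Z_n(a+a_n,b+a_n)}{Z_n(\mathbb{R})}\to\frac1{\sqrt{2\pi}}(b-a)\quad\text{a.s. on }\{Z_n(\mathbb{R})\to\infty\},$$ where $a_n=\sum_{i=0}^{n-1}\mu_i$ and $b_n=\left(\sum_{i=0}^{n-1}\sigma_i^2\right)^{1/2}$.
   Context: Branching random walk in a random environment in time. Let $\xi=(\xi_n)_{n\ge 0}$ be a stationary and ergodic sequence of random variables with values in a measurable space $\Theta$; each realization of $\xi_n$ determines a probability distribution $\eta_n=\eta(\xi_n)$ on $\mathbb{N}\times\mathbb{R}\times\mathbb{R}\times\cdots$. Given $\xi$ (quenched law $\mathbb{P}_\xi$, expectation $\mathbb{E}_\xi$), let $X(u)=(N(u),L_1(u),L_2(u),\dots)$, indexed by finite sequences $u\in\{\emptyset\}\cup\bigcup_{n\ge1}\mathbb{N}^n$, be independent random vectors, $X(u)$ having law $\eta_n$ when the length $|u|$ equals $n$ (values $L_i(u)$ with $i>N(u)$ play no role). The initial particle $\emptyset$ is at $S_\emptyset=0$; each particle $u$ of generation $n$, located at $S_u$, is replaced by $N(u)$ particles $ui$ of generation $n+1$ located at $S_{ui}=S_u+L_i(u)$, $1\le i\le N(u)$. Let $\mathbb{T}_n$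 be the set of particles of generation $n$ and $Z_n=\sum_{u\in\mathbb{T}_n}\delta_{S_u}$ their counting measure; $Z_n(x,y)$ is the number of particles of generation $n$ in the interval $(x,y)$. The annealed law $\mathbb{P}$ (expectation $\mathbb{E}$) is $\mathbb{P}_\xi$ integrated against the law of $\xi$; "a.s." refers to $\mathbb{P}$. Write $N=N(\emptyset)$ and $m_n=\mathbb{E}_\xi N(u)$ for $|u|=n$. Standing assumption: $\mathbb{E}\log m_0\in(0,\infty)$ and $\mathbb{E}\frac{N}{m_0}\log^+N<\infty$. Notation: for $|u|=n$, $\nu_n(A)=\frac1{m_n}\mathbb{E}_\xi\sum_{i=1}^{N(u)}\mathbf{1}_{\{L_i(u)\in A\}}$ (a probability measure on $\mathbb{R}$ depending on $\xi_n$), $\mu_n=\int x\,\nu_n(dx)$ and $\sigma_n^2=\int(x-\mu_n)^2\nu_n(dx)$. A probability measure on $\mathbb{R}$ is non-lattice if it is not concentrated on any set $c+d\mathbb{Z}$, $c,d\in\mathbb{R}$. *)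

theory Defs
  imports "HOL-Probability.Probability"
begin

text \<open>A value of \<open>X(u) = (N(u), L\<^sub>1(u), L\<^sub>2(u), \<dots>)\<close> is a pair \<open>(N, L)\<close>.
  Children are numbered from 0: \<open>L i\<close> with \<open>i < N\<close> is the displacement of the child \<open>u @ [i]\<close>,
  so that the finite sequences indexing the particles are exactly the lists of naturals.\<close>

type_synonym offspring = "nat \<times> (nat \<Rightarrow> real)"

definition offspring_space :: "offspring measure" where
  "offspring_space = count_space UNIV \<Otimes>\<^sub>M PiM UNIV (\<lambda>_. borel)"

subsection \<open>The environment\<close>

abbreviation env_space :: "'e measure \<Rightarrow> (nat \<Rightarrow> 'e) measure" where
  "env_space \<Theta> \<equiv> PiM UNIV (\<lambda>_. \<Theta>)"

definition env_law :: "'w measure \<Rightarrow> 'e measure \<Rightarrow> (nat \<Rightarrow> 'w \<Rightarrow> 'e) \<Rightarrow> (nat \<Rightarrow> 'e) measure" where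
  "env_law M \<Theta> \<xi> = distr M (env_space \<Theta>) (\<lambda>\<omega> n. \<xi> n \<omega>)"

definition shift :: "(nat \<Rightarrow> 'e) \<Rightarrow> nat \<Rightarrow> 'e" where
  "shift x = (\<lambda>n. x (Suc n))"

definition stationary_seq :: "'w measure \<Rightarrow> 'e measure \<Rightarrow> (nat \<Rightarrow> 'w \<Rightarrow> 'e) \<Rightarrow> bool" where
  "stationary_seq M \<Theta> \<xi> \<longleftrightarrow> distr (env_law M \<Theta> \<xi>) (env_space \<Theta>) shift = env_law M \<Theta> \<xi>"

definition ergodic_seq :: "'w measure \<Rightarrow> 'e measure \<Rightarrow> (nat \<Rightarrow> 'w \<Rightarrow> 'e) \<Rightarrow> bool" where
  "ergodic_seq M \<Theta> \<xi> \<longleftrightarrow>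
     (\<forall>A\<in>sets (env_space \<Theta>). shift -` A \<inter> space (env_space \<Theta>) = A \<longrightarrow>
        measure (env_law M \<Theta> \<xi>) A \<in> {0, 1})"

subsection \<open>Branching random walk in a random environment in time\<close>

definition quenched_law :: "('e \<Rightarrow> offspring measure) \<Rightarrow> (nat \<Rightarrow> 'e) \<Rightarrow> (nat list \<Rightarrow> offspring) measure" where
  "quenched_law \<eta> x = PiM UNIV (\<lambda>u. \<eta> (x (length u)))"

text \<open>The measure \<open>M\<close> plays the role of the annealed law \<open>\<P>\<close>. The last assumption says that
  \<^const>\<open>quenched_law\<close> is the regular conditional law of the family \<open>X\<close> given \<open>\<xi>\<close>, i.e. that the
  joint law of \<open>(\<xi>, X)\<close> is the quenched law integrated against the law of \<open>\<xi>\<close>.\<close>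

locale brw_random_environment = prob_space M
  for M :: "'w measure" +
  fixes \<Theta> :: "'e measure"
    and \<eta> :: "'e \<Rightarrow> offspring measure"
    and \<xi> :: "nat \<Rightarrow> 'w \<Rightarrow> 'e"
    and X :: "nat list \<Rightarrow> 'w \<Rightarrow> offspring"
  assumes \<eta>_kernel: "\<eta> \<in> \<Theta> \<rightarrow>\<^sub>M prob_algebra offspring_space"
    and \<xi>_measurable: "\<xi> n \<in> M \<rightarrow>\<^sub>M \<Theta>"
    and \<xi>_stationary: "stationary_seq M \<Theta> \<xi>"
    and \<xi>_ergodic: "ergodic_seq M \<Theta> \<xi>"
    and X_measurable: "X u \<in> M \<rightarrow>\<^sub>M offspring_space"
    and conditional_law:
      "\<lbrakk>A \<in> sets (env_space \<Theta>); B \<in> sets (PiM UNIV (\<lambda>_::nat list. offspring_space))\<rbrakk> \<Longrightarrow>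
        emeasure M {\<omega> \<in> space M. (\<lambda>n. \<xi> n \<omega>) \<in> A \<and> (\<lambda>u. X u \<omega>) \<in> B}
          = (\<integral>\<^sup>+x\<in>A. emeasure (quenched_law \<eta> x) B \<partial>env_law M \<Theta> \<xi>)"

text \<open>The argument \<open>t\<close> of the following functions is a realization of the whole family \<open>(X(u))\<close>.\<close>

primrec particles :: "(nat list \<Rightarrow> offspring) \<Rightarrow> nat \<Rightarrow> nat list set" where
  "particles t 0 = {[]}"
| "particles t (Suc n) = {u @ [i] |u i. u \<in> particles t n \<and> i < fst (t u)}"

definition position :: "(nat list \<Rightarrow> offspring) \<Rightarrow> nat list \<Rightarrow> real" where
  "position t u = (\<Sum>k<length u. snd (t (take k u)) (u ! k))"

lemma position_Nil: "position t [] = 0"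
  by (simp add: position_def)

lemma position_snoc: "position t (u @ [i]) = position t u + snd (t u) i"
  by (simp add: position_def nth_append)

lemma finite_particles: "finite (particles t n)"
proof (induction n)
  case (Suc n)
  have "particles t (Suc n) = (\<Union>u\<in>particles t n. (\<lambda>i. u @ [i]) ` {..<fst (t u)})"
    by auto
  with Suc show ?case by simp
qed simp

definition Z :: "(nat list \<Rightarrow> offspring) \<Rightarrow> nat \<Rightarrow> real set \<Rightarrow> nat" where
  "Z t n A = card {u \<in> particles t n. position t u \<in> A}"

subsection \<open>Quantities attached to an offspring law\<close>

text \<open>These are functions of the law \<open>p = \<eta>\<^sub>n\<close>: under the quenched law, \<open>X(u)\<close> has law \<open>\<eta>\<^sub>n\<close> for
  \<open>|u| = n\<close>, so \<open>\<E>\<^sub>\<xi> f(X(u))\<close> is the integral of \<open>f\<close> with respect to \<open>\<eta>\<^sub>n\<close>.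
  The mean and the variance are \<open>[0,\<infinity>]\<close>-valued, so that an infinite value is not confused with 0.\<close>

definition mean_offspring :: "offspring measure \<Rightarrow> ennreal" where
  "mean_offspring p = (\<integral>\<^sup>+z. of_nat (fst z) \<partial>p)"

definition \<nu>_of :: "offspring measure \<Rightarrow> real measure" where
  "\<nu>_of p = measure_of UNIV (sets borel)
     (\<lambda>A. (\<integral>\<^sup>+z. (\<Sum>i<fst z. indicator A (snd z i)) \<partial>p) / mean_offspring p)"

text \<open>\<open>\<mu>_of p\<close> is 0 by convention if the identity is not integrable with respect to the probability
  measure \<open>\<nu>_of p\<close>; in that case \<open>\<sigma>2_of p = \<infinity>\<close>.\<close>

definition \<mu>_of :: "offspring measure \<Rightarrow> real" where
  "\<mu>_of p = (\<integral>x. x \<partial>\<nu>_of p)"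

definition \<sigma>2_of :: "offspring measure \<Rightarrow> ennreal" where
  "\<sigma>2_of p = (\<integral>\<^sup>+x. ennreal ((x - \<mu>_of p)\<^sup>2) \<partial>\<nu>_of p)"

definition non_lattice :: "real measure \<Rightarrow> bool" where
  "non_lattice \<nu> \<longleftrightarrow> \<not> (\<exists>c d :: real. AE x in \<nu>. \<exists>k::int. x = c + d * of_int k)"

definition centering :: "('e \<Rightarrow> offspring measure) \<Rightarrow> (nat \<Rightarrow> 'e) \<Rightarrow> nat \<Rightarrow> real" where
  "centering \<eta> x n = (\<Sum>i<n. \<mu>_of (\<eta> (x i)))"

definition scaling :: "('e \<Rightarrow> offspring measure) \<Rightarrow> (nat \<Rightarrow> 'e) \<Rightarrow> nat \<Rightarrow> real" where
  "scaling \<eta> x n = sqrt (\<Sum>i<n. enn2real (\<sigma>2_of (\<eta> (x i))))"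

definition log_plus :: "real \<Rightarrow> real" where
  "log_plus x = max 0 (ln x)"

lemma space_\<nu>_of [simp]: "space (\<nu>_of p) = UNIV"
  by (simp add: \<nu>_of_def space_measure_of_conv)

lemma sets_\<nu>_of [simp, measurable_cong]: "sets (\<nu>_of p) = sets borel"
  using sets.sigma_sets_eq[of "borel :: real measure"]
  by (simp add: \<nu>_of_def sets_measure_of_conv)

lemma measurable_offspring_sum:
  assumes [measurable]: "A \<in> sets borel"
  shows "(\<lambda>z. \<Sum>i<fst z. indicator A (snd z i) :: ennreal) \<in> borel_measurable offspring_space"
proof -
  have [measurable]: "fst \<in> offspring_space \<rightarrow>\<^sub>M count_space UNIV"
    unfolding offspring_space_def by measurable
  have [measurable]: "(\<lambda>z. snd z i) \<in> borel_measurable offspring_space" for i :: nat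
    unfolding offspring_space_def by measurable
  show ?thesis
    by (rule measurable_compose_countable[where f = "\<lambda>n z. \<Sum>i<n. indicator A (snd z i)" and g = fst])
       measurable
qed

lemma emeasure_\<nu>_of:
  assumes p: "sets p = sets offspring_space" and A: "A \<in> sets borel"
  shows "emeasure (\<nu>_of p) A
    = (\<integral>\<^sup>+z. (\<Sum>i<fst z. indicator A (snd z i)) \<partial>p) / mean_offspring p"
proof -
  let ?F = "\<lambda>A. (\<integral>\<^sup>+z. (\<Sum>i<fst z. indicator A (snd z i)) \<partial>p) / mean_offspring p"
  have "countably_additive (sets borel) ?F"
  proof (rule countably_additiveI)
    fix B :: "nat \<Rightarrow> real set"
    assume B: "range B \<subseteq> sets borel" "disjoint_family B"
    have meas: "(\<lambda>z. \<Sum>i<fst z. indicator (B j) (snd z i) :: ennreal) \<in> borel_measurable p" for j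
      using measurable_offspring_sum[of "B j"] B(1) measurable_cong_sets[OF p refl] by blast
    have "(\<Sum>j. \<integral>\<^sup>+z. (\<Sum>i<fst z. indicator (B j) (snd z i)) \<partial>p)
        = (\<integral>\<^sup>+z. (\<Sum>j. \<Sum>i<fst z. indicator (B j) (snd z i)) \<partial>p)"
      using meas by (rule nn_integral_suminf[symmetric])
    also have "\<dots> = (\<integral>\<^sup>+z. (\<Sum>i<fst z. indicator (\<Union>j. B j) (snd z i)) \<partial>p)"
      by (simp add: suminf_sum suminf_indicator[OF B(2)])
    finally show "(\<Sum>j. ?F (B j)) = ?F (\<Union>j. B j)"
      by (simp add: divide_ennreal_def)
  qed
  then show ?thesis
    using A sets.sigma_sets_eq[of "borel :: real measure"]
    by (intro emeasure_measure_of[OF \<nu>_of_def]) (auto simp: positive_def)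
qed

lemma prob_space_\<nu>_of:
  assumes "sets p = sets offspring_space" "mean_offspring p \<noteq> 0" "mean_offspring p \<noteq> \<infinity>"
  shows "prob_space (\<nu>_of p)"
proof
  have "(\<integral>\<^sup>+z. (\<Sum>i<fst z. indicator UNIV (snd z i)) \<partial>p) = mean_offspring p"
    by (simp add: mean_offspring_def)
  then show "emeasure (\<nu>_of p) (space (\<nu>_of p)) = 1"
    using assms by (simp add: emeasure_\<nu>_of ennreal_divide_self top.not_eq_extremum)
qed

end

(*
  Fix the environment and let P_n = m_0 ... m_(n-1), W_n = Z_n(R) / P_n.  Put k = n^a with
  a < 1 (rounded down to a power of two).  Conditioning on generation k splits the count into a
  sum over the particles u of generation k of the probability that a walk with independent steps
  nu_k, ..., nu_(n-1), started at S_u, hits the interval.  The local limit theorem for that walk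
  (Breiman's argument: a Fejer kernel and Levy's continuity theorem) replaces each probability by
  (b - a) / (b_n sqrt(2 pi)) for the particles with |S_u - a_k| << sqrt n, and these are almost
  all particles, since the mean square displacement in generation k is of order k = o(n).

  The conditioning error is a sum over j in [k, n) of martingale increments.  Truncating N(u) at
  exp(c j), the truncated increments have exponentially small second moments, and the remainder
  has mean d_j = E_xi[N/m_j; N > exp(c j)].  As sqrt n <= const * j^(beta-1) for j >= k, the error
  times sqrt n vanishes because sum_j j^(beta-1) d_j < oo, which is the moment condition of
  order beta; beta > 3/2 is what allows a < 1.

  The same decomposition with constant test function gives the convergence of W_n.  Restarted from
  a generation k with Z_k >= K it bounds P_xi(W = 0, Z_k >= K) by eps + C / sqrt K for infinitely
  many k (by recurrence of the environment), hence W > 0 on the event that Z_n tends to infinity.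
*)

theory Submission
  imports Defs "HOL-Real_Asymp.Real_Asymp"
begin

section \<open>The Fejer kernel\<close>

text \<open>The Fejer kernel is chosen because its Fourier transform is a tent supported in
  \<open>[-1, 1]\<close>. Hence characteristic functions enter only on bounded intervals, where the
  non-lattice condition gives decay; at infinity none can be expected, since the step laws may be
  discrete. The rate of this decay has no positive lower bound common to all environments, but it is
  almost surely positive, and the ergodic theorem bounds its averages over the generations from
  below. The exponent is a = 1 / (2 (\<beta> - 1)), the smallest one for which sqrt n is at most a
  constant times k^(\<beta> - 1). The test functions, which are hitting probabilities, change with
  n, so no single martingale is followed as n grows. All errors are bounded in mean and summed
  instead. The truncated part is summed over n as well as over j, which its exponential smallness in
  j permits. The remainder is not that small, but its bound does not involve the test function and
  hence not n, so one series in j serves all n.\<close>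

definition tri :: "real \<Rightarrow> real" where "tri t = max 0 (1 - \<bar>t\<bar>)"

text \<open>Away from 0 this is \<open>(sin (s / 2) / (s / 2))\<^sup>2\<close>, and 1 is the limit
  at 0. It is the Fourier transform of \<open>tri\<close>, and \<open>fejer s / (2 * pi)\<close> is
  a probability density.\<close>

definition fejer :: "real \<Rightarrow> real" where
  "fejer s = (if s = 0 then 1 else 2 * (1 - cos s) / s\<^sup>2)"

lemma tri_nonneg: "0 \<le> tri t" and tri_le_1: "tri t \<le> 1"
  and tri_eq_0: "1 \<le> \<bar>t\<bar> \<Longrightarrow> tri t = 0" and tri_minus: "tri (- t) = tri t"
  by (auto simp: tri_def)

lemma borel_measurable_tri [measurable]: "tri \<in> borel_measurable borel"
  unfolding tri_def by measurable

lemma borel_measurable_fejer [measurable]: "fejer \<in> borel_measurable borel"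
  unfolding fejer_def by measurable

lemma fejer_nonneg: "0 \<le> fejer s"
  by (auto simp: fejer_def)

text \<open>The zeros of \<open>1 - cos s\<close> closest to 0, apart from 0 itself, are at distance
  \<open>2 * pi\<close>. On this interval the kernel can later be divided out.\<close>

lemma fejer_pos: "\<bar>s\<bar> < 2 * pi \<Longrightarrow> 0 < fejer s"
proof -
  assume s: "\<bar>s\<bar> < 2 * pi"
  have "cos s \<noteq> 1" if "s \<noteq> 0"
  proof
    assume "cos s = 1"
    then obtain n :: int where "s = of_int n * 2 * pi"
      by (auto simp: cos_one_2pi_int)
    with s that show False
      by (auto simp: abs_mult)
  qed
  then show ?thesis
    by (auto simp: fejer_def intro!: divide_pos_pos) (metis cos_le_one less_eq_real_def)
qed

lemma isCont_fejer: "s \<noteq> 0 \<Longrightarrow> isCont fejer s"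
proof -
  assume s: "s \<noteq> 0"
  have "isCont (\<lambda>s::real. 2 * (1 - cos s) / s\<^sup>2) s"
    using s by (intro continuous_intros) auto
  moreover have "eventually (\<lambda>s. fejer s = 2 * (1 - cos s) / s\<^sup>2) (nhds s)"
    using t1_space_nhds[OF s] by eventually_elim (simp add: fejer_def)
  ultimately show ?thesis by (simp add: isCont_cong)
qed

lemma integrable_tri_iexp: "integrable lborel (\<lambda>t. of_real (tri t) * iexp (t * s))"
proof (rule Bochner_Integration.integrable_bound)
  show "integrable lborel (indicator {-1..1::real} :: real \<Rightarrow> real)" by simp
qed (auto simp: norm_mult tri_def indicator_def)

lemma integral_tri_iexp: "(CLINT t|lborel. of_real (tri t) * iexp (t * s)) = of_real (fejer s)"
proof (cases "s = 0")
  case True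
  have 1: "(LINT t|lborel. indicator {0..1} t *\<^sub>R (1 - t)) = (1 - 1\<^sup>2/2) - (0 - 0\<^sup>2/2 :: real)"
    by (rule integral_FTC_Icc[where F="\<lambda>t. t - t\<^sup>2/2"])
       (auto intro!: derivative_eq_intros continuous_intros simp: has_real_derivative_iff_has_vector_derivative[symmetric])
  have 2: "(LINT t|lborel. indicator {-1..0} t *\<^sub>R (1 + t)) = (0 + 0\<^sup>2/2) - (-1 + (-1)\<^sup>2/2 :: real)"
    by (rule integral_FTC_Icc[where F="\<lambda>t. t + t\<^sup>2/2"])
       (auto intro!: derivative_eq_intros continuous_intros simp: has_real_derivative_iff_has_vector_derivative[symmetric])
  \<comment> \<open>The two closed halves overlap at 0, where the right-hand side is 2 and the tent
    is 1; this single point is a null set.\<close>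
  have "(LINT t|lborel. tri t) = (LINT t|lborel. indicator {0..1} t *\<^sub>R (1 - t) + indicator {-1..0} t *\<^sub>R (1 + t))"
    by (rule integral_cong_AE)
      (use AE_lborel_singleton[of 0] in \<open>auto simp: tri_def indicator_def elim!: eventually_mono\<close>)
  also have "\<dots> = 1"
  proof -
    have "set_integrable lborel {0..1} (\<lambda>t::real. 1 - t)" "set_integrable lborel {-1..0} (\<lambda>t::real. 1 + t)"
      by (auto intro!: borel_integrable_atLeastAtMost' continuous_intros)
    then show ?thesis
      using 1 2 unfolding set_integrable_def by (subst Bochner_Integration.integral_add) auto
  qed
  finally show ?thesis
    using True by (simp add: fejer_def integral_complex_of_real)
next
  case s: False
  let ?c = "- 1 / (of_real s)\<^sup>2 :: complex"
  \<comment> \<open>Antiderivatives on the right and the left half of the tent, found by parts; the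
    slope of the tent changes sign at 0, and so does the term with \<open>?c\<close>.\<close>
  let ?G = "\<lambda>t. of_real (1 - t) * iexp (t * s) / (\<i> * s) + ?c * iexp (t * s)"
  let ?H = "\<lambda>t. of_real (1 + t) * iexp (t * s) / (\<i> * s) - ?c * iexp (t * s)"
  have 1: "(CLINT t|lborel. indicator {0..1} t *\<^sub>R (of_real (1 - t) * iexp (t * s))) = ?G 1 - ?G 0"
  proof (rule integral_FTC_Icc)
    fix t :: real
    have "((\<lambda>z. (1 - z) * exp (\<i> * (z * s)) / (\<i> * s) + ?c * exp (\<i> * (z * s))) has_field_derivative
        (1 - of_real t) * exp (\<i> * (of_real t * s))) (at (of_real t))"
      using s by (auto intro!: derivative_eq_intros simp: field_simps power2_eq_square)
    from has_vector_derivative_real_field[OF this, of "{0..1}"]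
    show "(?G has_vector_derivative of_real (1 - t) * iexp (t * s)) (at t within {0..1})"
      by simp
  qed (auto intro!: continuous_intros)
  have 2: "(CLINT t|lborel. indicator {-1..0} t *\<^sub>R (of_real (1 + t) * iexp (t * s))) = ?H 0 - ?H (-1)"
  proof (rule integral_FTC_Icc)
    fix t :: real
    have "((\<lambda>z. (1 + z) * exp (\<i> * (z * s)) / (\<i> * s) - ?c * exp (\<i> * (z * s))) has_field_derivative
        (1 + of_real t) * exp (\<i> * (of_real t * s))) (at (of_real t))"
      using s by (auto intro!: derivative_eq_intros simp: field_simps power2_eq_square)
    from has_vector_derivative_real_field[OF this, of "{-1..0}"]
    show "(?H has_vector_derivative of_real (1 + t) * iexp (t * s)) (at t within {-1..0})"
      by simp
  qed (auto intro!: continuous_intros)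
  have "(CLINT t|lborel. of_real (tri t) * iexp (t * s)) =
     (CLINT t|lborel. indicator {0..1} t *\<^sub>R (of_real (1 - t) * iexp (t * s)) +
        indicator {-1..0} t *\<^sub>R (of_real (1 + t) * iexp (t * s)))"
    by (rule integral_cong_AE)
      (use AE_lborel_singleton[of 0] in \<open>auto simp: tri_def indicator_def elim!: eventually_mono\<close>)
  also have "\<dots> = ?G 1 - ?G 0 + (?H 0 - ?H (-1))"
    unfolding 1[symmetric] 2[symmetric]
    by (intro Bochner_Integration.integral_add)
      (auto intro!: borel_integrable_atLeastAtMost' continuous_intros simp flip: set_integrable_def)
  also have "\<dots> = ?c * (iexp s + iexp (-s) - 2)"
    by (simp add: algebra_simps)
  also have "iexp s + iexp (-s) = 2 * cos (of_real s)"
    by (simp add: cos_exp_eq)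
  also have "?c * (2 * cos (of_real s) - 2) = of_real (fejer s)"
    using s by (simp add: fejer_def cos_of_real field_simps)
  finally show ?thesis .
qed

text \<open>A Fourier transform is bounded by the integral of the modulus of the transformed
  function; for the tent this is 1, the value of the transform at 0.\<close>

lemma fejer_le_1: "fejer s \<le> 1"
proof -
  have "\<bar>fejer s\<bar> = norm (CLINT t|lborel. of_real (tri t) * iexp (t * s))"
    by (simp only: integral_tri_iexp norm_of_real)
  also have "\<dots> \<le> (LINT t|lborel. norm (of_real (tri t) * iexp (t * s)))"
    by (rule integral_norm_bound)
  also have "\<dots> = (LINT t|lborel. tri t)"
    by (simp add: norm_mult tri_nonneg)
  also have "\<dots> = 1"
  proof -
    have "complex_of_real (LINT t|lborel. tri t) = of_real 1"
      using integral_tri_iexp[of 0] by (simp add: fejer_def)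
    then show ?thesis by (simp only: of_real_eq_iff)
  qed
  finally show ?thesis by simp
qed

text \<open>A majorant of Cauchy type, for integrability. The constant is 4 + 1:
  \<open>2 * (1 - cos s)\<close> is at most 4 and \<open>fejer s\<close> at most 1.\<close>

lemma fejer_le_Cauchy: "fejer s \<le> 5 * inverse (1 + s\<^sup>2)"
proof -
  have "fejer s * s\<^sup>2 \<le> 4" 
  proof (cases "s = 0")
    case False
    then have "fejer s * s\<^sup>2 = 2 * (1 - cos s)" by (simp add: fejer_def)
    moreover have "2 * (1 - c) \<le> 4" if "- 1 \<le> c" for c :: real using that by simp
    then have "2 * (1 - cos s) \<le> 4" using cos_ge_minus_one by blast
    ultimately show ?thesis by (simp only:)
  qed simp
  then have "fejer s * (1 + s\<^sup>2) \<le> 5" using fejer_le_1[of s] by (simp add: algebra_simps)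
  moreover have "0 < 1 + s\<^sup>2" by (simp add: add_pos_nonneg)
  ultimately show ?thesis by (simp add: field_simps)
qed

lemma integrable_fejer: "integrable lborel fejer"
proof (rule Bochner_Integration.integrable_bound)
  show "integrable lborel (\<lambda>x::real. 5 * inverse (1 + x\<^sup>2))"
    using integrable_inverse_1_plus_square by (simp add: set_integrable_def)
qed (use fejer_le_Cauchy fejer_nonneg in \<open>auto simp: abs_of_nonneg intro!: AE_I2 order_trans[OF _ abs_ge_self]\<close>)

text \<open>Parseval's identity, by Fubini. Smoothing with the kernel sees the characteristic
  function only within distance 1 of the frequency \<theta>.\<close>

lemma (in real_distribution) expectation_fejer_iexp:
  "(CLINT y|M. of_real (fejer y) * iexp (\<theta> * y)) = (CLINT t|lborel. of_real (tri t) * char M (t + \<theta>))"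
proof -
  interpret P: pair_sigma_finite M lborel ..
  let ?f = "\<lambda>y t. of_real (tri t) * iexp ((t + \<theta>) * y) :: complex"
  have "(CLINT y|M. of_real (fejer y) * iexp (\<theta> * y)) = (CLINT y|M. CLINT t|lborel. ?f y t)"
  proof (rule Bochner_Integration.integral_cong[OF refl])
    fix y
    have "of_real (fejer y) * iexp (\<theta> * y) = (CLINT t|lborel. of_real (tri t) * iexp (t * y)) * iexp (\<theta> * y)"
      by (simp only: integral_tri_iexp)
    also have "\<dots> = (CLINT t|lborel. of_real (tri t) * iexp (t * y) * iexp (\<theta> * y))"
      by (rule integral_mult_left_zero[symmetric])
    also have "\<dots> = (CLINT t|lborel. ?f y t)"
      by (simp add: algebra_simps exp_add)
    finally show "of_real (fejer y) * iexp (\<theta> * y) = (CLINT t|lborel. ?f y t)" .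
  qed
  also have "\<dots> = (CLINT t|lborel. CLINT y|M. ?f y t)"
  proof (rule P.Fubini_integral[symmetric])
    have "integrable (M \<Otimes>\<^sub>M lborel) (\<lambda>(y,t). of_real (tri t) * iexp ((t + \<theta>) * y))"
    proof (rule P.Fubini_integrable)
      have "(LINT t|lborel. norm (?f y t)) = (LINT t|lborel. tri t)" for y
        by (simp add: norm_mult tri_nonneg)
      then show "integrable M (\<lambda>y. LINT t|lborel. norm (case (y,t) of (y, t) \<Rightarrow> ?f y t))"
        by simp
      show "AE y in M. integrable lborel (\<lambda>t. case (y,t) of (y, t) \<Rightarrow> ?f y t)"
      proof (rule AE_I2)
        fix y
        have "integrable lborel (\<lambda>t. of_real (tri t) * iexp (t * y) * iexp (\<theta> * y))"
          by (intro integrable_mult_left integrable_tri_iexp)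
        then show "integrable lborel (\<lambda>t. case (y,t) of (y, t) \<Rightarrow> ?f y t)"
          by (simp add: algebra_simps exp_add)
      qed
    qed measurable
    then show "integrable (M \<Otimes>\<^sub>M lborel) (\<lambda>(y,t). ?f y t)" by simp
  qed
  also have "\<dots> = (CLINT t|lborel. of_real (tri t) * char M (t + \<theta>))"
    by (simp add: char_def)
  finally show ?thesis .
qed

section \<open>Gaussian asymptotics of smoothed laws and Fourier inversion of the kernel\<close>

lemma integral_exp_minus_square:
  assumes "c > 0"
  shows "integrable lborel (\<lambda>x. exp (- c * x\<^sup>2))" "(LINT x|lborel. exp (- c * x\<^sup>2)) = sqrt (pi / c)"
proof -
  have eq: "sqrt (pi / c) * normal_density 0 (1 / sqrt (2 * c)) x = exp (- c * x\<^sup>2)" for x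
    using assms by (auto simp: normal_density_def power_divide field_simps real_sqrt_divide fun_eq_iff real_sqrt_mult)
  show "integrable lborel (\<lambda>x. exp (- c * x\<^sup>2))" "(LINT x|lborel. exp (- c * x\<^sup>2)) = sqrt (pi / c)"
    unfolding eq[symmetric] using assms by auto
qed

text \<open>The substitution \<open>t = s / r n - \<theta>\<close> in Parseval's identity absorbs
  the factor \<open>r n\<close>, and dominated convergence applies. The tent forces the argument
  \<open>s / r n\<close> to have modulus at most \<open>1 + \<bar>\<theta>\<bar>\<close>, and there
  \<open>dom\<close> is a Gaussian majorant in \<open>s\<close>. What remains is the Gaussian
  integral times the tent at \<theta>.\<close>

lemma local_limit_smooth:
  fixes Y :: "nat \<Rightarrow> real measure" and r :: "nat \<Rightarrow> real"
  assumes rd: "\<And>n. real_distribution (Y n)"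
    and r: "filterlim r at_top sequentially"
    and \<sigma>: "\<sigma> > 0"
    and dom: "\<And>R. R > 0 \<Longrightarrow> \<exists>c>0. \<forall>\<^sub>F n in sequentially. \<forall>t. \<bar>t\<bar> \<le> R \<longrightarrow> cmod (char (Y n) t) \<le> exp (- c * (r n)\<^sup>2 * t\<^sup>2)"
    and lim: "\<And>s. (\<lambda>n. char (Y n) (s / r n)) \<longlonglongrightarrow> of_real (exp (- (\<sigma> * s)\<^sup>2 / 2))"
  shows "(\<lambda>n. of_real (r n) * (CLINT y|Y n. of_real (fejer y) * iexp (\<theta> * y))) \<longlonglongrightarrow> of_real (tri \<theta> * (sqrt (2 * pi) / \<sigma>))"
proof -
  interpret real_distribution "Y n" for n by fact
  let ?R = "1 + \<bar>\<theta>\<bar>"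
  obtain c where c: "c > 0" and c2: "\<forall>\<^sub>F n in sequentially. \<forall>t. \<bar>t\<bar> \<le> ?R \<longrightarrow> cmod (char (Y n) t) \<le> exp (- c * (r n)\<^sup>2 * t\<^sup>2)"
    using dom[of ?R] by (meson add_pos_nonneg abs_ge_zero zero_less_one)
  have "\<forall>\<^sub>F n in sequentially. r n > 0"
    using r by (simp add: filterlim_at_top_dense)
  with c2 have "\<forall>\<^sub>F n in sequentially. r n > 0 \<and> (\<forall>t. \<bar>t\<bar> \<le> ?R \<longrightarrow> cmod (char (Y n) t) \<le> exp (- c * (r n)\<^sup>2 * t\<^sup>2))"
    by eventually_elim auto
  then obtain n0 where n0: "\<And>n. n \<ge> n0 \<Longrightarrow> r n > 0"
    "\<And>n t. n \<ge> n0 \<Longrightarrow> \<bar>t\<bar> \<le> ?R \<Longrightarrow> cmod (char (Y n) t) \<le> exp (- c * (r n)\<^sup>2 * t\<^sup>2)"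
    unfolding eventually_sequentially by blast
  have eq: "of_real (r n) * (CLINT y|Y n. of_real (fejer y) * iexp (\<theta> * y))
      = (CLINT s|lborel. of_real (tri (s / r n - \<theta>)) * char (Y n) (s / r n))" if "n \<ge> n0" for n
    unfolding expectation_fejer_iexp
    using n0(1)[OF that]
    by (subst lborel_integral_real_affine[where c="1 / r n" and t="-\<theta>"]) (auto simp: scaleR_conv_of_real)
  let ?g = "\<lambda>n s. of_real (tri (s / r (n + n0) - \<theta>)) * char (Y (n + n0)) (s / r (n + n0))"
  have "(\<lambda>n. CLINT s|lborel. ?g n s) \<longlonglongrightarrow> (CLINT s|lborel. of_real (tri (0 - \<theta>) * exp (- (\<sigma> * s)\<^sup>2 / 2)))"
  proof (rule integral_dominated_convergence)
    show "integrable lborel (\<lambda>x. exp (- c * x\<^sup>2))" by (rule integral_exp_minus_square[OF c])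
    show "AE s in lborel. (\<lambda>n. ?g n s) \<longlonglongrightarrow> of_real (tri (0 - \<theta>) * exp (- (\<sigma> * s)\<^sup>2 / 2))"
    proof (rule AE_I2)
      fix s
      have "(\<lambda>n. s / r n) \<longlonglongrightarrow> 0"
        by (rule real_tendsto_divide_at_top[OF tendsto_const r])
      then have "(\<lambda>n. tri (s / r n - \<theta>)) \<longlonglongrightarrow> tri (0 - \<theta>)"
        unfolding tri_def by (intro tendsto_intros)
      then have "(\<lambda>n. of_real (tri (s / r n - \<theta>)) * char (Y n) (s / r n)) \<longlonglongrightarrow> of_real (tri (0 - \<theta>)) * of_real (exp (- (\<sigma> * s)\<^sup>2 / 2))"
        by (intro tendsto_mult tendsto_of_real lim)
      then show "(\<lambda>n. ?g n s) \<longlonglongrightarrow> of_real (tri (0 - \<theta>) * exp (- (\<sigma> * s)\<^sup>2 / 2))"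
        by (auto dest: LIMSEQ_ignore_initial_segment[where k=n0])
    qed
    fix n
    show "AE s in lborel. norm (?g n s) \<le> exp (- c * s\<^sup>2)"
    proof (rule AE_I2)
      fix s
      let ?t = "s / r (n + n0)"
      have rp: "r (n + n0) > 0" by (rule n0) simp
      show "norm (?g n s) \<le> exp (- c * s\<^sup>2)"
      proof (cases "\<bar>?t\<bar> \<le> ?R")
        case True
        then have "cmod (char (Y (n + n0)) ?t) \<le> exp (- c * (r (n + n0))\<^sup>2 * ?t\<^sup>2)"
          by (intro n0(2)) auto
        also have "(r (n + n0))\<^sup>2 * ?t\<^sup>2 = s\<^sup>2" using rp by (simp add: power_divide)
        then have "- c * (r (n + n0))\<^sup>2 * ?t\<^sup>2 = - c * s\<^sup>2" by (simp add: mult.assoc)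
        finally have "cmod (char (Y (n + n0)) ?t) \<le> exp (- c * s\<^sup>2)" .
        then show ?thesis
          using mult_mono[OF tri_le_1[of "?t - \<theta>"], of "cmod (char (Y (n + n0)) ?t)" "exp (- c * s\<^sup>2)"]
          by (simp add: norm_mult tri_nonneg)
      next
        case False
        then have "tri (?t - \<theta>) = 0" by (intro tri_eq_0) auto
        then show ?thesis by simp
      qed
    qed
  qed measurable
  also have "(CLINT s|lborel. of_real (tri (0 - \<theta>) * exp (- (\<sigma> * s)\<^sup>2 / 2)) :: complex) = of_real (tri \<theta> * (sqrt (2 * pi) / \<sigma>))"
  proof -
    have "(LINT s|lborel. exp (- (\<sigma> * s)\<^sup>2 / 2)) = (LINT s|lborel. exp (- (\<sigma>\<^sup>2 / 2) * s\<^sup>2))"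
      by (simp add: power_mult_distrib)
    also have "\<dots> = sqrt (pi / (\<sigma>\<^sup>2 / 2))"
      using \<sigma> by (intro integral_exp_minus_square) simp
    also have "pi / (\<sigma>\<^sup>2 / 2) = 2 * pi / \<sigma>\<^sup>2" by simp
    finally have "(LINT s|lborel. exp (- (\<sigma> * s)\<^sup>2 / 2)) = sqrt (2 * pi) / \<sigma>"
      using \<sigma> by (simp add: real_sqrt_divide)
    then show ?thesis
      unfolding integral_complex_of_real by (simp add: tri_minus)
  qed
  finally have "(\<lambda>n. of_real (r (n + n0)) * (CLINT y|Y (n + n0). of_real (fejer y) * iexp (\<theta> * y))) \<longlonglongrightarrow> of_real (tri \<theta> * (sqrt (2 * pi) / \<sigma>))"
    by (simp only: eq[OF le_add2])
  then show ?thesis by (rule LIMSEQ_offset)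
qed


text \<open>The inversion formula is obtained without computing an improper integral: both sides are
  the limit of \<open>n * E (fejer Y\<^sub>n * exp (i \<theta> Y\<^sub>n))\<close> for \<open>Y\<^sub>n\<close> normal with standard deviation \<open>n\<close>.\<close>

lemma integral_fejer_iexp: "(CLINT y|lborel. of_real (fejer y) * iexp (\<theta> * y)) = of_real (2 * pi * tri \<theta>)"
proof -
  define Y where "Y n = distr std_normal_distribution borel (\<lambda>x. real n * x)" for n
  have rd: "real_distribution (Y n)" for n
    unfolding Y_def by (intro prob_space.real_distribution_distr prob_space_normal_density) auto
  have ch: "char (Y n) t = exp (- (real n * t)\<^sup>2 / 2)" for n t
  proof -
    have "char (Y n) t = char std_normal_distribution (real n * t)"
      unfolding Y_def char_def by (subst integral_distr) (auto simp: mult_ac)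
    then show ?thesis by (simp add: char_std_normal_distribution)
  qed
  have "(\<lambda>n. of_real (real n) * (CLINT y|Y n. of_real (fejer y) * iexp (\<theta> * y))) \<longlonglongrightarrow> of_real (tri \<theta> * (sqrt (2 * pi) / 1))"
  proof (rule local_limit_smooth[OF rd])
    fix R :: real
    show "\<exists>c>0. \<forall>\<^sub>F n in sequentially. \<forall>t. \<bar>t\<bar> \<le> R \<longrightarrow> cmod (char (Y n) t) \<le> exp (- c * (real n)\<^sup>2 * t\<^sup>2)"
      by (intro exI[of _ "1/2"]) (auto simp: ch power_mult_distrib)
  next
    fix s :: real
    have "\<forall>\<^sub>F n in sequentially. char (Y n) (s / real n) = of_real (exp (- (1 * s)\<^sup>2 / 2))"
      using eventually_gt_at_top[of 0] by eventually_elim (simp add: ch)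
    then show "(\<lambda>n. char (Y n) (s / real n)) \<longlonglongrightarrow> of_real (exp (- (1 * s)\<^sup>2 / 2))"
      by (rule tendsto_eventually)
  qed (auto simp: filterlim_real_sequentially)
  moreover have "(\<lambda>n. of_real (real n) * (CLINT y|Y n. of_real (fejer y) * iexp (\<theta> * y))) \<longlonglongrightarrow>
      (CLINT y|lborel. of_real (fejer y / sqrt (2 * pi)) * iexp (\<theta> * y))"
  \<comment> \<open>The index is shifted by 1 because \<open>Y 0\<close> is a point mass and has no
    density.\<close>
  proof (rule LIMSEQ_offset)
    have eq: "of_real (real (n + 1)) * (CLINT y|Y (n + 1). of_real (fejer y) * iexp (\<theta> * y)) =
      (CLINT y|lborel. of_real (std_normal_density (y / real (n + 1)) * fejer y) * iexp (\<theta> * y))" for n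
    proof -
      have "(CLINT y|Y (n + 1). of_real (fejer y) * iexp (\<theta> * y)) =
        (CLINT x|lborel. of_real (std_normal_density x * fejer (real (n + 1) * x)) * iexp (\<theta> * (real (n + 1) * x)))"
        unfolding Y_def by (subst integral_distr, simp_all) (subst integral_density, auto simp: scaleR_conv_of_real mult_ac)
      then show ?thesis
        by (subst lborel_integral_real_affine[where c="real (n + 1)" and t=0]) (auto simp: scaleR_conv_of_real)
    qed
    show "(\<lambda>n. of_real (real (n + 1)) * (CLINT y|Y (n + 1). of_real (fejer y) * iexp (\<theta> * y))) \<longlonglongrightarrow>
      (CLINT y|lborel. of_real (fejer y / sqrt (2 * pi)) * iexp (\<theta> * y))"
      unfolding eq
    proof (rule integral_dominated_convergence)
      show "integrable lborel fejer" by (rule integrable_fejer)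
      show "AE y in lborel. (\<lambda>n. of_real (std_normal_density (y / real (n + 1)) * fejer y) * iexp (\<theta> * y))
         \<longlonglongrightarrow> of_real (fejer y / sqrt (2 * pi)) * iexp (\<theta> * y)"
      proof (rule AE_I2)
        fix y
        have "(\<lambda>n. y / real (n + 1)) \<longlonglongrightarrow> 0"
          using LIMSEQ_Suc[OF lim_const_over_n[of y]] by simp
        then have "(\<lambda>n. std_normal_density (y / real (n + 1))) \<longlonglongrightarrow> std_normal_density 0"
          unfolding std_normal_density_def by (intro tendsto_intros) auto
        then have "(\<lambda>n. of_real (std_normal_density (y / real (n + 1)) * fejer y) * iexp (\<theta> * y))
         \<longlonglongrightarrow> of_real (std_normal_density 0 * fejer y) * iexp (\<theta> * y)"
          by (intro tendsto_intros)
        then show "(\<lambda>n. of_real (std_normal_density (y / real (n + 1)) * fejer y) * iexp (\<theta> * y))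
         \<longlonglongrightarrow> of_real (fejer y / sqrt (2 * pi)) * iexp (\<theta> * y)"
          by (simp add: std_normal_density_def)
      qed
      fix n
      have "std_normal_density x \<le> 1" for x
      proof -
        have "1 \<le> sqrt (2 * pi)" using pi_ge_two by (intro real_le_rsqrt) auto
        then have "1 / sqrt (2 * pi) * exp (- x\<^sup>2 / 2) \<le> 1 * 1"
          by (intro mult_mono) auto
        then show ?thesis by (simp add: std_normal_density_def)
      qed
      then show "AE y in lborel. norm (of_real (std_normal_density (y / real (n + 1)) * fejer y) * iexp (\<theta> * y)) \<le> fejer y"
        by (intro AE_I2) (simp add: norm_mult fejer_nonneg mult_left_le_one_le abs_mult)
    qed measurable
  qed
  ultimately have "of_real (tri \<theta> * (sqrt (2 * pi) / 1)) = (CLINT y|lborel. of_real (fejer y / sqrt (2 * pi)) * iexp (\<theta> * y))"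
    by (rule LIMSEQ_unique)
  also have "\<dots> = (CLINT y|lborel. of_real (fejer y) * iexp (\<theta> * y)) / of_real (sqrt (2 * pi))"
    by simp
  finally have "(CLINT y|lborel. of_real (fejer y) * iexp (\<theta> * y)) = of_real (tri \<theta> * (sqrt (2 * pi) / 1)) * of_real (sqrt (2 * pi))"
    by (simp add: field_simps)
  also have "\<dots> = of_real (tri \<theta> * (sqrt (2 * pi) * sqrt (2 * pi)))"
    by (simp only: of_real_mult[symmetric]) (simp add: mult_ac)
  finally show ?thesis by (simp add: mult_ac)
qed

definition fejer_distribution :: "real measure" where
  "fejer_distribution = density lborel (\<lambda>x. ennreal (fejer x / (2 * pi)))"

lemma integral_fejer: "(LINT y|lborel. fejer y) = 2 * pi"
proof -
  have "complex_of_real (LINT y|lborel. fejer y) = of_real (2 * pi)"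
    using integral_fejer_iexp[of 0] by (simp add: tri_def integral_complex_of_real)
  then show ?thesis by (simp only: of_real_eq_iff)
qed

lemma real_distribution_fejer: "real_distribution fejer_distribution"
proof -
  have "(\<integral>\<^sup>+x. ennreal (fejer x / (2 * pi)) \<partial>lborel) = ennreal (LINT x|lborel. fejer x / (2 * pi))"
    by (rule nn_integral_eq_integral) (auto intro!: integrable_fejer fejer_nonneg divide_nonneg_pos)
  then have "prob_space fejer_distribution"
    unfolding fejer_distribution_def
    by (intro prob_spaceI) (simp add: emeasure_density integral_fejer)
  then show ?thesis
    by (auto simp: real_distribution_def real_distribution_axioms_def fejer_distribution_def)
qed

lemma char_fejer: "char fejer_distribution \<theta> = of_real (tri \<theta>)"
proof -
  have "char fejer_distribution \<theta> = (CLINT y|lborel. (of_real (fejer y) * iexp (\<theta> * y)) / of_real (2 * pi))"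
    unfolding char_def fejer_distribution_def
    by (subst integral_density) (auto simp: fejer_nonneg scaleR_conv_of_real field_simps)
  also have "\<dots> = of_real (2 * pi * tri \<theta>) / of_real (2 * pi)"
    by (simp only: integral_divide_zero integral_fejer_iexp)
  finally show ?thesis by (simp flip: of_real_divide of_real_mult)
qed


section \<open>Local limits on intervals inside \<open>(- 2 * pi, 2 * pi)\<close>\<close>

lemma integral_fejer_inverse_indicator:
  assumes "real_distribution N" "- (2 * pi) < a" "b < 2 * pi"
  shows "(LINT y|N. fejer y * (indicator {a<..<b} y / fejer y)) = measure N {a<..<b}"
proof -
  interpret real_distribution N by fact
  have "fejer y * (indicator {a<..<b} y / fejer y) = indicator {a<..<b} y" for y
  proof (cases "y \<in> {a<..<b}")
    case True
    then have "\<bar>y\<bar> < 2 * pi" using assms(2,3) by (simp add: abs_less_iff)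
    then show ?thesis using fejer_pos[of y] by simp
  qed simp
  then show ?thesis by simp
qed

text \<open>The half-angle form shows that the kernel is continuous also at 0. It therefore attains
  a minimum on the closed interval, which is positive by \<open>fejer_pos\<close>.\<close>

lemma fejer_lower_bound:
  assumes "- (2 * pi) < a" "b < 2 * pi"
  obtains \<delta> where "\<delta> > 0" "\<And>y. y \<in> {a<..<b} \<Longrightarrow> \<delta> \<le> fejer y"
proof (cases "a < b")
  case True
  let ?h = "\<lambda>y. (if y = 0 then 1 else sin (y / 2) / (y / 2))\<^sup>2"
  have h: "fejer y = ?h y" for y
    using cos_double_sin[of "y/2"] by (auto simp: fejer_def power_divide)
  have "isCont (\<lambda>y::real. if y = 0 then 1 else sin (y / 2) / (y / 2)) x" for x
  proof (cases "x = 0")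
    case True
    have "((\<lambda>y::real. sin (y / 2) / (y / 2)) \<longlongrightarrow> 1) (at 0)"
    proof -
      have "((\<lambda>y::real. sin y / y) \<longlongrightarrow> 1) (at 0)"
        using DERIV_sin[of "0::real"] by (simp add: DERIV_def)
      moreover have "filterlim (\<lambda>y::real. y / 2) (at 0) (at 0)"
        by (intro filterlim_atI tendsto_eq_intros) (auto simp: eventually_at_filter)
      ultimately show ?thesis by (rule filterlim_compose)
    qed
    then have "((\<lambda>y::real. if y = 0 then 1 else sin (y / 2) / (y / 2)) \<longlongrightarrow> 1) (at 0)"
      by (rule Lim_transform_eventually) (auto simp: eventually_at_filter)
    with True show ?thesis by (simp add: isCont_def)
  next
    case False
    have "isCont (\<lambda>y::real. sin (y / 2) / (y / 2)) x"
      using False by (intro continuous_intros) auto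
    moreover have "eventually (\<lambda>y::real. (if y = 0 then 1 else sin (y / 2) / (y / 2)) = sin (y / 2) / (y / 2)) (nhds x)"
      using t1_space_nhds[OF False] by eventually_elim simp
    ultimately show ?thesis by (subst isCont_cong) auto
  qed
  then have "continuous_on {a..b} fejer"
    unfolding h[abs_def] by (intro continuous_at_imp_continuous_on ballI continuous_intros)
  then obtain x where x: "x \<in> {a..b}" "\<And>y. y \<in> {a..b} \<Longrightarrow> fejer x \<le> fejer y"
    using continuous_attains_inf[of "{a..b}" fejer] True by auto
  show thesis
    by (rule that[of "fejer x"]) (use x assms fejer_pos[of x] in auto)
qed (auto intro: that[of 1])

text \<open>Breiman's argument: the laws of \<open>Y\<^sub>n\<close> reweighted by the Fejer kernel converge weakly by
  Levy's theorem, and the weight is divided out again, being positive on \<open>(- 2 \<pi>, 2 \<pi>)\<close>.\<close>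

lemma local_limit_aux:
  fixes Y :: "nat \<Rightarrow> real measure" and r :: "nat \<Rightarrow> real"
  assumes rd: "\<And>n. real_distribution (Y n)"
    and r: "filterlim r at_top sequentially"
    and \<sigma>: "\<sigma> > 0"
    and dom: "\<And>R. R > 0 \<Longrightarrow> \<exists>c>0. \<forall>\<^sub>F n in sequentially. \<forall>t. \<bar>t\<bar> \<le> R \<longrightarrow> cmod (char (Y n) t) \<le> exp (- c * (r n)\<^sup>2 * t\<^sup>2)"
    and lim: "\<And>s. (\<lambda>n. char (Y n) (s / r n)) \<longlonglongrightarrow> of_real (exp (- (\<sigma> * s)\<^sup>2 / 2))"
    and ab: "- (2 * pi) < a" "a < b" "b < 2 * pi"
  shows "(\<lambda>n. r n * measure (Y n) {a<..<b}) \<longlonglongrightarrow> (b - a) / (\<sigma> * sqrt (2 * pi))"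
proof -
  interpret real_distribution "Y n" for n by fact
  define e where "e n = (LINT y|Y n. fejer y)" for n
  have int: "integrable (Y n) fejer" for n
    by (intro integrable_const_bound[of _ 1]) (auto simp: fejer_nonneg fejer_le_1)
  have e_iexp: "(CLINT y|Y n. of_real (fejer y) * iexp (0 * y)) = of_real (e n)" for n
    by (simp add: e_def integral_complex_of_real)
  have "(\<lambda>n. complex_of_real (r n * e n)) \<longlonglongrightarrow> of_real (tri 0 * (sqrt (2 * pi) / \<sigma>))"
    using local_limit_smooth[OF rd r \<sigma> dom lim, of 0] unfolding e_iexp by simp
  then have re: "(\<lambda>n. r n * e n) \<longlonglongrightarrow> sqrt (2 * pi) / \<sigma>"
    unfolding tendsto_of_real_iff by (simp add: tri_def)
  have "\<forall>\<^sub>F n in sequentially. r n * e n > 0"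
    using order_tendstoD(1)[OF re, of 0] \<sigma> by simp
  moreover have "\<forall>\<^sub>F n in sequentially. r n > 0"
    using r by (simp add: filterlim_at_top_dense)
  ultimately have "\<forall>\<^sub>F n in sequentially. e n > 0"
    by eventually_elim (simp add: zero_less_mult_iff)
  \<comment> \<open>From \<open>n0\<close> on the total weight is positive and the reweighted law is
    a probability measure; for this reason all laws are shifted by \<open>n0\<close>.\<close>
  then obtain n0 where e_pos: "\<And>n. n \<ge> n0 \<Longrightarrow> e n > 0"
    by (auto simp: eventually_sequentially)
  define \<rho> where "\<rho> n = density (Y (n + n0)) (\<lambda>y. ennreal (fejer y / e (n + n0)))" for n
  have int_\<rho>: "(LINT y|\<rho> n. f y) = (LINT y|Y (n + n0). fejer y *\<^sub>R f y) /\<^sub>R e (n + n0)"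
    if [measurable]: "f \<in> borel_measurable borel" for n and f :: "real \<Rightarrow> 'b :: {banach, second_countable_topology}"
  proof -
    have "(LINT y|\<rho> n. f y) = (LINT y|Y (n + n0). inverse (e (n + n0)) *\<^sub>R (fejer y *\<^sub>R f y))"
      unfolding \<rho>_def using e_pos[of "n + n0"]
      by (subst integral_density) (auto simp: fejer_nonneg divide_inverse mult_ac)
    also have "\<dots> = inverse (e (n + n0)) *\<^sub>R (LINT y|Y (n + n0). fejer y *\<^sub>R f y)"
      by (rule integral_scaleR_right)
    finally show ?thesis .
  qed
  have rd\<rho>: "real_distribution (\<rho> n)" for n
  proof -
    have "(\<integral>\<^sup>+y. ennreal (fejer y / e (n + n0)) \<partial>Y (n + n0)) = ennreal (LINT y|Y (n + n0). fejer y / e (n + n0))"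
      using e_pos[of "n + n0"] by (intro nn_integral_eq_integral) (auto simp: int fejer_nonneg)
    also have "\<dots> = 1" using e_pos[of "n + n0"] by (simp add: e_def[symmetric])
    finally have "prob_space (\<rho> n)"
      unfolding \<rho>_def by (intro prob_spaceI) (simp add: emeasure_density)
    then show ?thesis
      by (auto simp: real_distribution_def real_distribution_axioms_def \<rho>_def)
  qed
  have "weak_conv_m \<rho> fejer_distribution"
  proof (rule levy_continuity[OF rd\<rho> real_distribution_fejer])
    fix \<theta>
    \<comment> \<open>A quotient of two smoothed expectations, at the frequencies \<theta> and 0.
      Expanded by \<open>r (n + n0)\<close>, both have limits by \<open>local_limit_smooth\<close>,
      and the quotient of the limits is \<open>tri \<theta>\<close>.\<close>
    have "char (\<rho> n) \<theta> = of_real (r (n + n0)) * (CLINT y|Y (n + n0). of_real (fejer y) * iexp (\<theta> * y)) / of_real (r (n + n0) * e (n + n0))" 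
      if "r (n + n0) > 0" for n
      unfolding char_def using that by (subst int_\<rho>) (auto simp: scaleR_conv_of_real field_simps)
    moreover have "\<forall>\<^sub>F n in sequentially. r (n + n0) > 0"
      using r by (auto simp: filterlim_at_top_dense intro: sequentially_offset)
    ultimately have "\<forall>\<^sub>F n in sequentially. char (\<rho> n) \<theta> = of_real (r (n + n0)) * (CLINT y|Y (n + n0). of_real (fejer y) * iexp (\<theta> * y)) / of_real (r (n + n0) * e (n + n0))"
      by (auto elim: eventually_mono)
    moreover have "(\<lambda>n. of_real (r (n + n0)) * (CLINT y|Y (n + n0). of_real (fejer y) * iexp (\<theta> * y)) / of_real (r (n + n0) * e (n + n0)))
       \<longlonglongrightarrow> of_real (tri \<theta> * (sqrt (2 * pi) / \<sigma>)) / of_real (sqrt (2 * pi) / \<sigma>)"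
      using \<sigma> by (intro tendsto_divide tendsto_of_real LIMSEQ_ignore_initial_segment[OF re]
        LIMSEQ_ignore_initial_segment[OF local_limit_smooth[OF rd r \<sigma> dom lim]]) auto
    moreover have "of_real (tri \<theta> * (sqrt (2 * pi) / \<sigma>)) / of_real (sqrt (2 * pi) / \<sigma>) = char fejer_distribution \<theta>"
      using \<sigma> by (simp add: char_fejer)
    ultimately show "(\<lambda>n. char (\<rho> n) \<theta>) \<longlonglongrightarrow> char fejer_distribution \<theta>"
      by (simp only: tendsto_cong)
  qed
  \<comment> \<open>Dividing by the kernel undoes the reweighting, so that integrating
    \<open>f\<close> returns the measure of the interval up to the total weight.\<close>
  define f where "f y = indicator {a<..<b} y / fejer y" for y
  have [measurable]: "f \<in> borel_measurable borel" unfolding f_def by measurable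
  obtain \<delta> where \<delta>: "\<delta> > 0" "\<And>y. y \<in> {a<..<b} \<Longrightarrow> \<delta> \<le> fejer y"
    using fejer_lower_bound[of a b] ab by auto
  have "(\<lambda>n. LINT y|\<rho> n. f y) \<longlonglongrightarrow> (LINT y|fejer_distribution. f y)"
  proof (rule weak_conv_imp_bdd_ae_continuous_conv[OF rd\<rho> real_distribution_fejer \<open>weak_conv_m \<rho> fejer_distribution\<close>])
    show "norm (f y) \<le> 1 / \<delta>" for y
      using \<delta>(2)[of y] \<delta>(1) by (auto simp: f_def indicator_def fejer_nonneg intro!: frac_le)
    \<comment> \<open>The point 0 is listed because \<open>isCont_fejer\<close> leaves it out; all
      three points are null for the limit law.\<close>
    have "{x. \<not> isCont f x} \<subseteq> {a, b, 0}"
    proof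
      fix x assume x: "x \<in> {x. \<not> isCont f x}"
      have "isCont f x" if "x \<noteq> 0" "x \<noteq> a" "x \<noteq> b"
      proof (cases "x \<in> {a<..<b}")
        case True
        have "isCont (\<lambda>y. 1 / fejer y) x"
          using isCont_fejer[OF that(1)] \<delta>(2)[OF True] \<delta>(1) by (intro continuous_intros) auto
        moreover have "eventually (\<lambda>y. y \<in> {a<..<b}) (nhds x)"
          using True by (intro eventually_nhds_in_open) auto
        then have "eventually (\<lambda>y. f y = 1 / fejer y) (nhds x)"
          by eventually_elim (simp add: f_def)
        ultimately show ?thesis by (subst isCont_cong) auto
      next
        case False
        then have "eventually (\<lambda>y. y \<in> - {a..b}) (nhds x)"
          using that by (intro eventually_nhds_in_open) auto
        then have "eventually (\<lambda>y. f y = 0) (nhds x)"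
          by eventually_elim (auto simp add: f_def indicator_def)
        then show ?thesis by (subst isCont_cong) auto
      qed
      with x show "x \<in> {a, b, 0}" by auto
    qed
    moreover have "emeasure fejer_distribution {a, b, 0} = 0"
    proof -
      have "AE x in lborel. x \<noteq> a \<and> x \<noteq> b \<and> x \<noteq> 0"
        using AE_lborel_singleton[of a] AE_lborel_singleton[of b] AE_lborel_singleton[of 0] by eventually_elim auto
      then have "(\<integral>\<^sup>+x. ennreal (fejer x / (2 * pi)) * indicator {a, b, 0} x \<partial>lborel) = 0"
        by (subst nn_integral_0_iff_AE, measurable) (erule eventually_mono, simp)
      then show ?thesis
        unfolding fejer_distribution_def by (subst emeasure_density) auto
    qed
    ultimately show "emeasure fejer_distribution {x. \<not> isCont f x} = 0"
      using emeasure_eq_0[of "{a, b, 0}" fejer_distribution] by (simp add: fejer_distribution_def)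
  qed measurable
  also have "(LINT y|fejer_distribution. f y) = (b - a) / (2 * pi)"
  proof -
    have "(LINT y|fejer_distribution. f y) = (LINT y|lborel. indicator {a<..<b} y / (2 * pi))"
      unfolding fejer_distribution_def
    proof (subst integral_density)
      show "(LINT x|lborel. (fejer x / (2 * pi)) *\<^sub>R f x) = (LINT y|lborel. indicator {a<..<b} y / (2 * pi))"
        by (intro Bochner_Integration.integral_cong) (use \<delta> in \<open>force simp: f_def indicator_def\<close>)+
    qed (auto simp: fejer_nonneg)
    then show ?thesis using ab by simp
  qed
  finally have lim_f: "(\<lambda>n. LINT y|\<rho> n. f y) \<longlonglongrightarrow> (b - a) / (2 * pi)" .
  have int_f: "(LINT y|\<rho> n. f y) = measure (Y (n + n0)) {a<..<b} / e (n + n0)" for n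
    using integral_fejer_inverse_indicator[OF rd ab(1,3), of "n + n0"]
    by (subst int_\<rho>) (auto simp: f_def divide_inverse mult.commute)
  have "(\<lambda>n. measure (Y (n + n0)) {a<..<b} / e (n + n0) * (r (n + n0) * e (n + n0))) \<longlonglongrightarrow> (b - a) / (2 * pi) * (sqrt (2 * pi) / \<sigma>)"
    using lim_f unfolding int_f by (rule tendsto_mult) (rule LIMSEQ_ignore_initial_segment[OF re])
  moreover have "measure (Y (n + n0)) {a<..<b} / e (n + n0) * (r (n + n0) * e (n + n0)) = r (n + n0) * measure (Y (n + n0)) {a<..<b}" for n
    using e_pos[of "n + n0"] by simp
  moreover have "(b - a) / (2 * pi) * (sqrt (2 * pi) / \<sigma>) = (b - a) / (\<sigma> * sqrt (2 * pi))"
    using \<sigma> real_sqrt_mult_self[of "2 * pi"] by (simp add: field_simps)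
  ultimately have "(\<lambda>n. r (n + n0) * measure (Y (n + n0)) {a<..<b}) \<longlonglongrightarrow> (b - a) / (\<sigma> * sqrt (2 * pi))"
    by simp
  then show ?thesis by (rule LIMSEQ_offset)
qed

section \<open>Local limit theorem from characteristic functions\<close>

lemma char_affine:
  assumes "real_distribution N"
  shows "char (distr N borel (\<lambda>y. (y - x) / l)) t = iexp (- (t / l) * x) * char N (t / l)"
proof -
  interpret real_distribution N by fact
  have "char (distr N borel (\<lambda>y. (y - x) / l)) t = (CLINT y|N. iexp (- (t / l) * x) * iexp (t / l * y))"
  proof -
    have "iexp (t * ((y - x) / l)) = iexp (- (t / l) * x) * iexp (t / l * y)" for y
    proof -
      have "t * ((y - x) / l) = - (t / l) * x + t / l * y" by (simp add: diff_divide_distrib right_diff_distrib)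
      then show ?thesis by (simp only: of_real_add distrib_left exp_add)
    qed
    then show ?thesis unfolding char_def by (subst integral_distr) simp_all
  qed
  also have "\<dots> = iexp (- (t / l) * x) * char N (t / l)"
    unfolding char_def by (rule integral_mult_right_zero)
  finally show ?thesis .
qed

lemma measure_distr_affine:
  assumes "real_distribution N" "l > 0"
  shows "measure (distr N borel (\<lambda>y. (y - x) / l)) {a / l<..<b / l} = measure N {a + x<..<b + x}"
proof -
  interpret real_distribution N by fact
  have "(\<lambda>y. (y - x) / l) -` {a / l<..<b / l} = {a + x<..<b + x}"
    using assms(2) by (auto simp: divide_less_cancel)
  then show ?thesis by (subst measure_distr) auto
qed

text \<open>Scaling by \<open>l\<close> brings an arbitrary interval into \<open>(-1, 1)\<close>,
  where the kernel is positive. The translation by \<open>x n\<close> multiplies the characteristic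
  function at \<open>s / r n\<close> by a phase that tends to 1, since \<open>x n\<close> is
  negligible against \<open>r n\<close>.\<close>

lemma local_limit:
  fixes Y :: "nat \<Rightarrow> real measure" and r x :: "nat \<Rightarrow> real"
  assumes rd: "\<And>n. real_distribution (Y n)"
    and r: "filterlim r at_top sequentially"
    and \<sigma>: "\<sigma> > 0"
    and dom: "\<And>R. R > 0 \<Longrightarrow> \<exists>c>0. \<forall>\<^sub>F n in sequentially. \<forall>t. \<bar>t\<bar> \<le> R \<longrightarrow> cmod (char (Y n) t) \<le> exp (- c * (r n)\<^sup>2 * t\<^sup>2)"
    and lim: "\<And>s. (\<lambda>n. char (Y n) (s / r n)) \<longlonglongrightarrow> of_real (exp (- (\<sigma> * s)\<^sup>2 / 2))"
    and x: "(\<lambda>n. x n / r n) \<longlonglongrightarrow> 0"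
    and ab: "a < b"
  shows "(\<lambda>n. r n * measure (Y n) {a + x n<..<b + x n}) \<longlonglongrightarrow> (b - a) / (\<sigma> * sqrt (2 * pi))"
proof -
  interpret real_distribution "Y n" for n by fact
  define l where "l = \<bar>a\<bar> + \<bar>b\<bar> + 1"
  have l: "l > 0" "\<bar>a / l\<bar> < 1" "\<bar>b / l\<bar> < 1" by (auto simp: l_def)
  have "(\<lambda>n. r n * measure (distr (Y n) borel (\<lambda>y. (y - x n) / l)) {a / l<..<b / l})
     \<longlonglongrightarrow> (b / l - a / l) / (\<sigma> / l * sqrt (2 * pi))"
  proof (rule local_limit_aux)
    fix R :: real assume "R > 0"
    then obtain c where c: "c > 0" "\<forall>\<^sub>F n in sequentially. \<forall>t. \<bar>t\<bar> \<le> R / l \<longrightarrow> cmod (char (Y n) t) \<le> exp (- c * (r n)\<^sup>2 * t\<^sup>2)"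
      using dom[of "R / l"] l by auto
    show "\<exists>c>0. \<forall>\<^sub>F n in sequentially. \<forall>t. \<bar>t\<bar> \<le> R \<longrightarrow> cmod (char (distr (Y n) borel (\<lambda>y. (y - x n) / l)) t) \<le> exp (- c * (r n)\<^sup>2 * t\<^sup>2)"
    proof (intro exI[of _ "c / l\<^sup>2"] conjI)
      from c(2) show "\<forall>\<^sub>F n in sequentially. \<forall>t. \<bar>t\<bar> \<le> R \<longrightarrow> cmod (char (distr (Y n) borel (\<lambda>y. (y - x n) / l)) t) \<le> exp (- (c / l\<^sup>2) * (r n)\<^sup>2 * t\<^sup>2)"
      proof eventually_elim
        case (elim n)
        show ?case
        proof (intro allI impI)
          fix t assume "\<bar>t\<bar> \<le> R"
          then have "\<bar>t / l\<bar> \<le> R / l" using l by (simp add: divide_right_mono)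
          with elim have "cmod (char (Y n) (t / l)) \<le> exp (- c * (r n)\<^sup>2 * (t / l)\<^sup>2)" by blast
          then show "cmod (char (distr (Y n) borel (\<lambda>y. (y - x n) / l)) t) \<le> exp (- (c / l\<^sup>2) * (r n)\<^sup>2 * t\<^sup>2)"
            by (simp only: char_affine[OF rd] norm_mult norm_exp_i_times) (simp add: power_divide)
        qed
      qed
    qed (use c l in auto)
  next
    fix s
    have "(\<lambda>n. - (s / l) * (x n / r n)) \<longlonglongrightarrow> - (s / l) * 0"
      by (intro tendsto_intros x)
    then have "(\<lambda>n. iexp (- (s / l) * (x n / r n)) * char (Y n) (s / l / r n)) \<longlonglongrightarrow> iexp (- (s / l) * 0) * of_real (exp (- (\<sigma> * (s / l))\<^sup>2 / 2))"
      by (intro tendsto_mult tendsto_exp tendsto_of_real lim tendsto_const x)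
    then show "(\<lambda>n. char (distr (Y n) borel (\<lambda>y. (y - x n) / l)) (s / r n)) \<longlonglongrightarrow> of_real (exp (- (\<sigma> / l * s)\<^sup>2 / 2))"
      by (simp add: char_affine[OF rd] mult_ac)
  next
    show "- (2 * pi) < a / l" "b / l < 2 * pi" using l(2,3) pi_ge_two by linarith+
    show "a / l < b / l" using ab l(1) by (rule divide_strict_right_mono)
    show "real_distribution (distr (Y n) borel (\<lambda>y. (y - x n) / l))" for n
      by (rule real_distribution_distr) simp
  qed (use r \<sigma> l in auto)
  moreover have "(b / l - a / l) / (\<sigma> / l * sqrt (2 * pi)) = (b - a) / (\<sigma> * sqrt (2 * pi))"
    using l(1) by (simp add: diff_divide_distrib[symmetric])
  ultimately show ?thesis
    by (simp only: measure_distr_affine[OF rd l(1)])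
qed

text \<open>A translation does not change the modulus of a characteristic function, so the decay
  alone gives a bound uniform in \<open>x\<close>. It takes care of particles that are too far off
  for the local limit.\<close>

lemma local_limit_bounded:
  fixes Y :: "nat \<Rightarrow> real measure" and r :: "nat \<Rightarrow> real"
  assumes rd: "\<And>n. real_distribution (Y n)"
    and r: "filterlim r at_top sequentially"
    and dom: "\<And>R. R > 0 \<Longrightarrow> \<exists>c>0. \<forall>\<^sub>F n in sequentially. \<forall>t. \<bar>t\<bar> \<le> R \<longrightarrow> cmod (char (Y n) t) \<le> exp (- c * (r n)\<^sup>2 * t\<^sup>2)"
  shows "\<exists>C. \<forall>\<^sub>F n in sequentially. \<forall>x. r n * measure (Y n) {a + x<..<b + x} \<le> C"
proof -
  interpret real_distribution "Y n" for n by fact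
  define l where "l = \<bar>a\<bar> + \<bar>b\<bar> + 1"
  have l: "l > 0" "\<bar>a / l\<bar> < 1" "\<bar>b / l\<bar> < 1" by (auto simp: l_def)
  have "- (2 * pi) < a / l" "b / l < 2 * pi" using l(2,3) pi_ge_two by linarith+
  then obtain \<delta> where \<delta>: "\<delta> > 0" "\<And>y. y \<in> {a / l<..<b / l} \<Longrightarrow> \<delta> \<le> fejer y"
    using fejer_lower_bound by blast
  obtain c where c: "c > 0" "\<forall>\<^sub>F n in sequentially. \<forall>t. \<bar>t\<bar> \<le> 1 / l \<longrightarrow> cmod (char (Y n) t) \<le> exp (- c * (r n)\<^sup>2 * t\<^sup>2)"
    using dom[of "1 / l"] l by auto
  have "\<forall>\<^sub>F n in sequentially. r n > 0"
    using r by (simp add: filterlim_at_top_dense)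
  with c(2) have "\<forall>\<^sub>F n in sequentially. \<forall>x. r n * measure (Y n) {a + x<..<b + x} \<le> sqrt (pi / (c / l\<^sup>2)) / \<delta>"
  proof eventually_elim
    case (elim n)
    let ?k = "c / l\<^sup>2 * (r n)\<^sup>2"
    have k: "?k > 0" using elim c l by simp
    show ?case
    proof
      fix x
      let ?N = "distr (Y n) borel (\<lambda>y. (y - x) / l)"
      interpret N: real_distribution ?N
        by (rule real_distribution_distr) simp
      have "\<delta> * measure (Y n) {a + x<..<b + x} = (LINT y|?N. \<delta> * indicator {a / l<..<b / l} y)"
        using measure_distr_affine[OF rd[of n] l(1)] by simp
      also have "\<dots> \<le> (LINT y|?N. fejer y)"
        using \<delta> by (intro integral_mono) (auto simp: indicator_def fejer_nonneg fejer_le_1 intro!: N.integrable_const_bound[of _ 1])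
      also have "\<dots> \<le> norm (CLINT y|?N. of_real (fejer y) * iexp (0 * y))"
        by (simp add: integral_complex_of_real)
      also have "\<dots> \<le> (LINT t|lborel. norm (of_real (tri t) * char ?N (t + 0)))"
        unfolding N.expectation_fejer_iexp by (rule integral_norm_bound)
      also have "\<dots> \<le> (LINT t|lborel. exp (- ?k * t\<^sup>2))"
      proof (rule Bochner_Integration.integral_mono_AE)
        have bound: "norm (of_real (tri t) * char ?N (t + 0)) \<le> exp (- ?k * t\<^sup>2)" for t
        proof (cases "\<bar>t\<bar> \<le> 1")
          case True
          then have "\<bar>t / l\<bar> \<le> 1 / l" using l by (simp add: divide_right_mono)
          with elim have "cmod (char (Y n) (t / l)) \<le> exp (- c * (r n)\<^sup>2 * (t / l)\<^sup>2)" by blast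
          then have "cmod (char ?N t) \<le> exp (- ?k * t\<^sup>2)"
            by (simp only: char_affine[OF rd] norm_mult norm_exp_i_times) (simp add: power_divide)
          then show ?thesis
            using mult_mono[OF tri_le_1[of t], of "cmod (char ?N t)" "exp (- ?k * t\<^sup>2)"]
            by (simp add: norm_mult tri_nonneg)
        qed (simp add: tri_eq_0)
        then show "AE t in lborel. norm (of_real (tri t) * char ?N (t + 0)) \<le> exp (- ?k * t\<^sup>2)"
          by blast
        show int: "integrable lborel (\<lambda>t. exp (- ?k * t\<^sup>2))" by (rule integral_exp_minus_square[OF k])
        show "integrable lborel (\<lambda>t. norm (of_real (tri t) * char ?N (t + 0)))"
          using bound by (intro Bochner_Integration.integrable_bound[OF int]) auto
      qed
      also have "\<dots> = sqrt (pi / ?k)" by (rule integral_exp_minus_square[OF k])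
      also have "\<dots> = sqrt (pi / (c / l\<^sup>2)) / r n" using elim l c
        by (simp add: real_sqrt_divide real_sqrt_mult field_simps)
      finally show "r n * measure (Y n) {a + x<..<b + x} \<le> sqrt (pi / (c / l\<^sup>2)) / \<delta>"
        using \<delta>(1) elim(2) by (simp add: field_simps)
    qed
  qed
  then show ?thesis by blast
qed

text \<open>Uniformity in \<open>x\<close> follows from the pointwise statement along a sequence of worst \<open>x\<^sub>n\<close>.\<close>

lemma local_limit_uniform:
  fixes Y :: "nat \<Rightarrow> real measure" and r \<eta> :: "nat \<Rightarrow> real"
  assumes rd: "\<And>n. real_distribution (Y n)"
    and r: "filterlim r at_top sequentially"
    and \<sigma>: "\<sigma> > 0"
    and dom: "\<And>R. R > 0 \<Longrightarrow> \<exists>c>0. \<forall>\<^sub>F n in sequentially. \<forall>t. \<bar>t\<bar> \<le> R \<longrightarrow> cmod (char (Y n) t) \<le> exp (- c * (r n)\<^sup>2 * t\<^sup>2)"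
    and lim: "\<And>s. (\<lambda>n. char (Y n) (s / r n)) \<longlonglongrightarrow> of_real (exp (- (\<sigma> * s)\<^sup>2 / 2))"
    and \<eta>: "\<eta> \<longlonglongrightarrow> 0" and ab: "a < b" and e: "e > 0"
  shows "\<forall>\<^sub>F n in sequentially. \<forall>x. \<bar>x\<bar> \<le> \<eta> n * r n \<longrightarrow>
     \<bar>r n * measure (Y n) {a + x<..<b + x} - (b - a) / (\<sigma> * sqrt (2 * pi))\<bar> < e"
proof -
  define P where "P n x \<longleftrightarrow> \<bar>x\<bar> \<le> \<eta> n * r n \<and> \<not> \<bar>r n * measure (Y n) {a + x<..<b + x} - (b - a) / (\<sigma> * sqrt (2 * pi))\<bar> < e" for n x
  define x where "x n = (if \<exists>x. P n x then SOME x. P n x else 0)" for n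
  have x: "P n (x n)" if "P n y" for n y
    using that unfolding x_def by (auto intro: someI)
  have "\<forall>\<^sub>F n in sequentially. r n > 0"
    using r by (simp add: filterlim_at_top_dense)
  then have "\<forall>\<^sub>F n in sequentially. norm (x n / r n) \<le> \<bar>\<eta> n\<bar>"
  proof eventually_elim
    case (elim n)
    show ?case
    proof (cases "\<exists>y. P n y")
      case True
      then have "\<bar>x n\<bar> \<le> \<eta> n * r n" using x P_def by blast
      also have "\<dots> \<le> \<bar>\<eta> n\<bar> * r n" using elim by (intro mult_right_mono) auto
      finally show ?thesis using elim by (simp add: divide_le_eq)
    qed (auto simp: x_def)
  qed
  then have "(\<lambda>n. x n / r n) \<longlonglongrightarrow> 0"
    by (rule Lim_null_comparison) (use tendsto_rabs_zero[OF \<eta>] in simp)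
  from local_limit[OF rd r \<sigma> dom lim this ab]
  have "\<forall>\<^sub>F n in sequentially. \<bar>r n * measure (Y n) {a + x n<..<b + x n} - (b - a) / (\<sigma> * sqrt (2 * pi))\<bar> < e"
    using e by (auto dest!: tendstoD simp: dist_real_def)
  then show ?thesis
  proof eventually_elim
    case (elim n)
    then have "\<not> P n (x n)" by (auto simp: P_def)
    then have "\<not> P n y" for y using x by blast
    then show ?case by (auto simp: P_def)
  qed
qed

section \<open>Sums of independent, non-identically distributed variables\<close>

lemma real_distributionI:
  "prob_space N \<Longrightarrow> sets N = sets borel \<Longrightarrow> real_distribution N"
  using sets_eq_imp_space_eq[of N borel]
  by (auto simp: real_distribution_def real_distribution_axioms_def)

lemma real_distribution_convolution:
  fixes N1 N2 :: "real measure"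
  assumes "real_distribution N1" "real_distribution N2"
  shows "real_distribution (N1 \<star> N2)"
proof -
  interpret N1: real_distribution N1 by fact
  interpret N2: real_distribution N2 by fact
  interpret P: pair_prob_space N1 N2 ..
  show ?thesis
    unfolding convolution_def by (rule P.real_distribution_distr) simp
qed

lemma char_convolution:
  fixes N1 N2 :: "real measure"
  assumes "real_distribution N1" "real_distribution N2"
  shows "char (N1 \<star> N2) t = char N1 t * char N2 t"
proof -
  interpret N1: real_distribution N1 by fact
  interpret N2: real_distribution N2 by fact
  interpret P: pair_prob_space N1 N2 ..
  have "char (N1 \<star> N2) t = (CLINT z|N1 \<Otimes>\<^sub>M N2. (case z of (x, y) \<Rightarrow> iexp (t * x) * iexp (t * y)))"
    unfolding char_def convolution_def
    by (subst integral_distr) (auto simp: case_prod_beta' distrib_left exp_add)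
  also have "\<dots> = (CLINT x|N1. CLINT y|N2. iexp (t * x) * iexp (t * y))"
    by (subst P.integral_fst'[symmetric])
       (auto intro!: P.integrable_const_bound[of _ 1] simp: norm_mult)
  also have "\<dots> = char N1 t * char N2 t"
    unfolding char_def by simp
  finally show ?thesis .
qed

text \<open>The law of a sum of \<open>l\<close> independent steps beginning with step
  \<open>j\<close>. The first step is peeled off, which matches conditioning on the next
  generation.\<close>

primrec conv_from :: "(nat \<Rightarrow> real measure) \<Rightarrow> nat \<Rightarrow> nat \<Rightarrow> real measure" where
  "conv_from \<nu> j 0 = return borel 0"
| "conv_from \<nu> j (Suc l) = (\<nu> j \<star> conv_from \<nu> (Suc j) l)"

lemma real_distribution_conv_from:
  assumes "\<And>j. real_distribution (\<nu> j)"
  shows "real_distribution (conv_from \<nu> j l)"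
proof (induction l arbitrary: j)
  case 0
  show ?case by (auto intro!: real_distributionI prob_space_return)
qed (simp add: real_distribution_convolution assms)

lemma char_conv_from:
  assumes "\<And>j. real_distribution (\<nu> j)"
  shows "char (conv_from \<nu> j l) t = (\<Prod>i\<in>{j..<j + l}. char (\<nu> i) t)"
proof (induction l arbitrary: j)
  case 0
  show ?case by (simp add: char_def integral_return)
next
  case (Suc l)
  have "{j..<j + Suc l} = insert j {Suc j..<Suc j + l}" by auto
  then show ?case
    by (simp add: char_convolution assms real_distribution_conv_from Suc)
qed

definition var_of :: "real measure \<Rightarrow> real" where
  "var_of N = (LINT x|N. (x - (LINT x|N. x))\<^sup>2)"

text \<open>The truncated variance of Lindeberg's condition.\<close>

definition tail_var :: "real \<Rightarrow> real measure \<Rightarrow> real" where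
  "tail_var K N = (LINT x|N. (x - (LINT x|N. x))\<^sup>2 * indicator {x. K < \<bar>x - (LINT x|N. x)\<bar>} x)"

definition sq_dist :: "real measure \<Rightarrow> bool" where
  "sq_dist N \<longleftrightarrow> real_distribution N \<and> integrable N (\<lambda>x. x\<^sup>2)"

lemma sq_dist_integrable:
  assumes "sq_dist N" shows "integrable N (\<lambda>x. x)" "integrable N (\<lambda>x. (x - m)\<^sup>2)"
proof -
  interpret real_distribution N using assms by (simp add: sq_dist_def)
  show 1: "integrable N (\<lambda>x. x)"
  proof (rule square_integrable_imp_integrable)
    show "integrable N (\<lambda>x. x\<^sup>2)" using assms unfolding sq_dist_def by blast
  qed simp
  show "integrable N (\<lambda>x. (x - m)\<^sup>2)"
    unfolding power2_diff using 1 assms[unfolded sq_dist_def, THEN conjunct2]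
    by (intro Bochner_Integration.integrable_diff Bochner_Integration.integrable_add
        integrable_mult_left integrable_mult_right integrable_const)
qed

lemma var_of_nonneg: "0 \<le> var_of N"
  by (simp add: var_of_def)

lemma tail_var_nonneg: "0 \<le> tail_var K N"
  unfolding tail_var_def by (rule Bochner_Integration.integral_nonneg) simp

lemma (in real_distribution) var_of_le:
  assumes "sq_dist M" "K \<ge> 0"
  shows "var_of M \<le> K\<^sup>2 + tail_var K M"
proof -
  let ?m = "LINT x|M. x"
  have int: "integrable M (\<lambda>x. (x - ?m)\<^sup>2 * indicator {x. K < \<bar>x - ?m\<bar>} x)"
    by (rule Bochner_Integration.integrable_bound[OF sq_dist_integrable(2)[OF assms(1), of ?m]]) (auto simp: indicator_def)
  have "var_of M \<le> (LINT x|M. K\<^sup>2 + (x - ?m)\<^sup>2 * indicator {x. K < \<bar>x - ?m\<bar>} x)"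
    unfolding var_of_def
  proof (rule integral_mono)
    fix x
    show "(x - ?m)\<^sup>2 \<le> K\<^sup>2 + (x - ?m)\<^sup>2 * indicator {x. K < \<bar>x - ?m\<bar>} x"
      using assms(2) by (auto simp: indicator_def abs_le_square_iff[symmetric])
  qed (use int sq_dist_integrable(2)[OF assms(1)] in auto)
  also have "\<dots> = K\<^sup>2 + tail_var K M"
    unfolding tail_var_def using int prob_space by simp
  finally show ?thesis .
qed

lemma abs_one_minus_exp_le:
  fixes x :: real assumes "0 \<le> x" shows "\<bar>1 - x - exp (- x)\<bar> \<le> x\<^sup>2 / 2"
proof -
  have "1 - x \<le> exp (- x)" using exp_ge_add_one_self[of "- x"] by simp
  moreover have "exp (- x) \<le> 1 - x + x\<^sup>2 / 2"
  proof -
    let ?f = "\<lambda>x::real. 1 - x + x\<^sup>2 / 2 - exp (- x)"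
    have "?f 0 \<le> ?f x"
    proof (rule DERIV_nonneg_imp_nondecreasing[OF assms])
      fix y :: real assume "0 \<le> y"
      have "(?f has_real_derivative (- 1 + y + exp (- y))) (at y)"
        by (auto intro!: derivative_eq_intros)
      moreover have "0 \<le> - 1 + y + exp (- y)"
        using exp_ge_add_one_self[of "- y"] by simp
      ultimately show "\<exists>d. (?f has_real_derivative d) (at y) \<and> 0 \<le> d" by blast
    qed
    then show ?thesis by simp
  qed
  ultimately show ?thesis by (simp add: abs_le_iff)
qed

text \<open>The Taylor remainder is the minimum of a quadratic and a cubic bound. The quadratic one
  is used for deviations beyond \<open>K\<close>, the cubic one otherwise, where one of its factors
  is at most \<open>K\<close>. The phase factor removes the mean.\<close>

lemma char_centered_approx1:
  assumes N: "sq_dist N" and K: "K \<ge> 0"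
  shows "cmod (iexp (- t * (LINT x|N. x)) * char N t - (1 - t\<^sup>2 * var_of N / 2))
     \<le> t\<^sup>2 * (tail_var K N + \<bar>t\<bar> * K * var_of N / 6)"
proof -
  interpret real_distribution N using N by (simp add: sq_dist_def)
  let ?m = "LINT x|N. x" and ?X = "\<lambda>x. x - (LINT x|N. x)"
  note int = sq_dist_integrable(1)[OF N] sq_dist_integrable(2)[OF N, of ?m]
  have intt: "integrable N (\<lambda>x. (x - ?m)\<^sup>2 * indicator {x. K < \<bar>x - ?m\<bar>} x)"
    by (rule Bochner_Integration.integrable_bound[OF int(2)]) (auto simp: indicator_def)
  have "cmod (char (distr N borel ?X) t - (1 - t^2 * var_of N / 2)) \<le>
    (t^2 / 6) * expectation (\<lambda>x. min (6 * (?X x)^2) (\<bar>t\<bar> * \<bar>?X x\<bar>^3))"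
  proof (rule char_approx3')
    show e: "expectation ?X = 0" using int(1) prob_space by simp
    show "variance ?X = var_of N" unfolding e by (simp add: var_of_def)
    show "integrable N ?X" by (rule Bochner_Integration.integrable_diff[OF int(1) integrable_const])
    show "integrable N (\<lambda>x. (?X x)\<^sup>2)" by (rule int(2))
  qed simp_all
  also have "char (distr N borel ?X) t = iexp (- t * ?m) * char N t"
    using char_affine[OF real_distribution_axioms, of ?m 1 t] by simp
  also have "(t^2 / 6) * expectation (\<lambda>x. min (6 * (?X x)^2) (\<bar>t\<bar> * \<bar>?X x\<bar>^3))
     \<le> (t^2 / 6) * expectation (\<lambda>x. 6 * ((?X x)\<^sup>2 * indicator {x. K < \<bar>?X x\<bar>} x) + \<bar>t\<bar> * K * (?X x)\<^sup>2)"
  proof (intro mult_left_mono integral_mono)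
    show "integrable N (\<lambda>x. min (6 * (?X x)^2) (\<bar>t\<bar> * \<bar>?X x\<bar>^3))"
      by (rule Bochner_Integration.integrable_bound[OF integrable_mult_right[OF int(2), of 6]])
         (auto simp: abs_le_iff)
    show "min (6 * (?X x)^2) (\<bar>t\<bar> * \<bar>?X x\<bar>^3) \<le> 6 * ((?X x)\<^sup>2 * indicator {x. K < \<bar>?X x\<bar>} x) + \<bar>t\<bar> * K * (?X x)\<^sup>2" for x
    proof (cases "K < \<bar>?X x\<bar>")
      case False
      have "\<bar>t\<bar> * \<bar>?X x\<bar>^3 = \<bar>t\<bar> * (\<bar>?X x\<bar> * (?X x)\<^sup>2)" by (simp add: power3_eq_cube power2_eq_square)
      also have "\<dots> \<le> \<bar>t\<bar> * (K * (?X x)\<^sup>2)" using False by (intro mult_left_mono mult_right_mono) auto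
      finally show ?thesis using False by (simp add: min_le_iff_disj)
    qed (use K in \<open>auto simp: min_le_iff_disj\<close>)
  qed (use int intt in auto)
  also have "\<dots> = t\<^sup>2 * (tail_var K N + \<bar>t\<bar> * K * var_of N / 6)"
    using int intt by (simp add: tail_var_def var_of_def field_simps)
  finally show ?thesis .
qed

text \<open>Passing from \<open>1 - x\<close> to \<open>exp (- x)\<close> costs the square of the
  variance. One factor is kept and the other replaced by \<open>K\<^sup>2 + tail_var K N\<close>,
  because averages of variances are under control but averages of their squares are not.\<close>

lemma char_centered_approx:
  assumes N: "sq_dist N" and K: "K \<ge> 0"
  shows "cmod (iexp (- t * (LINT x|N. x)) * char N t - exp (- (t\<^sup>2 * var_of N / 2)))
     \<le> t\<^sup>2 * (tail_var K N + \<bar>t\<bar> * K * var_of N / 6) + t^4 / 8 * (var_of N * (K\<^sup>2 + tail_var K N))"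
proof -
  interpret real_distribution N using N by (simp add: sq_dist_def)
  note 1 = char_centered_approx1[OF N K, of t]
  have "cmod (complex_of_real ((1 - t^2 * var_of N / 2) - exp (- (t\<^sup>2 * var_of N / 2)))) \<le> (t^2 * var_of N / 2)\<^sup>2 / 2"
    unfolding norm_of_real by (rule abs_one_minus_exp_le) (simp add: var_of_nonneg)
  also have "\<dots> = t^4 / 8 * (var_of N * var_of N)" by (simp add: power2_eq_square power4_eq_xxxx)
  also have "\<dots> \<le> t^4 / 8 * (var_of N * (K\<^sup>2 + tail_var K N))"
    by (intro mult_left_mono var_of_le var_of_nonneg N K) auto
  finally have 2: "cmod (complex_of_real ((1 - t^2 * var_of N / 2) - exp (- (t\<^sup>2 * var_of N / 2)))) \<le> t^4 / 8 * (var_of N * (K\<^sup>2 + tail_var K N))" .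
  show ?thesis
    using norm_triangle_mono[OF 1 2] by (simp add: algebra_simps)
qed


text \<open>Deterministic conditions that the ergodic theorem provides for almost every environment.
  Beyond square integrability they concern averages over the steps: a single law may have a large
  variance, and its decay rate \<open>w j\<close> may be 0.\<close>

locale sq_dist_seq =
  fixes \<nu> :: "nat \<Rightarrow> real measure" and k :: "nat \<Rightarrow> nat" and s2 :: real
  assumes sq: "\<And>j. sq_dist (\<nu> j)"
    and k_le: "\<And>n. k n \<le> n" and k_small: "(\<lambda>n. real (k n) / real n) \<longlonglongrightarrow> 0"
    and s2_pos: "0 < s2"
    and var_avg: "(\<lambda>n. (\<Sum>j<n. var_of (\<nu> j)) / real n) \<longlonglongrightarrow> s2"
    and lindeberg: "\<And>e. 0 < e \<Longrightarrow> \<exists>K\<ge>0. \<forall>\<^sub>F n in sequentially. (\<Sum>j<n. tail_var K (\<nu> j)) / real n \<le> e"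
    and char_decay: "\<And>R. 0 < R \<Longrightarrow> \<exists>w c. 0 < c \<and>
       (\<forall>j. 0 \<le> w j \<and> w j \<le> 1 \<and> (\<forall>t. \<bar>t\<bar> \<le> R \<longrightarrow> (cmod (char (\<nu> j) t))\<^sup>2 \<le> 1 - w j * t\<^sup>2)) \<and>
       (\<forall>\<^sub>F n in sequentially. c * real n \<le> (\<Sum>j<n. w j))"
begin

lemma rd: "real_distribution (\<nu> j)"
  using sq unfolding sq_dist_def by blast

definition mean :: "nat \<Rightarrow> real" where "mean j = (LINT x|\<nu> j. x)"

definition Y :: "nat \<Rightarrow> real measure" where
  "Y n = distr (conv_from \<nu> (k n) (n - k n)) borel (\<lambda>y. y - (\<Sum>j\<in>{k n..<n}. mean j))"

lemma real_distribution_Y: "real_distribution (Y n)"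
proof -
  interpret real_distribution "conv_from \<nu> (k n) (n - k n)"
    by (rule real_distribution_conv_from[OF rd])
  show ?thesis unfolding Y_def by (rule real_distribution_distr) simp
qed

lemma char_Y: "char (Y n) t = (\<Prod>j\<in>{k n..<n}. iexp (- t * mean j) * char (\<nu> j) t)"
proof -
  have "char (Y n) t = iexp (- t * (\<Sum>j\<in>{k n..<n}. mean j)) * char (conv_from \<nu> (k n) (n - k n)) t"
    unfolding Y_def using char_affine[OF real_distribution_conv_from[OF rd], where l=1] by simp
  also have "char (conv_from \<nu> (k n) (n - k n)) t = (\<Prod>j\<in>{k n..<n}. char (\<nu> j) t)"
    using char_conv_from[of \<nu> "k n" "n - k n" t, OF rd] k_le[of n] by simp
  also have "iexp (- t * (\<Sum>j\<in>{k n..<n}. mean j)) = (\<Prod>j\<in>{k n..<n}. iexp (- t * mean j))"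
    by (simp add: sum_distrib_left exp_sum)
  finally show ?thesis by (simp add: prod.distrib)
qed

lemma norm_char_le_1: "cmod (char (\<nu> j) t) \<le> 1"
  using real_distribution.cmod_char_le_1[OF rd] .

text \<open>The squared factors are at most \<open>exp (- (w j * t\<^sup>2))\<close> by
  \<open>1 - x \<le> exp (- x)\<close>. Leaving out the first \<open>k n\<close> steps loses at most
  \<open>k n\<close> of the sum of the \<open>w j\<close>, which is eventually below half of the
  bound \<open>c * real n\<close>; undoing the square halves the constant once more, giving
  \<open>c / 4\<close>.\<close>

lemma char_Y_decay:
  assumes "R > 0"
  shows "\<exists>c>0. \<forall>\<^sub>F n in sequentially. \<forall>t. \<bar>t\<bar> \<le> R \<longrightarrow> cmod (char (Y n) t) \<le> exp (- c * (sqrt (real n))\<^sup>2 * t\<^sup>2)"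
proof -
  obtain w c where c: "0 < c" and w: "\<And>j. 0 \<le> w j" "\<And>j. w j \<le> 1"
    "\<And>j t. \<bar>t\<bar> \<le> R \<Longrightarrow> (cmod (char (\<nu> j) t))\<^sup>2 \<le> 1 - w j * t\<^sup>2"
    and cn: "\<forall>\<^sub>F n in sequentially. c * real n \<le> (\<Sum>j<n. w j)"
    using char_decay[OF assms] by blast
  have kn: "\<forall>\<^sub>F n in sequentially. real (k n) / real n < c / 2"
    using order_tendstoD(2)[OF k_small, of "c / 2"] c by simp
  have "\<forall>\<^sub>F n in sequentially. \<forall>t. \<bar>t\<bar> \<le> R \<longrightarrow> cmod (char (Y n) t) \<le> exp (- (c / 4) * (sqrt (real n))\<^sup>2 * t\<^sup>2)"
    using cn kn eventually_gt_at_top[of 0]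
  proof eventually_elim
    case (elim n)
    have "(\<Sum>j<n. w j) = (\<Sum>j<k n. w j) + (\<Sum>j\<in>{k n..<n}. w j)"
      using k_le[of n] by (subst sum.union_disjoint[symmetric]) (auto intro!: sum.cong)
    moreover have "(\<Sum>j<k n. w j) \<le> real (k n)"
      using sum_mono[of "{..<k n}" w "\<lambda>_. 1"] w(2) by simp
    moreover have "real (k n) \<le> c / 2 * real n" using elim by (simp add: divide_less_eq)
    ultimately have sw: "c / 2 * real n \<le> (\<Sum>j\<in>{k n..<n}. w j)"
      using elim(1) by simp
    show ?case
    proof (intro allI impI)
      fix t assume t: "\<bar>t\<bar> \<le> R"
      have "(cmod (char (Y n) t))\<^sup>2 = (\<Prod>j\<in>{k n..<n}. (cmod (char (\<nu> j) t))\<^sup>2)"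
        unfolding char_Y by (simp add: norm_mult prod_power_distrib flip: prod_norm)
      also have "\<dots> \<le> (\<Prod>j\<in>{k n..<n}. exp (- (w j * t\<^sup>2)))"
      proof (intro prod_mono conjI)
        fix j
        show "(cmod (char (\<nu> j) t))\<^sup>2 \<le> exp (- (w j * t\<^sup>2))"
          using w(3)[OF t, of j] exp_ge_add_one_self[of "- (w j * t\<^sup>2)"] by simp
      qed simp
      also have "\<dots> = exp (- ((\<Sum>j\<in>{k n..<n}. w j) * t\<^sup>2))"
        by (simp add: exp_sum[symmetric] sum_distrib_right sum_negf)
      also have "\<dots> \<le> exp (- (c / 2 * real n * t\<^sup>2))"
        using mult_right_mono[OF sw, of "t\<^sup>2"] by simp
      also have "\<dots> = (exp (- (c / 4) * (sqrt (real n))\<^sup>2 * t\<^sup>2))\<^sup>2"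
        by (simp flip: exp_double)
      finally show "cmod (char (Y n) t) \<le> exp (- (c / 4) * (sqrt (real n))\<^sup>2 * t\<^sup>2)"
        by (rule power2_le_imp_le) simp
    qed
  qed
  with c show ?thesis by (intro exI[of _ "c / 4"]) auto
qed

lemma var_avg_segment: "(\<lambda>n. (\<Sum>j\<in>{k n..<n}. var_of (\<nu> j)) / real n) \<longlonglongrightarrow> s2"
proof -
  let ?S = "\<lambda>n. \<Sum>j<n. var_of (\<nu> j)"
  obtain B where B: "\<And>n. ?S n / real n \<le> B"
    using convergent_imp_Bseq[OF convergentI[OF var_avg]] unfolding Bseq_def
    by (metis abs_le_D1 real_norm_def)
  have S: "?S n \<le> B * real n" for n
    using B[of n] by (cases "n = 0") (auto simp: divide_le_eq)
  have "(\<lambda>n. ?S (k n) / real n) \<longlonglongrightarrow> 0"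
  proof (rule Lim_null_comparison)
    show "(\<lambda>n. B * (real (k n) / real n)) \<longlonglongrightarrow> 0"
      using tendsto_mult_right_zero[OF k_small] .
    show "\<forall>\<^sub>F n in sequentially. norm (?S (k n) / real n) \<le> B * (real (k n) / real n)"
      using S[of "k n" for n] by (intro always_eventually allI) (auto simp: sum_nonneg var_of_nonneg divide_right_mono)
  qed
  from tendsto_diff[OF var_avg this]
  have "(\<lambda>n. ?S n / real n - ?S (k n) / real n) \<longlonglongrightarrow> s2" by simp
  moreover have "?S n / real n - ?S (k n) / real n = (\<Sum>j\<in>{k n..<n}. var_of (\<nu> j)) / real n" for n
  proof -
    have "?S n = ?S (k n) + (\<Sum>j\<in>{k n..<n}. var_of (\<nu> j))"
      using k_le[of n] by (subst sum.union_disjoint[symmetric]) (auto intro!: sum.cong)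
    then show ?thesis by (simp add: diff_divide_distrib[symmetric])
  qed
  ultimately show ?thesis by simp
qed

text \<open>Lindeberg's argument: since all factors have modulus at most 1, the difference of the
  two products is at most the sum of the differences of the factors, and
  \<open>char_centered_approx\<close> applies to each of them at
  \<open>s / sqrt (real n)\<close>.\<close>

lemma char_Y_limit: "(\<lambda>n. char (Y n) (s / sqrt (real n))) \<longlonglongrightarrow> of_real (exp (- (sqrt s2 * s)\<^sup>2 / 2))"
proof -
  let ?t = "\<lambda>n. s / sqrt (real n)"
  let ?V = "\<lambda>n. (\<Sum>j<n. var_of (\<nu> j)) / real n"
  define E where "E n = complex_of_real (exp (- (s\<^sup>2 / 2 * ((\<Sum>j\<in>{k n..<n}. var_of (\<nu> j)) / real n))))" for n
  have "E \<longlonglongrightarrow> of_real (exp (- (s\<^sup>2 / 2 * s2)))"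
    unfolding E_def by (intro tendsto_intros var_avg_segment)
  moreover have "(\<lambda>n. char (Y n) (?t n) - E n) \<longlonglongrightarrow> 0"
  proof (rule tendsto_0_le[where K=1, OF _ always_eventually])
    show "(\<lambda>n. cmod (char (Y n) (?t n) - E n)) \<longlonglongrightarrow> 0"
    proof (rule tendstoI)
      fix d :: real assume d: "d > 0"
      define B where "B = s2 + 1"
      have B: "B > 0" using s2_pos by (simp add: B_def)
      \<comment> \<open>Chosen so that the terms of the final estimate that are proportional to
        \<open>e\<close> add up to at most \<open>d / 2\<close>; the summand 1 keeps the denominator
        positive when \<open>s\<close> is 0.\<close>
      define e where "e = d / 2 / (s\<^sup>2 + s^4 * B + 1)"
      have den: "s\<^sup>2 + s^4 * B + 1 > 0" using B by (intro add_nonneg_pos add_nonneg_nonneg) auto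
      have e: "e > 0" using d den by (simp add: e_def)
      obtain K where K: "K \<ge> 0" and tail: "\<forall>\<^sub>F n in sequentially. (\<Sum>j<n. tail_var K (\<nu> j)) / real n \<le> e"
        using lindeberg[OF e] by blast
      have "(\<lambda>n. \<bar>s\<bar>^3 * K * B / 6 * (1 / sqrt (real n)) + s^4 / 8 * (B * K\<^sup>2 * (1 / real n))) \<longlonglongrightarrow> \<bar>s\<bar>^3 * K * B / 6 * 0 + s^4 / 8 * (B * K\<^sup>2 * 0)"
        by (intro tendsto_intros lim_1_over_n) (auto intro!: filterlim_compose[OF sqrt_at_top] filterlim_real_sequentially tendsto_divide_0[OF tendsto_const] filterlim_at_top_imp_at_infinity)
      then have small: "\<forall>\<^sub>F n in sequentially. \<bar>s\<bar>^3 * K * B / 6 * (1 / sqrt (real n)) + s^4 / 8 * (B * K\<^sup>2 * (1 / real n)) < d / 2"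
        using d by (intro order_tendstoD(2)) auto
      have VB: "\<forall>\<^sub>F n in sequentially. ?V n < B"
        using order_tendstoD(2)[OF var_avg] by (simp add: B_def)
      show "\<forall>\<^sub>F n in sequentially. dist (cmod (char (Y n) (?t n) - E n)) 0 < d"
        using tail small VB eventually_gt_at_top[of 0]
      proof eventually_elim
        case (elim n)
        let ?T = "\<Sum>j<n. tail_var K (\<nu> j)" and ?S = "\<Sum>j<n. var_of (\<nu> j)"
        have n: "real n > 0" "sqrt (real n) > 0" using elim by auto
        have t2: "(?t n)\<^sup>2 = s\<^sup>2 / real n" by (simp add: power_divide)
        have t4: "(?t n)^4 = s^4 / (real n)\<^sup>2"
        proof -
          have "(?t n)^4 = ((?t n)\<^sup>2)\<^sup>2" by simp
          also have "\<dots> = s^4 / (real n)\<^sup>2" unfolding t2 by (simp add: power_divide)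
          finally show ?thesis .
        qed
        have E: "E n = (\<Prod>j\<in>{k n..<n}. complex_of_real (exp (- ((?t n)\<^sup>2 * var_of (\<nu> j) / 2))))"
          unfolding E_def t2 of_real_prod[symmetric] exp_sum[OF finite_atLeastLessThan, symmetric]
          by (simp add: sum_negf sum_divide_distrib sum_distrib_left mult_ac)
        have "cmod (char (Y n) (?t n) - E n) \<le> (\<Sum>j\<in>{k n..<n}. cmod (iexp (- ?t n * mean j) * char (\<nu> j) (?t n) - of_real (exp (- ((?t n)\<^sup>2 * var_of (\<nu> j) / 2)))))"
          unfolding char_Y E by (rule norm_prod_diff) (auto simp: norm_mult norm_char_le_1 var_of_nonneg)
        also have "\<dots> \<le> (\<Sum>j\<in>{k n..<n}. (?t n)\<^sup>2 * (tail_var K (\<nu> j) + \<bar>?t n\<bar> * K * var_of (\<nu> j) / 6)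
              + (?t n)^4 / 8 * (var_of (\<nu> j) * (K\<^sup>2 + tail_var K (\<nu> j))))"
          unfolding mean_def by (intro sum_mono char_centered_approx[OF sq K])
        also have "\<dots> \<le> (\<Sum>j<n. (?t n)\<^sup>2 * (tail_var K (\<nu> j) + \<bar>?t n\<bar> * K * var_of (\<nu> j) / 6)
              + (?t n)^4 / 8 * (var_of (\<nu> j) * (K\<^sup>2 + tail_var K (\<nu> j))))"
          using K by (intro sum_mono2) (auto intro!: add_nonneg_nonneg mult_nonneg_nonneg simp: tail_var_nonneg var_of_nonneg)
        \<comment> \<open>A single truncated variance is enlarged to the sum \<open>?T\<close>,
          which turns the sum of products into a product of sums. This is affordable because
          \<open>(?t n)^4\<close> has order \<open>1 / (real n)\<^sup>2\<close>.\<close>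
        also have "\<dots> \<le> (\<Sum>j<n. (?t n)\<^sup>2 * (tail_var K (\<nu> j) + \<bar>?t n\<bar> * K * var_of (\<nu> j) / 6)
              + (?t n)^4 / 8 * (var_of (\<nu> j) * (K\<^sup>2 + ?T)))"
          by (intro sum_mono add_left_mono mult_left_mono member_le_sum) (auto simp: tail_var_nonneg var_of_nonneg)
        also have "\<dots> = (?t n)\<^sup>2 * (?T + \<bar>?t n\<bar> * K * ?S / 6) + (?t n)^4 / 8 * (?S * (K\<^sup>2 + ?T))"
          by (simp only: sum.distrib sum_distrib_left[symmetric] sum_distrib_right[symmetric] sum_divide_distrib[symmetric])
        also have "\<dots> = s\<^sup>2 * (?T / real n) + \<bar>s\<bar>^3 * K / 6 * (1 / sqrt (real n)) * ?V n + s^4 / 8 * (?V n * (K\<^sup>2 * (1 / real n) + ?T / real n))"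
          unfolding t2 t4 using n by (simp add: abs_div field_simps power2_eq_square power3_eq_cube)
        also have "\<dots> \<le> s\<^sup>2 * e + \<bar>s\<bar>^3 * K / 6 * (1 / sqrt (real n)) * B + s^4 / 8 * (B * (K\<^sup>2 * (1 / real n) + e))"
        proof (intro add_mono mult_left_mono mult_mono)
          show "?T / real n \<le> e" "?T / real n \<le> e" "?V n \<le> B" "?V n \<le> B" using elim by simp_all
          have "0 \<le> ?T / real n" by (intro divide_nonneg_nonneg sum_nonneg tail_var_nonneg) simp
          then show "0 \<le> K\<^sup>2 * (1 / real n) + ?T / real n" by simp
        qed (use K B in auto)
        also have "\<dots> = (s\<^sup>2 + s^4 * B / 8) * e + (\<bar>s\<bar>^3 * K * B / 6 * (1 / sqrt (real n)) + s^4 / 8 * (B * K\<^sup>2 * (1 / real n)))"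
          by (simp add: algebra_simps)
        also have "\<dots> < d / 2 + d / 2"
        proof (rule add_le_less_mono)
          have "(s\<^sup>2 + s^4 * B / 8) * e \<le> (s\<^sup>2 + s^4 * B + 1) * e"
            using e B by (intro mult_right_mono) auto
          also have "\<dots> = d / 2"
          proof -
            have "x * (d / 2 / x) = d / 2" if "x > 0" for x :: real using that by simp
            from this[OF den] show ?thesis unfolding e_def .
          qed
          finally show "(s\<^sup>2 + s^4 * B / 8) * e \<le> d / 2" .
        qed (rule elim(2))
        finally show ?case by simp
      qed
    qed
  qed simp
  ultimately have "(\<lambda>n. char (Y n) (?t n) - E n + E n) \<longlonglongrightarrow> 0 + of_real (exp (- (s\<^sup>2 / 2 * s2)))"
    by (intro tendsto_add)
  then show ?thesis
    using s2_pos by (simp add: power_mult_distrib mult_ac)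
qed

lemma measure_Y: "measure (Y n) {a + x<..<b + x} =
  measure (conv_from \<nu> (k n) (n - k n)) {a + x + (\<Sum>j\<in>{k n..<n}. mean j)<..<b + x + (\<Sum>j\<in>{k n..<n}. mean j)}"
  using measure_distr_affine[OF real_distribution_conv_from[OF rd], where l = 1 and x = "\<Sum>j\<in>{k n..<n}. mean j" and a = "a + x" and b = "b + x"]
  by (simp add: Y_def)

lemma conv_local_limit_bounded:
  "\<exists>C. \<forall>\<^sub>F n in sequentially. \<forall>x. sqrt (real n) * measure (Y n) {a + x<..<b + x} \<le> C"
  by (rule local_limit_bounded[OF real_distribution_Y _ char_Y_decay])
     (auto intro: filterlim_compose[OF sqrt_at_top filterlim_real_sequentially])

lemma conv_local_limit:
  assumes "\<eta> \<longlonglongrightarrow> 0" "a < b" "e > 0"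
  shows "\<forall>\<^sub>F n in sequentially. \<forall>x. \<bar>x\<bar> \<le> \<eta> n * sqrt (real n) \<longrightarrow>
     \<bar>sqrt (real n) * measure (Y n) {a + x<..<b + x} - (b - a) / (sqrt s2 * sqrt (2 * pi))\<bar> < e"
  by (rule local_limit_uniform[OF real_distribution_Y _ _ char_Y_decay char_Y_limit assms])
     (auto intro: filterlim_compose[OF sqrt_at_top filterlim_real_sequentially] simp: s2_pos)

end

section \<open>Decay of characteristic functions of non-lattice laws\<close>

lemma tail_var_tendsto_0:
  assumes N: "sq_dist N"
  shows "(\<lambda>n. tail_var (real n) N) \<longlonglongrightarrow> 0"
proof -
  interpret real_distribution N using N by (simp add: sq_dist_def)
  let ?m = "LINT x|N. x"
  have "(\<lambda>n. LINT x|N. (x - ?m)\<^sup>2 * indicator {x. real n < \<bar>x - ?m\<bar>} x) \<longlonglongrightarrow> (LINT x|N. 0)"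
  proof (rule integral_dominated_convergence)
    show "integrable N (\<lambda>x. (x - ?m)\<^sup>2)" by (rule sq_dist_integrable[OF N])
    show "AE x in N. (\<lambda>n. (x - ?m)\<^sup>2 * indicator {x. real n < \<bar>x - ?m\<bar>} x) \<longlonglongrightarrow> 0"
    proof (rule AE_I2)
      fix x
      have "\<forall>\<^sub>F n in sequentially. \<bar>x - ?m\<bar> \<le> real n"
        using eventually_ge_at_top[of "nat \<lceil>\<bar>x - ?m\<bar>\<rceil>"] by eventually_elim (simp add: nat_ceiling_le_eq)
      then have "\<forall>\<^sub>F n in sequentially. (x - ?m)\<^sup>2 * indicator {x. real n < \<bar>x - ?m\<bar>} x = 0"
        by eventually_elim (simp add: indicator_def)
      then show "(\<lambda>n. (x - ?m)\<^sup>2 * indicator {x. real n < \<bar>x - ?m\<bar>} x) \<longlonglongrightarrow> 0"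
        by (rule tendsto_eventually)
    qed
  qed (auto simp: indicator_def)
  then show ?thesis by (simp add: tail_var_def)
qed

text \<open>A law of variance 0 sits at its mean, which is the degenerate lattice with spacing
  \<open>d = 0\<close>.\<close>

lemma var_of_pos:
  assumes N: "sq_dist N" and nl: "non_lattice N"
  shows "0 < var_of N"
proof (rule ccontr)
  interpret real_distribution N using N by (simp add: sq_dist_def)
  assume "\<not> 0 < var_of N"
  then have "var_of N = 0" using var_of_nonneg[of N] by linarith
  then have "(LINT x|N. (x - (LINT x|N. x))\<^sup>2) = 0" by (simp only: var_of_def)
  then have "AE x in N. (x - (LINT x|N. x))\<^sup>2 = 0"
    using integral_nonneg_eq_0_iff_AE[OF sq_dist_integrable(2)[OF N]] by simp
  then have "AE x in N. \<exists>k::int. x = (LINT x|N. x) + 0 * of_int k" by simp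
  with nl show False unfolding non_lattice_def by blast
qed

text \<open>Equality in the triangle inequality: if the modulus is 1 and \<open>c\<close> is the
  phase, then \<open>1 - cos (t * x - c)\<close> is nonnegative with integral 0, so that
  \<open>x\<close> lies in a lattice of spacing \<open>2 * pi / t\<close>.\<close>

lemma char_lt_1:
  assumes "real_distribution N" and nl: "non_lattice N" and t: "t \<noteq> 0"
  shows "cmod (char N t) < 1"
proof (rule ccontr)
  interpret real_distribution N by fact
  assume "\<not> cmod (char N t) < 1"
  then have 1: "cmod (char N t) = 1" using cmod_char_le_1[of t] by simp
  define c where "c = Arg (char N t)"
  have ch: "char N t = iexp c"
  proof -
    have "char N t \<noteq> 0" using 1 by auto
    with 1 cis_Arg[of "char N t"] show ?thesis by (simp add: c_def sgn_eq cis_conv_exp)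
  qed
  have int: "integrable N (\<lambda>x. iexp (t * x - c))" by (rule integrable_iexp) auto
  have "(CLINT x|N. iexp (t * x - c)) = (CLINT x|N. iexp (- c) * iexp (t * x))"
    by (simp add: algebra_simps exp_diff exp_minus field_simps)
  also have "\<dots> = iexp (- c) * char N t" unfolding char_def by (rule integral_mult_right_zero)
  also have "\<dots> = 1" unfolding ch by (simp flip: exp_add)
  finally have one: "(CLINT x|N. iexp (t * x - c)) = 1" .
  have "(LINT x|N. Re (iexp (t * x - c))) = 1" unfolding integral_Re[OF int] one by simp
  moreover have "Re (iexp y) = cos y" for y by (simp add: Re_exp)
  ultimately have cos1: "(LINT x|N. cos (t * x - c)) = 1" by (simp only:)
  have intc: "integrable N (\<lambda>x. cos (t * x - c))"
    by (rule integrable_const_bound[of _ 1]) auto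
  have "(LINT x|N. 1 - cos (t * x - c)) = 0"
    using cos1 intc prob_space by simp
  then have "AE x in N. 1 - cos (t * x - c) = 0"
    using integral_nonneg_eq_0_iff_AE[of N "\<lambda>x. 1 - cos (t * x - c)"] intc by simp
  then have "AE x in N. \<exists>k::int. x = c / t + (2 * pi / t) * of_int k"
  proof eventually_elim
    case (elim x)
    then have "cos (t * x - c) = 1" by simp
    then obtain k :: int where "t * x - c = of_int k * 2 * pi" by (auto simp: cos_one_2pi_int)
    then have "x = c / t + (2 * pi / t) * of_int k" using t by (simp add: field_simps)
    then show ?case by blast
  qed
  with nl show False unfolding non_lattice_def by blast
qed

definition decay_ratio :: "real measure \<Rightarrow> real \<Rightarrow> real" where
  "decay_ratio N t = (1 - (cmod (char N t))\<^sup>2) / t\<^sup>2"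

text \<open>The infimum ranges over rationals only, to keep the rate measurable in the law. A positive
  rate controls the characteristic function on all of \<open>[- R, R]\<close>, both near 0 and away from it.\<close>

definition char_decay_rate :: "real \<Rightarrow> real measure \<Rightarrow> real" where
  "char_decay_rate R N = min 1 (INF t\<in>{0<..R} \<inter> \<rat>. decay_ratio N t)"

lemma decay_ratio_nonneg: "real_distribution N \<Longrightarrow> 0 \<le> decay_ratio N t"
  using real_distribution.cmod_char_le_1[of N t] power_le_one[of "cmod (char N t)" 2]
  by (simp add: decay_ratio_def)

lemma rat_interval_nonempty: "0 < (R::real) \<Longrightarrow> {0<..R} \<inter> \<rat> \<noteq> {}"
  using Rats_dense_in_real[of 0 R] by fastforce

lemma char_decay_rate_le_1: "char_decay_rate R N \<le> 1"
  by (simp add: char_decay_rate_def)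

lemma char_decay_rate_nonneg:
  assumes "real_distribution N" "0 < R" shows "0 \<le> char_decay_rate R N"
  unfolding char_decay_rate_def using rat_interval_nonempty[OF assms(2)] decay_ratio_nonneg[OF assms(1)]
  by (intro min.boundedI cINF_greatest) auto

lemma continuous_on_decay_ratio:
  assumes "real_distribution N" "0 \<notin> A" shows "continuous_on A (decay_ratio N)"
proof -
  interpret real_distribution N by fact
  have "continuous_on A (char N)" using isCont_char by (intro continuous_at_imp_continuous_on) auto
  then show ?thesis
    unfolding decay_ratio_def[abs_def] using assms(2) by (intro continuous_intros) auto
qed

lemma cmod_char_minus: "real_distribution N \<Longrightarrow> cmod (char N (- t)) = cmod (char N t)"
proof -
  assume "real_distribution N"
  then interpret real_distribution N .
  have "char N (- t) = (CLINT x|N. cnj (iexp (t * x)))"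
    unfolding char_def by (simp add: exp_cnj)
  also have "\<dots> = cnj (char N t)"
    unfolding char_def by (rule integral_bounded_linear[OF bounded_linear_cnj]) (rule integrable_iexp, auto)
  finally show ?thesis by simp
qed

text \<open>Continuity of \<open>decay_ratio\<close> away from 0 passes from rational to real
  arguments, and conjugation treats negative ones.\<close>

lemma char_decay_rate_bound:
  assumes N: "real_distribution N" and t: "\<bar>t\<bar> \<le> R"
  shows "(cmod (char N t))\<^sup>2 \<le> 1 - char_decay_rate R N * t\<^sup>2"
proof -
  interpret real_distribution N by fact
  have pos: "(cmod (char N t))\<^sup>2 \<le> 1 - char_decay_rate R N * t\<^sup>2" if t: "0 < t" "t \<le> R" for t
  proof -
    have rat: "char_decay_rate R N \<le> decay_ratio N q" if "q \<in> {0<..R} \<inter> \<rat>" for q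
    proof -
      have "(INF t\<in>{0<..R} \<inter> \<rat>. decay_ratio N t) \<le> decay_ratio N q"
        using that decay_ratio_nonneg[OF N] by (intro cINF_lower bdd_belowI[of _ 0]) auto
      then show ?thesis by (simp add: char_decay_rate_def min.coboundedI2)
    qed
    have "char_decay_rate R N \<le> decay_ratio N t"
    proof (rule field_le_epsilon)
      fix e :: real assume e: "e > 0"
      have "isCont (decay_ratio N) t"
        using continuous_on_decay_ratio[OF N, of "{0<..}"] t
        by (auto simp: continuous_on_eq_continuous_at)
      then have "\<exists>d>0. \<forall>x. \<bar>x - t\<bar> < d \<longrightarrow> \<bar>decay_ratio N x - decay_ratio N t\<bar> < e"
        using e by (auto simp: continuous_at_eps_delta dist_real_def)
      then obtain d where d: "d > 0" "\<And>x. \<bar>x - t\<bar> < d \<Longrightarrow> \<bar>decay_ratio N x - decay_ratio N t\<bar> < e" by blast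
      obtain q where q: "q \<in> \<rat>" "max 0 (t - d) < q" "q < t"
        using Rats_dense_in_real[of "max 0 (t - d)" t] t d by auto
      have "char_decay_rate R N \<le> decay_ratio N q" using q t by (intro rat) auto
      also have "\<dots> \<le> decay_ratio N t + e" using d(2)[of q] q by auto
      finally show "char_decay_rate R N \<le> decay_ratio N t + e" .
    qed
    then show ?thesis using t by (simp add: decay_ratio_def field_simps)
  qed
  consider "t = 0" | "t > 0" | "t < 0" by linarith
  then show ?thesis
  proof cases
    case 1 then show ?thesis using cmod_char_le_1[of 0] by (simp add: power_le_one)
  next
    case 2 then show ?thesis using pos t by auto
  next
    case 3 then show ?thesis using pos[of "- t"] t cmod_char_minus[OF N, of t] by auto
  qed
qed

text \<open>Near 0 the second-order expansion keeps the ratio above a quarter of the variance. On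
  the remaining compact interval the ratio is continuous, and it is positive by
  \<open>char_lt_1\<close>.\<close>

lemma char_decay_rate_pos:
  assumes N: "sq_dist N" and nl: "non_lattice N" and R: "0 < R"
  shows "0 < char_decay_rate R N"
proof -
  interpret real_distribution N using N by (simp add: sq_dist_def)
  let ?v = "var_of N"
  have v: "?v > 0" by (rule var_of_pos[OF N nl])
  have "\<forall>\<^sub>F n in sequentially. tail_var (real n) N < ?v / 8"
    using order_tendstoD(2)[OF tail_var_tendsto_0[OF N], of "?v / 8"] v by simp
  then obtain n where n: "tail_var (real n) N < ?v / 8" by (auto simp: eventually_sequentially)
  \<comment> \<open>The first entry makes \<open>t * real n \<le> 1 / 2\<close>, which tames the
    cubic term; the second makes \<open>t\<^sup>2 * ?v \<le> 1\<close>, so that the leading term is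
    its own modulus.\<close>
  define t0 where "t0 = min (1 / (real n + 1) / 2) (1 / (?v + 1))"
  have t0: "t0 > 0" using v by (simp add: t0_def)
  have near: "?v / 4 \<le> decay_ratio N t" if t: "0 < t" "t \<le> t0" for t
  proof -
    have tn: "t * real n \<le> 1 / 2"
    proof -
      have "t * real n \<le> (1 / (real n + 1) / 2) * (real n + 1)" using t by (intro mult_mono) (auto simp: t0_def)
      also have "\<dots> = 1 / 2" by (simp add: divide_simps)
      finally show ?thesis .
    qed
    have "t \<le> 1 / (?v + 1)" using t by (simp add: t0_def)
    then have tv: "t * (?v + 1) \<le> 1" using v by (simp add: pos_le_divide_eq)
    have t1: "t \<le> 1" 
    proof -
      have "t * 1 \<le> t * (?v + 1)" using t v by (intro mult_left_mono) auto
      with tv show ?thesis by linarith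
    qed
    have "t\<^sup>2 * ?v = t * (t * ?v)" by (simp add: power2_eq_square)
    also have "\<dots> \<le> 1 * 1" using t t1 tv v by (intro mult_mono) (auto simp: algebra_simps)
    finally have t2v: "t\<^sup>2 * ?v \<le> 1" by simp
    have "cmod (char N t) = cmod (iexp (- t * (LINT x|N. x)) * char N t)" by (simp add: norm_mult)
    also have "\<dots> \<le> cmod (of_real (1 - t\<^sup>2 * ?v / 2)) + t\<^sup>2 * (tail_var (real n) N + \<bar>t\<bar> * real n * ?v / 6)"
      using char_centered_approx1[OF N, of "real n" t] norm_triangle_sub[of "iexp (- t * (LINT x|N. x)) * char N t" "of_real (1 - t\<^sup>2 * ?v / 2)"]
      by simp
    \<comment> \<open>The two errors 1/8 and 1/12 add up to less than 1/4, so at least half of the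
      main term \<open>t\<^sup>2 * ?v / 2\<close> survives.\<close>
    also have "\<dots> \<le> (1 - t\<^sup>2 * ?v / 2) + t\<^sup>2 * (?v / 8 + ?v / 12)"
    proof (intro add_mono mult_left_mono)
      show "cmod (of_real (1 - t\<^sup>2 * ?v / 2)) \<le> 1 - t\<^sup>2 * ?v / 2" unfolding norm_of_real using t2v by simp
      have "t * real n * ?v \<le> 1 / 2 * ?v" using tn v by (intro mult_right_mono) auto
      then show "\<bar>t\<bar> * real n * ?v / 6 \<le> ?v / 12" using t by simp
    qed (use n in auto)
    also have "\<dots> \<le> 1 - ?v / 4 * t\<^sup>2" using mult_nonneg_nonneg[of "t\<^sup>2" ?v] v by (simp add: algebra_simps)
    finally have a: "cmod (char N t) \<le> 1 - ?v / 4 * t\<^sup>2" .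
    have "(cmod (char N t))\<^sup>2 \<le> cmod (char N t)"
      using cmod_char_le_1[of t] by (simp add: power2_eq_square mult_left_le_one_le)
    with a have "?v / 4 * t\<^sup>2 \<le> 1 - (cmod (char N t))\<^sup>2" by simp
    then show ?thesis using t by (simp add: decay_ratio_def pos_le_divide_eq)
  qed
  have "\<exists>\<delta>>0. \<forall>t\<in>{t0..R}. \<delta> \<le> decay_ratio N t"
  proof (cases "t0 \<le> R")
    case True
    have "continuous_on {t0..R} (decay_ratio N)"
      using t0 by (intro continuous_on_decay_ratio real_distribution_axioms) auto
    then obtain x where x: "x \<in> {t0..R}" "\<And>y. y \<in> {t0..R} \<Longrightarrow> decay_ratio N x \<le> decay_ratio N y"
      using continuous_attains_inf[of "{t0..R}" "decay_ratio N"] True by auto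
    have "cmod (char N x) < 1" using x(1) t0 by (intro char_lt_1[OF real_distribution_axioms nl]) auto
    then have "(cmod (char N x))\<^sup>2 < 1" by (simp add: power_less_one_iff abs_square_less_1)
    then have "decay_ratio N x > 0" using x(1) t0 by (simp add: decay_ratio_def)
    with x(2) show ?thesis by blast
  qed (auto intro: exI[of _ 1])
  then obtain \<delta> where \<delta>: "\<delta> > 0" "\<And>t. t \<in> {t0..R} \<Longrightarrow> \<delta> \<le> decay_ratio N t" by blast
  have "min \<delta> (?v / 4) \<le> (INF t\<in>{0<..R} \<inter> \<rat>. decay_ratio N t)"
  proof (rule cINF_greatest[OF rat_interval_nonempty[OF R]])
    fix t assume "t \<in> {0<..R} \<inter> \<rat>"
    then show "min \<delta> (?v / 4) \<le> decay_ratio N t"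
      using near[of t] \<delta>(2)[of t] by (cases "t \<le> t0") (auto simp: min_le_iff_disj)
  qed
  then have "min 1 (min \<delta> (?v / 4)) \<le> char_decay_rate R N"
    unfolding char_decay_rate_def by (intro min.mono) auto
  moreover have "0 < min 1 (min \<delta> (?v / 4))" using \<delta> v by simp
  ultimately show ?thesis by linarith
qed

section \<open>The quenched branching random walk\<close>

text \<open>Membership is a finite conjunction about the proper prefixes of \<open>u\<close>.
  Measurability, and the independence of generation \<open>n\<close> from the labels of length
  \<open>n\<close> or more, are read off from it.\<close>

lemma particles_iff:
  "u \<in> particles t n \<longleftrightarrow> length u = n \<and> (\<forall>k<n. u ! k < fst (t (take k u)))"
proof (induction n arbitrary: u)
  case (Suc n)
  show ?case
  proof (cases u rule: rev_cases)
    case (snoc v i)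
    have "u \<in> particles t (Suc n) \<longleftrightarrow> v \<in> particles t n \<and> i < fst (t v)"
      using snoc by auto
    also have "\<dots> \<longleftrightarrow> length u = Suc n \<and> (\<forall>k<Suc n. u ! k < fst (t (take k u)))"
      unfolding Suc using snoc by (auto simp: nth_append less_Suc_eq)
    finally show ?thesis .
  qed auto
qed auto

lemma length_particles: "u \<in> particles t n \<Longrightarrow> length u = n"
  by (simp add: particles_iff)

lemma particles_cong:
  "(\<And>u. length u < n \<Longrightarrow> t u = t' u) \<Longrightarrow> particles t n = particles t' n"
  by (auto simp: set_eq_iff particles_iff)

lemma position_cong:
  "(\<And>v. length v < length u \<Longrightarrow> t v = t' v) \<Longrightarrow> position t u = position t' u"
  unfolding position_def by (intro sum.cong) auto

lemma particles_upd: "n \<le> length v \<Longrightarrow> particles (t(v := z)) n = particles t n"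
  by (rule particles_cong) auto

lemma position_upd: "length u \<le> length v \<Longrightarrow> position (t(v := z)) u = position t u"
  by (rule position_cong) auto

lemma sum_particles_Suc:
  "(\<Sum>u\<in>particles t (Suc n). f u) = (\<Sum>u\<in>particles t n. \<Sum>i<fst (t u). f (u @ [i]))"
proof -
  have "(\<Sum>u\<in>particles t n. \<Sum>i<fst (t u). f (u @ [i])) = (\<Sum>(u, i)\<in>(SIGMA u:particles t n. {..<fst (t u)}). f (u @ [i]))"
    by (intro sum.Sigma finite_particles ballI) simp
  also have "\<dots> = (\<Sum>u\<in>particles t (Suc n). f u)"
    by (rule sum.reindex_bij_witness[where j="\<lambda>(u, i). u @ [i]" and i="\<lambda>u. (butlast u, last u)"]) auto
  finally show ?thesis ..
qed

lemma measurable_fst_offspring [measurable]: "fst \<in> offspring_space \<rightarrow>\<^sub>M count_space UNIV"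
  unfolding offspring_space_def by measurable

lemma measurable_snd_offspring [measurable]: "(\<lambda>z. snd z i) \<in> borel_measurable offspring_space"
  unfolding offspring_space_def by measurable

lemma space_offspring [simp]: "space offspring_space = UNIV"
  by (simp add: offspring_space_def space_pair_measure space_PiM)

lemma nn_integral_\<nu>_of:
  assumes p: "sets p = sets offspring_space" and f: "f \<in> borel_measurable borel"
  shows "(\<integral>\<^sup>+y. f y \<partial>\<nu>_of p) = (\<integral>\<^sup>+z. (\<Sum>i<fst z. f (snd z i)) \<partial>p) / mean_offspring p"
  using f
proof (induction rule: borel_measurable_induct)
  case (cong f g)
  then show ?case by (simp add: space_borel fun_eq_iff[symmetric])
next
  case (set A)
  then show ?case using emeasure_\<nu>_of[OF p, of A] by simp
next
  case (mult u c)
  note [measurable] = mult(2)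
  have [measurable]: "(\<lambda>z. \<Sum>i<fst z. u (snd z i)) \<in> borel_measurable p"
    unfolding measurable_cong_sets[OF p refl]
    by (rule measurable_compose_countable[where f="\<lambda>n z. \<Sum>i<n. u (snd z i)" and g=fst]) measurable
  have "(\<integral>\<^sup>+z. (\<Sum>i<fst z. c * u (snd z i)) \<partial>p) = c * (\<integral>\<^sup>+z. (\<Sum>i<fst z. u (snd z i)) \<partial>p)"
    by (subst nn_integral_cmult[symmetric]) (auto simp: sum_distrib_left)
  then show ?case using mult by (simp add: nn_integral_cmult ennreal_times_divide)
next
  case (add u v)
  have [measurable]: "u \<in> borel_measurable borel" "v \<in> borel_measurable borel" using add by auto
  have [measurable]: "(\<lambda>z. \<Sum>i<fst z. w (snd z i)) \<in> borel_measurable p" if [measurable]: "w \<in> borel_measurable borel" for w :: "real \<Rightarrow> ennreal"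
    unfolding measurable_cong_sets[OF p refl]
    by (rule measurable_compose_countable[where f="\<lambda>n z. \<Sum>i<n. w (snd z i)" and g=fst]) measurable
  have "(\<integral>\<^sup>+z. (\<Sum>i<fst z. v (snd z i) + u (snd z i)) \<partial>p) = (\<integral>\<^sup>+z. (\<Sum>i<fst z. v (snd z i)) \<partial>p) + (\<integral>\<^sup>+z. (\<Sum>i<fst z. u (snd z i)) \<partial>p)"
    by (subst nn_integral_add[symmetric]) (auto simp: sum.distrib)
  then show ?case using add by (simp add: nn_integral_add add_divide_distrib_ennreal)
next
  case (seq U)
  note [measurable] = seq(1)
  have [measurable]: "(\<lambda>z. \<Sum>i<fst z. w (snd z i)) \<in> borel_measurable p" if [measurable]: "w \<in> borel_measurable borel" for w :: "real \<Rightarrow> ennreal"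
    unfolding measurable_cong_sets[OF p refl]
    by (rule measurable_compose_countable[where f="\<lambda>n z. \<Sum>i<n. w (snd z i)" and g=fst]) measurable
  have inc: "incseq (\<lambda>k z. \<Sum>i<fst z. U k (snd z i))"
    using seq(3) by (auto simp: incseq_def le_fun_def intro!: sum_mono)
  have "(\<Sum>i<fst z. (SUP k. U k) (snd z i)) = (SUP k. \<Sum>i<fst z. U k (snd z i))" for z :: offspring
    using seq(3) by (simp add: image_comp ennreal_SUP_sum incseq_def le_fun_def)
  then have "(\<integral>\<^sup>+z. (\<Sum>i<fst z. (SUP k. U k) (snd z i)) \<partial>p) = (SUP k. \<integral>\<^sup>+z. (\<Sum>i<fst z. U k (snd z i)) \<partial>p)"
    by (simp only:) (rule nn_integral_monotone_convergence_SUP[OF inc], measurable)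
  moreover have "(\<integral>\<^sup>+y. (SUP k. U k) y \<partial>\<nu>_of p) = (SUP k. \<integral>\<^sup>+y. U k y \<partial>\<nu>_of p)"
    using seq(3) by (simp add: image_comp nn_integral_monotone_convergence_SUP)
  ultimately show ?case using seq by (simp add: SUP_divide_ennreal)
qed

text \<open>Fixed finite index sets that exhaust the lists of length \<open>n\<close>. A sum over
  the random set of particles is a limit of sums over boxes, which yields measurability and lets
  expectations be interchanged with sums.\<close>

definition list_box :: "nat \<Rightarrow> nat \<Rightarrow> nat list set" where
  "list_box n r = {u. set u \<subseteq> {..<r} \<and> length u = n}"

lemma finite_list_box: "finite (list_box n r)"
  unfolding list_box_def by (rule finite_lists_length_eq) simp

lemma list_box_mono: "r \<le> s \<Longrightarrow> list_box n r \<subseteq> list_box n s"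
  by (auto simp: list_box_def)

lemma eventually_particles_list_box: "\<forall>\<^sub>F r in sequentially. particles t n \<subseteq> list_box n r"
proof -
  have "\<exists>r. particles t n \<subseteq> list_box n r"
  proof -
    have "finite (\<Union>u\<in>particles t n. set u)" using finite_particles by auto
    then obtain r where "\<forall>i\<in>(\<Union>u\<in>particles t n. set u). i < r"
      using finite_nat_set_iff_bounded by blast
    then show ?thesis by (intro exI[of _ r]) (auto simp: list_box_def length_particles)
  qed
  then obtain r where r: "particles t n \<subseteq> list_box n r" ..
  show ?thesis using eventually_ge_at_top[of r]
    by eventually_elim (use r list_box_mono in blast)
qed

lemma sum_list_box_tendsto:
  fixes f :: "nat list \<Rightarrow> 'c :: {topological_space, comm_monoid_add}"
  shows "(\<lambda>r. \<Sum>u\<in>list_box n r. if u \<in> particles t n then f u else 0) \<longlonglongrightarrow> (\<Sum>u\<in>particles t n. f u)"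
proof -
  have "\<forall>\<^sub>F r in sequentially. (\<Sum>u\<in>list_box n r. if u \<in> particles t n then f u else 0) = (\<Sum>u\<in>particles t n. f u)"
    using eventually_particles_list_box[of t n]
  proof eventually_elim
    case (elim r)
    then show ?case
      by (simp add: sum.If_cases finite_list_box Int_absorb1 Collect_mem_eq)
  qed
  then show ?thesis by (rule tendsto_eventually)
qed

locale quenched =
  fixes p :: "nat \<Rightarrow> offspring measure"
  assumes prob_p: "\<And>j. prob_space (p j)"
    and sets_p [simp, measurable_cong]: "\<And>j. sets (p j) = sets offspring_space"
    and mean_pos: "\<And>j. 0 < mean_offspring (p j)"
    and mean_finite: "\<And>j. mean_offspring (p j) < \<infinity>"
begin

definition m :: "nat \<Rightarrow> real" where "m j = enn2real (mean_offspring (p j))"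

definition P :: "nat \<Rightarrow> real" where "P n = (\<Prod>i<n. m i)"

definition Q :: "(nat list \<Rightarrow> offspring) measure" where "Q = PiM UNIV (\<lambda>u. p (length u))"

abbreviation \<nu> :: "nat \<Rightarrow> real measure" where "\<nu> j \<equiv> \<nu>_of (p j)"

lemma mean_eq: "mean_offspring (p j) = ennreal (m j)"
  using mean_finite[of j] by (simp add: m_def ennreal_enn2real_if less_top)

lemma m_pos: "0 < m j"
  using mean_pos[of j] by (simp add: mean_eq)

lemma P_pos: "0 < P n"
  by (simp add: P_def prod_pos m_pos)

lemma P_Suc: "P (Suc n) = P n * m n"
  by (simp add: P_def)

lemma prob_Q: "prob_space Q"
  unfolding Q_def by (intro prob_space_PiM prob_p)

lemma space_p [simp]: "space (p j) = UNIV"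
  using sets_eq_imp_space_eq[OF sets_p] by simp

lemma space_Q [simp]: "space Q = UNIV"
  by (simp add: Q_def space_PiM PiE_def extensional_def)

lemma sets_Q: "sets Q = sets (PiM UNIV (\<lambda>_. offspring_space))"
  unfolding Q_def by (intro sets_PiM_cong) auto

lemma prob_\<nu>: "prob_space (\<nu> j)"
  using mean_pos[of j] mean_finite[of j] by (intro prob_space_\<nu>_of) auto

lemma real_distribution_\<nu>: "real_distribution (\<nu> j)"
  by (intro real_distributionI prob_\<nu>) simp

lemma measurable_coord [measurable]: "(\<lambda>t. t u) \<in> Q \<rightarrow>\<^sub>M offspring_space"
  unfolding measurable_cong_sets[OF sets_Q refl] by measurable

lemma measurable_fst_coord [measurable]: "(\<lambda>t. fst (t u)) \<in> Q \<rightarrow>\<^sub>M count_space UNIV"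
  using measurable_compose[OF measurable_coord measurable_fst_offspring] .

lemma measurable_snd_coord [measurable]: "(\<lambda>t. snd (t u) i) \<in> borel_measurable Q"
  using measurable_compose[OF measurable_coord measurable_snd_offspring] .

lemma measurable_particles [measurable]: "Measurable.pred Q (\<lambda>t. u \<in> particles t n)"
  unfolding particles_iff by measurable

lemma measurable_position [measurable]: "(\<lambda>t. position t u) \<in> borel_measurable Q"
  unfolding position_def by measurable

lemma measurable_particles_list_box [measurable]: "Measurable.pred Q (\<lambda>t. particles t n \<subseteq> list_box n r)"
  unfolding subset_eq Ball_def
proof (rule pred_intros_countable(1))
  fix x
  show "Measurable.pred Q (\<lambda>t. x \<in> particles t n \<longrightarrow> x \<in> list_box n r)"
    by (cases "x \<in> list_box n r") simp_all
qed

lemma measurable_sum_particles [measurable (raw)]: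
  fixes f :: "nat list \<Rightarrow> (nat list \<Rightarrow> offspring) \<Rightarrow> real"
  assumes [measurable]: "\<And>u. f u \<in> borel_measurable Q"
  shows "(\<lambda>t. \<Sum>u\<in>particles t n. f u t) \<in> borel_measurable Q"
  by (rule borel_measurable_LIMSEQ_metric[OF _ sum_list_box_tendsto]) measurable

lemma measurable_sum_particles_ennreal [measurable (raw)]:
  fixes f :: "nat list \<Rightarrow> (nat list \<Rightarrow> offspring) \<Rightarrow> ennreal"
  assumes [measurable]: "\<And>u. f u \<in> borel_measurable Q"
  shows "(\<lambda>t. \<Sum>u\<in>particles t n. f u t) \<in> borel_measurable Q"
  by (rule borel_measurable_LIMSEQ_order[OF sum_list_box_tendsto]) measurable

lemma measurable_card_particles [measurable]: "(\<lambda>t. real (card (particles t n))) \<in> borel_measurable Q"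
  using measurable_sum_particles[of "\<lambda>_ _. 1 :: real" n] by simp

lemma distr_upd: "distr (p (length v) \<Otimes>\<^sub>M Q) Q (\<lambda>(z, t). t(v := z)) = Q"
  using distr_pair_PiM_eq_PiM[of UNIV "\<lambda>u. p (length u)" v] prob_p by (simp add: Q_def)

lemma measurable_upd [measurable]: "(\<lambda>(z, t). t(v := z)) \<in> p (length v) \<Otimes>\<^sub>M Q \<rightarrow>\<^sub>M Q"
  using measurable_pair_swap[OF measurable_add_dim[of v UNIV "\<lambda>u. p (length u)"]]
  unfolding Q_def by (simp add: case_prod_beta')

text \<open>Redrawing the offspring of one label \<open>v\<close> independently leaves the product
  law unchanged. If the rest of the integrand ignores \<open>v\<close>, the inner integral is the
  conditional expectation given all other labels; this takes the place of conditioning on a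
  generation.\<close>

lemma nn_integral_resample:
  assumes [measurable]: "f \<in> borel_measurable Q"
  shows "(\<integral>\<^sup>+t. f t \<partial>Q) = (\<integral>\<^sup>+t. \<integral>\<^sup>+z. f (t(v := z)) \<partial>p (length v) \<partial>Q)"
proof -
  interpret p: prob_space "p (length v)" by (rule prob_p)
  interpret Q: prob_space Q by (rule prob_Q)
  interpret pair_prob_space "p (length v)" Q ..
  have "(\<integral>\<^sup>+t. f t \<partial>Q) = (\<integral>\<^sup>+t. f t \<partial>distr (p (length v) \<Otimes>\<^sub>M Q) Q (\<lambda>(z, t). t(v := z)))"
    by (simp only: distr_upd)
  also have "\<dots> = (\<integral>\<^sup>+x. f (case x of (z, t) \<Rightarrow> t(v := z)) \<partial>(p (length v) \<Otimes>\<^sub>M Q))"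
    by (rule nn_integral_distr) measurable
  also have "\<dots> = (\<integral>\<^sup>+t. \<integral>\<^sup>+z. f (t(v := z)) \<partial>p (length v) \<partial>Q)"
    by (subst nn_integral_snd[symmetric]) auto
  finally show ?thesis .
qed

lemma integral_resample:
  fixes f :: "(nat list \<Rightarrow> offspring) \<Rightarrow> real"
  assumes [measurable]: "f \<in> borel_measurable Q" and bdd: "\<And>t. \<bar>f t\<bar> \<le> B"
  shows "(LINT t|Q. f t) = (LINT t|Q. LINT z|p (length v). f (t(v := z)))"
proof -
  interpret p: prob_space "p (length v)" by (rule prob_p)
  interpret Q: prob_space Q by (rule prob_Q)
  interpret pair_prob_space "p (length v)" Q ..
  have "(LINT t|Q. f t) = (LINT t|distr (p (length v) \<Otimes>\<^sub>M Q) Q (\<lambda>(z, t). t(v := z)). f t)"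
    by (simp only: distr_upd)
  also have "\<dots> = (LINT x|(p (length v) \<Otimes>\<^sub>M Q). f (case x of (z, t) \<Rightarrow> t(v := z)))"
    by (rule integral_distr) measurable
  also have "\<dots> = (LINT x|(p (length v) \<Otimes>\<^sub>M Q). (case x of (z, t) \<Rightarrow> f (t(v := z))))"
    by (simp add: case_prod_beta')
  also have "\<dots> = (LINT t|Q. LINT z|p (length v). f (t(v := z)))"
    by (rule integral_snd[symmetric]) (auto intro!: integrable_const_bound[of _ B] bdd simp: case_prod_beta')
  finally show ?thesis .
qed

end

section \<open>Many-to-one formula\<close>

text \<open>Measurability with respect to the generations before \<open>j\<close>, expressed as a
  property of functions so that it combines directly with resampling.\<close>

definition depends_below :: "nat \<Rightarrow> ((nat list \<Rightarrow> offspring) \<Rightarrow> 'a) \<Rightarrow> bool" where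
  "depends_below j G \<longleftrightarrow> (\<forall>t t'. (\<forall>u. length u < j \<longrightarrow> t u = t' u) \<longrightarrow> G t = G t')"

lemma depends_below_upd: "depends_below j G \<Longrightarrow> j \<le> length v \<Longrightarrow> G (t(v := z)) = G t"
  unfolding depends_below_def by auto

lemma depends_below_mono: "depends_below j G \<Longrightarrow> j \<le> k \<Longrightarrow> depends_below k G"
  unfolding depends_below_def by (meson less_le_trans)

lemma depends_below_particles: "depends_below j (\<lambda>t. f (particles t j))"
  unfolding depends_below_def using particles_cong by metis

lemma depends_below_const: "depends_below j (\<lambda>t. c)"
  by (simp add: depends_below_def)

lemma depends_below_comp2: "depends_below j F \<Longrightarrow> depends_below j G \<Longrightarrow> depends_below j (\<lambda>t. f (F t) (G t))"
  unfolding depends_below_def by metis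

lemma depends_below_comp: "depends_below j G \<Longrightarrow> depends_below j (\<lambda>t. f (G t))"
  unfolding depends_below_def by metis

lemma borel_measurable_nn_integral_shift:
  fixes f :: "real \<Rightarrow> ennreal"
  assumes "finite_measure N" "sets N = sets borel" and [measurable]: "f \<in> borel_measurable borel"
  shows "(\<lambda>s. \<integral>\<^sup>+y. f (s + y) \<partial>N) \<in> borel_measurable borel"
proof -
  interpret finite_measure N by fact
  note [measurable_cong] = assms(2)
  show ?thesis by measurable
qed

context quenched
begin

lemma measurable_indicator_particles [measurable]:
  "(\<lambda>t. indicator (particles t n) u :: 'a :: {zero_neq_one, topological_space}) \<in> borel_measurable Q"
  unfolding indicator_def by measurable

lemma sum_particles_count_space:
  "(\<Sum>u\<in>particles t j. a u) = (\<integral>\<^sup>+u. a u * indicator (particles t j) u \<partial>count_space UNIV)" for a :: "nat list \<Rightarrow> ennreal"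
  by (subst nn_integral_count_space_indicator[symmetric]) (auto simp: nn_integral_count_space_finite finite_particles)

lemma nn_integral_sum_particles:
  assumes [measurable]: "\<And>u. a u \<in> borel_measurable Q"
  shows "(\<integral>\<^sup>+t. (\<Sum>u\<in>particles t j. a u t) \<partial>Q) = (\<integral>\<^sup>+u. \<integral>\<^sup>+t. a u t * indicator (particles t j) u \<partial>Q \<partial>count_space UNIV)"
  unfolding sum_particles_count_space by (rule nn_integral_count_space_nn_integral) auto

text \<open>Conditioning on generation \<open>j\<close>. For a fixed \<open>u\<close> of length
  \<open>j\<close>, redrawing \<open>t u\<close> affects neither \<open>G\<close> nor the position
  of \<open>u\<close> nor whether \<open>u\<close> is a particle. The sum over the random set is
  first written as an integral over all lists, which can be interchanged with the
  expectation.\<close>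

lemma nn_integral_particle_step:
  assumes G [measurable]: "G \<in> borel_measurable Q" "depends_below j G"
    and h [measurable]: "(\<lambda>(s, z). h s z) \<in> borel_measurable (borel \<Otimes>\<^sub>M offspring_space)"
  shows "(\<integral>\<^sup>+t. G t * (\<Sum>u\<in>particles t j. h (position t u) (t u)) \<partial>Q)
    = (\<integral>\<^sup>+t. G t * (\<Sum>u\<in>particles t j. \<integral>\<^sup>+z. h (position t u) z \<partial>p j) \<partial>Q)"
proof -
  interpret p: prob_space "p j" by (rule prob_p)
  have [measurable]: "(\<lambda>t. h (position t u) (t u)) \<in> borel_measurable Q" for u
    using measurable_compose[OF measurable_Pair[OF measurable_position[of u] measurable_coord[of u]] h] by simp
  have [measurable]: "(\<lambda>s. \<integral>\<^sup>+z. h s z \<partial>p j) \<in> borel_measurable borel"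
  proof -
    have "(\<lambda>(s, z). h s z) \<in> borel_measurable (borel \<Otimes>\<^sub>M p j)"
      using h by (simp cong: measurable_cong_sets sets_pair_measure_cong)
    then show ?thesis by (rule p.borel_measurable_nn_integral)
  qed
  have [measurable]: "h s \<in> borel_measurable (p j)" for s
    using measurable_compose[OF measurable_Pair1'[of s borel offspring_space] h] by (simp cong: measurable_cong_sets)
  have "(\<integral>\<^sup>+t. G t * (\<Sum>u\<in>particles t j. h (position t u) (t u)) \<partial>Q)
     = (\<integral>\<^sup>+t. (\<Sum>u\<in>particles t j. G t * h (position t u) (t u)) \<partial>Q)"
    by (simp add: sum_distrib_left)
  also have "\<dots> = (\<integral>\<^sup>+u. \<integral>\<^sup>+t. G t * h (position t u) (t u) * indicator (particles t j) u \<partial>Q \<partial>count_space UNIV)"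
    by (rule nn_integral_sum_particles) measurable
  also have "\<dots> = (\<integral>\<^sup>+u. \<integral>\<^sup>+t. G t * (\<integral>\<^sup>+z. h (position t u) z \<partial>p j) * indicator (particles t j) u \<partial>Q \<partial>count_space UNIV)"
  proof (rule nn_integral_cong)
    fix u :: "nat list"
    show "(\<integral>\<^sup>+t. G t * h (position t u) (t u) * indicator (particles t j) u \<partial>Q) = (\<integral>\<^sup>+t. G t * (\<integral>\<^sup>+z. h (position t u) z \<partial>p j) * indicator (particles t j) u \<partial>Q)"
    proof (cases "length u = j")
      case True
      have "(\<integral>\<^sup>+t. G t * h (position t u) (t u) * indicator (particles t j) u \<partial>Q)
        = (\<integral>\<^sup>+t. \<integral>\<^sup>+z. G t * h (position t u) z * indicator (particles t j) u \<partial>p j \<partial>Q)"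
        using True by (subst nn_integral_resample[of _ u]) (auto simp: depends_below_upd[OF G(2)] particles_upd position_upd)
      also have "\<dots> = (\<integral>\<^sup>+t. G t * (\<integral>\<^sup>+z. h (position t u) z \<partial>p j) * indicator (particles t j) u \<partial>Q)"
        by (intro nn_integral_cong) (simp add: nn_integral_multc nn_integral_cmult)
      finally show ?thesis .
    next
      case False
      then have "u \<notin> particles t j" for t using length_particles by blast
      then show ?thesis by simp
    qed
  qed
  also have "\<dots> = (\<integral>\<^sup>+t. (\<Sum>u\<in>particles t j. G t * (\<integral>\<^sup>+z. h (position t u) z \<partial>p j)) \<partial>Q)"
    by (rule nn_integral_sum_particles[symmetric]) measurable
  also have "\<dots> = (\<integral>\<^sup>+t. G t * (\<Sum>u\<in>particles t j. \<integral>\<^sup>+z. h (position t u) z \<partial>p j) \<partial>Q)"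
    by (simp add: sum_distrib_left)
  finally show ?thesis .
qed

lemma nn_integral_offspring_sum:
  assumes f: "f \<in> borel_measurable borel"
  shows "(\<integral>\<^sup>+z. (\<Sum>i<fst z. f (snd z i)) \<partial>p j) = ennreal (m j) * (\<integral>\<^sup>+y. f y \<partial>\<nu> j)"
  unfolding nn_integral_\<nu>_of[OF sets_p f] mean_eq
  using m_pos[of j] by (simp add: ennreal_times_divide mult.commute[of "ennreal (m j)"] mult_divide_eq_ennreal)

lemma many_to_one_step:
  assumes G [measurable]: "G \<in> borel_measurable Q" "depends_below j G"
    and f [measurable]: "f \<in> borel_measurable borel"
  shows "(\<integral>\<^sup>+t. G t * (\<Sum>u\<in>particles t (Suc j). f (position t u)) \<partial>Q)
    = ennreal (m j) * (\<integral>\<^sup>+t. G t * (\<Sum>u\<in>particles t j. \<integral>\<^sup>+y. f (position t u + y) \<partial>\<nu> j) \<partial>Q)"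
proof -
  interpret \<nu>: prob_space "\<nu> j" by (rule prob_\<nu>)
  have hm: "(\<lambda>(s, z). \<Sum>i<fst z. f (s + snd z i)) \<in> borel_measurable (borel \<Otimes>\<^sub>M offspring_space)"
    unfolding case_prod_beta'
    by (rule measurable_compose_countable[where f="\<lambda>n x. \<Sum>i<n. f (fst x + snd (snd x) i)" and g="\<lambda>x. fst (snd x)"]) measurable
  have "(\<integral>\<^sup>+t. G t * (\<Sum>u\<in>particles t (Suc j). f (position t u)) \<partial>Q)
    = (\<integral>\<^sup>+t. G t * (\<Sum>u\<in>particles t j. \<Sum>i<fst (t u). f (position t u + snd (t u) i)) \<partial>Q)"
    by (simp only: sum_particles_Suc position_snoc)
  also have "\<dots> = (\<integral>\<^sup>+t. G t * (\<Sum>u\<in>particles t j. \<integral>\<^sup>+z. (\<Sum>i<fst z. f (position t u + snd z i)) \<partial>p j) \<partial>Q)"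
    by (rule nn_integral_particle_step[OF G hm])
  also have "\<dots> = (\<integral>\<^sup>+t. G t * (\<Sum>u\<in>particles t j. ennreal (m j) * \<integral>\<^sup>+y. f (position t u + y) \<partial>\<nu> j) \<partial>Q)"
    by (subst nn_integral_offspring_sum) auto
  also have "\<dots> = (\<integral>\<^sup>+t. ennreal (m j) * (G t * (\<Sum>u\<in>particles t j. \<integral>\<^sup>+y. f (position t u + y) \<partial>\<nu> j)) \<partial>Q)"
    by (simp add: sum_distrib_left mult_ac)
  also have "\<dots> = ennreal (m j) * (\<integral>\<^sup>+t. G t * (\<Sum>u\<in>particles t j. \<integral>\<^sup>+y. f (position t u + y) \<partial>\<nu> j) \<partial>Q)"
  proof (rule nn_integral_cmult)
    have [measurable]: "(\<lambda>s. \<integral>\<^sup>+y. f (s + y) \<partial>\<nu> j) \<in> borel_measurable borel"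
      by (rule borel_measurable_nn_integral_shift) (auto intro: \<nu>.finite_measure_axioms)
    show "(\<lambda>t. G t * (\<Sum>u\<in>particles t j. \<integral>\<^sup>+y. f (position t u + y) \<partial>\<nu> j)) \<in> borel_measurable Q"
      by measurable
  qed
  finally show ?thesis .
qed

lemma real_distribution_conv: "real_distribution (conv_from \<nu> j l)"
  by (rule real_distribution_conv_from[OF real_distribution_\<nu>])

text \<open>The mean of a sum over generation \<open>j + l\<close> is the expected growth of the
  population times an expectation along one random walk with steps of law \<open>\<nu>\<close>. The
  weight \<open>G\<close> makes it a statement conditional on the first \<open>j\<close>
  generations.\<close>

lemma many_to_one:
  assumes G [measurable]: "G \<in> borel_measurable Q" and "depends_below j G"
    and f [measurable]: "f \<in> borel_measurable borel"
  shows "(\<integral>\<^sup>+t. G t * (\<Sum>u\<in>particles t (j + l). f (position t u)) \<partial>Q)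
    = ennreal (P (j + l) / P j) * (\<integral>\<^sup>+t. G t * (\<Sum>u\<in>particles t j. \<integral>\<^sup>+y. f (position t u + y) \<partial>conv_from \<nu> j l) \<partial>Q)"
  using assms(2)
proof (induction l arbitrary: j)
  case 0
  then show ?case using P_pos[of j] by (simp add: nn_integral_return)
next
  case (Suc l)
  have conv_fin: "finite_measure (conv_from \<nu> i l)" "sets (conv_from \<nu> i l) = sets borel" for i
    using real_distribution_conv[of i l] by (auto simp: real_distribution_def real_distribution_axioms_def prob_space_def)
  have \<nu>_fin: "finite_measure (\<nu> i)" for i using prob_\<nu>[of i] by (simp add: prob_space_def)
  have dep: "depends_below (Suc j) G" by (rule depends_below_mono[OF Suc.prems]) simp
  have fm: "(\<lambda>s. \<integral>\<^sup>+y. f (s + y) \<partial>conv_from \<nu> (Suc j) l) \<in> borel_measurable borel"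
    by (rule borel_measurable_nn_integral_shift[OF conv_fin f])
  have "(\<integral>\<^sup>+t. G t * (\<Sum>u\<in>particles t (j + Suc l). f (position t u)) \<partial>Q)
     = ennreal (P (j + Suc l) / P (Suc j)) * (\<integral>\<^sup>+t. G t * (\<Sum>u\<in>particles t (Suc j). \<integral>\<^sup>+y. f (position t u + y) \<partial>conv_from \<nu> (Suc j) l) \<partial>Q)"
    using Suc.IH[OF dep] by simp
  also have "\<dots> = ennreal (P (j + Suc l) / P (Suc j)) * (ennreal (m j) * (\<integral>\<^sup>+t. G t * (\<Sum>u\<in>particles t j. \<integral>\<^sup>+x. \<integral>\<^sup>+y. f (position t u + x + y) \<partial>conv_from \<nu> (Suc j) l \<partial>\<nu> j) \<partial>Q))"
    by (simp only: many_to_one_step[OF G Suc.prems fm])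
  also have "(\<lambda>t u. \<integral>\<^sup>+x. \<integral>\<^sup>+y. f (position t u + x + y) \<partial>conv_from \<nu> (Suc j) l \<partial>\<nu> j) = (\<lambda>t u. \<integral>\<^sup>+y. f (position t u + y) \<partial>conv_from \<nu> j (Suc l))"
    using \<nu>_fin conv_fin by (subst conv_from.simps, subst nn_integral_convolution) (auto simp: add.assoc)
  also have "ennreal (P (j + Suc l) / P (Suc j)) * (ennreal (m j) * I) = ennreal (P (j + Suc l) / P j) * I" for I
  proof -
    have "ennreal (P (j + Suc l) / P (Suc j)) * ennreal (m j) = ennreal (P (j + Suc l) / P j)"
      using P_pos m_pos[of j] P_Suc[of j] by (subst ennreal_mult[symmetric]) (auto simp: less_imp_le)
    then show ?thesis by (simp add: mult.assoc[symmetric])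
  qed
  finally show ?case .
qed

definition W :: "nat \<Rightarrow> (nat list \<Rightarrow> offspring) \<Rightarrow> real" where
  "W n t = real (card (particles t n)) / P n"

lemma W_nonneg: "0 \<le> W n t"
  using P_pos[of n] by (simp add: W_def)

lemma measurable_W [measurable]: "W n \<in> borel_measurable Q"
  unfolding W_def by measurable

text \<open>The martingale property of \<open>W\<close>, tested against weights from generation
  \<open>k\<close>; it is \<open>many_to_one\<close> with a constant function.\<close>

lemma nn_integral_W:
  assumes [measurable]: "G \<in> borel_measurable Q" and G: "depends_below k G" and "k \<le> n"
  shows "(\<integral>\<^sup>+t. G t * ennreal (W n t) \<partial>Q) = (\<integral>\<^sup>+t. G t * ennreal (W k t) \<partial>Q)"
proof -
  obtain l where l: "n = k + l" using assms(3) le_Suc_ex by blast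
  have W: "G t * ennreal (W i t) = G t * (\<Sum>u\<in>particles t i. 1) * ennreal (1 / P i)" for i t
    using P_pos[of i] by (simp add: W_def mult.assoc divide_inverse ennreal_mult flip: ennreal_of_nat_eq_real_of_nat)
  have m1: "(\<lambda>t. G t * (\<Sum>u\<in>particles t i. 1)) \<in> borel_measurable Q" for i
    by measurable
  have e1: "emeasure (conv_from \<nu> k l) (space (conv_from \<nu> k l)) = 1"
    using real_distribution_conv[of k l] by (simp add: real_distribution_def prob_space.emeasure_space_1)
  have "(\<integral>\<^sup>+t. G t * ennreal (W n t) \<partial>Q) = (\<integral>\<^sup>+t. G t * (\<Sum>u\<in>particles t n. 1) \<partial>Q) * ennreal (1 / P n)"
    unfolding W by (rule nn_integral_multc[OF m1])
  also have "(\<integral>\<^sup>+t. G t * (\<Sum>u\<in>particles t n. 1) \<partial>Q) = ennreal (P n / P k) * (\<integral>\<^sup>+t. G t * (\<Sum>u\<in>particles t k. 1) \<partial>Q)"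
    using many_to_one[OF assms(1) G, of "\<lambda>_. 1" l] by (simp add: l e1)
  also have "\<dots> * ennreal (1 / P n) = (\<integral>\<^sup>+t. G t * (\<Sum>u\<in>particles t k. 1) \<partial>Q) * ennreal (1 / P k)"
  proof -
    have "ennreal (P n / P k) * ennreal (1 / P n) = ennreal (1 / P k)"
      using P_pos[of n] P_pos[of k] by (subst ennreal_mult[symmetric]) auto
    then show ?thesis by (metis (no_types, lifting) mult.assoc mult.commute)
  qed
  also have "\<dots> = (\<integral>\<^sup>+t. G t * ennreal (W k t) \<partial>Q)"
    unfolding W by (rule nn_integral_multc[OF m1, symmetric])
  finally show ?thesis .
qed

end

section \<open>Martingale increments\<close>

text \<open>The Cauchy-Schwarz inequality against the constant 1, obtained by integrating
  \<open>2 * (f x * c) \<le> (f x)\<^sup>2 + c\<^sup>2\<close>.\<close>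

lemma (in prob_space) nn_integral_le_of_square:
  fixes f :: "'a \<Rightarrow> real"
  assumes [measurable]: "f \<in> borel_measurable M" and "\<And>x. 0 \<le> f x" and c: "0 < c"
    and sq: "(\<integral>\<^sup>+x. ennreal ((f x)\<^sup>2) \<partial>M) \<le> ennreal (c\<^sup>2)"
  shows "(\<integral>\<^sup>+x. ennreal (f x) \<partial>M) \<le> ennreal c"
proof -
  have e: "ennreal (a * b + d) = ennreal a * ennreal b + ennreal d" if "0 \<le> a" "0 \<le> b" "0 \<le> d" for a b d
    using that by (simp add: ennreal_plus ennreal_mult)
  have "(\<integral>\<^sup>+x. ennreal (f x) \<partial>M) \<le> (\<integral>\<^sup>+x. ennreal ((f x)\<^sup>2) * ennreal (1 / (2 * c)) + ennreal (c / 2) \<partial>M)"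
  proof (rule nn_integral_mono)
    fix x
    have "2 * (f x * c) \<le> (f x)\<^sup>2 + c\<^sup>2" using sum_squares_bound[of "f x" c] by (simp add: mult.assoc)
    then have "f x \<le> (f x)\<^sup>2 * (1 / (2 * c)) + c / 2" using c by (simp add: field_simps power2_eq_square)
    then have "ennreal (f x) \<le> ennreal ((f x)\<^sup>2 * (1 / (2 * c)) + c / 2)" by (rule ennreal_leI)
    then show "ennreal (f x) \<le> ennreal ((f x)\<^sup>2) * ennreal (1 / (2 * c)) + ennreal (c / 2)"
      using e[of "(f x)\<^sup>2" "1 / (2 * c)" "c / 2"] c by simp
  qed
  also have "\<dots> = (\<integral>\<^sup>+x. ennreal ((f x)\<^sup>2) \<partial>M) * ennreal (1 / (2 * c)) + ennreal (c / 2)"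
    by (simp add: nn_integral_add nn_integral_multc emeasure_space_1)
  also have "\<dots> \<le> ennreal (c\<^sup>2) * ennreal (1 / (2 * c)) + ennreal (c / 2)"
    by (intro add_mono mult_right_mono sq) auto
  also have "\<dots> = ennreal (c\<^sup>2 * (1 / (2 * c)) + c / 2)"
    using e[of "c\<^sup>2" "1 / (2 * c)" "c / 2"] c by simp
  also have "c\<^sup>2 * (1 / (2 * c)) + c / 2 = c" using c by (simp add: power2_eq_square)
  finally show ?thesis .
qed

context quenched
begin

text \<open>Different particles of one generation have independent offspring and
  \<open>\<psi>\<close> is centred, so redrawing one of the two labels kills every mixed term of the
  square; only the diagonal is left.\<close>

lemma second_moment_box:
  assumes G [measurable]: "G \<in> borel_measurable Q" and G0: "\<And>t. 0 \<le> G t" and GB: "\<And>t. G t \<le> B"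
    and Gd: "depends_below j G" and Gbox: "\<And>t. G t \<noteq> 0 \<Longrightarrow> particles t j \<subseteq> list_box j r"
    and \<psi> [measurable]: "(\<lambda>(s, z). \<psi> s z) \<in> borel_measurable (borel \<Otimes>\<^sub>M offspring_space)"
    and \<psi>C: "\<And>s z. \<bar>\<psi> s z\<bar> \<le> C" and \<psi>0: "\<And>s. (LINT z|p j. \<psi> s z) = 0"
  shows "(\<integral>\<^sup>+t. ennreal (G t * (\<Sum>u\<in>particles t j. \<psi> (position t u) (t u))\<^sup>2) \<partial>Q)
    = (\<integral>\<^sup>+t. ennreal (G t * (\<Sum>u\<in>particles t j. (\<psi> (position t u) (t u))\<^sup>2)) \<partial>Q)"
proof -
  interpret Q: prob_space Q by (rule prob_Q)
  \<comment> \<open>Extended by 0 to labels that are not particles, the contributions can be summed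
    over the fixed box instead of over a random set.\<close>
  define y where "y u t = of_bool (u \<in> particles t j) * \<psi> (position t u) (t u)" for u t
  have [measurable]: "(\<lambda>t. \<psi> (position t u) (t u)) \<in> borel_measurable Q" for u
    using measurable_compose[OF measurable_Pair[OF measurable_position[of u] measurable_coord[of u]] \<psi>] by simp
  have [measurable]: "y u \<in> borel_measurable Q" for u
    unfolding y_def of_bool_def by measurable
  have C: "0 \<le> C" using \<psi>C[of undefined undefined] by linarith
  have yC: "\<bar>y u t\<bar> \<le> C" for u t using \<psi>C C by (simp add: y_def)
  have B: "0 \<le> B" using G0 GB order_trans by blast
  have bound: "\<bar>G t * (y u t * y v t)\<bar> \<le> B * (C * C)" for u v t
    unfolding abs_mult using G0[of t] GB[of t] yC B C by (intro mult_mono) auto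
  have int: "integrable Q (\<lambda>t. G t * (y u t * y v t))" for u v
    by (intro Q.integrable_const_bound[of _ "B * (C * C)"]) (use bound in auto)
  have cross: "(LINT t|Q. G t * (y u t * y v t)) = 0" if uv: "u \<noteq> v" "length u = j" "length v = j" for u v
  proof -
    have "(LINT t|Q. G t * (y u t * y v t)) = (LINT t|Q. LINT z|p (length v). G (t(v := z)) * (y u (t(v := z)) * y v (t(v := z))))"
      by (rule integral_resample[OF _ bound]) measurable
    also have "\<dots> = (LINT t|Q. LINT z|p j. (G t * y u t * of_bool (v \<in> particles t j)) * \<psi> (position t v) z)"
      using uv by (simp add: y_def depends_below_upd[OF Gd] particles_upd position_upd mult_ac)
    also have "\<dots> = 0" by (simp add: \<psi>0)
    finally show ?thesis .
  qed
  have y_sum: "G t * f (\<Sum>u\<in>particles t j. h (position t u) (t u)) = G t * f (\<Sum>u\<in>list_box j r. of_bool (u \<in> particles t j) * h (position t u) (t u))"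
    for f :: "real \<Rightarrow> real" and h t
  proof (cases "G t = 0")
    case False
    have "(\<Sum>u\<in>list_box j r. of_bool (u \<in> particles t j) * h (position t u) (t u)) = (\<Sum>u\<in>list_box j r \<inter> particles t j. h (position t u) (t u))"
      unfolding sum.inter_restrict[OF finite_list_box] by (intro sum.cong) auto
    then show ?thesis using Gbox[OF False] by (simp add: Int_absorb1)
  qed simp
  have L: "G t * (\<Sum>u\<in>particles t j. \<psi> (position t u) (t u))\<^sup>2 = (\<Sum>u\<in>list_box j r. \<Sum>v\<in>list_box j r. G t * (y u t * y v t))" for t
    unfolding y_sum[of t "\<lambda>x. x\<^sup>2" \<psi>] unfolding power2_eq_square y_def sum_product
    by (simp only: sum_distrib_left)
  have ob: "of_bool b * (of_bool b * x) = of_bool b * x" for b and x :: real by simp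
  have R: "G t * (\<Sum>u\<in>particles t j. (\<psi> (position t u) (t u))\<^sup>2) = (\<Sum>u\<in>list_box j r. G t * (y u t * y u t))" for t
    using y_sum[of t "\<lambda>x. x" "\<lambda>s z. (\<psi> s z)\<^sup>2"] by (simp add: y_def power2_eq_square sum_distrib_left mult_ac ob)
  have nn: "(\<integral>\<^sup>+t. ennreal (f t) \<partial>Q) = ennreal (LINT t|Q. f t)" if "integrable Q f" "\<And>t. 0 \<le> f t" for f
    by (rule nn_integral_eq_integral) (use that in auto)
  have "(LINT t|Q. (\<Sum>u\<in>list_box j r. \<Sum>v\<in>list_box j r. G t * (y u t * y v t))) = (\<Sum>u\<in>list_box j r. \<Sum>v\<in>list_box j r. LINT t|Q. G t * (y u t * y v t))"
    using int by (simp add: Bochner_Integration.integral_sum Bochner_Integration.integrable_sum)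
  also have "\<dots> = (\<Sum>u\<in>list_box j r. LINT t|Q. G t * (y u t * y u t))"
  proof (rule sum.cong[OF refl])
    fix u assume u: "u \<in> list_box j r"
    have "(\<Sum>v\<in>list_box j r. LINT t|Q. G t * (y u t * y v t)) = (\<Sum>v\<in>list_box j r. if v = u then LINT t|Q. G t * (y u t * y u t) else 0)"
      using u cross[of u] by (intro sum.cong) (auto simp: list_box_def)
    also have "\<dots> = (LINT t|Q. G t * (y u t * y u t))" using u finite_list_box by simp
    finally show "(\<Sum>v\<in>list_box j r. LINT t|Q. G t * (y u t * y v t)) = (LINT t|Q. G t * (y u t * y u t))" .
  qed
  also have "\<dots> = (LINT t|Q. (\<Sum>u\<in>list_box j r. G t * (y u t * y u t)))"
    using int by (simp add: Bochner_Integration.integral_sum)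
  finally have eq: "(LINT t|Q. G t * (\<Sum>u\<in>particles t j. \<psi> (position t u) (t u))\<^sup>2) = (LINT t|Q. G t * (\<Sum>u\<in>particles t j. (\<psi> (position t u) (t u))\<^sup>2))"
    unfolding L R .
  have "integrable Q (\<lambda>t. G t * (\<Sum>u\<in>particles t j. \<psi> (position t u) (t u))\<^sup>2)"
    "integrable Q (\<lambda>t. G t * (\<Sum>u\<in>particles t j. (\<psi> (position t u) (t u))\<^sup>2))"
    unfolding L R using int by auto
  then show ?thesis using eq G0 by (simp add: nn sum_nonneg)
qed

text \<open>The number of particles may have an infinite second moment, so the sum cannot be expanded
  directly; the weight \<open>G\<close> is first restricted to trees whose generation \<open>j\<close> lies in a finite box.\<close>

lemma second_moment:
  assumes G [measurable]: "G \<in> borel_measurable Q" and G0: "\<And>t. 0 \<le> G t" and GB: "\<And>t. G t \<le> B"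
    and Gd: "depends_below j G"
    and \<psi> [measurable]: "(\<lambda>(s, z). \<psi> s z) \<in> borel_measurable (borel \<Otimes>\<^sub>M offspring_space)"
    and \<psi>C: "\<And>s z. \<bar>\<psi> s z\<bar> \<le> C" and \<psi>0: "\<And>s. (LINT z|p j. \<psi> s z) = 0"
    and V: "\<And>s. (\<integral>\<^sup>+z. ennreal ((\<psi> s z)\<^sup>2) \<partial>p j) \<le> ennreal V"
  shows "(\<integral>\<^sup>+t. ennreal (G t * (\<Sum>u\<in>particles t j. \<psi> (position t u) (t u))\<^sup>2) \<partial>Q)
    \<le> ennreal V * (\<integral>\<^sup>+t. ennreal (G t) * ennreal (real (card (particles t j))) \<partial>Q)"
proof -
  have [measurable]: "(\<lambda>t. \<psi> (position t u) (t u)) \<in> borel_measurable Q" for u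
    using measurable_compose[OF measurable_Pair[OF measurable_position[of u] measurable_coord[of u]] \<psi>] by simp
  define Gr where "Gr r t = G t * of_bool (particles t j \<subseteq> list_box j r)" for r t
  have [measurable]: "Gr r \<in> borel_measurable Q" for r
    unfolding Gr_def of_bool_def by measurable
  have Gr_dep: "depends_below j (Gr r)" for r
    unfolding Gr_def by (rule depends_below_comp2[OF Gd depends_below_particles])
  have "0 \<le> B" using G0 GB order_trans by blast
  then have GrB: "0 \<le> Gr r t" "Gr r t \<le> B" for r t using G0 GB by (auto simp: Gr_def)
  let ?f = "\<lambda>t. G t * (\<Sum>u\<in>particles t j. \<psi> (position t u) (t u))\<^sup>2"
  let ?fr = "\<lambda>r t. Gr r t * (\<Sum>u\<in>particles t j. \<psi> (position t u) (t u))\<^sup>2"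
  have le: "(\<integral>\<^sup>+t. ennreal (?fr r t) \<partial>Q) \<le> ennreal V * (\<integral>\<^sup>+t. ennreal (G t) * ennreal (real (card (particles t j))) \<partial>Q)" for r
  proof -
    have "(\<integral>\<^sup>+t. ennreal (?fr r t) \<partial>Q) = (\<integral>\<^sup>+t. ennreal (Gr r t * (\<Sum>u\<in>particles t j. (\<psi> (position t u) (t u))\<^sup>2)) \<partial>Q)"
      by (rule second_moment_box[OF _ GrB Gr_dep _ \<psi> \<psi>C \<psi>0]) (auto simp: Gr_def)
    also have "\<dots> = (\<integral>\<^sup>+t. ennreal (Gr r t) * (\<Sum>u\<in>particles t j. ennreal ((\<psi> (position t u) (t u))\<^sup>2)) \<partial>Q)"
      using GrB by (simp add: ennreal_mult sum_nonneg sum_ennreal)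
    also have "\<dots> = (\<integral>\<^sup>+t. ennreal (Gr r t) * (\<Sum>u\<in>particles t j. \<integral>\<^sup>+z. ennreal ((\<psi> (position t u) z)\<^sup>2) \<partial>p j) \<partial>Q)"
      by (rule nn_integral_particle_step) (auto intro: depends_below_comp Gr_dep)
    also have "\<dots> \<le> (\<integral>\<^sup>+t. ennreal V * (ennreal (G t) * ennreal (real (card (particles t j)))) \<partial>Q)"
    proof (rule nn_integral_mono)
      fix t
      have "ennreal (Gr r t) * (\<Sum>u\<in>particles t j. \<integral>\<^sup>+z. ennreal ((\<psi> (position t u) z)\<^sup>2) \<partial>p j)
         \<le> ennreal (G t) * (\<Sum>u\<in>particles t j. ennreal V)"
        using G0 by (intro mult_mono sum_mono V ennreal_leI) (auto simp: Gr_def)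
      also have "\<dots> = ennreal V * (ennreal (G t) * ennreal (real (card (particles t j))))"
        by (simp add: mult_ac ennreal_of_nat_eq_real_of_nat)
      finally show "ennreal (Gr r t) * (\<Sum>u\<in>particles t j. \<integral>\<^sup>+z. ennreal ((\<psi> (position t u) z)\<^sup>2) \<partial>p j) \<le> ennreal V * (ennreal (G t) * ennreal (real (card (particles t j))))" .
    qed
    also have "\<dots> = ennreal V * (\<integral>\<^sup>+t. ennreal (G t) * ennreal (real (card (particles t j))) \<partial>Q)"
      by (rule nn_integral_cmult) measurable
    finally show ?thesis .
  qed
  have "(\<lambda>r. \<integral>\<^sup>+t. ennreal (?fr r t) \<partial>Q) \<longlonglongrightarrow> (\<integral>\<^sup>+t. ennreal (?f t) \<partial>Q)"
  proof (rule nn_integral_LIMSEQ)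
    show "incseq (\<lambda>r t. ennreal (?fr r t))"
    proof (unfold incseq_def le_fun_def, intro allI impI ennreal_leI mult_right_mono)
      fix q r t assume "q \<le> (r::nat)"
      then show "Gr q t \<le> Gr r t"
        using G0[of t] subset_trans[OF _ list_box_mono, of "particles t j" j q r] by (auto simp: Gr_def of_bool_def)
    qed simp
    fix t
    have "\<forall>\<^sub>F r in sequentially. ennreal (?fr r t) = ennreal (?f t)"
      using eventually_particles_list_box[of t j] by eventually_elim (simp add: Gr_def)
    then show "(\<lambda>r. ennreal (?fr r t)) \<longlonglongrightarrow> ennreal (?f t)" by (rule tendsto_eventually)
  qed measurable
  then show ?thesis by (rule LIMSEQ_le_const2) (use le in blast)
qed


section \<open>Truncated increments: fluctuation of the small families, mean of the large
  ones\<close>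

definition trunc :: "(real \<Rightarrow> real) \<Rightarrow> real \<Rightarrow> nat \<Rightarrow> real \<Rightarrow> offspring \<Rightarrow> real" where
  "trunc g \<tau> j s z = (\<Sum>i<fst z. g (s + snd z i)) / m j * of_bool (real (fst z) \<le> \<tau>)"

definition fluct :: "(real \<Rightarrow> real) \<Rightarrow> real \<Rightarrow> nat \<Rightarrow> (nat list \<Rightarrow> offspring) \<Rightarrow> real" where
  "fluct g \<tau> j t = \<bar>\<Sum>u\<in>particles t j. trunc g \<tau> j (position t u) (t u) - (LINT z|p j. trunc g \<tau> j (position t u) z)\<bar> / P j"

definition over :: "real \<Rightarrow> nat \<Rightarrow> (nat list \<Rightarrow> offspring) \<Rightarrow> real" where
  "over \<tau> j t = (\<Sum>u\<in>particles t j. real (fst (t u)) / m j * of_bool (\<tau> < real (fst (t u)))) / P j"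

definition mean_over :: "real \<Rightarrow> nat \<Rightarrow> real" where
  "mean_over \<tau> j = (LINT z|p j. real (fst z) / m j * of_bool (\<tau> < real (fst z)))"

text \<open>The common form of the quantities compared: \<open>g = 1\<close> gives \<open>W\<close>,
  an indicator the normalized count in a set, and a hitting probability its conditional
  expectation.\<close>

definition F :: "(real \<Rightarrow> real) \<Rightarrow> nat \<Rightarrow> (nat list \<Rightarrow> offspring) \<Rightarrow> real" where
  "F g j t = (\<Sum>u\<in>particles t j. g (position t u)) / P j"

lemma F_1: "F (\<lambda>_. 1) j t = W j t"
  by (simp add: F_def W_def)

lemma measurable_offspring_sum_joint [measurable]:
  fixes g :: "real \<Rightarrow> real"
  assumes [measurable]: "g \<in> borel_measurable borel"
  shows "(\<lambda>(s, z). \<Sum>i<fst z. g (s + snd z i)) \<in> borel_measurable (borel \<Otimes>\<^sub>M offspring_space)"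
  unfolding case_prod_beta'
  by (rule measurable_compose_countable[where f="\<lambda>n x. \<Sum>i<n. g (fst x + snd (snd x) i)" and g="\<lambda>x. fst (snd x)"]) measurable

lemma measurable_trunc:
  assumes [measurable]: "g \<in> borel_measurable borel"
  shows "(\<lambda>(s, z). trunc g \<tau> j s z) \<in> borel_measurable (borel \<Otimes>\<^sub>M offspring_space)"
proof -
  have "(\<lambda>x. (case x of (s, z) \<Rightarrow> \<Sum>i<fst z. g (s + snd z i)) / m j * of_bool (real (fst (snd x)) \<le> \<tau>)) \<in> borel_measurable (borel \<Otimes>\<^sub>M offspring_space)"
    unfolding of_bool_def by measurable
  then show ?thesis by (simp add: trunc_def case_prod_beta')
qed

lemma measurable_offspring_real [measurable]:
  "(\<lambda>z. real (fst z)) \<in> borel_measurable offspring_space" "(\<lambda>z. real (fst z)) \<in> borel_measurable (p j)"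
  using measurable_compose[OF measurable_fst_offspring, of real borel]
  by (simp_all add: measurable_cong_sets[OF sets_p refl])

lemma integrable_fst: "integrable (p j) (\<lambda>z. real (fst z))" "(LINT z|p j. real (fst z)) = m j"
proof -
  have "(\<integral>\<^sup>+z. ennreal (real (fst z)) \<partial>p j) = ennreal (m j)"
    using mean_eq[of j] by (simp add: mean_offspring_def ennreal_of_nat_eq_real_of_nat)
  then show "integrable (p j) (\<lambda>z. real (fst z))" "(LINT z|p j. real (fst z)) = m j"
    using m_pos[of j] by (auto intro!: integrableI_nonneg simp: integral_eq_nn_integral)
qed

lemma integrable_over: "integrable (p j) (\<lambda>z. real (fst z) / m j * of_bool (\<tau> < real (fst z)))"
proof (rule Bochner_Integration.integrable_bound)
  show "integrable (p j) (\<lambda>z. real (fst z) / m j)" using integrable_fst by simp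
  show "(\<lambda>z. real (fst z) / m j * of_bool (\<tau> < real (fst z))) \<in> borel_measurable (p j)"
    unfolding of_bool_def by measurable
qed auto

lemma mean_over_nonneg: "0 \<le> mean_over \<tau> j"
  unfolding mean_over_def using m_pos[of j] by (intro Bochner_Integration.integral_nonneg) auto

lemma mean_over_eq: "ennreal (mean_over \<tau> j) = (\<integral>\<^sup>+z. ennreal (real (fst z) / m j * of_bool (\<tau> < real (fst z))) \<partial>p j)"
  unfolding mean_over_def
  using m_pos[of j] by (intro nn_integral_eq_integral[symmetric] integrable_over) auto

lemma over_nonneg: "0 \<le> over \<tau> j t"
  unfolding over_def using m_pos[of j] P_pos[of j] by (intro divide_nonneg_pos sum_nonneg) auto

lemma fluct_nonneg: "0 \<le> fluct g \<tau> j t"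
  unfolding fluct_def using P_pos[of j] by simp

lemma measurable_over [measurable]: "over \<tau> j \<in> borel_measurable Q"
  unfolding over_def of_bool_def by measurable

lemma borel_measurable_offspring_sum:
  fixes g :: "real \<Rightarrow> real"
  assumes [measurable]: "g \<in> borel_measurable borel"
  shows "(\<lambda>z. \<Sum>i<fst z. g (s + snd z i)) \<in> borel_measurable (p j)"
  unfolding measurable_cong_sets[OF sets_p refl]
  by (rule measurable_compose_countable[where f="\<lambda>n z. \<Sum>i<n. g (s + snd z i)" and g=fst]) measurable

context
  fixes g :: "real \<Rightarrow> real" and j :: nat
  assumes g [measurable]: "g \<in> borel_measurable borel" and g01: "\<And>s. 0 \<le> g s" "\<And>s. g s \<le> 1"
begin

lemma offspring_sum_bounds: "0 \<le> (\<Sum>i<fst z. g (s + snd z i))" "(\<Sum>i<fst z. g (s + snd z i)) \<le> real (fst z)"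
  using g01 sum_mono[of "{..<fst z}" "\<lambda>i. g (s + snd z i)" "\<lambda>_. 1"] by (auto intro: sum_nonneg)

lemma trunc_bounds: "0 \<le> trunc g \<tau> j s z" "trunc g \<tau> j s z \<le> real (fst z) / m j" "0 \<le> \<tau> \<Longrightarrow> trunc g \<tau> j s z \<le> \<tau> / m j"
  unfolding trunc_def using offspring_sum_bounds[of s z] m_pos[of j]
  by (auto simp: divide_right_mono of_bool_def intro: order_trans)

lemma integrable_trunc: "integrable (p j) (trunc g \<tau> j s)"
proof (rule Bochner_Integration.integrable_bound)
  show "integrable (p j) (\<lambda>z. real (fst z) / m j)" using integrable_fst by simp
  show "trunc g \<tau> j s \<in> borel_measurable (p j)"
    unfolding trunc_def[abs_def] of_bool_def using borel_measurable_offspring_sum[OF g, of s j] by measurable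
qed (use trunc_bounds m_pos[of j] in auto)

text \<open>By the assumption on \<open>h\<close> the difference is a martingale increment. Families
  of size at most \<open>\<tau>\<close>, recentred, make up \<open>fluct\<close>. The large families
  contribute at most \<open>over\<close>, and their missing share in the recentring at most
  \<open>mean_over\<close> per particle. Both bounds only use \<open>0 \<le> g \<le> 1\<close>, so
  they are the same for every \<open>g\<close>.\<close>

lemma F_increment:
  assumes h: "\<And>s. h s = (LINT z|p j. (\<Sum>i<fst z. g (s + snd z i)) / m j)"
  shows "\<bar>F g (Suc j) t - F h j t\<bar> \<le> fluct g \<tau> j t + (over \<tau> j t + W j t * mean_over \<tau> j)"
proof -
  let ?\<psi>0 = "\<lambda>s z. (\<Sum>i<fst z. g (s + snd z i)) / m j"
  let ?c = "\<lambda>s. LINT z|p j. trunc g \<tau> j s z"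
  have split: "?\<psi>0 s z = trunc g \<tau> j s z + ?\<psi>0 s z * of_bool (\<tau> < real (fst z))" for s z
    by (simp add: trunc_def of_bool_def)
  have rest: "0 \<le> ?\<psi>0 s z * of_bool (\<tau> < real (fst z))" "?\<psi>0 s z * of_bool (\<tau> < real (fst z)) \<le> real (fst z) / m j * of_bool (\<tau> < real (fst z))" for s z
    using offspring_sum_bounds[of s z] m_pos[of j] by (auto intro!: mult_right_mono divide_right_mono)
  have int_rest: "integrable (p j) (\<lambda>z. ?\<psi>0 s z * of_bool (\<tau> < real (fst z)))" for s
  proof (rule Bochner_Integration.integrable_bound[OF integrable_over[of j \<tau>]])
    show "(\<lambda>z. ?\<psi>0 s z * of_bool (\<tau> < real (fst z))) \<in> borel_measurable (p j)"
      unfolding of_bool_def using borel_measurable_offspring_sum[OF g, of s j] by measurable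
    show "AE z in p j. norm (?\<psi>0 s z * of_bool (\<tau> < real (fst z))) \<le> norm (real (fst z) / m j * of_bool (\<tau> < real (fst z)))"
    proof (rule AE_I2)
      fix z
      show "norm (?\<psi>0 s z * of_bool (\<tau> < real (fst z))) \<le> norm (real (fst z) / m j * of_bool (\<tau> < real (fst z)))"
        using rest[of s z] unfolding real_norm_def by linarith
    qed
  qed
  have h_eq: "h s = ?c s + (LINT z|p j. ?\<psi>0 s z * of_bool (\<tau> < real (fst z)))" for s
    unfolding h by (subst split) (rule Bochner_Integration.integral_add[OF integrable_trunc int_rest])
  have h_bounds: "\<bar>h s - ?c s\<bar> \<le> mean_over \<tau> j" for s
  proof -
    have "0 \<le> (LINT z|p j. ?\<psi>0 s z * of_bool (\<tau> < real (fst z)))"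
      using rest by (intro Bochner_Integration.integral_nonneg)
    moreover have "(LINT z|p j. ?\<psi>0 s z * of_bool (\<tau> < real (fst z))) \<le> mean_over \<tau> j"
      unfolding mean_over_def by (intro integral_mono int_rest integrable_over rest)
    ultimately show ?thesis unfolding h_eq by simp
  qed
  have "F g (Suc j) t = (\<Sum>u\<in>particles t j. ?\<psi>0 (position t u) (t u)) / P j"
    unfolding F_def sum_particles_Suc position_snoc
    using m_pos[of j] by (simp add: P_Suc sum_divide_distrib mult.commute)
  then have "F g (Suc j) t - F h j t = (\<Sum>u\<in>particles t j. ?\<psi>0 (position t u) (t u) - h (position t u)) / P j"
    by (simp add: F_def sum_subtractf diff_divide_distrib)
  also have "(\<Sum>u\<in>particles t j. ?\<psi>0 (position t u) (t u) - h (position t u))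
     = (\<Sum>u\<in>particles t j. (trunc g \<tau> j (position t u) (t u) - ?c (position t u))
        + (?\<psi>0 (position t u) (t u) * of_bool (\<tau> < real (fst (t u))) + (?c (position t u) - h (position t u))))"
    by (intro sum.cong refl, subst split) simp
  also have "\<dots> = (\<Sum>u\<in>particles t j. trunc g \<tau> j (position t u) (t u) - ?c (position t u))
      + (\<Sum>u\<in>particles t j. ?\<psi>0 (position t u) (t u) * of_bool (\<tau> < real (fst (t u))) + (?c (position t u) - h (position t u)))"
    by (rule sum.distrib)
  finally have eq: "F g (Suc j) t - F h j t = \<dots> / P j" .
  have "\<bar>\<Sum>u\<in>particles t j. ?\<psi>0 (position t u) (t u) * of_bool (\<tau> < real (fst (t u))) + (?c (position t u) - h (position t u))\<bar>
    \<le> (\<Sum>u\<in>particles t j. real (fst (t u)) / m j * of_bool (\<tau> < real (fst (t u))) + mean_over \<tau> j)"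
  proof (rule order_trans[OF sum_abs], rule sum_mono)
    fix u
    show "\<bar>?\<psi>0 (position t u) (t u) * of_bool (\<tau> < real (fst (t u))) + (?c (position t u) - h (position t u))\<bar>
       \<le> real (fst (t u)) / m j * of_bool (\<tau> < real (fst (t u))) + mean_over \<tau> j"
      using rest[of "position t u" "t u"] h_bounds[of "position t u"] by linarith
  qed
  also have "\<dots> = P j * (over \<tau> j t + W j t * mean_over \<tau> j)"
    using P_pos[of j] by (simp add: over_def W_def sum.distrib field_simps)
  finally have 2: "\<bar>\<Sum>u\<in>particles t j. ?\<psi>0 (position t u) (t u) * of_bool (\<tau> < real (fst (t u))) + (?c (position t u) - h (position t u))\<bar> / P j
    \<le> over \<tau> j t + W j t * mean_over \<tau> j"
    using P_pos[of j] by (simp add: divide_le_eq mult.commute)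
  show ?thesis
    unfolding eq add_divide_distrib
    by (rule order_trans[OF abs_triangle_ineq]) (use 2 P_pos[of j] in \<open>simp add: fluct_def abs_divide\<close>)
qed

lemma measurable_mean_trunc: "(\<lambda>s. LINT z|p j. trunc g \<tau> j s z) \<in> borel_measurable borel"
proof -
  interpret p: prob_space "p j" by (rule prob_p)
  have "(\<lambda>(s, z). trunc g \<tau> j s z) \<in> borel_measurable (borel \<Otimes>\<^sub>M p j)"
    using measurable_trunc[OF g] by (simp cong: measurable_cong_sets sets_pair_measure_cong)
  then show ?thesis by (rule p.borel_measurable_lebesgue_integral)
qed

lemma measurable_fluct [measurable]: "fluct g \<tau> j \<in> borel_measurable Q"
proof -
  have [measurable]: "(\<lambda>t. trunc g \<tau> j (position t u) (t u)) \<in> borel_measurable Q" for u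
    using measurable_compose[OF measurable_Pair[OF measurable_position[of u] measurable_coord[of u]] measurable_trunc[OF g]] by simp
  note measurable_mean_trunc [measurable]
  show ?thesis unfolding fluct_def[abs_def] by measurable
qed

text \<open>The square of a truncated contribution is at most \<open>\<tau> / m j\<close> times
  \<open>real (fst z) / m j\<close>, which has mean 1; so every particle adds variance at most
  \<open>\<tau> / m j\<close>. Dividing by \<open>(P j)\<^sup>2\<close> while generation
  \<open>j\<close> has about \<open>P j\<close> particles leaves
  \<open>\<tau> / P (Suc j)\<close>.\<close>

lemma nn_integral_fluct_square:
  assumes G [measurable]: "G \<in> borel_measurable Q" and G0: "\<And>t. 0 \<le> G t" and GB: "\<And>t. G t \<le> B"
    and Gd: "depends_below j G" and \<tau>: "0 \<le> \<tau>"
  shows "(\<integral>\<^sup>+t. ennreal (G t * (fluct g \<tau> j t)\<^sup>2) \<partial>Q) \<le> ennreal (\<tau> / P (Suc j)) * (\<integral>\<^sup>+t. ennreal (G t) * ennreal (W j t) \<partial>Q)"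
proof -
  interpret p: prob_space "p j" by (rule prob_p)
  let ?c = "\<lambda>s. LINT z|p j. trunc g \<tau> j s z"
  let ?\<psi> = "\<lambda>s z. trunc g \<tau> j s z - ?c s"
  note measurable_mean_trunc [measurable]
  have tr [measurable]: "trunc g \<tau> j s \<in> borel_measurable (p j)" for s
    using integrable_trunc by simp
  have c_bounds: "0 \<le> ?c s" "?c s \<le> \<tau> / m j" for s
    using trunc_bounds(1)[of \<tau> s] trunc_bounds(3)[OF \<tau>, of s] integral_mono[OF integrable_trunc[of \<tau> s], of "\<lambda>_. \<tau> / m j"]
    by (auto intro!: Bochner_Integration.integral_nonneg simp: p.prob_space[simplified])
  have var: "(\<integral>\<^sup>+z. ennreal ((?\<psi> s z)\<^sup>2) \<partial>p j) \<le> ennreal (\<tau> / m j)" for s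
  proof -
    have sq: "integrable (p j) (\<lambda>z. (trunc g \<tau> j s z)\<^sup>2)"
      using trunc_bounds(1)[of \<tau> s] trunc_bounds(3)[OF \<tau>, of s]
      by (intro p.integrable_const_bound[of _ "(\<tau> / m j)\<^sup>2"]) (auto intro!: power_mono)
    have int: "integrable (p j) (\<lambda>z. (?\<psi> s z)\<^sup>2)"
      unfolding power2_diff using sq integrable_trunc[of \<tau> s]
      by (intro Bochner_Integration.integrable_diff Bochner_Integration.integrable_add integrable_mult_left integrable_mult_right p.integrable_const)
    \<comment> \<open>Centring can only lower the second moment.\<close>
    have "(LINT z|p j. (?\<psi> s z)\<^sup>2) = (LINT z|p j. (trunc g \<tau> j s z)\<^sup>2) - (?c s)\<^sup>2"
      by (rule p.variance_eq[OF integrable_trunc sq])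
    then have 1: "(LINT z|p j. (?\<psi> s z)\<^sup>2) \<le> (LINT z|p j. (trunc g \<tau> j s z)\<^sup>2)" by simp
    have "(LINT z|p j. (trunc g \<tau> j s z)\<^sup>2) \<le> (LINT z|p j. \<tau> / m j * (real (fst z) / m j))"
    proof (rule integral_mono[OF sq])
      show "integrable (p j) (\<lambda>z. \<tau> / m j * (real (fst z) / m j))" using integrable_fst(1)[of j] by simp
      show "(trunc g \<tau> j s z)\<^sup>2 \<le> \<tau> / m j * (real (fst z) / m j)" for z
        unfolding power2_eq_square using trunc_bounds(1)[of \<tau> s z] trunc_bounds(2)[of \<tau> s z] trunc_bounds(3)[OF \<tau>, of s z] by (intro mult_mono) auto
    qed
    also have "\<dots> = \<tau> / m j" using integrable_fst[of j] m_pos[of j] by simp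
    finally have "(LINT z|p j. (?\<psi> s z)\<^sup>2) \<le> \<tau> / m j" using 1 by (rule order_trans[rotated])
    then show ?thesis
      using nn_integral_eq_integral[OF int] by (simp add: ennreal_leI)
  qed
  have "(\<integral>\<^sup>+t. ennreal (G t * (\<Sum>u\<in>particles t j. ?\<psi> (position t u) (t u))\<^sup>2) \<partial>Q)
    \<le> ennreal (\<tau> / m j) * (\<integral>\<^sup>+t. ennreal (G t) * ennreal (real (card (particles t j))) \<partial>Q)"
  proof (rule second_moment[OF G G0 GB Gd])
    have "(\<lambda>x. (case x of (s, z) \<Rightarrow> trunc g \<tau> j s z) - ?c (fst x)) \<in> borel_measurable (borel \<Otimes>\<^sub>M offspring_space)"
      using measurable_trunc[OF g] by measurable
    then show "(\<lambda>(s, z). ?\<psi> s z) \<in> borel_measurable (borel \<Otimes>\<^sub>M offspring_space)"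
      by (simp add: case_prod_beta')
    show "\<bar>?\<psi> s z\<bar> \<le> \<tau> / m j" for s z
      using trunc_bounds(1)[of \<tau> s z] trunc_bounds(3)[OF \<tau>, of s z] c_bounds[of s] by linarith
    show "(LINT z|p j. ?\<psi> s z) = 0" for s
      using integrable_trunc[of \<tau> s] p.prob_space by simp
  qed (rule var)
  then have le: "(\<integral>\<^sup>+t. ennreal (G t * (\<Sum>u\<in>particles t j. ?\<psi> (position t u) (t u))\<^sup>2) \<partial>Q) * ennreal (1 / (P j)\<^sup>2)
     \<le> ennreal (\<tau> / m j) * (\<integral>\<^sup>+t. ennreal (G t) * ennreal (real (card (particles t j))) \<partial>Q) * ennreal (1 / (P j)\<^sup>2)"
    by (rule mult_right_mono) simp
  have [measurable]: "(\<lambda>t. trunc g \<tau> j (position t u) (t u)) \<in> borel_measurable Q" for u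
    using measurable_compose[OF measurable_Pair[OF measurable_position[of u] measurable_coord[of u]] measurable_trunc[OF g]] by simp
  have "(\<integral>\<^sup>+t. ennreal (G t * (fluct g \<tau> j t)\<^sup>2) \<partial>Q) = (\<integral>\<^sup>+t. ennreal (G t * (\<Sum>u\<in>particles t j. ?\<psi> (position t u) (t u))\<^sup>2) * ennreal (1 / (P j)\<^sup>2) \<partial>Q)"
    using G0 by (intro nn_integral_cong) (simp add: fluct_def power_divide ennreal_mult[symmetric])
  also have "\<dots> = (\<integral>\<^sup>+t. ennreal (G t * (\<Sum>u\<in>particles t j. ?\<psi> (position t u) (t u))\<^sup>2) \<partial>Q) * ennreal (1 / (P j)\<^sup>2)"
    by (rule nn_integral_multc) measurable
  also note le
  also have "(\<integral>\<^sup>+t. ennreal (G t) * ennreal (real (card (particles t j))) \<partial>Q) = ennreal (P j) * (\<integral>\<^sup>+t. ennreal (G t) * ennreal (W j t) \<partial>Q)"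
  proof -
    have "ennreal (real (card (particles t j))) = ennreal (P j) * ennreal (W j t)" for t
      using P_pos[of j] by (subst ennreal_mult[symmetric]) (auto simp: W_def)
    then show ?thesis by (subst nn_integral_cmult[symmetric]) (auto simp: mult_ac)
  qed
  also have "ennreal (\<tau> / m j) * (ennreal (P j) * I) * ennreal (1 / (P j)\<^sup>2) = ennreal (\<tau> / P (Suc j)) * I" for I
  proof -
    have "ennreal (\<tau> / m j) * ennreal (P j) * ennreal (1 / (P j)\<^sup>2) = ennreal (\<tau> / P (Suc j))"
      using P_pos[of j] m_pos[of j] \<tau> by (simp add: ennreal_mult[symmetric] P_Suc power2_eq_square)
    then show ?thesis by (metis (no_types, lifting) mult.assoc mult.commute)
  qed
  finally show ?thesis .
qed

text \<open>The first moment is bounded through the second, hence \<open>G\<close> enters the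
  assumption squared; the martingale property moves \<open>W\<close> from generation
  \<open>j\<close> back to \<open>k\<close>, where \<open>G\<close> is known.\<close>

lemma nn_integral_fluct:
  assumes G [measurable]: "G \<in> borel_measurable Q" and G0: "\<And>t. 0 \<le> G t" and GB: "\<And>t. G t \<le> B"
    and Gd: "depends_below k G" and k: "k \<le> j" and \<tau>: "0 < \<tau>" and K: "0 < K"
    and GW: "(\<integral>\<^sup>+t. ennreal ((G t)\<^sup>2) * ennreal (W k t) \<partial>Q) \<le> ennreal K"
  shows "(\<integral>\<^sup>+t. ennreal (G t * fluct g \<tau> j t) \<partial>Q) \<le> ennreal (sqrt (K * \<tau> / P (Suc j)))"
proof (rule prob_space.nn_integral_le_of_square[OF prob_Q])
  have "0 \<le> B" using G0 GB order_trans by blast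
  have "(\<integral>\<^sup>+t. ennreal ((G t * fluct g \<tau> j t)\<^sup>2) \<partial>Q) = (\<integral>\<^sup>+t. ennreal ((G t)\<^sup>2 * (fluct g \<tau> j t)\<^sup>2) \<partial>Q)"
    by (simp add: power_mult_distrib)
  also have "\<dots> \<le> ennreal (\<tau> / P (Suc j)) * (\<integral>\<^sup>+t. ennreal ((G t)\<^sup>2) * ennreal (W j t) \<partial>Q)"
    using depends_below_mono[OF depends_below_comp[OF Gd] k, of "\<lambda>x. x\<^sup>2"] G0 GB \<tau>
    by (intro nn_integral_fluct_square[of _ "B\<^sup>2"]) (auto intro!: power_mono)
  also have "(\<integral>\<^sup>+t. ennreal ((G t)\<^sup>2) * ennreal (W j t) \<partial>Q) = (\<integral>\<^sup>+t. ennreal ((G t)\<^sup>2) * ennreal (W k t) \<partial>Q)"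
    using k by (intro nn_integral_W depends_below_comp[OF Gd]) measurable
  also have "ennreal (\<tau> / P (Suc j)) * \<dots> \<le> ennreal (\<tau> / P (Suc j)) * ennreal K"
    by (rule mult_left_mono[OF GW]) simp
  also have "\<dots> = ennreal ((sqrt (K * \<tau> / P (Suc j)))\<^sup>2)"
    using K \<tau> P_pos[of "Suc j"] by (simp add: ennreal_mult[symmetric] mult.commute)
  finally show "(\<integral>\<^sup>+t. ennreal ((G t * fluct g \<tau> j t)\<^sup>2) \<partial>Q) \<le> ennreal ((sqrt (K * \<tau> / P (Suc j)))\<^sup>2)" .
qed (use G0 fluct_nonneg K \<tau> P_pos[of "Suc j"] in auto)

end

lemma nn_integral_over:
  assumes G [measurable]: "G \<in> borel_measurable Q" and Gd: "depends_below k G" and k: "k \<le> j"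
  shows "(\<integral>\<^sup>+t. G t * ennreal (over \<tau> j t) \<partial>Q) = ennreal (mean_over \<tau> j) * (\<integral>\<^sup>+t. G t * ennreal (W k t) \<partial>Q)"
proof -
  let ?h = "\<lambda>z. ennreal (real (fst z) / m j * of_bool (\<tau> < real (fst z)))"
  have hm [measurable]: "?h \<in> borel_measurable offspring_space"
    unfolding of_bool_def by measurable
  have Gd': "depends_below j G" by (rule depends_below_mono[OF Gd k])
  have "ennreal (over \<tau> j t) = (\<Sum>u\<in>particles t j. ?h (t u)) * ennreal (1 / P j)" for t
    unfolding over_def using P_pos[of j] m_pos[of j]
    by (subst sum_ennreal) (auto simp: ennreal_mult[symmetric] sum_nonneg)
  then have "(\<integral>\<^sup>+t. G t * ennreal (over \<tau> j t) \<partial>Q) = (\<integral>\<^sup>+t. G t * (\<Sum>u\<in>particles t j. ?h (t u)) * ennreal (1 / P j) \<partial>Q)"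
    by (simp add: mult.assoc)
  also have "\<dots> = (\<integral>\<^sup>+t. G t * (\<Sum>u\<in>particles t j. ?h (t u)) \<partial>Q) * ennreal (1 / P j)"
    using measurable_compose[OF measurable_coord hm] by (intro nn_integral_multc) measurable
  also have "(\<integral>\<^sup>+t. G t * (\<Sum>u\<in>particles t j. ?h (t u)) \<partial>Q) = (\<integral>\<^sup>+t. G t * (\<Sum>u\<in>particles t j. \<integral>\<^sup>+z. ?h z \<partial>p j) \<partial>Q)"
    by (rule nn_integral_particle_step[OF G Gd', of "\<lambda>_. ?h"]) measurable
  also have "\<dots> * ennreal (1 / P j) = (\<integral>\<^sup>+t. G t * (\<Sum>u\<in>particles t j. \<integral>\<^sup>+z. ?h z \<partial>p j) * ennreal (1 / P j) \<partial>Q)"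
    by (rule nn_integral_multc[symmetric]) measurable
  also have "\<dots> = (\<integral>\<^sup>+t. ennreal (mean_over \<tau> j) * (G t * ennreal (W j t)) \<partial>Q)"
  proof (rule nn_integral_cong)
    fix t
    have "(\<Sum>u\<in>particles t j. \<integral>\<^sup>+z. ?h z \<partial>p j) = ennreal (mean_over \<tau> j) * ennreal (real (card (particles t j)))"
      unfolding mean_over_eq by (simp add: mult.commute ennreal_of_nat_eq_real_of_nat)
    moreover have "ennreal (real (card (particles t j))) * ennreal (1 / P j) = ennreal (W j t)"
      using P_pos[of j] by (subst ennreal_mult[symmetric]) (auto simp: W_def)
    ultimately show "G t * (\<Sum>u\<in>particles t j. \<integral>\<^sup>+z. ?h z \<partial>p j) * ennreal (1 / P j) = ennreal (mean_over \<tau> j) * (G t * ennreal (W j t))"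
      by (metis (no_types, lifting) mult.assoc mult.left_commute)
  qed
  also have "\<dots> = ennreal (mean_over \<tau> j) * (\<integral>\<^sup>+t. G t * ennreal (W j t) \<partial>Q)"
    by (rule nn_integral_cmult) measurable
  also have "(\<integral>\<^sup>+t. G t * ennreal (W j t) \<partial>Q) = (\<integral>\<^sup>+t. G t * ennreal (W k t) \<partial>Q)"
    by (rule nn_integral_W[OF G Gd k])
  finally show ?thesis .
qed

end

section \<open>Convergence and positivity of the martingale limit\<close>

text \<open>Summable expectations give almost surely summable terms. The convergence of
  \<open>W\<close> and the vanishing of all error terms on the tree come from here, so no maximal
  inequality is involved.\<close>

lemma (in prob_space) AE_summable:
  fixes f :: "nat \<Rightarrow> 'a \<Rightarrow> real"
  assumes [measurable]: "\<And>n. f n \<in> borel_measurable M" and f0: "\<And>n x. 0 \<le> f n x"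
    and le: "\<And>n. (\<integral>\<^sup>+x. ennreal (f n x) \<partial>M) \<le> ennreal (c n)" and c: "summable c" "\<And>n. 0 \<le> c n"
  shows "AE x in M. summable (\<lambda>n. f n x)"
proof -
  have "(\<integral>\<^sup>+x. (\<Sum>n. ennreal (f n x)) \<partial>M) = (\<Sum>n. \<integral>\<^sup>+x. ennreal (f n x) \<partial>M)"
    by (rule nn_integral_suminf) measurable
  also have "\<dots> \<le> (\<Sum>n. ennreal (c n))" by (intro suminf_le le) auto
  also have "\<dots> = ennreal (\<Sum>n. c n)" by (rule suminf_ennreal2) (use c in auto)
  also have "\<dots> < \<infinity>" by simp
  finally have "AE x in M. (\<Sum>n. ennreal (f n x)) \<noteq> \<infinity>"
    by (intro nn_integral_PInf_AE) auto
  then show ?thesis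
    by eventually_elim (auto intro: summable_suminf_not_top f0)
qed

lemma convergent_of_summable_increments:
  fixes X :: "nat \<Rightarrow> real"
  assumes "summable (\<lambda>n. \<bar>X (Suc n) - X n\<bar>)" shows "convergent X"
proof -
  have "summable (\<lambda>n. X (Suc n) - X n)" using assms by (rule summable_rabs_cancel)
  then have "(\<lambda>n. \<Sum>i<n. X (Suc i) - X i) \<longlonglongrightarrow> (\<Sum>i. X (Suc i) - X i)" by (rule summable_LIMSEQ)
  then have "(\<lambda>n. X n - X 0) \<longlonglongrightarrow> (\<Sum>i. X (Suc i) - X i)" by (simp add: sum_lessThan_telescope)
  then have "(\<lambda>n. X n - X 0 + X 0) \<longlonglongrightarrow> (\<Sum>i. X (Suc i) - X i) + X 0" by (intro tendsto_intros)
  then show ?thesis by (auto simp: convergent_def)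
qed

context quenched
begin

lemma W_increment: "\<bar>W (Suc j) t - W j t\<bar> \<le> fluct (\<lambda>_. 1) \<tau> j t + (over \<tau> j t + W j t * mean_over \<tau> j)"
proof -
  have "(1::real) = (LINT z|p j. (\<Sum>i<fst z. 1) / m j)"
    using integrable_fst[of j] m_pos[of j] by simp
  then show ?thesis using F_increment[of "\<lambda>_. 1" "\<lambda>_. 1" j t \<tau>] by (simp add: F_1)
qed

lemma nn_integral_fluct_simple:
  assumes "g \<in> borel_measurable borel" "\<And>s. 0 \<le> g s" "\<And>s. g s \<le> 1" and \<tau>: "0 < \<tau>"
  shows "(\<integral>\<^sup>+t. ennreal (fluct g \<tau> j t) \<partial>Q) \<le> ennreal (sqrt (\<tau> / P (Suc j)))"
proof -
  interpret Q: prob_space Q by (rule prob_Q)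
  have "(\<integral>\<^sup>+t. ennreal (1\<^sup>2) * ennreal (W 0 t) \<partial>Q) \<le> ennreal 1"
    by (simp add: W_def P_def Q.emeasure_space_1[simplified])
  then show ?thesis
    using nn_integral_fluct[OF assms(1-3), of "\<lambda>_. 1" 1 0 j \<tau> 1] \<tau> by (simp add: depends_below_const)
qed

lemma nn_integral_over_simple:
  "(\<integral>\<^sup>+t. ennreal (over \<tau> j t + W j t * mean_over \<tau> j) \<partial>Q) = ennreal (2 * mean_over \<tau> j)"
proof -
  interpret Q: prob_space Q by (rule prob_Q)
  have 1: "(\<integral>\<^sup>+t. ennreal (W 0 t) \<partial>Q) = 1"
    by (simp add: W_def P_def Q.emeasure_space_1[simplified])
  have "(\<integral>\<^sup>+t. ennreal (over \<tau> j t + W j t * mean_over \<tau> j) \<partial>Q)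
      = (\<integral>\<^sup>+t. ennreal (over \<tau> j t) + ennreal (W j t) * ennreal (mean_over \<tau> j) \<partial>Q)"
    by (simp add: over_nonneg W_nonneg mean_over_nonneg ennreal_plus ennreal_mult)
  also have "\<dots> = (\<integral>\<^sup>+t. ennreal (over \<tau> j t) \<partial>Q) + (\<integral>\<^sup>+t. ennreal (W j t) \<partial>Q) * ennreal (mean_over \<tau> j)"
    by (simp add: nn_integral_add nn_integral_multc)
  also have "\<dots> = ennreal (mean_over \<tau> j) + ennreal (mean_over \<tau> j)"
    using nn_integral_over[of "\<lambda>_. 1" 0 j \<tau>] nn_integral_W[of "\<lambda>_. 1" 0 j] by (simp add: depends_below_const 1)
  finally show ?thesis by (simp add: mean_over_nonneg ennreal_plus[symmetric] del: ennreal_plus)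
qed

end

locale quenched_growth = quenched +
  fixes c C :: real
  assumes c_pos: "0 < c" and C_pos: "0 < C" and growth: "\<And>n. C * exp (3 * c * real n) \<le> P n"
    and summable_over: "summable (\<lambda>j. mean_over (exp (c * real j)) j)"
begin

text \<open>This fixes the factor 3 in \<open>growth\<close>: truncation at
  \<open>exp (c * real j)\<close> against growth \<open>exp (3 * c * real j)\<close> leaves a second
  moment of order \<open>exp (- 2 * c * real j)\<close>, hence a first moment of order
  \<open>exp (- c * real j)\<close>.\<close>

lemma fluct_bound: "sqrt (exp (c * real j) / P (Suc j)) \<le> (1 / sqrt C) * exp (- c) ^ j"
proof -
  have "exp (c * real j) / P (Suc j) \<le> exp (c * real j) / (C * exp (3 * c * real j))"
  proof (intro divide_left_mono)
    have "C * exp (3 * c * real j) \<le> C * exp (3 * c * real (Suc j))"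
      using c_pos C_pos by simp
    also have "\<dots> \<le> P (Suc j)" by (rule growth)
    finally show "C * exp (3 * c * real j) \<le> P (Suc j)" .
  qed (use P_pos C_pos in auto)
  also have "\<dots> = (exp (c * real j) / exp (3 * c * real j)) / C" by simp
  also have "exp (c * real j) / exp (3 * c * real j) = exp (c * real j - 3 * c * real j)" by (simp only: exp_diff)
  also have "c * real j - 3 * c * real j = 2 * (- c * real j)" by simp
  also have "exp \<dots> = (exp (- c) ^ j)\<^sup>2"
    by (simp add: exp_double exp_of_nat_mult[symmetric] mult.commute)
  finally have "sqrt (exp (c * real j) / P (Suc j)) \<le> sqrt ((exp (- c) ^ j)\<^sup>2 / C)"
    by (simp only: real_sqrt_le_iff)
  moreover have "sqrt ((exp (- c) ^ j)\<^sup>2 / C) = (1 / sqrt C) * exp (- c) ^ j" by (simp add: real_sqrt_divide)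
  ultimately show ?thesis by (simp only:)
qed

lemma W_convergent: "AE t in Q. convergent (\<lambda>n. W n t)"
proof -
  interpret Q: prob_space Q by (rule prob_Q)
  have "AE t in Q. summable (\<lambda>j. fluct (\<lambda>_. 1) (exp (c * real j)) j t)"
  proof (rule Q.AE_summable)
    show "(\<integral>\<^sup>+t. ennreal (fluct (\<lambda>_. 1) (exp (c * real j)) j t) \<partial>Q) \<le> ennreal ((1 / sqrt C) * exp (- c) ^ j)" for j
      by (rule order_trans[OF nn_integral_fluct_simple ennreal_leI[OF fluct_bound]]) simp_all
    show "summable (\<lambda>j. (1 / sqrt C) * exp (- c) ^ j)"
      using c_pos by (intro summable_mult summable_geometric) auto
  qed (use C_pos fluct_nonneg in auto)
  moreover have "AE t in Q. summable (\<lambda>j. over (exp (c * real j)) j t + W j t * mean_over (exp (c * real j)) j)"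
    by (rule Q.AE_summable[where c="\<lambda>j. 2 * mean_over (exp (c * real j)) j"])
       (auto simp: nn_integral_over_simple mean_over_nonneg over_nonneg W_nonneg simp del: ennreal_plus intro!: summable_mult summable_over)
  ultimately show ?thesis
  proof eventually_elim
    case (elim t)
    have "summable (\<lambda>j. fluct (\<lambda>_. 1) (exp (c * real j)) j t + (over (exp (c * real j)) j t + W j t * mean_over (exp (c * real j)) j))"
      by (rule summable_add[OF elim])
    then have "summable (\<lambda>j. \<bar>W (Suc j) t - W j t\<bar>)"
      by (rule summable_comparison_test') (use W_increment in auto)
    then show ?case by (rule convergent_of_summable_increments)
  qed
qed

end

section \<open>Survival: the limit of \<open>W\<close> is positive when the population grows\<close>

context quenched
begin

text \<open>On the event, \<open>W\<close> must fall from \<open>W k\<close> to 0, so its variation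
  after generation \<open>k\<close>, divided by \<open>W k\<close>, is at least 1, and Markov's
  inequality bounds the probability. With many particles in generation \<open>k\<close> the relative
  fluctuations are averaged out, which produces the factor \<open>1 / sqrt (real K)\<close>.
  Convergence to 0 is expressed through \<open>1 / real (Suc r)\<close> to keep the event
  measurable.\<close>

lemma extinction_estimate:
  assumes K: "0 < K" and \<tau>: "\<And>i. 0 < \<tau> i"
    and sf: "summable (\<lambda>i. sqrt (\<tau> i * P k / P (Suc (k + i))))" and so: "summable (\<lambda>i. mean_over (\<tau> i) (k + i))"
  shows "emeasure Q {t. K \<le> card (particles t k) \<and> (\<forall>r::nat. \<exists>n0. \<forall>n\<ge>n0. W n t < 1 / real (Suc r))}
    \<le> ennreal ((\<Sum>i. sqrt (\<tau> i * P k / P (Suc (k + i)))) / sqrt (real K) + 2 * (\<Sum>i. mean_over (\<tau> i) (k + i)))"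
    (is "emeasure Q ?A \<le> _")
proof -
  interpret Q: prob_space Q by (rule prob_Q)
  define G where "G t = (if K \<le> card (particles t k) then 1 / W k t else 0)" for t
  have A_meas [measurable]: "?A \<in> sets Q"
  proof -
    have "?A = {t \<in> space Q. real K \<le> real (card (particles t k)) \<and> (\<forall>r::nat. \<exists>n0. \<forall>n\<ge>n0. W n t < 1 / real (Suc r))}" by simp
    also have "\<dots> \<in> sets Q" by measurable
    finally show ?thesis .
  qed
  have G_meas [measurable]: "G \<in> borel_measurable Q"
  proof -
    have "G = (\<lambda>t. if real K \<le> real (card (particles t k)) then 1 / W k t else 0)" by (simp add: G_def fun_eq_iff)
    also have "\<dots> \<in> borel_measurable Q" by measurable
    finally show ?thesis .
  qed
  have Gd: "depends_below k G"
    unfolding G_def W_def by (rule depends_below_particles)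
  have G0: "0 \<le> G t" for t by (simp add: G_def W_nonneg)
  have Wk: "real K / P k \<le> W k t" if "K \<le> card (particles t k)" for t
    unfolding W_def using that P_pos[of k] by (intro divide_right_mono) auto
  have GB: "G t \<le> P k / real K" for t
  proof (cases "K \<le> card (particles t k)")
    case True
    have "1 / W k t \<le> 1 / (real K / P k)"
      using Wk[OF True] K P_pos[of k] by (intro divide_left_mono mult_pos_pos) (auto intro: less_le_trans[OF _ Wk[OF True]])
    then show ?thesis using True by (simp add: G_def)
  qed (use P_pos[of k] in \<open>simp add: G_def less_imp_le\<close>)
  have Wk_pos: "0 < W k t" if "K \<le> card (particles t k)" for t
    using Wk[OF that] K P_pos[of k] by (intro less_le_trans[OF _ Wk[OF that]]) simp
  have GW: "G t * W k t \<le> 1" for t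
    using Wk_pos[of t] by (simp add: G_def)
  \<comment> \<open>\<open>G t * W k t\<close> is 1 or 0, so \<open>(G t)\<^sup>2 * W k t\<close> is
    at most \<open>G t\<close>, and \<open>W k t\<close> is at least \<open>real K / P k\<close>
    wherever \<open>G t\<close> is not 0.\<close>
  have G2W: "(\<integral>\<^sup>+t. ennreal ((G t)\<^sup>2) * ennreal (W k t) \<partial>Q) \<le> ennreal (P k / real K)"
  proof -
    have "ennreal ((G t)\<^sup>2) * ennreal (W k t) \<le> ennreal (P k / real K)" for t
    proof -
      have "(G t)\<^sup>2 * W k t = G t * (G t * W k t)" by (simp add: power2_eq_square)
      also have "\<dots> \<le> P k / real K * 1" using G0 GB GW W_nonneg P_pos[of k] by (intro mult_mono) auto
      finally show ?thesis by (simp add: ennreal_mult[symmetric] W_nonneg ennreal_leI)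
    qed
    then have "(\<integral>\<^sup>+t. ennreal ((G t)\<^sup>2) * ennreal (W k t) \<partial>Q) \<le> (\<integral>\<^sup>+t. ennreal (P k / real K) \<partial>Q)"
      by (intro nn_integral_mono)
    then show ?thesis by (simp add: Q.emeasure_space_1[simplified])
  qed
  have GW1: "(\<integral>\<^sup>+t. ennreal (G t) * ennreal (W k t) \<partial>Q) \<le> 1"
  proof -
    have "(\<integral>\<^sup>+t. ennreal (G t) * ennreal (W k t) \<partial>Q) \<le> (\<integral>\<^sup>+t. 1 \<partial>Q)"
      using GW G0 W_nonneg by (intro nn_integral_mono) (simp add: ennreal_mult[symmetric] flip: ennreal_1 del: ennreal_1)
    then show ?thesis by (simp add: Q.emeasure_space_1[simplified])
  qed
  let ?d = "\<lambda>i t. \<bar>W (Suc (k + i)) t - W (k + i) t\<bar>"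
  \<comment> \<open>The partial sums dominate \<open>1 - G t * W (k + n) t\<close>, which tends to
    1; if the series diverges there is nothing to show.\<close>
  have one_le: "1 \<le> (\<Sum>i. ennreal (G t * ?d i t))" if t: "t \<in> ?A" for t
  proof (cases "(\<Sum>i. ennreal (G t * ?d i t)) = \<infinity>")
    case False
    then have sum: "summable (\<lambda>i. G t * ?d i t)"
      by (intro summable_suminf_not_top) (auto simp: G0)
    have Gpos: "G t = 1 / W k t" "0 < W k t" using t Wk_pos by (auto simp: G_def)
    have W0: "(\<lambda>n. W n t) \<longlonglongrightarrow> 0"
    proof (rule LIMSEQ_I)
      fix e :: real assume "0 < e"
      then obtain r where r: "inverse (real (Suc r)) < e" using reals_Archimedean by blast
      obtain n0 where "\<forall>n\<ge>n0. W n t < 1 / real (Suc r)" using t by auto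
      with r show "\<exists>no. \<forall>n\<ge>no. norm (W n t - 0) < e"
        by (intro exI[of _ n0]) (auto simp: W_nonneg inverse_eq_divide intro: less_trans)
    qed
    have "1 - G t * W (k + n) t \<le> (\<Sum>i. G t * ?d i t)" for n
    proof -
      have "W k t - W (k + n) t = (\<Sum>i<n. W (k + i) t - W (k + Suc i) t)"
        using sum_lessThan_telescope'[of "\<lambda>i. W (k + i) t" n] by simp
      also have "\<dots> \<le> (\<Sum>i<n. ?d i t)" by (intro sum_mono) auto
      finally have "G t * (W k t - W (k + n) t) \<le> G t * (\<Sum>i<n. ?d i t)" by (rule mult_left_mono[OF _ G0])
      also have "\<dots> = (\<Sum>i<n. G t * ?d i t)" by (rule sum_distrib_left)
      also have "\<dots> \<le> (\<Sum>i. G t * ?d i t)" using sum G0 by (intro sum_le_suminf) auto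
      finally show ?thesis using Gpos by (simp add: right_diff_distrib)
    qed
    moreover have "(\<lambda>n. 1 - G t * W (k + n) t) \<longlonglongrightarrow> 1 - G t * 0"
      by (intro tendsto_intros LIMSEQ_ignore_initial_segment[OF W0, of k, unfolded add.commute[of _ k]])
    ultimately have "1 \<le> (\<Sum>i. G t * ?d i t)" by (intro LIMSEQ_le_const2[of _ 1 "\<Sum>i. G t * ?d i t"]) auto
    also have "ennreal \<dots> = (\<Sum>i. ennreal (G t * ?d i t))"
      using sum G0 by (intro suminf_ennreal2[symmetric]) auto
    finally show ?thesis by (simp add: ennreal_leI flip: ennreal_1 del: ennreal_1) 
  qed simp
  have step: "(\<integral>\<^sup>+t. ennreal (G t * ?d i t) \<partial>Q) \<le> ennreal (sqrt (\<tau> i * P k / P (Suc (k + i))) / sqrt (real K) + 2 * mean_over (\<tau> i) (k + i))" for i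
  proof -
    let ?o = "mean_over (\<tau> i) (k + i)"
    have "(\<integral>\<^sup>+t. ennreal (G t * ?d i t) \<partial>Q) \<le> (\<integral>\<^sup>+t. ennreal (G t * fluct (\<lambda>_. 1) (\<tau> i) (k + i) t) + (ennreal (G t) * ennreal (over (\<tau> i) (k + i) t) + ennreal (G t) * ennreal (W (k + i) t) * ennreal ?o) \<partial>Q)"
    proof (rule nn_integral_mono)
      fix t
      have "G t * ?d i t \<le> G t * fluct (\<lambda>_. 1) (\<tau> i) (k + i) t + (G t * over (\<tau> i) (k + i) t + G t * W (k + i) t * ?o)"
        using mult_left_mono[OF W_increment[of "k + i" t "\<tau> i"] G0[of t]] by (simp add: distrib_left mult.assoc)
      then show "ennreal (G t * ?d i t) \<le> ennreal (G t * fluct (\<lambda>_. 1) (\<tau> i) (k + i) t) + (ennreal (G t) * ennreal (over (\<tau> i) (k + i) t) + ennreal (G t) * ennreal (W (k + i) t) * ennreal ?o)"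
        by (simp add: ennreal_mult[symmetric] ennreal_plus[symmetric] G0 fluct_nonneg over_nonneg W_nonneg mean_over_nonneg ennreal_leI del: ennreal_plus)
    qed
    also have "\<dots> = (\<integral>\<^sup>+t. ennreal (G t * fluct (\<lambda>_. 1) (\<tau> i) (k + i) t) \<partial>Q) + ((\<integral>\<^sup>+t. ennreal (G t) * ennreal (over (\<tau> i) (k + i) t) \<partial>Q) + (\<integral>\<^sup>+t. ennreal (G t) * ennreal (W (k + i) t) \<partial>Q) * ennreal ?o)"
      by (simp add: nn_integral_add nn_integral_multc)
    also have "\<dots> \<le> ennreal (sqrt (P k / real K * \<tau> i / P (Suc (k + i)))) + (ennreal ?o * 1 + 1 * ennreal ?o)"
    proof (intro add_mono)
      show "(\<integral>\<^sup>+t. ennreal (G t * fluct (\<lambda>_. 1) (\<tau> i) (k + i) t) \<partial>Q) \<le> ennreal (sqrt (P k / real K * \<tau> i / P (Suc (k + i))))"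
        by (rule nn_integral_fluct[OF _ _ _ G_meas G0 GB Gd _ \<tau> _ G2W]) (use P_pos[of k] K in auto)
      have "(\<integral>\<^sup>+t. ennreal (G t) * ennreal (over (\<tau> i) (k + i) t) \<partial>Q) = ennreal ?o * (\<integral>\<^sup>+t. ennreal (G t) * ennreal (W k t) \<partial>Q)"
        by (rule nn_integral_over) (auto intro: depends_below_comp[OF Gd])
      also have "\<dots> \<le> ennreal ?o * 1" by (intro mult_left_mono GW1) simp
      finally show "(\<integral>\<^sup>+t. ennreal (G t) * ennreal (over (\<tau> i) (k + i) t) \<partial>Q) \<le> ennreal ?o * 1" .
      have "(\<integral>\<^sup>+t. ennreal (G t) * ennreal (W (k + i) t) \<partial>Q) = (\<integral>\<^sup>+t. ennreal (G t) * ennreal (W k t) \<partial>Q)"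
        by (rule nn_integral_W) (auto intro: depends_below_comp[OF Gd])
      then show "(\<integral>\<^sup>+t. ennreal (G t) * ennreal (W (k + i) t) \<partial>Q) * ennreal ?o \<le> 1 * ennreal ?o"
        using GW1 by (intro mult_right_mono) auto
    qed
    also have "\<dots> = ennreal (sqrt (P k / real K * \<tau> i / P (Suc (k + i))) + 2 * ?o)"
      using \<tau>[of i] P_pos[of k] P_pos[of "Suc (k + i)"]
      by (simp add: mean_over_nonneg ennreal_plus[symmetric] less_imp_le del: ennreal_plus)
    also have "P k / real K * \<tau> i / P (Suc (k + i)) = \<tau> i * P k / P (Suc (k + i)) / real K" by (simp add: mult_ac)
    finally show ?thesis by (simp only: real_sqrt_divide)
  qed
  have "emeasure Q ?A = (\<integral>\<^sup>+t. indicator ?A t \<partial>Q)" by (rule nn_integral_indicator[OF A_meas, symmetric])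
  also have "\<dots> \<le> (\<integral>\<^sup>+t. (\<Sum>i. ennreal (G t * ?d i t)) \<partial>Q)"
    by (intro nn_integral_mono) (auto simp: indicator_def intro: one_le)
  also have "\<dots> = (\<Sum>i. \<integral>\<^sup>+t. ennreal (G t * ?d i t) \<partial>Q)" by (rule nn_integral_suminf) measurable
  also have "\<dots> \<le> (\<Sum>i. ennreal (sqrt (\<tau> i * P k / P (Suc (k + i))) / sqrt (real K) + 2 * mean_over (\<tau> i) (k + i)))"
    by (intro suminf_le step) auto
  also have "\<dots> = ennreal (\<Sum>i. sqrt (\<tau> i * P k / P (Suc (k + i))) / sqrt (real K) + 2 * mean_over (\<tau> i) (k + i))"
    using sf so \<tau> P_pos by (intro suminf_ennreal2 add_nonneg_nonneg summable_add summable_divide summable_mult) (auto simp: mean_over_nonneg less_imp_le)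
  also have "(\<Sum>i. sqrt (\<tau> i * P k / P (Suc (k + i))) / sqrt (real K) + 2 * mean_over (\<tau> i) (k + i))
     = (\<Sum>i. sqrt (\<tau> i * P k / P (Suc (k + i)))) / sqrt (real K) + 2 * (\<Sum>i. mean_over (\<tau> i) (k + i))"
    using sf so by (simp add: suminf_add[symmetric] suminf_divide suminf_mult summable_divide summable_mult)
  finally show ?thesis .
qed

text \<open>The bound \<open>R\<close> is available before \<open>K\<close> is chosen and is shared
  by infinitely many restart generations \<open>k\<close>. Hence, for every \<open>n0\<close>, some
  \<open>k\<close> beyond \<open>n0\<close> may serve as the new origin, and the probability that at
  least \<open>K\<close> particles live from \<open>n0\<close> on while \<open>W\<close> tends to 0
  is at most \<open>e\<close>, uniformly in \<open>n0\<close>.\<close>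

lemma survival_positive:
  assumes rec: "\<And>e. 0 < e \<Longrightarrow> \<exists>\<tau> R. (\<forall>i. 0 < \<tau> i) \<and> (\<exists>\<^sub>\<infinity>k.
      summable (\<lambda>i. sqrt (\<tau> i * P k / P (Suc (k + i)))) \<and> (\<Sum>i. sqrt (\<tau> i * P k / P (Suc (k + i)))) \<le> R \<and>
      summable (\<lambda>i. mean_over (\<tau> i) (k + i)) \<and> (\<Sum>i. mean_over (\<tau> i) (k + i)) \<le> e)"
  shows "AE t in Q. filterlim (\<lambda>n. card (particles t n)) at_top sequentially \<longrightarrow> \<not> (\<lambda>n. W n t) \<longlonglongrightarrow> 0"
proof -
  interpret Q: prob_space Q by (rule prob_Q)
  define D where "D = {t. \<forall>r::nat. \<exists>n0. \<forall>n\<ge>n0. W n t < 1 / real (Suc r)}"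
  define B where "B K n0 = {t. (\<forall>k\<ge>n0. K \<le> card (particles t k))} \<inter> D" for K n0
  have D_meas [measurable]: "D \<in> sets Q"
  proof -
    have "D = {t \<in> space Q. \<forall>r::nat. \<exists>n0. \<forall>n\<ge>n0. W n t < 1 / real (Suc r)}" by (simp add: D_def)
    also have "\<dots> \<in> sets Q" by measurable
    finally show ?thesis .
  qed
  have B_meas [measurable]: "B K n0 \<in> sets Q" for K n0
  proof -
    have "B K n0 = {t \<in> space Q. \<forall>k\<ge>n0. real K \<le> real (card (particles t k))} \<inter> D" by (simp add: B_def)
    also have "\<dots> \<in> sets Q" by measurable
    finally show ?thesis .
  qed
  define A where "A = (\<Inter>K. \<Union>n0. B K n0)"
  have A_meas [measurable]: "A \<in> sets Q" unfolding A_def by measurable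
  have "emeasure Q A \<le> 0 + ennreal e" if e: "0 < e" for e
  proof -
    obtain \<tau> R where \<tau>: "\<And>i. 0 < \<tau> i" and inf: "\<exists>\<^sub>\<infinity>k.
      summable (\<lambda>i. sqrt (\<tau> i * P k / P (Suc (k + i)))) \<and> (\<Sum>i. sqrt (\<tau> i * P k / P (Suc (k + i)))) \<le> R \<and>
      summable (\<lambda>i. mean_over (\<tau> i) (k + i)) \<and> (\<Sum>i. mean_over (\<tau> i) (k + i)) \<le> e / 4"
      using rec[of "e / 4"] e by auto
    \<comment> \<open>\<open>K\<close> makes the fluctuation part \<open>R / sqrt (real K)\<close>
      at most \<open>e / 2\<close>; the other half is twice the excess, which is at most
      \<open>e / 4\<close>.\<close>
    obtain K0 :: nat where K0: "(2 * R / e)\<^sup>2 \<le> real K0" using real_arch_simple by blast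
    define K where "K = Suc K0"
    have K: "0 < K" "(2 * R / e)\<^sup>2 \<le> real K" using K0 by (auto simp: K_def)
    have "2 * R / e \<le> sqrt (real K)" using real_le_rsqrt[OF K(2)] .
    then have RK: "R / sqrt (real K) \<le> e / 2" using K e by (simp add: field_simps)
    have "emeasure Q (B K n0) \<le> ennreal e" for n0
    proof -
      obtain k where k: "k \<ge> n0" and sf: "summable (\<lambda>i. sqrt (\<tau> i * P k / P (Suc (k + i))))" and R: "(\<Sum>i. sqrt (\<tau> i * P k / P (Suc (k + i)))) \<le> R"
        and so: "summable (\<lambda>i. mean_over (\<tau> i) (k + i))" and o: "(\<Sum>i. mean_over (\<tau> i) (k + i)) \<le> e / 4"
        using inf unfolding INFM_nat_le by blast
      let ?A = "{t. K \<le> card (particles t k) \<and> (\<forall>r::nat. \<exists>n0. \<forall>n\<ge>n0. W n t < 1 / real (Suc r))}"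
      have "?A = {t \<in> space Q. real K \<le> real (card (particles t k))} \<inter> D" by (auto simp: D_def)
      also have "\<dots> \<in> sets Q" by measurable
      finally have "emeasure Q (B K n0) \<le> emeasure Q ?A"
        using k by (intro emeasure_mono) (auto simp: B_def D_def)
      also have "\<dots> \<le> ennreal ((\<Sum>i. sqrt (\<tau> i * P k / P (Suc (k + i)))) / sqrt (real K) + 2 * (\<Sum>i. mean_over (\<tau> i) (k + i)))"
        by (rule extinction_estimate[OF K(1) \<tau> sf so])
      also have "\<dots> \<le> ennreal e"
      proof (rule ennreal_leI)
        have "(\<Sum>i. sqrt (\<tau> i * P k / P (Suc (k + i)))) / sqrt (real K) \<le> R / sqrt (real K)"
          using R by (intro divide_right_mono) auto
        then show "(\<Sum>i. sqrt (\<tau> i * P k / P (Suc (k + i)))) / sqrt (real K) + 2 * (\<Sum>i. mean_over (\<tau> i) (k + i)) \<le> e"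
          using RK o by linarith
      qed
      finally show ?thesis .
    qed
    moreover have "incseq (B K)" by (auto simp: incseq_def B_def)
    then have "emeasure Q (\<Union>n0. B K n0) = (SUP n0. emeasure Q (B K n0))"
      by (intro SUP_emeasure_incseq[symmetric]) auto
    ultimately have "emeasure Q (\<Union>n0. B K n0) \<le> ennreal e" by (simp add: SUP_le_iff)
    moreover have "emeasure Q A \<le> emeasure Q (\<Union>n0. B K n0)"
      unfolding A_def by (intro emeasure_mono) auto
    ultimately show ?thesis by simp
  qed
  then have "emeasure Q A \<le> 0" by (rule ennreal_le_epsilon)
  then have "AE t in Q. t \<notin> A" by (intro AE_not_in) (auto simp: null_sets_def)
  then show ?thesis
  proof eventually_elim
    case (elim t)
    show ?case
    proof (intro impI notI)
      assume Z: "filterlim (\<lambda>n. card (particles t n)) at_top sequentially" and W: "(\<lambda>n. W n t) \<longlonglongrightarrow> 0"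
      have "\<exists>n0. \<forall>n\<ge>n0. W n t < 1 / real (Suc r)" for r
        using order_tendstoD(2)[OF W, of "1 / real (Suc r)"] by (auto simp: eventually_sequentially)
      then have "t \<in> D" by (simp add: D_def)
      moreover have "\<exists>n0. \<forall>k\<ge>n0. K \<le> card (particles t k)" for K
        using Z by (auto simp: filterlim_at_top eventually_sequentially)
      ultimately have "t \<in> A" by (auto simp: A_def B_def)
      with elim show False by blast
    qed
  qed
qed

end

section \<open>Dyadic generations\<close>

text \<open>The intermediate generation is the largest power of 2 below \<open>n\<^bsup>1/(2\<gamma>)\<^esup>\<close>: along powers of 2 a bound
  in expectation suffices for almost sure convergence of the mean square displacement.\<close>

definition dyadic_exponent :: "real \<Rightarrow> nat \<Rightarrow> nat" where
  "dyadic_exponent \<gamma> n = nat \<lfloor>log 2 (real n powr (1 / (2 * \<gamma>)))\<rfloor>"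

definition dyadic :: "real \<Rightarrow> nat \<Rightarrow> nat" where
  "dyadic \<gamma> n = (if n = 0 then 0 else 2 ^ dyadic_exponent \<gamma> n)"

context
  fixes \<gamma> :: real assumes \<gamma>: "1 / 2 < \<gamma>"
begin

lemma dyadic_bounds:
  assumes "0 < n"
  shows "real (dyadic \<gamma> n) \<le> real n powr (1 / (2 * \<gamma>))" "real n powr (1 / (2 * \<gamma>)) < 2 * real (dyadic \<gamma> n)"
proof -
  let ?x = "real n powr (1 / (2 * \<gamma>))"
  have x: "1 \<le> ?x" using assms \<gamma> by (intro ge_one_powr_ge_zero) auto
  have lv: "real (dyadic_exponent \<gamma> n) = of_int \<lfloor>log 2 ?x\<rfloor>" 
  proof -
    have "0 \<le> log 2 y" if "1 \<le> y" for y :: real using that by simp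
    from this[OF x] show ?thesis by (simp add: dyadic_exponent_def)
  qed
  have "real (dyadic \<gamma> n) = 2 powr real (dyadic_exponent \<gamma> n)" using assms by (simp add: dyadic_def powr_realpow)
  also have "\<dots> \<le> 2 powr (log 2 ?x)" unfolding lv by simp
  also have "\<dots> = ?x" using assms by (intro powr_log_cancel) auto
  finally show "real (dyadic \<gamma> n) \<le> ?x" .
  have "?x = 2 powr (log 2 ?x)" using assms by (intro powr_log_cancel[symmetric]) auto
  also have "\<dots> < 2 powr (real (dyadic_exponent \<gamma> n) + 1)" unfolding lv by simp
  also have "\<dots> = 2 * real (dyadic \<gamma> n)" using assms by (simp add: dyadic_def powr_add powr_realpow)
  finally show "?x < 2 * real (dyadic \<gamma> n)" .
qed

lemma dyadic_le: "dyadic \<gamma> n \<le> n"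
proof (cases "n = 0")
  case False
  have "1 / (2 * \<gamma>) < 1" using \<gamma> by (simp add: divide_less_eq)
  then have "real n powr (1 / (2 * \<gamma>)) \<le> real n powr 1" using False by (intro powr_mono) auto
  then have "real (dyadic \<gamma> n) \<le> real n" using dyadic_bounds(1)[of n] False by simp
  then show ?thesis by simp
qed (simp add: dyadic_def)

lemma dyadic_small: "(\<lambda>n. real (dyadic \<gamma> n) / real n) \<longlonglongrightarrow> 0"
proof (rule Lim_null_comparison)
  have "1 / (2 * \<gamma>) - 1 < 0" using \<gamma> by (simp add: divide_less_eq)
  then show "(\<lambda>n. real n powr (1 / (2 * \<gamma>) - 1)) \<longlonglongrightarrow> 0"
    by (intro tendsto_neg_powr filterlim_real_sequentially)
  show "\<forall>\<^sub>F n in sequentially. norm (real (dyadic \<gamma> n) / real n) \<le> real n powr (1 / (2 * \<gamma>) - 1)"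
    using eventually_gt_at_top[of 0]
    by eventually_elim (use dyadic_bounds(1) in \<open>auto simp: powr_diff divide_right_mono\<close>)
qed

lemma filterlim_dyadic_exponent: "filterlim (dyadic_exponent \<gamma>) at_top sequentially"
  unfolding dyadic_exponent_def
  by (rule filterlim_compose[OF filterlim_nat_sequentially] filterlim_compose[OF filterlim_floor_sequentially])+
     (use \<gamma> in real_asymp)

lemma filterlim_dyadic: "filterlim (dyadic \<gamma>) at_top sequentially"
proof -
  have "\<forall>\<^sub>F n in sequentially. dyadic_exponent \<gamma> n \<le> dyadic \<gamma> n"
    using eventually_gt_at_top[of 0] by eventually_elim (auto simp: dyadic_def less_imp_le)
  then show ?thesis by (rule filterlim_at_top_mono[OF filterlim_dyadic_exponent])
qed

text \<open>Lets the normalization \<open>sqrt (real n)\<close> be absorbed by the weight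
  \<open>real (Suc j) powr \<gamma>\<close> for every generation \<open>j\<close> from the
  intermediate one on.\<close>

lemma sqrt_le_dyadic: "sqrt (real n) \<le> (2 * real (dyadic \<gamma> n)) powr \<gamma>"
proof (cases "n = 0")
  case False
  have "sqrt (real n) = (real n powr (1 / (2 * \<gamma>))) powr \<gamma>"
    using \<gamma> False by (simp add: powr_powr powr_half_sqrt)
  also have "\<dots> \<le> (2 * real (dyadic \<gamma> n)) powr \<gamma>"
    using \<gamma> dyadic_bounds(2)[of n] False by (intro powr_mono2) auto
  finally show ?thesis .
qed simp

lemma dyadic_powr_le: "0 < n \<Longrightarrow> (2 ^ dyadic_exponent \<gamma> n) powr (2 * \<gamma>) \<le> real n"
proof -
  assume n: "0 < n"
  have "(2 ^ dyadic_exponent \<gamma> n) powr (2 * \<gamma>) \<le> (real n powr (1 / (2 * \<gamma>))) powr (2 * \<gamma>)"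
    using dyadic_bounds(1)[OF n] n \<gamma> by (intro powr_mono2) (auto simp: dyadic_def)
  also have "\<dots> = real n" using n \<gamma> by (simp add: powr_powr)
  finally show ?thesis .
qed

text \<open>The intermediate generation exceeds half a positive power of \<open>n\<close>, so the
  exponential beats every polynomial; the comparison series is the sum of
  \<open>1 / n\<^sup>2\<close>.\<close>

lemma summable_sqrt_exp_dyadic:
  assumes c: "0 < (c::real)"
  shows "summable (\<lambda>n. sqrt (real n) * exp (- c) ^ dyadic \<gamma> n)"
proof (rule summable_comparison_test_ev)
  define a where "a = 1 / (2 * \<gamma>)"
  have a: "0 < a" using \<gamma> by (simp add: a_def)
  have "(\<lambda>n. sqrt (real n) * exp (- (c / 2) * real n powr a) * real n ^ 2) \<longlonglongrightarrow> 0"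
    using a c by real_asymp
  then have "\<forall>\<^sub>F n in sequentially. sqrt (real n) * exp (- (c / 2) * real n powr a) * real n ^ 2 < 1"
    by (rule order_tendstoD) simp
  then show "\<forall>\<^sub>F n in sequentially. norm (sqrt (real n) * exp (- c) ^ dyadic \<gamma> n) \<le> inverse (real n ^ 2)"
    using eventually_gt_at_top[of 0]
  proof eventually_elim
    case (elim n)
    have "exp (- c) ^ dyadic \<gamma> n = exp (- c * real (dyadic \<gamma> n))" by (simp add: exp_of_nat_mult[symmetric] mult.commute)
    also have "\<dots> \<le> exp (- (c / 2) * real n powr a)"
      using dyadic_bounds(2)[OF elim(2)] c mult_left_mono[of "real n powr a" "2 * real (dyadic \<gamma> n)" "c / 2"] by (simp add: a_def)
    finally have "sqrt (real n) * exp (- c) ^ dyadic \<gamma> n \<le> sqrt (real n) * exp (- (c / 2) * real n powr a)"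
      by (intro mult_left_mono) auto
    also have "\<dots> \<le> inverse (real n ^ 2)"
      using elim by (simp add: field_simps)
    finally show ?case by simp
  qed
  show "summable (\<lambda>n. inverse (real n ^ 2))" by (rule inverse_power_summable) simp
qed

end

lemma nn_integral_square_shift:
  assumes N: "sq_dist N"
  shows "(\<integral>\<^sup>+y. ennreal ((d + (y - (LINT x|N. x)))\<^sup>2) \<partial>N) = ennreal (d\<^sup>2 + var_of N)"
proof -
  interpret real_distribution N using N by (simp add: sq_dist_def)
  let ?m = "LINT x|N. x"
  note int = sq_dist_integrable(1)[OF N] sq_dist_integrable(2)[OF N, of ?m]
  have eq: "(d + (y - ?m))\<^sup>2 = d\<^sup>2 + 2 * d * (y - ?m) + (y - ?m)\<^sup>2" for y
    by (simp add: power2_eq_square algebra_simps)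
  have i1: "integrable N (\<lambda>y. d\<^sup>2 + 2 * d * (y - ?m))"
    by (intro Bochner_Integration.integrable_add integrable_mult_right Bochner_Integration.integrable_diff int(1) integrable_const)
  have 0: "(LINT y|N. y - ?m) = 0" using int(1) prob_space by simp
  have "(LINT y|N. (d + (y - ?m))\<^sup>2) = (LINT y|N. d\<^sup>2 + 2 * d * (y - ?m)) + (LINT y|N. (y - ?m)\<^sup>2)"
    unfolding eq by (rule Bochner_Integration.integral_add[OF i1 int(2)])
  also have "(LINT y|N. d\<^sup>2 + 2 * d * (y - ?m)) = d\<^sup>2 + 2 * d * (LINT y|N. y - ?m)"
    using int(1) prob_space by (subst Bochner_Integration.integral_add) auto
  finally have "(LINT y|N. (d + (y - ?m))\<^sup>2) = d\<^sup>2 + var_of N" unfolding 0 by (simp add: var_of_def)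
  moreover have "integrable N (\<lambda>y. (d + (y - ?m))\<^sup>2)"
    unfolding eq by (rule Bochner_Integration.integrable_add[OF i1 int(2)])
  ultimately show ?thesis by (subst nn_integral_eq_integral) auto
qed

text \<open>Variances of independent steps add up. The offset \<open>d\<close> is what the induction
  needs: the deviation of the first step becomes part of the offset for the others.\<close>

lemma nn_integral_square_conv_from:
  assumes sq: "\<And>j. sq_dist (\<nu> j)"
  shows "(\<integral>\<^sup>+y. ennreal ((d + (y - (\<Sum>i\<in>{j..<j + l}. LINT x|\<nu> i. x)))\<^sup>2) \<partial>conv_from \<nu> j l)
    = ennreal (d\<^sup>2 + (\<Sum>i\<in>{j..<j + l}. var_of (\<nu> i)))"
proof (induction l arbitrary: j d)
  case 0
  show ?case by (simp add: nn_integral_return)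
next
  case (Suc l)
  have rd: "real_distribution (\<nu> i)" for i using sq unfolding sq_dist_def by blast
  have fin: "finite_measure (\<nu> j)" "sets (\<nu> j) = sets borel"
    "finite_measure (conv_from \<nu> (Suc j) l)" "sets (conv_from \<nu> (Suc j) l) = sets borel"
    using rd[of j] real_distribution_conv_from[OF rd, where j="Suc j" and l=l]
    by (auto simp: real_distribution_def real_distribution_axioms_def prob_space_def)
  have set_eq: "{j..<j + Suc l} = insert j {Suc j..<Suc j + l}" by auto
  let ?m = "\<lambda>i. LINT x|\<nu> i. x"
  let ?V = "\<Sum>i\<in>{Suc j..<Suc j + l}. var_of (\<nu> i)" and ?S = "\<Sum>i\<in>{Suc j..<Suc j + l}. ?m i"
  have V: "0 \<le> ?V" by (intro sum_nonneg var_of_nonneg)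
  have "(\<integral>\<^sup>+y. ennreal ((d + (y - (?m j + ?S)))\<^sup>2) \<partial>conv_from \<nu> j (Suc l))
     = (\<integral>\<^sup>+x. \<integral>\<^sup>+y. ennreal ((d + (x + y - (?m j + ?S)))\<^sup>2) \<partial>conv_from \<nu> (Suc j) l \<partial>\<nu> j)"
    unfolding conv_from.simps by (rule nn_integral_convolution) (use fin in auto)
  also have "\<dots> = (\<integral>\<^sup>+x. \<integral>\<^sup>+y. ennreal (((d + (x - ?m j)) + (y - ?S))\<^sup>2) \<partial>conv_from \<nu> (Suc j) l \<partial>\<nu> j)"
    by (simp add: algebra_simps)
  also have "\<dots> = (\<integral>\<^sup>+x. ennreal ((d + (x - ?m j))\<^sup>2) + ennreal ?V \<partial>\<nu> j)"
    by (simp only: Suc.IH ennreal_plus[OF zero_le_power2 V])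
  also have "\<dots> = ennreal (d\<^sup>2 + var_of (\<nu> j)) + ennreal ?V"
    using prob_space.emeasure_space_1[of "\<nu> j"] rd[of j] fin
    by (subst nn_integral_add) (auto simp: nn_integral_square_shift[OF sq] real_distribution_def measurable_cong_sets[OF fin(2) refl])
  also have "\<dots> = ennreal (d\<^sup>2 + (var_of (\<nu> j) + ?V))"
    using V by (simp add: ennreal_plus[symmetric] var_of_nonneg add.assoc del: ennreal_plus)
  finally show ?case unfolding set_eq by simp
qed

section \<open>The quenched local limit theorem\<close>

lemma tail_sum_tendsto_0:
  fixes f :: "nat \<Rightarrow> real"
  assumes f: "summable f" "\<And>i. 0 \<le> f i" and k: "filterlim k at_top sequentially" "\<And>n. k n \<le> n"
  shows "(\<lambda>n. \<Sum>j\<in>{k n..<n}. f j) \<longlonglongrightarrow> 0"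
proof (rule Lim_null_comparison)
  have "(\<lambda>n. \<Sum>j<k n. f j) \<longlonglongrightarrow> suminf f"
    using filterlim_compose[OF summable_LIMSEQ[OF f(1)] k(1)] .
  then have "(\<lambda>n. suminf f - (\<Sum>j<k n. f j)) \<longlonglongrightarrow> suminf f - suminf f"
    by (intro tendsto_intros)
  then show "(\<lambda>n. suminf f - (\<Sum>j<k n. f j)) \<longlonglongrightarrow> 0" by simp
  show "\<forall>\<^sub>F n in sequentially. norm (\<Sum>j\<in>{k n..<n}. f j) \<le> suminf f - (\<Sum>j<k n. f j)"
  proof (intro always_eventually allI)
    fix n
    have "(\<Sum>j<n. f j) = (\<Sum>j<k n. f j) + (\<Sum>j\<in>{k n..<n}. f j)"
      using k(2)[of n] by (subst sum.union_disjoint[symmetric]) (auto intro!: sum.cong)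
    moreover have "(\<Sum>j<n. f j) \<le> suminf f" using f by (intro sum_le_suminf) auto
    ultimately show "norm (\<Sum>j\<in>{k n..<n}. f j) \<le> suminf f - (\<Sum>j<k n. f j)"
      using f(2) by (simp add: sum_nonneg)
  qed
qed

lemma sum_lessThan_split:
  fixes f :: "nat \<Rightarrow> real"
  assumes "k \<le> n" shows "(\<Sum>j<n. f j) = (\<Sum>j<k. f j) + (\<Sum>j\<in>{k..<n}. f j)"
  using assms by (subst sum.union_disjoint[symmetric]) (auto intro!: sum.cong)

locale quenched_llt = quenched_growth +
  fixes s2 \<gamma> :: real
  assumes \<gamma>: "1 / 2 < \<gamma>"
    and summable_over_powr: "summable (\<lambda>j. real (Suc j) powr \<gamma> * mean_over (exp (c * real j)) j)"
    and llt: "sq_dist_seq (\<lambda>j. \<nu>_of (p j)) (dyadic \<gamma>) s2"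
begin

sublocale L: sq_dist_seq "\<lambda>j. \<nu>_of (p j)" "dyadic \<gamma>" s2 by (rule llt)

definition center :: "nat \<Rightarrow> real" where "center n = (\<Sum>i<n. L.mean i)"

text \<open>Seen from a particle of generation \<open>j\<close> at \<open>s\<close>, this is the
  expected share of its descendants in generation \<open>n\<close> that lie in the interval. As
  \<open>j\<close> runs from the intermediate generation to \<open>n\<close>, it leads from the
  averaged to the actual count.\<close>

definition hit :: "real \<Rightarrow> real \<Rightarrow> nat \<Rightarrow> nat \<Rightarrow> real \<Rightarrow> real" where
  "hit a b n j s = measure (conv_from \<nu> j (n - j)) {a + center n - s<..<b + center n - s}"

lemma ennreal_hit:
  "ennreal (hit a b n j s) = (\<integral>\<^sup>+y. indicator {a + center n<..<b + center n} (s + y) \<partial>conv_from \<nu> j (n - j))"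
proof -
  interpret N: real_distribution "conv_from \<nu> j (n - j)" by (rule real_distribution_conv)
  have "(\<lambda>y. indicator {a + center n<..<b + center n} (s + y) :: ennreal) = indicator {a + center n - s<..<b + center n - s}"
    by (auto simp: fun_eq_iff indicator_def)
  then show ?thesis by (simp add: hit_def N.emeasure_eq_measure)
qed

lemma hit_bounds: "0 \<le> hit a b n j s" "hit a b n j s \<le> 1"
proof -
  interpret N: real_distribution "conv_from \<nu> j (n - j)" by (rule real_distribution_conv)
  show "0 \<le> hit a b n j s" "hit a b n j s \<le> 1" by (auto simp: hit_def)
qed

lemma conv_finite: "finite_measure (conv_from \<nu> j l)" "sets (conv_from \<nu> j l) = sets borel"
  using real_distribution_conv[of j l] by (auto simp: real_distribution_def real_distribution_axioms_def prob_space_def)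

lemma measurable_hit [measurable]: "hit a b n j \<in> borel_measurable borel"
proof -
  have "(\<lambda>s. \<integral>\<^sup>+y. indicator {a + center n<..<b + center n} (s + y) \<partial>conv_from \<nu> j (n - j)) \<in> borel_measurable borel"
    by (rule borel_measurable_nn_integral_shift[OF conv_finite]) simp
  then have "(\<lambda>s. enn2real (ennreal (hit a b n j s))) \<in> borel_measurable borel"
    unfolding ennreal_hit by (rule borel_measurable_enn2real)
  then show ?thesis by (simp add: hit_bounds)
qed

text \<open>First-step decomposition of the walk. It is the hypothesis of
  \<open>F_increment\<close>: for fixed \<open>n\<close>, the quantities
  \<open>F (hit a b n j) j\<close> form a martingale in \<open>j\<close>.\<close>

lemma hit_step:
  assumes "j < n"
  shows "hit a b n j s = (LINT z|p j. (\<Sum>i<fst z. hit a b n (Suc j) (s + snd z i)) / m j)"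
proof -
  let ?I = "indicator {a + center n<..<b + center n} :: real \<Rightarrow> ennreal"
  have nj: "n - j = Suc (n - Suc j)" using assms by simp
  have fin: "finite_measure (\<nu> j)" using prob_\<nu>[of j] by (simp add: prob_space_def)
  have "ennreal (hit a b n j s) = (\<integral>\<^sup>+x. \<integral>\<^sup>+y. ?I (s + (x + y)) \<partial>conv_from \<nu> (Suc j) (n - Suc j) \<partial>\<nu> j)"
    unfolding ennreal_hit nj conv_from.simps by (rule nn_integral_convolution[OF fin conv_finite(1)]) (simp_all add: conv_finite)
  also have "\<dots> = (\<integral>\<^sup>+x. ennreal (hit a b n (Suc j) (s + x)) \<partial>\<nu> j)"
    unfolding ennreal_hit by (simp add: add.assoc)
  also have "\<dots> = (\<integral>\<^sup>+z. (\<Sum>i<fst z. ennreal (hit a b n (Suc j) (s + snd z i))) \<partial>p j) / ennreal (m j)"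
    unfolding mean_eq[symmetric] by (rule nn_integral_\<nu>_of) auto
  also have "\<dots> = (\<integral>\<^sup>+z. ennreal (\<Sum>i<fst z. hit a b n (Suc j) (s + snd z i)) / ennreal (m j) \<partial>p j)"
    using borel_measurable_offspring_sum[OF measurable_hit, of a b n "Suc j" s j]
    by (simp add: sum_ennreal hit_bounds nn_integral_divide)
  also have "\<dots> = (\<integral>\<^sup>+z. ennreal ((\<Sum>i<fst z. hit a b n (Suc j) (s + snd z i)) / m j) \<partial>p j)"
    using m_pos[of j] by (simp add: divide_ennreal sum_nonneg hit_bounds)
  finally have "hit a b n j s = enn2real \<dots>"
    using hit_bounds[of a b n j s] by (metis enn2real_ennreal)
  also have "\<dots> = (LINT z|p j. (\<Sum>i<fst z. hit a b n (Suc j) (s + snd z i)) / m j)"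
    using borel_measurable_offspring_sum[OF measurable_hit, of a b n "Suc j" s j] m_pos[of j]
    by (intro integral_eq_nn_integral[symmetric]) (auto intro!: divide_nonneg_pos sum_nonneg hit_bounds)
  finally show ?thesis .
qed

lemma F_hit_n: "F (hit a b n n) n t = real (card {u \<in> particles t n. position t u \<in> {a + center n<..<b + center n}}) / P n"
proof -
  have "hit a b n n s = indicator {a + center n<..<b + center n} s" for s
    by (simp add: hit_def measure_return indicator_def)
  then have "F (hit a b n n) n t = (\<Sum>u\<in>particles t n. indicator {a + center n<..<b + center n} (position t u)) / P n"
    by (simp add: F_def)
  also have "(\<Sum>u\<in>particles t n. indicator {a + center n<..<b + center n} (position t u) :: real) = real (card {u \<in> particles t n. position t u \<in> {a + center n<..<b + center n}})"
    by (simp add: indicator_def of_bool_def sum.If_cases finite_particles Int_def)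
  finally show ?thesis .
qed

abbreviation rest_term :: "nat \<Rightarrow> (nat list \<Rightarrow> offspring) \<Rightarrow> real" where
  "rest_term j t \<equiv> over (exp (c * real j)) j t + W j t * mean_over (exp (c * real j)) j"

lemma rest_term_nonneg: "0 \<le> rest_term j t"
  by (simp add: over_nonneg W_nonneg mean_over_nonneg)

lemma F_hit_difference:
  "\<bar>F (hit a b n n) n t - F (hit a b n (dyadic \<gamma> n)) (dyadic \<gamma> n) t\<bar>
    \<le> (\<Sum>j\<in>{dyadic \<gamma> n..<n}. fluct (hit a b n (Suc j)) (exp (c * real j)) j t) + (\<Sum>j\<in>{dyadic \<gamma> n..<n}. rest_term j t)"
proof -
  have 1: "F (hit a b n n) n t - F (hit a b n (dyadic \<gamma> n)) (dyadic \<gamma> n) t = (\<Sum>j\<in>{dyadic \<gamma> n..<n}. F (hit a b n (Suc j)) (Suc j) t - F (hit a b n j) j t)"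
    by (rule sum_Suc_diff'[OF L.k_le, symmetric])
  have 2: "\<bar>\<Sum>j\<in>{dyadic \<gamma> n..<n}. F (hit a b n (Suc j)) (Suc j) t - F (hit a b n j) j t\<bar>
    \<le> (\<Sum>j\<in>{dyadic \<gamma> n..<n}. fluct (hit a b n (Suc j)) (exp (c * real j)) j t + rest_term j t)"
  proof (rule order_trans[OF sum_abs], rule sum_mono)
    fix j assume "j \<in> {dyadic \<gamma> n..<n}"
    then have "j < n" by simp
    show "\<bar>F (hit a b n (Suc j)) (Suc j) t - F (hit a b n j) j t\<bar> \<le> fluct (hit a b n (Suc j)) (exp (c * real j)) j t + rest_term j t"
      by (rule F_increment[OF measurable_hit hit_bounds hit_step[OF \<open>j < n\<close>]])
  qed
  show ?thesis
    using 2 unfolding 1 sum.distrib .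
qed

text \<open>The fluctuations depend on \<open>n\<close> through the test function, so their means
  are summed over \<open>n\<close> too. The geometric bound makes the inner sum at most
  \<open>A\<close> times its first term, at generation \<open>dyadic \<gamma> n\<close>, and this
  beats \<open>sqrt (real n)\<close>.\<close>

lemma fluct_sums_vanish:
  "AE t in Q. (\<lambda>n. sqrt (real n) * (\<Sum>j\<in>{dyadic \<gamma> n..<n}. fluct (hit a b n (Suc j)) (exp (c * real j)) j t)) \<longlonglongrightarrow> 0"
proof -
  interpret Q: prob_space Q by (rule prob_Q)
  let ?f = "\<lambda>n t. sqrt (real n) * (\<Sum>j\<in>{dyadic \<gamma> n..<n}. fluct (hit a b n (Suc j)) (exp (c * real j)) j t)"
  define A where "A = 1 / sqrt C * (1 / (1 - exp (- c)))"
  have e1: "exp (- c) < 1" using c_pos by simp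
  have A: "0 \<le> A" using C_pos e1 by (simp add: A_def)
  have geo: "(\<Sum>j\<in>{k..<n}. (1 / sqrt C) * exp (- c) ^ j) \<le> A * exp (- c) ^ k" if "k \<le> n" for k n
  proof -
    have "(\<Sum>j\<in>{k..<n}. exp (- c) ^ j) = (\<Sum>j<n - k. exp (- c) ^ (k + j))"
      using that by (subst sum.atLeastLessThan_shift_0) (simp add: atLeast0LessThan add.commute)
    also have "\<dots> = exp (- c) ^ k * (\<Sum>j<n - k. exp (- c) ^ j)" by (simp add: power_add sum_distrib_left)
    also have "\<dots> \<le> exp (- c) ^ k * (\<Sum>j. exp (- c) ^ j)"
      using e1 by (intro mult_left_mono sum_le_suminf summable_geometric) auto
    also have "(\<Sum>j. exp (- c) ^ j) = 1 / (1 - exp (- c))" using e1 by (intro suminf_geometric) simp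
    finally have "(1 / sqrt C) * (\<Sum>j\<in>{k..<n}. exp (- c) ^ j) \<le> (1 / sqrt C) * (exp (- c) ^ k * (1 / (1 - exp (- c))))"
      using C_pos by (intro mult_left_mono) auto
    then show ?thesis by (simp add: A_def sum_distrib_left mult_ac)
  qed
  have "AE t in Q. summable (\<lambda>n. ?f n t)"
  proof (rule Q.AE_summable[where c="\<lambda>n. A * (sqrt (real n) * exp (- c) ^ dyadic \<gamma> n)"])
    fix n
    have "(\<integral>\<^sup>+t. ennreal (?f n t) \<partial>Q) = (\<integral>\<^sup>+t. ennreal (sqrt (real n)) * (\<Sum>j\<in>{dyadic \<gamma> n..<n}. ennreal (fluct (hit a b n (Suc j)) (exp (c * real j)) j t)) \<partial>Q)"
      by (simp add: ennreal_mult sum_ennreal fluct_nonneg sum_nonneg)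
    also have "\<dots> = ennreal (sqrt (real n)) * (\<Sum>j\<in>{dyadic \<gamma> n..<n}. \<integral>\<^sup>+t. ennreal (fluct (hit a b n (Suc j)) (exp (c * real j)) j t) \<partial>Q)"
      using measurable_fluct[OF measurable_hit hit_bounds] by (simp add: nn_integral_cmult nn_integral_sum)
    also have "\<dots> \<le> ennreal (sqrt (real n)) * (\<Sum>j\<in>{dyadic \<gamma> n..<n}. ennreal ((1 / sqrt C) * exp (- c) ^ j))"
      by (intro mult_left_mono sum_mono order_trans[OF nn_integral_fluct_simple[OF measurable_hit hit_bounds] ennreal_leI[OF fluct_bound]]) simp_all
    also have "\<dots> = ennreal (sqrt (real n) * (\<Sum>j\<in>{dyadic \<gamma> n..<n}. (1 / sqrt C) * exp (- c) ^ j))"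
      using C_pos by (subst sum_ennreal) (auto simp: ennreal_mult sum_nonneg)
    also have "\<dots> \<le> ennreal (sqrt (real n) * (A * exp (- c) ^ dyadic \<gamma> n))"
      by (intro ennreal_leI mult_left_mono geo L.k_le) auto
    finally show "(\<integral>\<^sup>+t. ennreal (?f n t) \<partial>Q) \<le> ennreal (A * (sqrt (real n) * exp (- c) ^ dyadic \<gamma> n))"
      by (simp add: mult_ac)
    show "?f n \<in> borel_measurable Q"
      using measurable_fluct[OF measurable_hit hit_bounds] by measurable
  qed (use A fluct_nonneg summable_sqrt_exp_dyadic[OF \<gamma> c_pos] in \<open>auto intro!: summable_mult sum_nonneg mult_nonneg_nonneg\<close>)
  then show ?thesis
    by eventually_elim (rule summable_LIMSEQ_zero)
qed

text \<open>The remainder of generation \<open>j\<close> is the same for all \<open>n\<close>. With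
  the weight \<open>real (Suc j) powr \<gamma>\<close>, which dominates \<open>sqrt (real n)\<close>
  up to a constant, the sums are tails of one convergent series.\<close>

lemma rest_sums_vanish: "AE t in Q. (\<lambda>n. sqrt (real n) * (\<Sum>j\<in>{dyadic \<gamma> n..<n}. rest_term j t)) \<longlonglongrightarrow> 0"
proof -
  interpret Q: prob_space Q by (rule prob_Q)
  have "AE t in Q. summable (\<lambda>j. real (Suc j) powr \<gamma> * rest_term j t)"
  proof (rule Q.AE_summable[where c="\<lambda>j. 2 * (real (Suc j) powr \<gamma> * mean_over (exp (c * real j)) j)"])
    fix j
    have "(\<integral>\<^sup>+t. ennreal (real (Suc j) powr \<gamma> * rest_term j t) \<partial>Q) = (\<integral>\<^sup>+t. ennreal (real (Suc j) powr \<gamma>) * ennreal (rest_term j t) \<partial>Q)"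
      by (simp only: ennreal_mult[OF powr_ge_zero rest_term_nonneg])
    also have "\<dots> = ennreal (real (Suc j) powr \<gamma>) * (\<integral>\<^sup>+t. ennreal (rest_term j t) \<partial>Q)"
      by (rule nn_integral_cmult) measurable
    also have "\<dots> = ennreal (real (Suc j) powr \<gamma>) * ennreal (2 * mean_over (exp (c * real j)) j)"
      by (simp only: nn_integral_over_simple)
    also have "\<dots> = ennreal (real (Suc j) powr \<gamma> * (2 * mean_over (exp (c * real j)) j))"
      by (subst ennreal_mult) (auto simp: mean_over_nonneg)
    finally show "(\<integral>\<^sup>+t. ennreal (real (Suc j) powr \<gamma> * rest_term j t) \<partial>Q) \<le> ennreal (2 * (real (Suc j) powr \<gamma> * mean_over (exp (c * real j)) j))"
      by (simp add: mult_ac)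
  qed (use rest_term_nonneg summable_over_powr in \<open>auto simp: mean_over_nonneg intro!: summable_mult mult_nonneg_nonneg\<close>)
  then show ?thesis
  proof eventually_elim
    case (elim t)
    let ?h = "\<lambda>j. real (Suc j) powr \<gamma> * rest_term j t"
    have "(\<lambda>n. \<Sum>j\<in>{dyadic \<gamma> n..<n}. ?h j) \<longlonglongrightarrow> 0"
      by (rule tail_sum_tendsto_0[OF elim _ filterlim_dyadic[OF \<gamma>] L.k_le]) (intro mult_nonneg_nonneg rest_term_nonneg powr_ge_zero)
    then have lim: "(\<lambda>n. 2 powr \<gamma> * (\<Sum>j\<in>{dyadic \<gamma> n..<n}. ?h j)) \<longlonglongrightarrow> 0"
      by (rule tendsto_mult_right_zero)
    have "sqrt (real n) * (\<Sum>j\<in>{dyadic \<gamma> n..<n}. rest_term j t) \<le> 2 powr \<gamma> * (\<Sum>j\<in>{dyadic \<gamma> n..<n}. ?h j)" for n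
      unfolding sum_distrib_left
    proof (rule sum_mono)
      fix j assume j: "j \<in> {dyadic \<gamma> n..<n}"
      have "sqrt (real n) \<le> (2 * real (dyadic \<gamma> n)) powr \<gamma>" by (rule sqrt_le_dyadic[OF \<gamma>])
      also have "\<dots> \<le> (2 * real (Suc j)) powr \<gamma>" using j \<gamma> by (intro powr_mono2) auto
      also have "\<dots> = 2 powr \<gamma> * real (Suc j) powr \<gamma>" by (simp add: powr_mult del: of_nat_Suc)
      finally show "sqrt (real n) * rest_term j t \<le> 2 powr \<gamma> * ?h j"
        unfolding mult.assoc[symmetric] by (rule mult_right_mono[OF _ rest_term_nonneg])
    qed
    then show ?case
      by (intro Lim_null_comparison[OF always_eventually lim])
         (auto simp: abs_mult abs_of_nonneg sum_nonneg rest_term_nonneg)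
  qed
qed

lemma F_hit_difference_vanishes:
  "AE t in Q. (\<lambda>n. sqrt (real n) * (F (hit a b n n) n t - F (hit a b n (dyadic \<gamma> n)) (dyadic \<gamma> n) t)) \<longlonglongrightarrow> 0"
  using fluct_sums_vanish[of a b] rest_sums_vanish
proof eventually_elim
  case (elim t)
  have "(\<lambda>n. sqrt (real n) * (\<Sum>j\<in>{dyadic \<gamma> n..<n}. fluct (hit a b n (Suc j)) (exp (c * real j)) j t) + sqrt (real n) * (\<Sum>j\<in>{dyadic \<gamma> n..<n}. rest_term j t)) \<longlonglongrightarrow> 0"
    using tendsto_add[OF elim] by simp
  then show ?case
  proof (rule Lim_null_comparison[rotated])
    show "\<forall>\<^sub>F n in sequentially. norm (sqrt (real n) * (F (hit a b n n) n t - F (hit a b n (dyadic \<gamma> n)) (dyadic \<gamma> n) t))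
      \<le> sqrt (real n) * (\<Sum>j\<in>{dyadic \<gamma> n..<n}. fluct (hit a b n (Suc j)) (exp (c * real j)) j t) + sqrt (real n) * (\<Sum>j\<in>{dyadic \<gamma> n..<n}. rest_term j t)"
    proof (intro always_eventually allI)
      fix n
      show "norm (sqrt (real n) * (F (hit a b n n) n t - F (hit a b n (dyadic \<gamma> n)) (dyadic \<gamma> n) t))
      \<le> sqrt (real n) * (\<Sum>j\<in>{dyadic \<gamma> n..<n}. fluct (hit a b n (Suc j)) (exp (c * real j)) j t) + sqrt (real n) * (\<Sum>j\<in>{dyadic \<gamma> n..<n}. rest_term j t)"
        using mult_left_mono[OF F_hit_difference[of a b n t], of "sqrt (real n)"] by (simp add: abs_mult distrib_left)
    qed
  qed
qed

section \<open>Mean square displacement in the intermediate generation, and the limit of the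
  averaged count\<close>

definition spread :: "nat \<Rightarrow> (nat list \<Rightarrow> offspring) \<Rightarrow> real" where
  "spread k = F (\<lambda>s. (s - center k)\<^sup>2) k"

lemma spread_nonneg: "0 \<le> spread k t"
  unfolding spread_def F_def using P_pos[of k] by (intro divide_nonneg_pos sum_nonneg) auto

lemma nn_integral_spread: "(\<integral>\<^sup>+t. ennreal (spread k t) \<partial>Q) = ennreal (\<Sum>i<k. var_of (\<nu> i))"
proof -
  interpret Q: prob_space Q by (rule prob_Q)
  let ?f = "\<lambda>s. ennreal ((s - center k)\<^sup>2)"
  have "ennreal (spread k t) = (\<Sum>u\<in>particles t k. ?f (position t u)) * ennreal (1 / P k)" for t
    using P_pos[of k] by (simp add: spread_def F_def sum_ennreal sum_nonneg ennreal_mult[symmetric])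
  then have "(\<integral>\<^sup>+t. ennreal (spread k t) \<partial>Q) = (\<integral>\<^sup>+t. (\<Sum>u\<in>particles t k. ?f (position t u)) \<partial>Q) * ennreal (1 / P k)"
    by (simp add: nn_integral_multc)
  also have "(\<integral>\<^sup>+t. (\<Sum>u\<in>particles t k. ?f (position t u)) \<partial>Q) = ennreal (P k) * (\<integral>\<^sup>+y. ?f y \<partial>conv_from \<nu> 0 k)"
    using many_to_one[where G="\<lambda>_. 1" and j=0 and f="?f" and l=k] by (simp add: depends_below_const P_def position_Nil Q.emeasure_space_1[simplified])
  also have "(\<integral>\<^sup>+y. ?f y \<partial>conv_from \<nu> 0 k) = ennreal (\<Sum>i<k. var_of (\<nu> i))"
    using nn_integral_square_conv_from[of "\<lambda>j. \<nu>_of (p j)", OF L.sq, where d=0 and j=0 and l=k]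
    by (simp add: center_def L.mean_def atLeast0LessThan)
  also have "ennreal (P k) * ennreal (\<Sum>i<k. var_of (\<nu> i)) * ennreal (1 / P k) = ennreal (\<Sum>i<k. var_of (\<nu> i))"
    using P_pos[of k] by (simp add: ennreal_mult[symmetric] sum_nonneg var_of_nonneg)
  finally show ?thesis .
qed

lemma spread_vanishes: "AE t in Q. (\<lambda>n. spread (dyadic \<gamma> n) t / real n) \<longlonglongrightarrow> 0"
proof -
  interpret Q: prob_space Q by (rule prob_Q)
  obtain B where B: "\<And>n. (\<Sum>j<n. var_of (\<nu> j)) / real n \<le> B"
    using convergent_imp_Bseq[OF convergentI[OF L.var_avg]] unfolding Bseq_def
    by (metis abs_le_D1 real_norm_def)
  have S: "(\<Sum>j<n. var_of (\<nu> j)) \<le> B * real n" for n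
    using B[of n] by (cases "n = 0") (auto simp: divide_le_eq)
  have B0: "0 \<le> B" using B[of 0] by simp
  \<comment> \<open>By \<open>dyadic_powr_le\<close>, \<open>D i\<close> is at most \<open>n\<close>
    for every positive \<open>n\<close> with dyadic exponent \<open>i\<close>. The mean of
    \<open>spread (2 ^ i)\<close> is at most \<open>B * 2 ^ i\<close>, and
    \<open>2 ^ i / D i\<close> is a convergent geometric sequence of terms because
    \<open>\<gamma>\<close> exceeds 1/2.\<close>
  define D where "D i = ((2::real) ^ i) powr (2 * \<gamma>)" for i
  have D: "0 < D i" for i by (simp add: D_def)
  have DB: "(2::real) ^ i / D i = (2 powr (1 - 2 * \<gamma>)) ^ i" for i
  proof -
    have "(2::real) ^ i / D i = (2 powr real i) powr 1 / (2 powr real i) powr (2 * \<gamma>)" by (simp add: D_def powr_realpow)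
    also have "\<dots> = (2 powr real i) powr (1 - 2 * \<gamma>)" by (rule powr_diff[symmetric])
    also have "\<dots> = (2 powr (1 - 2 * \<gamma>)) powr real i" by (simp add: powr_powr mult.commute)
    also have "\<dots> = (2 powr (1 - 2 * \<gamma>)) ^ i" by (simp add: powr_realpow)
    finally show ?thesis .
  qed
  have [measurable]: "spread k \<in> borel_measurable Q" for k
    unfolding spread_def F_def by measurable
  have "AE t in Q. summable (\<lambda>i. spread (2 ^ i) t * (1 / D i))"
  proof (rule Q.AE_summable[where c="\<lambda>i. B * (2 powr (1 - 2 * \<gamma>)) ^ i"])
    fix i
    have "(\<integral>\<^sup>+t. ennreal (spread (2 ^ i) t * (1 / D i)) \<partial>Q) = (\<integral>\<^sup>+t. ennreal (spread (2 ^ i) t) * ennreal (1 / D i) \<partial>Q)"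
      using D[of i] by (intro nn_integral_cong ennreal_mult) (auto simp: spread_nonneg)
    also have "\<dots> = (\<integral>\<^sup>+t. ennreal (spread (2 ^ i) t) \<partial>Q) * ennreal (1 / D i)"
      by (rule nn_integral_multc) measurable
    also have "\<dots> = ennreal ((\<Sum>j<2 ^ i. var_of (\<nu> j)) * (1 / D i))"
      unfolding nn_integral_spread using D[of i] by (intro ennreal_mult[symmetric] sum_nonneg var_of_nonneg) auto
    also have "\<dots> \<le> ennreal (B * (2 powr (1 - 2 * \<gamma>)) ^ i)"
    proof (rule ennreal_leI)
      have "(\<Sum>j<2 ^ i. var_of (\<nu> j)) * (1 / D i) \<le> B * real (2 ^ i) * (1 / D i)"
        using D[of i] by (intro mult_right_mono S) auto
      also have "\<dots> = B * (2 ^ i / D i)" by simp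
      also have "\<dots> = B * (2 powr (1 - 2 * \<gamma>)) ^ i" unfolding DB ..
      finally show "(\<Sum>j<2 ^ i. var_of (\<nu> j)) * (1 / D i) \<le> B * (2 powr (1 - 2 * \<gamma>)) ^ i" .
    qed
    finally show "(\<integral>\<^sup>+t. ennreal (spread (2 ^ i) t * (1 / D i)) \<partial>Q) \<le> ennreal (B * (2 powr (1 - 2 * \<gamma>)) ^ i)" .
    show "0 \<le> B * (2 powr (1 - 2 * \<gamma>)) ^ i" using B0 by simp
  next
    have "(2::real) powr (1 - 2 * \<gamma>) < 2 powr 0" using \<gamma> by (intro powr_less_mono) auto
    then show "summable (\<lambda>i. B * (2 powr (1 - 2 * \<gamma>)) ^ i)"
      by (intro summable_mult summable_geometric) simp
  qed (use spread_nonneg D in \<open>auto simp: less_imp_le\<close>)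
  then show ?thesis
  proof eventually_elim
    case (elim t)
    have "(\<lambda>n. spread (2 ^ dyadic_exponent \<gamma> n) t * (1 / D (dyadic_exponent \<gamma> n))) \<longlonglongrightarrow> 0"
      using filterlim_compose[OF summable_LIMSEQ_zero[OF elim] filterlim_dyadic_exponent[OF \<gamma>]] .
    then show ?case
    proof (rule Lim_null_comparison[rotated])
      show "\<forall>\<^sub>F n in sequentially. norm (spread (dyadic \<gamma> n) t / real n) \<le> spread (2 ^ dyadic_exponent \<gamma> n) t * (1 / D (dyadic_exponent \<gamma> n))"
        using eventually_gt_at_top[of 0]
      proof eventually_elim
        case (elim n)
        have "spread (2 ^ dyadic_exponent \<gamma> n) t / real n \<le> spread (2 ^ dyadic_exponent \<gamma> n) t / D (dyadic_exponent \<gamma> n)"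
          using dyadic_powr_le[OF \<gamma> elim] D[of "dyadic_exponent \<gamma> n"] elim by (intro divide_left_mono spread_nonneg mult_pos_pos) (auto simp: D_def)
        then show ?case using elim by (simp add: dyadic_def spread_nonneg)
      qed
    qed
  qed
qed

text \<open>Particles near the centre are treated by the local limit theorem, uniformly over their
  positions. For the others the scaled probability is only bounded, but Chebyshev's inequality with
  \<open>spread\<close> shows that their normalized number vanishes.\<close>

lemma sqrt_F_hit_limit:
  assumes ab: "a < b" and v: "(\<lambda>n. spread (dyadic \<gamma> n) t / real n) \<longlonglongrightarrow> 0" and w: "(\<lambda>n. W n t) \<longlonglongrightarrow> w"
  shows "(\<lambda>n. sqrt (real n) * F (hit a b n (dyadic \<gamma> n)) (dyadic \<gamma> n) t) \<longlonglongrightarrow> (b - a) / (sqrt s2 * sqrt (2 * pi)) * w"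
proof -
  let ?L = "(b - a) / (sqrt s2 * sqrt (2 * pi))"
  let ?k = "dyadic \<gamma>"
  have L: "0 \<le> ?L" using ab L.s2_pos by simp
  \<comment> \<open>The added \<open>1 / real (Suc n)\<close> makes \<open>v'\<close> strictly
    positive without changing the limit.\<close>
  define v' where "v' n = spread (?k n) t / real n + 1 / real (Suc n)" for n
  have v'0: "0 < v' n" for n unfolding v'_def by (intro add_nonneg_pos divide_nonneg_nonneg spread_nonneg) auto
  have v'lim: "v' \<longlonglongrightarrow> 0" unfolding v'_def using tendsto_add[OF v LIMSEQ_Suc[OF lim_1_over_n]] by simp
  \<comment> \<open>The fourth root balances two demands: the window
    \<open>\<eta> n * sqrt (real n)\<close> stays negligible against \<open>sqrt (real n)\<close>,
    while Chebyshev's inequality leaves \<open>v' n / (\<eta> n)\<^sup>2 = sqrt (v' n)\<close>,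
    which still tends to 0.\<close>
  define \<eta> where "\<eta> n = sqrt (sqrt (v' n))" for n
  have \<eta>0: "0 < \<eta> n" for n using v'0 by (simp add: \<eta>_def)
  have \<eta>lim: "\<eta> \<longlonglongrightarrow> 0" unfolding \<eta>_def using tendsto_real_sqrt[OF tendsto_real_sqrt[OF v'lim]] by simp
  obtain Cb where Cb: "\<forall>\<^sub>F n in sequentially. \<forall>x. sqrt (real n) * measure (L.Y n) {a + x<..<b + x} \<le> Cb"
    using L.conv_local_limit_bounded by blast
  have hit_Y: "hit a b n (?k n) s = measure (L.Y n) {a + (center (?k n) - s)<..<b + (center (?k n) - s)}" for n s
  proof -
    have "center n = center (?k n) + (\<Sum>j\<in>{?k n..<n}. L.mean j)"
      unfolding center_def by (rule sum_lessThan_split[OF L.k_le])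
    then have "a + center n - s = a + (center (?k n) - s) + (\<Sum>j\<in>{?k n..<n}. L.mean j)"
      "b + center n - s = b + (center (?k n) - s) + (\<Sum>j\<in>{?k n..<n}. L.mean j)" by simp_all
    then show ?thesis unfolding hit_def L.measure_Y by (simp only:)
  qed
  have far: "(\<Sum>u\<in>particles t (?k n). of_bool (\<eta> n * sqrt (real n) < \<bar>center (?k n) - position t u\<bar>)) / P (?k n) \<le> sqrt (v' n)" (is "?far n \<le> _")
    if n: "0 < n" for n
  proof -
    have "?far n * (sqrt (v' n) * real n) = (\<Sum>u\<in>particles t (?k n). of_bool (\<eta> n * sqrt (real n) < \<bar>center (?k n) - position t u\<bar>) * (\<eta> n * sqrt (real n))\<^sup>2) / P (?k n)"
      using v'0[of n] by (simp add: sum_distrib_right power_mult_distrib \<eta>_def)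
    also have "\<dots> \<le> (\<Sum>u\<in>particles t (?k n). (position t u - center (?k n))\<^sup>2) / P (?k n)"
    proof (intro divide_right_mono sum_mono)
      fix u
      show "of_bool (\<eta> n * sqrt (real n) < \<bar>center (?k n) - position t u\<bar>) * (\<eta> n * sqrt (real n))\<^sup>2 \<le> (position t u - center (?k n))\<^sup>2"
      proof (cases "\<eta> n * sqrt (real n) < \<bar>center (?k n) - position t u\<bar>")
        case True
        then have "(\<eta> n * sqrt (real n))\<^sup>2 \<le> \<bar>center (?k n) - position t u\<bar>\<^sup>2"
          using \<eta>0[of n] by (intro power_mono) auto
        then show ?thesis using True by (simp add: power2_commute)
      qed simp
    qed (use P_pos[of "?k n"] in simp)
    also have "\<dots> = spread (?k n) t" by (simp add: spread_def F_def)
    also have "\<dots> \<le> v' n * real n" using n by (simp add: v'_def distrib_right)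
    also have "\<dots> = sqrt (v' n) * (sqrt (v' n) * real n)" using v'0[of n] by simp
    finally show ?thesis by (rule mult_right_le_imp_le) (use v'0[of n] n in simp)
  qed
  have Wk: "(\<lambda>n. W (?k n) t) \<longlonglongrightarrow> w"
    using filterlim_compose[OF w filterlim_dyadic[OF \<gamma>]] .
  have "(\<lambda>n. sqrt (real n) * F (hit a b n (?k n)) (?k n) t - ?L * W (?k n) t) \<longlonglongrightarrow> 0"
  proof (rule tendstoI)
    fix d :: real assume d: "0 < d"
    define e where "e = d / 2 / (\<bar>w\<bar> + 1)"
    have e: "0 < e" using d by (simp add: e_def)
    have "(\<lambda>n. (\<bar>Cb\<bar> + ?L) * sqrt (v' n)) \<longlonglongrightarrow> (\<bar>Cb\<bar> + ?L) * sqrt 0"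
      by (intro tendsto_intros v'lim)
    then have ev1: "\<forall>\<^sub>F n in sequentially. (\<bar>Cb\<bar> + ?L) * sqrt (v' n) < d / 2"
      using d by (intro order_tendstoD(2)) auto
    have ev2: "\<forall>\<^sub>F n in sequentially. W (?k n) t < \<bar>w\<bar> + 1"
      using order_tendstoD(2)[OF Wk, of "\<bar>w\<bar> + 1"] by simp
    have ev3: "\<forall>\<^sub>F n in sequentially. \<forall>x. \<bar>x\<bar> \<le> \<eta> n * sqrt (real n) \<longrightarrow>
       \<bar>sqrt (real n) * measure (L.Y n) {a + x<..<b + x} - ?L\<bar> < e"
      by (rule L.conv_local_limit[OF \<eta>lim ab e])
    show "\<forall>\<^sub>F n in sequentially. dist (sqrt (real n) * F (hit a b n (?k n)) (?k n) t - ?L * W (?k n) t) 0 < d"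
      using ev1 ev2 ev3 Cb eventually_gt_at_top[of 0]
    proof eventually_elim
      case (elim n)
      let ?x = "\<lambda>u. center (?k n) - position t u"
      have 1: "sqrt (real n) * F (hit a b n (?k n)) (?k n) t - ?L * W (?k n) t
        = (\<Sum>u\<in>particles t (?k n). sqrt (real n) * measure (L.Y n) {a + ?x u<..<b + ?x u} - ?L) / P (?k n)"
        by (simp add: F_def W_def hit_Y sum_subtractf diff_divide_distrib sum_distrib_left mult.commute)
      have 2: "\<bar>(\<Sum>u\<in>particles t (?k n). sqrt (real n) * measure (L.Y n) {a + ?x u<..<b + ?x u} - ?L) / P (?k n)\<bar> \<le> (\<Sum>u\<in>particles t (?k n). e + (\<bar>Cb\<bar> + ?L) * of_bool (\<eta> n * sqrt (real n) < \<bar>?x u\<bar>)) / P (?k n)"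
        unfolding abs_divide abs_of_pos[OF P_pos]
      proof (intro divide_right_mono order_trans[OF sum_abs] sum_mono)
        fix u
        show "\<bar>sqrt (real n) * measure (L.Y n) {a + ?x u<..<b + ?x u} - ?L\<bar> \<le> e + (\<bar>Cb\<bar> + ?L) * of_bool (\<eta> n * sqrt (real n) < \<bar>?x u\<bar>)"
        proof (cases "\<eta> n * sqrt (real n) < \<bar>?x u\<bar>")
          case True
          have "0 \<le> sqrt (real n) * measure (L.Y n) {a + ?x u<..<b + ?x u}" by simp
          moreover have "sqrt (real n) * measure (L.Y n) {a + ?x u<..<b + ?x u} \<le> Cb" using elim by blast
          ultimately have "\<bar>sqrt (real n) * measure (L.Y n) {a + ?x u<..<b + ?x u} - ?L\<bar> \<le> \<bar>Cb\<bar> + ?L" using L by linarith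
          then show ?thesis using True e by simp
        next
          case False
          then have "\<bar>?x u\<bar> \<le> \<eta> n * sqrt (real n)" by simp
          then have "\<bar>sqrt (real n) * measure (L.Y n) {a + ?x u<..<b + ?x u} - ?L\<bar> < e" using elim(3) by blast
          then show ?thesis using False by simp
        qed
      qed (use P_pos[of "?k n"] in simp)
      have "(\<Sum>u\<in>particles t (?k n). e + (\<bar>Cb\<bar> + ?L) * of_bool (\<eta> n * sqrt (real n) < \<bar>?x u\<bar>)) / P (?k n) = e * W (?k n) t + (\<bar>Cb\<bar> + ?L) * ?far n"
        by (simp add: sum.distrib add_divide_distrib W_def sum_distrib_left mult.commute)
      also have "\<dots> \<le> e * (\<bar>w\<bar> + 1) + (\<bar>Cb\<bar> + ?L) * sqrt (v' n)"
        using elim e L far[of n] by (intro add_mono mult_left_mono) auto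
      also have "\<dots> < d / 2 + d / 2"
      proof (rule add_le_less_mono[OF _ elim(1)])
        have "d / 2 / x * x \<le> d / 2" if "0 < x" for x :: real using that d by simp
        from this[of "\<bar>w\<bar> + 1"] show "e * (\<bar>w\<bar> + 1) \<le> d / 2" unfolding e_def by simp
      qed
      finally have "(\<Sum>u\<in>particles t (?k n). e + (\<bar>Cb\<bar> + ?L) * of_bool (\<eta> n * sqrt (real n) < \<bar>?x u\<bar>)) / P (?k n) < d" by simp
      with 2 have "\<bar>sqrt (real n) * F (hit a b n (?k n)) (?k n) t - ?L * W (?k n) t\<bar> < d"
        unfolding 1 by (rule le_less_trans)
      then show ?case by (simp only: dist_real_def diff_0_right)
    qed
  qed
  from tendsto_add[OF this tendsto_mult_left[OF Wk, of ?L]] show ?thesis by simp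
qed

theorem quenched_local_limit:
  assumes ab: "a < b"
  shows "AE t in Q. convergent (\<lambda>n. W n t) \<and>
    (\<lambda>n. sqrt (real n) * (real (card {u \<in> particles t n. position t u \<in> {a + center n<..<b + center n}}) / P n))
      \<longlonglongrightarrow> (b - a) / (sqrt s2 * sqrt (2 * pi)) * lim (\<lambda>n. W n t)"
  using W_convergent spread_vanishes F_hit_difference_vanishes[of a b]
proof eventually_elim
  case (elim t)
  have "(\<lambda>n. W n t) \<longlonglongrightarrow> lim (\<lambda>n. W n t)" using elim(1) by (simp add: convergent_LIMSEQ_iff)
  from tendsto_add[OF elim(3) sqrt_F_hit_limit[OF ab elim(2) this]] elim(1) show ?case
    unfolding F_hit_n[symmetric] by (simp add: right_diff_distrib)
qed

end

section \<open>The ergodic theorem\<close>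

locale ergodic_shift =
  fixes E :: "'e measure" and L :: "(nat \<Rightarrow> 'e) measure"
  assumes prob_L: "prob_space L"
    and sets_L: "sets L = sets (PiM UNIV (\<lambda>_. E))"
    and invariant: "distr L (PiM UNIV (\<lambda>_. E)) shift = L"
    and ergodic: "\<And>A. A \<in> sets L \<Longrightarrow> shift -` A \<inter> space L = A \<Longrightarrow> measure L A \<in> {0, 1}"
begin

sublocale prob_space L by (rule prob_L)

lemma space_L: "space L = space (PiM UNIV (\<lambda>_. E))"
  using sets_eq_imp_space_eq[OF sets_L] .

lemma measurable_shift [measurable]: "shift \<in> measurable L L"
proof -
  have "shift \<in> measurable (PiM UNIV (\<lambda>_. E)) (PiM UNIV (\<lambda>_. E))"
    unfolding shift_def by (rule measurable_PiM_single') (auto simp: space_PiM)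
  then show ?thesis by (simp add: measurable_cong_sets[OF sets_L sets_L])
qed

lemma distr_shift: "distr L L shift = L"
  using invariant distr_cong[OF refl sets_L[symmetric], of L shift shift] by simp

lemma distr_shift_pow: "distr L L (shift ^^ n) = L"
proof (induction n)
  case 0
  show ?case by (simp add: distr_id)
next
  case (Suc n)
  have [measurable]: "shift ^^ n \<in> measurable L L"
    by (induction n) (auto intro: measurable_comp)
  have "distr L L (shift ^^ Suc n) = distr (distr L L (shift ^^ n)) L shift"
    by (subst distr_distr) auto
  then show ?case unfolding Suc distr_shift .
qed

lemma measurable_shift_pow [measurable]: "shift ^^ n \<in> measurable L L"
  by (induction n) (auto intro: measurable_comp)

lemma shift_pow: "(shift ^^ n) x = (\<lambda>i. x (n + i))"
  by (induction n arbitrary: x) (auto simp: shift_def funpow_swap1)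

lemma AE_shift_pow:
  assumes "AE x in L. P x" shows "AE x in L. P ((shift ^^ n) x)"
proof (rule AE_distrD[of "shift ^^ n" L L])
  show "AE x in distr L L (shift ^^ n). P x" unfolding distr_shift_pow by fact
qed (rule measurable_shift_pow)

lemma nn_integral_shift_pow:
  "f \<in> borel_measurable L \<Longrightarrow> (\<integral>\<^sup>+x. f ((shift ^^ n) x) \<partial>L) = (\<integral>\<^sup>+x. f x \<partial>L)"
  using nn_integral_distr[of "shift ^^ n" L L f] by (simp add: distr_shift_pow)

lemma integral_shift:
  fixes f :: "(nat \<Rightarrow> 'e) \<Rightarrow> real"
  assumes "f \<in> borel_measurable L"
  shows "(LINT x|L. f (shift x)) = (LINT x|L. f x)"
  using integral_distr[of shift L L f] assms by (simp add: distr_shift)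

definition birkhoff :: "((nat \<Rightarrow> 'e) \<Rightarrow> real) \<Rightarrow> nat \<Rightarrow> (nat \<Rightarrow> 'e) \<Rightarrow> real" where
  "birkhoff f n x = (\<Sum>i<n. f ((shift ^^ i) x))"

lemma birkhoff_Suc: "birkhoff f (Suc n) x = f x + birkhoff f n (shift x)"
  unfolding birkhoff_def by (subst sum.lessThan_Suc_shift) (simp add: funpow_swap1)

lemma measurable_birkhoff [measurable]:
  "f \<in> borel_measurable L \<Longrightarrow> birkhoff f n \<in> borel_measurable L"
  unfolding birkhoff_def by (intro borel_measurable_sum) (rule measurable_compose[OF measurable_shift_pow])

text \<open>With \<open>M\<^sub>n\<close> the minimum of the first \<open>n\<close> Birkhoff sums, \<open>M\<^sub>n\<^sub>+\<^sub>1 = f + min 0 (M\<^sub>n \<circ> shift)\<close>.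
  If the sums were unbounded below, then integrating this identity would give
  \<open>\<integral>f \<le> \<integral>max 0 M\<^sub>n \<longrightarrow> 0\<close>.\<close>

lemma birkhoff_bounded_below:
  fixes f :: "(nat \<Rightarrow> 'e) \<Rightarrow> real"
  assumes f: "integrable L f" and pos: "0 < (LINT x|L. f x)"
  shows "AE x in L. \<exists>C. \<forall>n. C \<le> birkhoff f n x"
proof -
  have [measurable]: "f \<in> borel_measurable L" using f by simp
  \<comment> \<open>The event that the sums are unbounded below, with integer bounds so that it is
    visibly measurable. A shift of \<open>x\<close> changes the sums by the constant
    \<open>f x\<close>, so the event is invariant and ergodicity applies.\<close>
  define U where "U = {x \<in> space L. \<forall>K::nat. \<exists>n. birkhoff f n x < - real K}"
  have U_iff: "x \<in> U \<longleftrightarrow> x \<in> space L \<and> \<not> (\<exists>C. \<forall>n. C \<le> birkhoff f n x)" for x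
  proof -
    have "(\<forall>K::nat. \<exists>n. birkhoff f n x < - real K) \<longleftrightarrow> \<not> (\<exists>C. \<forall>n. C \<le> birkhoff f n x)"
    proof
      assume *: "\<forall>K::nat. \<exists>n. birkhoff f n x < - real K"
      show "\<not> (\<exists>C. \<forall>n. C \<le> birkhoff f n x)"
      proof
        assume "\<exists>C. \<forall>n. C \<le> birkhoff f n x"
        then obtain C where C: "\<And>n. C \<le> birkhoff f n x" by blast
        obtain K :: nat where "- C \<le> real K" using real_arch_simple by blast
        with * obtain n where "birkhoff f n x < - real K" by blast
        with C[of n] \<open>- C \<le> real K\<close> show False by linarith
      qed
    qed (meson not_le)
    then show ?thesis by (auto simp: U_def)
  qed
  have U_sets: "U \<in> sets L" unfolding U_def by measurable
  have inv: "shift -` U \<inter> space L = U"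
  proof -
    have "(\<exists>C. \<forall>n. C \<le> birkhoff f n (shift x)) \<longleftrightarrow> (\<exists>C. \<forall>n. C \<le> birkhoff f n x)" for x
    proof
      assume "\<exists>C. \<forall>n. C \<le> birkhoff f n (shift x)"
      then obtain C where C: "\<And>n. C \<le> birkhoff f n (shift x)" by blast
      have "min 0 (f x + C) \<le> birkhoff f n x" for n
      proof (cases n)
        case 0 then show ?thesis by (simp add: birkhoff_def)
      next
        case (Suc m) then show ?thesis using C[of m] by (simp add: birkhoff_Suc)
      qed
      then show "\<exists>C. \<forall>n. C \<le> birkhoff f n x" by blast
    next
      assume "\<exists>C. \<forall>n. C \<le> birkhoff f n x"
      then obtain C where C: "\<And>n. C \<le> birkhoff f n x" by blast
      have "C - f x \<le> birkhoff f n (shift x)" for n using C[of "Suc n"] by (simp add: birkhoff_Suc)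
      then show "\<exists>C. \<forall>n. C \<le> birkhoff f n (shift x)" by blast
    qed
    then show ?thesis using measurable_space[OF measurable_shift] by (auto simp: U_iff)
  qed
  have "measure L U \<noteq> 1"
  proof
    assume "measure L U = 1"
    then have AE_U: "AE x in L. x \<in> U" using prob_eq_1[OF U_sets] by simp
    \<comment> \<open>The minimum is over sums of length 1 to \<open>n + 1\<close>. The empty sum is
      left out, hence the explicit \<open>min 0\<close> in \<open>m_Suc\<close>.\<close>
    define m where "m n x = Min ((\<lambda>i. birkhoff f (Suc i) x) ` {..n})" for n x
    have m_meas [measurable]: "m n \<in> borel_measurable L" for n
      unfolding m_def by (intro borel_measurable_Min) auto
    have m_Suc: "m (Suc n) x = f x + min 0 (m n (shift x))" for n x
    proof -
      have "m (Suc n) x = Min ((\<lambda>i. f x + birkhoff f i (shift x)) ` {..Suc n})"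
        by (simp add: m_def birkhoff_Suc)
      also have "{..Suc n} = insert 0 (Suc ` {..n})" by (rule atMost_Suc_eq_insert_0)
      also have "(\<lambda>i. f x + birkhoff f i (shift x)) ` insert 0 (Suc ` {..n}) = (\<lambda>y. f x + y) ` insert 0 ((\<lambda>i. birkhoff f (Suc i) (shift x)) ` {..n})"
        by (simp add: image_image birkhoff_def)
      also have "Min \<dots> = f x + Min (insert 0 ((\<lambda>i. birkhoff f (Suc i) (shift x)) ` {..n}))"
        by (rule mono_Min_commute[symmetric]) (auto simp: mono_def)
      also have "Min (insert 0 ((\<lambda>i. birkhoff f (Suc i) (shift x)) ` {..n})) = min 0 (m n (shift x))"
        unfolding m_def by (subst Min_insert) auto
      finally show ?thesis .
    qed
    have m_dec: "m (Suc n) x \<le> m n x" for n x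
      unfolding m_def by (intro Min_antimono) auto
    have m_0: "m 0 x = f x" for x by (simp add: m_def birkhoff_def)
    have m_le_f: "m n x \<le> f x" for n x
      using m_dec[of _ x] m_0[of x] by (induction n) (auto intro: order_trans)
    have int_m: "integrable L (m n)" for n
    proof (induction n)
      case 0 show ?case using f by (simp add: m_0[abs_def])
    next
      case (Suc n)
      have "integrable L (\<lambda>x. m n (shift x))"
        using integrable_distr[of shift L L "m n"] Suc by (simp add: distr_shift)
      then show ?case unfolding m_Suc[abs_def] using f by (intro Bochner_Integration.integrable_add integrable_min) auto
    qed
    have "(LINT x|L. f x) \<le> (LINT x|L. max 0 (m n x))" for n
    proof -
      have "(LINT x|L. m (Suc n) x) = (LINT x|L. f x) + (LINT x|L. min 0 (m n (shift x)))"
        unfolding m_Suc[abs_def]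
        using integrable_distr[of shift L L "m n"] int_m[of n] f
        by (intro Bochner_Integration.integral_add integrable_min) (auto simp: distr_shift)
      also have "(LINT x|L. min 0 (m n (shift x))) = (LINT x|L. min 0 (m n x))"
        by (rule integral_shift[of "\<lambda>x. min 0 (m n x)"]) measurable
      finally have "(LINT x|L. f x) = (LINT x|L. m (Suc n) x) - (LINT x|L. min 0 (m n x))" by simp
      also have "\<dots> \<le> (LINT x|L. m n x) - (LINT x|L. min 0 (m n x))"
        using integral_mono[OF int_m int_m m_dec] by simp
      also have "\<dots> = (LINT x|L. m n x - min 0 (m n x))"
        using int_m by (intro Bochner_Integration.integral_diff[symmetric] integrable_min) auto
      also have "(\<lambda>x. m n x - min 0 (m n x)) = (\<lambda>x. max 0 (m n x))" by (auto simp: fun_eq_iff)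
      finally show ?thesis .
    qed
    moreover have "(\<lambda>n. LINT x|L. max 0 (m n x)) \<longlonglongrightarrow> (LINT x|L. 0)"
    proof (rule integral_dominated_convergence)
      show "integrable L (\<lambda>x. \<bar>f x\<bar>)" using f by simp
      show "AE x in L. norm (max 0 (m n x)) \<le> \<bar>f x\<bar>" for n
        
      proof (rule AE_I2)
        fix x show "norm (max 0 (m n x)) \<le> \<bar>f x\<bar>" using m_le_f[of n x] by (simp add: max_def)
      qed
      \<comment> \<open>On \<open>U\<close> some sum is negative, so the minimum is negative from
        that length on. The majorant is \<open>\<bar>f x\<bar>\<close> because
        \<open>m n x \<le> f x\<close>.\<close>
      show "AE x in L. (\<lambda>n. max 0 (m n x)) \<longlonglongrightarrow> 0"
        using AE_U
      proof eventually_elim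
        case (elim x)
        then obtain i where i: "birkhoff f i x < 0" unfolding U_def by (auto dest: spec[of _ 0])
        then have "i \<noteq> 0" by (intro notI) (simp add: birkhoff_def)
        then obtain j where j: "i = Suc j" using not0_implies_Suc by blast
        have "\<forall>\<^sub>F n in sequentially. max 0 (m n x) = 0"
          using eventually_ge_at_top[of j]
        proof eventually_elim
          case (elim n)
          have "m n x \<le> birkhoff f (Suc j) x" unfolding m_def using elim by (intro Min_le) auto
          with i j show ?case by simp
        qed
        then show ?case by (rule tendsto_eventually)
      qed
    qed measurable
    ultimately have "(LINT x|L. f x) \<le> 0"
      using LIMSEQ_le_const[of "\<lambda>n. LINT x|L. max 0 (m n x)" 0 "LINT x|L. f x"] by auto
    with pos show False by simp
  qed
  with ergodic[OF U_sets inv] have "measure L U = 0" by auto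
  then have "AE x in L. x \<notin> U" using prob_eq_0[OF U_sets] by simp
  then show ?thesis using AE_space by eventually_elim (simp add: U_iff)
qed

text \<open>Subtracting a constant slightly below the mean leaves a positive mean, so the reduced
  sums are bounded below and the averages cannot end up below that constant. Countably many
  constants suffice.\<close>

lemma birkhoff_liminf:
  fixes f :: "(nat \<Rightarrow> 'e) \<Rightarrow> real"
  assumes f: "integrable L f"
  shows "AE x in L. \<forall>c < (LINT x|L. f x). \<forall>\<^sub>F n in sequentially. c * real n \<le> birkhoff f n x"
proof -
  let ?I = "LINT x|L. f x"
  have "AE x in L. \<forall>i::nat. \<exists>C. \<forall>n. C \<le> birkhoff (\<lambda>x. f x - (?I - 1 / real (Suc i))) n x"
    unfolding AE_all_countable
  proof
    fix i
    have "integrable L (\<lambda>x. f x - (?I - 1 / real (Suc i)))" using f by simp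
    moreover have "0 < (LINT x|L. f x - (?I - 1 / real (Suc i)))"
      using f by (simp add: prob_space)
    ultimately show "AE x in L. \<exists>C. \<forall>n. C \<le> birkhoff (\<lambda>x. f x - (?I - 1 / real (Suc i))) n x"
      by (rule birkhoff_bounded_below)
  qed
  then show ?thesis
  proof eventually_elim
    case (elim x)
    show ?case
    proof (intro allI impI)
      fix c assume "c < ?I"
      then obtain i where i: "inverse (real (Suc i)) < ?I - c" using reals_Archimedean[of "?I - c"] by auto
      define d where "d = ?I - 1 / real (Suc i) - c"
      have d: "d > 0" using i by (simp add: d_def inverse_eq_divide)
      obtain C where C: "\<And>n. C \<le> birkhoff (\<lambda>x. f x - (?I - 1 / real (Suc i))) n x" using elim by blast
      show "\<forall>\<^sub>F n in sequentially. c * real n \<le> birkhoff f n x"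
        using eventually_ge_at_top[of "nat \<lceil>- C / d\<rceil>"]
      proof eventually_elim
        case (elim n)
        then have "- C / d \<le> real n" by (simp add: nat_ceiling_le_eq)
        then have "- C \<le> d * real n" using d pos_divide_le_eq[of d "- C" "real n"] by (simp add: mult.commute)
        moreover have "birkhoff (\<lambda>x. f x - (?I - 1 / real (Suc i))) n x = birkhoff f n x - real n * (?I - 1 / real (Suc i))"
          by (simp add: birkhoff_def sum_subtractf)
        then have "C \<le> birkhoff f n x - (d + c) * real n" using C[of n] by (simp add: d_def algebra_simps)
        ultimately show ?case by (simp add: algebra_simps)
      qed
    qed
  qed
qed

theorem birkhoff_ergodic:
  fixes f :: "(nat \<Rightarrow> 'e) \<Rightarrow> real"
  assumes f: "integrable L f"
  shows "AE x in L. (\<lambda>n. birkhoff f n x / real n) \<longlonglongrightarrow> (LINT x|L. f x)"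
proof -
  have "integrable L (\<lambda>x. - f x)" using f by simp
  from birkhoff_liminf[OF f] birkhoff_liminf[OF this] show ?thesis
  proof eventually_elim
    case (elim x)
    show ?case
    proof (rule order_tendstoI)
      fix c assume "c < (LINT x|L. f x)"
      then obtain c' where c': "c < c'" "c' < (LINT x|L. f x)" using dense by blast
      show "\<forall>\<^sub>F n in sequentially. c < birkhoff f n x / real n"
        using elim(1)[rule_format, OF c'(2)] eventually_gt_at_top[of 0]
      proof eventually_elim
        case (elim n)
        then have "c' \<le> birkhoff f n x / real n" by (simp add: le_divide_eq)
        with c' show ?case by simp
      qed
    next
      fix c assume "(LINT x|L. f x) < c"
      then obtain c' where c': "(LINT x|L. f x) < c'" "c' < c" using dense by blast
      then have "- c' < (LINT x|L. - f x)" by simp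
      from elim(2)[rule_format, OF this] eventually_gt_at_top[of 0]
      show "\<forall>\<^sub>F n in sequentially. birkhoff f n x / real n < c"
      proof eventually_elim
        case (elim n)
        then have "birkhoff f n x \<le> c' * real n" by (simp add: birkhoff_def sum_negf)
        then have "birkhoff f n x / real n \<le> c'" using elim by (simp add: divide_le_eq)
        with c' show ?case by simp
      qed
    qed
  qed
qed

text \<open>With only finitely many visits the sums of the indicator would stay bounded, whereas
  they grow at least linearly.\<close>

lemma recurrence:
  assumes A: "A \<in> sets L" "0 < measure L A"
  shows "AE x in L. \<exists>\<^sub>\<infinity>n. (shift ^^ n) x \<in> A"
proof -
  have "integrable L (indicator A :: _ \<Rightarrow> real)" using A(1) by (simp add: integrable_indicator_iff emeasure_eq_measure)
  from birkhoff_liminf[OF this] show ?thesis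
  proof eventually_elim
    case (elim x)
    let ?c = "measure L A / 2"
    have ev: "\<forall>\<^sub>F n in sequentially. ?c * real n \<le> birkhoff (indicator A) n x"
      using elim[rule_format, of ?c] A by simp
    show ?case
    proof (rule ccontr)
      assume "\<not> (\<exists>\<^sub>\<infinity>n. (shift ^^ n) x \<in> A)"
      then have fin: "finite {n. (shift ^^ n) x \<in> A}" by (simp add: INFM_iff_infinite)
      let ?B = "real (card {n. (shift ^^ n) x \<in> A})"
      have "birkhoff (indicator A) n x \<le> ?B" for n
      proof -
        have "birkhoff (indicator A) n x = real (card ({..<n} \<inter> {n. (shift ^^ n) x \<in> A}))"
          
          by (simp add: birkhoff_def indicator_def of_bool_def sum.If_cases)
        also have "\<dots> \<le> ?B" using fin by (intro of_nat_mono card_mono) auto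
        finally show ?thesis .
      qed
      then have "\<forall>\<^sub>F n in sequentially. ?c * real n \<le> ?B"
        using ev by (auto elim!: eventually_mono intro: order_trans)
      moreover have "\<forall>\<^sub>F n in sequentially. ?B / ?c < real n"
        using filterlim_real_sequentially by (simp add: filterlim_at_top_dense)
      ultimately have "\<forall>\<^sub>F n in sequentially. False"
      proof eventually_elim
        case (elim n)
        then show ?case using A(2) by (simp add: divide_less_eq mult.commute)
      qed
      then show False by simp
    qed
  qed
qed

end

section \<open>The annealed law\<close>

abbreviation tree_space :: "(nat list \<Rightarrow> offspring) measure" where
  "tree_space \<equiv> PiM UNIV (\<lambda>_. offspring_space)"

lemma space_tree_space [simp]: "space tree_space = UNIV"
  by (simp add: space_PiM PiE_def extensional_def)

context brw_random_environment
begin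

abbreviation env :: "(nat \<Rightarrow> 'e) measure" where "env \<equiv> PiM UNIV (\<lambda>_. \<Theta>)"
abbreviation L :: "(nat \<Rightarrow> 'e) measure" where "L \<equiv> env_law M \<Theta> \<xi>"

lemma measurable_\<xi>_seq [measurable]: "(\<lambda>\<omega> n. \<xi> n \<omega>) \<in> M \<rightarrow>\<^sub>M env"
  by (rule measurable_PiM_single') (use \<xi>_measurable measurable_space[OF \<xi>_measurable] in \<open>auto simp: space_PiM\<close>)

lemma measurable_X_family [measurable]: "(\<lambda>\<omega> u. X u \<omega>) \<in> M \<rightarrow>\<^sub>M tree_space"
  by (rule measurable_PiM_single') (use X_measurable in \<open>auto simp: space_PiM\<close>)

lemma sets_L [simp, measurable_cong]: "sets L = sets env"
  by (simp add: env_law_def)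

lemma space_L [simp]: "space L = space env"
  by (simp add: env_law_def)

lemma prob_L: "prob_space L"
  unfolding env_law_def by (rule prob_space_distr) measurable

sublocale E: ergodic_shift \<Theta> L
proof (rule ergodic_shift.intro)
  show "prob_space L" by (rule prob_L)
  show "sets L = sets env" by simp
  show "distr L env shift = L" using \<xi>_stationary by (simp add: stationary_seq_def)
  show "measure L A \<in> {0, 1}" if "A \<in> sets L" "shift -` A \<inter> space L = A" for A
    using \<xi>_ergodic that by (simp add: ergodic_seq_def)
qed

lemma space_env_D: "x \<in> space env \<Longrightarrow> x j \<in> space \<Theta>"
  by (auto simp: space_PiM)

lemma \<eta>_prob: "e \<in> space \<Theta> \<Longrightarrow> prob_space (\<eta> e)" and \<eta>_sets: "e \<in> space \<Theta> \<Longrightarrow> sets (\<eta> e) = sets offspring_space"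
  using measurable_space[OF \<eta>_kernel] by (auto simp: space_prob_algebra)

lemma \<eta>_subprob [measurable]: "\<eta> \<in> \<Theta> \<rightarrow>\<^sub>M subprob_algebra offspring_space"
  by (rule measurable_prob_algebraD[OF \<eta>_kernel])

lemma sets_quenched_law: "x \<in> space env \<Longrightarrow> sets (quenched_law \<eta> x) = sets tree_space"
  unfolding quenched_law_def by (intro sets_PiM_cong refl \<eta>_sets space_env_D)

lemma prob_quenched_law: "x \<in> space env \<Longrightarrow> prob_space (quenched_law \<eta> x)"
  unfolding quenched_law_def by (intro prob_space_PiM \<eta>_prob space_env_D)

text \<open>Cylinder rectangles generate the \<sigma>-algebra and are stable under intersection; on
  them the quenched law is a finite product of kernel values.\<close>

lemma measurable_quenched_law [measurable]: "quenched_law \<eta> \<in> env \<rightarrow>\<^sub>M subprob_algebra tree_space"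
proof (rule measurable_prob_algebraD, rule measurable_prob_algebra_generated)
  show "sets tree_space = sigma_sets (\<Pi>\<^sub>E i\<in>UNIV. space offspring_space) (prod_algebra UNIV (\<lambda>_::nat list. offspring_space))"
    by (rule sets_PiM)
  show "Int_stable (prod_algebra UNIV (\<lambda>_::nat list. offspring_space))" by (rule Int_stable_prod_algebra)
  show "prod_algebra UNIV (\<lambda>_::nat list. offspring_space) \<subseteq> Pow (\<Pi>\<^sub>E i\<in>UNIV. space offspring_space)"
    by (rule prod_algebra_sets_into_space)
  fix A :: "(nat list \<Rightarrow> offspring) set" assume "A \<in> prod_algebra UNIV (\<lambda>_::nat list. offspring_space)"
  then obtain J F where A: "A = prod_emb UNIV (\<lambda>_. offspring_space) J (Pi\<^sub>E J F)" and J: "finite J"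
    and F: "\<And>i. i \<in> J \<Longrightarrow> F i \<in> sets offspring_space"
    by (rule prod_algebraE) blast
  have "emeasure (quenched_law \<eta> x) A = (\<Prod>u\<in>J. emeasure (\<eta> (x (length u))) (F u))" if x: "x \<in> space env" for x
  proof -
    have "A = prod_emb UNIV (\<lambda>u. \<eta> (x (length u))) J (Pi\<^sub>E J F)"
      unfolding A prod_emb_def using sets_eq_imp_space_eq[OF \<eta>_sets[OF space_env_D[OF x]]] by simp
    then show ?thesis
      unfolding quenched_law_def using J F \<eta>_sets[OF space_env_D[OF x]]
      by (simp add: emeasure_PiM_emb \<eta>_prob space_env_D[OF x])
  qed
  moreover have "(\<lambda>x. \<Prod>u\<in>J. emeasure (\<eta> (x (length u))) (F u)) \<in> borel_measurable env"
  proof (rule borel_measurable_prod_ennreal)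
    fix u assume "u \<in> J"
    from F[OF this] show "(\<lambda>x. emeasure (\<eta> (x (length u))) (F u)) \<in> borel_measurable env"
      by (intro measurable_emeasure_kernel[of _ _ offspring_space] measurable_compose[OF _ \<eta>_subprob]) auto
  qed
  ultimately show "(\<lambda>x. emeasure (quenched_law \<eta> x) A) \<in> borel_measurable env"
    by (simp cong: measurable_cong)
qed (use prob_quenched_law sets_quenched_law in auto)

section \<open>Disintegration of the annealed law over the environment\<close>

definition joint :: "((nat \<Rightarrow> 'e) \<times> (nat list \<Rightarrow> offspring)) measure" where
  "joint = L \<bind> (\<lambda>x. return env x \<Otimes>\<^sub>M quenched_law \<eta> x)"

lemma measurable_joint_kernel: "(\<lambda>x. return env x \<Otimes>\<^sub>M quenched_law \<eta> x) \<in> L \<rightarrow>\<^sub>M subprob_algebra (env \<Otimes>\<^sub>M tree_space)"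
  by (intro measurable_pair_measure) (auto intro: return_measurable measurable_quenched_law simp: measurable_cong_sets[OF sets_L refl])

lemma nn_integral_kernel:
  assumes x: "x \<in> space env" and f: "f \<in> borel_measurable (env \<Otimes>\<^sub>M tree_space)"
  shows "(\<integral>\<^sup>+z. f z \<partial>(return env x \<Otimes>\<^sub>M quenched_law \<eta> x)) = (\<integral>\<^sup>+t. f (x, t) \<partial>quenched_law \<eta> x)"
proof -
  interpret q: prob_space "quenched_law \<eta> x" by (rule prob_quenched_law[OF x])
  have f': "f \<in> borel_measurable (env \<Otimes>\<^sub>M quenched_law \<eta> x)"
    using f by (simp cong: measurable_cong_sets sets_pair_measure_cong add: sets_quenched_law[OF x])
  then have "f \<in> borel_measurable (return env x \<Otimes>\<^sub>M quenched_law \<eta> x)"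
    by (simp cong: measurable_cong_sets sets_pair_measure_cong)
  then have "(\<integral>\<^sup>+z. f z \<partial>(return env x \<Otimes>\<^sub>M quenched_law \<eta> x)) = (\<integral>\<^sup>+y. \<integral>\<^sup>+t. f (y, t) \<partial>quenched_law \<eta> x \<partial>return env x)"
    by (rule q.nn_integral_fst[symmetric])
  also have "\<dots> = (\<integral>\<^sup>+t. f (x, t) \<partial>quenched_law \<eta> x)"
    using q.borel_measurable_nn_integral_fst[OF f'] by (intro nn_integral_return x)
  finally show ?thesis .
qed

text \<open>\<open>conditional_law\<close> is the equality of both measures on rectangles, which
  form a generator stable under intersection.\<close>

lemma distr_joint: "distr M (env \<Otimes>\<^sub>M tree_space) (\<lambda>\<omega>. (\<lambda>n. \<xi> n \<omega>, \<lambda>u. X u \<omega>)) = joint"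
proof (rule measure_eqI_generator_eq[OF Int_stable_pair_measure_generator[of env tree_space]])
  let ?G = "{a \<times> b | a b. a \<in> sets env \<and> b \<in> sets tree_space}"
  have ne: "space L \<noteq> {}" using prob_space.not_empty[OF prob_L] .
  have sets_j: "sets joint = sets (env \<Otimes>\<^sub>M tree_space)"
    unfolding joint_def by (rule sets_bind[OF sets_kernel[OF measurable_joint_kernel] ne])
  show "?G \<subseteq> Pow (space env \<times> space tree_space)"
    using sets.sets_into_space by fastforce
  show "sets (distr M (env \<Otimes>\<^sub>M tree_space) (\<lambda>\<omega>. (\<lambda>n. \<xi> n \<omega>, \<lambda>u. X u \<omega>))) = sigma_sets (space env \<times> space tree_space) ?G"
    by (simp add: sets_pair_measure)
  show "sets joint = sigma_sets (space env \<times> space tree_space) ?G"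
    unfolding sets_j by (simp add: sets_pair_measure)
  have "space env \<times> space tree_space \<in> ?G" using sets.top[of env] sets.top[of tree_space] by blast
  then show "range (\<lambda>_::nat. space env \<times> space tree_space) \<subseteq> ?G" by blast
  show "(\<Union>i::nat. space env \<times> space tree_space) = space env \<times> space tree_space" by simp
  show "emeasure (distr M (env \<Otimes>\<^sub>M tree_space) (\<lambda>\<omega>. (\<lambda>n. \<xi> n \<omega>, \<lambda>u. X u \<omega>))) (space env \<times> space tree_space) \<noteq> \<infinity>" for i :: nat
  proof -
    have "finite_measure (distr M (env \<Otimes>\<^sub>M tree_space) (\<lambda>\<omega>. (\<lambda>n. \<xi> n \<omega>, \<lambda>u. X u \<omega>)))"
      by (intro prob_space.finite_measure prob_space_distr) measurable
    then show ?thesis using finite_measure.emeasure_finite by (simp add: infinity_ennreal_def)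
  qed
  fix Z assume "Z \<in> ?G"
  then obtain A B where Z: "Z = A \<times> B" and A: "A \<in> sets env" and B: "B \<in> sets tree_space" by auto
  have "emeasure (distr M (env \<Otimes>\<^sub>M tree_space) (\<lambda>\<omega>. (\<lambda>n. \<xi> n \<omega>, \<lambda>u. X u \<omega>))) Z
     = emeasure M {\<omega> \<in> space M. (\<lambda>n. \<xi> n \<omega>) \<in> A \<and> (\<lambda>u. X u \<omega>) \<in> B}"
    using A B unfolding Z by (subst emeasure_distr) (auto intro!: arg_cong[where f="emeasure M"])
  also have "\<dots> = (\<integral>\<^sup>+x\<in>A. emeasure (quenched_law \<eta> x) B \<partial>L)" by (rule conditional_law[OF A B])
  also have "\<dots> = (\<integral>\<^sup>+x. emeasure (return env x \<Otimes>\<^sub>M quenched_law \<eta> x) Z \<partial>L)"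
  proof (rule nn_integral_cong)
    fix x assume "x \<in> space L"
    then have x: "x \<in> space env" by simp
    interpret q: prob_space "quenched_law \<eta> x" by (rule prob_quenched_law[OF x])
    show "emeasure (quenched_law \<eta> x) B * indicator A x = emeasure (return env x \<Otimes>\<^sub>M quenched_law \<eta> x) Z"
      unfolding Z using A B by (subst q.emeasure_pair_measure_Times) (auto simp: sets_quenched_law[OF x] mult.commute)
  qed
  also have "\<dots> = emeasure joint Z"
    unfolding joint_def using A B Z by (intro emeasure_bind[symmetric, OF ne measurable_joint_kernel]) auto
  finally show "emeasure (distr M (env \<Otimes>\<^sub>M tree_space) (\<lambda>\<omega>. (\<lambda>n. \<xi> n \<omega>, \<lambda>u. X u \<omega>))) Z = emeasure joint Z" .
qed

lemma nn_integral_joint: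
  assumes f [measurable]: "f \<in> borel_measurable (env \<Otimes>\<^sub>M tree_space)"
  shows "(\<integral>\<^sup>+\<omega>. f (\<lambda>n. \<xi> n \<omega>, \<lambda>u. X u \<omega>) \<partial>M) = (\<integral>\<^sup>+x. \<integral>\<^sup>+t. f (x, t) \<partial>quenched_law \<eta> x \<partial>L)"
proof -
  have "(\<integral>\<^sup>+\<omega>. f (\<lambda>n. \<xi> n \<omega>, \<lambda>u. X u \<omega>) \<partial>M) = (\<integral>\<^sup>+z. f z \<partial>joint)"
    unfolding distr_joint[symmetric] by (subst nn_integral_distr) measurable
  also have "\<dots> = (\<integral>\<^sup>+x. \<integral>\<^sup>+z. f z \<partial>(return env x \<Otimes>\<^sub>M quenched_law \<eta> x) \<partial>L)"
    unfolding joint_def by (rule nn_integral_bind[OF f measurable_joint_kernel])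
  also have "\<dots> = (\<integral>\<^sup>+x. \<integral>\<^sup>+t. f (x, t) \<partial>quenched_law \<eta> x \<partial>L)"
    by (intro nn_integral_cong nn_integral_kernel f) simp
  finally show ?thesis .
qed

text \<open>The passage from quenched to annealed statements: the indicator of failure integrates to
  0 over the tree for almost every environment, hence to 0 altogether. The price is joint
  measurability of the event.\<close>

lemma AE_annealed:
  assumes [measurable]: "Measurable.pred (env \<Otimes>\<^sub>M tree_space) (\<lambda>(x, t). R x t)"
    and AE: "AE x in L. AE t in quenched_law \<eta> x. R x t"
  shows "AE \<omega> in M. R (\<lambda>n. \<xi> n \<omega>) (\<lambda>u. X u \<omega>)"
proof -
  let ?f = "\<lambda>z. if (case z of (x, t) \<Rightarrow> R x t) then 0 else 1 :: ennreal"
  have f: "?f \<in> borel_measurable (env \<Otimes>\<^sub>M tree_space)" by measurable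
  have "(\<integral>\<^sup>+\<omega>. ?f (\<lambda>n. \<xi> n \<omega>, \<lambda>u. X u \<omega>) \<partial>M) = (\<integral>\<^sup>+x. \<integral>\<^sup>+t. ?f (x, t) \<partial>quenched_law \<eta> x \<partial>L)"
    by (rule nn_integral_joint[OF f])
  also have "\<dots> = (\<integral>\<^sup>+x. 0 \<partial>L)"
  proof (rule nn_integral_cong_AE)
    show "AE x in L. (\<integral>\<^sup>+t. ?f (x, t) \<partial>quenched_law \<eta> x) = 0"
      using AE
    proof eventually_elim
      case (elim x)
      have "(\<integral>\<^sup>+t. ?f (x, t) \<partial>quenched_law \<eta> x) = (\<integral>\<^sup>+t. 0 \<partial>quenched_law \<eta> x)"
        by (rule nn_integral_cong_AE) (use elim in \<open>auto elim: eventually_mono\<close>)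
      then show ?case by simp
    qed
  qed
  finally have 0: "(\<integral>\<^sup>+\<omega>. ?f (\<lambda>n. \<xi> n \<omega>, \<lambda>u. X u \<omega>) \<partial>M) = 0" by simp
  have "(\<lambda>\<omega>. ?f (\<lambda>n. \<xi> n \<omega>, \<lambda>u. X u \<omega>)) \<in> borel_measurable M"
    by (rule measurable_compose[OF _ f]) measurable
  then have "AE \<omega> in M. ?f (\<lambda>n. \<xi> n \<omega>, \<lambda>u. X u \<omega>) = 0"
    using 0 by (simp add: nn_integral_0_iff_AE)
  then show ?thesis by eventually_elim (simp split: if_splits)
qed

text \<open>Given the environment, the offspring of the root has law \<open>\<eta> (x 0)\<close>.
  This turns moment conditions under the annealed law into integrals over the environment.\<close>

lemma nn_integral_root:
  assumes f [measurable]: "(\<lambda>(e, z). f e z) \<in> borel_measurable (\<Theta> \<Otimes>\<^sub>M offspring_space)"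
  shows "(\<integral>\<^sup>+\<omega>. f (\<xi> 0 \<omega>) (X [] \<omega>) \<partial>M) = (\<integral>\<^sup>+x. \<integral>\<^sup>+z. f (x 0) z \<partial>\<eta> (x 0) \<partial>L)"
proof -
  let ?g = "\<lambda>z. case z of (x, t) \<Rightarrow> f (x 0) (t [])"
  have "(\<lambda>z. (fst z (0::nat), snd z ([]::nat list))) \<in> env \<Otimes>\<^sub>M tree_space \<rightarrow>\<^sub>M \<Theta> \<Otimes>\<^sub>M offspring_space"
    by measurable
  from measurable_compose[OF this f] have g: "?g \<in> borel_measurable (env \<Otimes>\<^sub>M tree_space)"
    by (simp add: case_prod_beta')
  have "(\<integral>\<^sup>+\<omega>. f (\<xi> 0 \<omega>) (X [] \<omega>) \<partial>M) = (\<integral>\<^sup>+x. \<integral>\<^sup>+t. f (x 0) (t []) \<partial>quenched_law \<eta> x \<partial>L)"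
    using nn_integral_joint[OF g] by simp
  also have "\<dots> = (\<integral>\<^sup>+x. \<integral>\<^sup>+z. f (x 0) z \<partial>\<eta> (x 0) \<partial>L)"
  proof (rule nn_integral_cong)
    fix x assume "x \<in> space L"
    then have x: "x \<in> space env" by simp
    have fx: "f (x 0) \<in> borel_measurable (\<eta> (x 0))"
      using measurable_compose[OF measurable_Pair1'[OF space_env_D[OF x, of 0], of offspring_space] f]
      by (simp add: measurable_cong_sets[OF \<eta>_sets[OF space_env_D[OF x]] refl])
    have d: "distr (quenched_law \<eta> x) (\<eta> (x (length ([]::nat list)))) (\<lambda>t. t []) = \<eta> (x (length ([]::nat list)))"
      unfolding quenched_law_def by (rule distr_PiM_component[where i="[]" and I=UNIV and M="\<lambda>u. \<eta> (x (length u))"]) (auto intro: \<eta>_prob space_env_D[OF x])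
    have "(\<integral>\<^sup>+z. f (x 0) z \<partial>\<eta> (x 0)) = (\<integral>\<^sup>+z. f (x 0) z \<partial>distr (quenched_law \<eta> x) (\<eta> (x 0)) (\<lambda>t. t []))"
      using d by simp
    also have "\<dots> = (\<integral>\<^sup>+t. f (x 0) (t []) \<partial>quenched_law \<eta> x)"
    proof (rule nn_integral_distr)
      show "f (x 0) \<in> borel_measurable (distr (quenched_law \<eta> x) (\<eta> (x 0)) (\<lambda>t. t []))" using fx by simp
      have "(\<lambda>t. t []) \<in> quenched_law \<eta> x \<rightarrow>\<^sub>M \<eta> (x (length ([]::nat list)))"
        unfolding quenched_law_def by (rule measurable_component_singleton) simp
      then show "(\<lambda>t. t []) \<in> quenched_law \<eta> x \<rightarrow>\<^sub>M \<eta> (x 0)" by simp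
    qed
    finally show "(\<integral>\<^sup>+t. f (x 0) (t []) \<partial>quenched_law \<eta> x) = (\<integral>\<^sup>+z. f (x 0) z \<partial>\<eta> (x 0))" ..
  qed
  finally show ?thesis .
qed

lemma AE_env_coordinate:
  assumes [measurable]: "Measurable.pred \<Theta> R" and "AE \<omega> in M. R (\<xi> 0 \<omega>)"
  shows "AE x in L. \<forall>j. R (x j)"
proof -
  have "AE x in L. R (x 0)"
    unfolding env_law_def by (subst AE_distr_iff) (use assms(2) in auto)
  from E.AE_shift_pow[OF this] have "AE x in L. R (x j)" for j by (simp add: E.shift_pow)
  then show ?thesis by (simp add: AE_all_countable)
qed

lemma integrable_env_coordinate:
  fixes f :: "'e \<Rightarrow> real"
  assumes "f \<in> borel_measurable \<Theta>"
  shows "integrable L (\<lambda>x. f (x 0)) \<longleftrightarrow> integrable M (\<lambda>\<omega>. f (\<xi> 0 \<omega>))"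
    "(LINT x|L. f (x 0)) = (LINT \<omega>|M. f (\<xi> 0 \<omega>))"
  unfolding env_law_def using assms
  by (subst integrable_distr_eq, auto) (subst integral_distr, auto)

lemma nn_integral_env_coordinate:
  assumes "f \<in> borel_measurable \<Theta>"
  shows "(\<integral>\<^sup>+x. f (x j) \<partial>L) = (\<integral>\<^sup>+\<omega>. f (\<xi> 0 \<omega>) \<partial>M)"
proof -
  have "(\<integral>\<^sup>+x. f (x j) \<partial>L) = (\<integral>\<^sup>+x. f (x 0) \<partial>L)"
    using E.nn_integral_shift_pow[of "\<lambda>x. f (x 0)" j] assms by (simp add: E.shift_pow)
  also have "\<dots> = (\<integral>\<^sup>+\<omega>. f (\<xi> 0 \<omega>) \<partial>M)"
    unfolding env_law_def using assms by (subst nn_integral_distr) auto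
  finally show ?thesis .
qed

end

section \<open>Measurability in the environment\<close>

text \<open>Stated without conditions on the mean, so that \<open>\<nu>_of\<close> is a kernel on
  the whole space. If the mean is 0 or infinite, the quotient is 0 by the conventions of
  \<open>ennreal\<close> and the measure is null.\<close>

lemma subprob_space_\<nu>_of:
  assumes p: "sets p = sets offspring_space"
  shows "subprob_space (\<nu>_of p)"
proof
  have "emeasure (\<nu>_of p) UNIV = mean_offspring p / mean_offspring p"
    using emeasure_\<nu>_of[OF p, of UNIV] by (simp add: mean_offspring_def)
  also have "\<dots> \<le> 1" by (cases "mean_offspring p = 0 \<or> mean_offspring p = \<infinity>") (auto simp: ennreal_divide_self less_top ennreal_top_divide)
  finally show "emeasure (\<nu>_of p) (space (\<nu>_of p)) \<le> 1" by simp
qed simp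

text \<open>A finite second moment about any point makes the identity integrable. So the
  conventional value 0 of \<open>\<mu>_of\<close> does not occur here, and \<open>\<mu>_of p\<close>
  is the true mean.\<close>

lemma sq_dist_\<nu>_of:
  assumes p: "sets p = sets offspring_space" "mean_offspring p \<noteq> 0" "mean_offspring p \<noteq> \<infinity>" and fin: "\<sigma>2_of p < \<infinity>"
  shows "sq_dist (\<nu>_of p)" "var_of (\<nu>_of p) = enn2real (\<sigma>2_of p)"
proof -
  have rd: "real_distribution (\<nu>_of p)" by (intro real_distributionI prob_space_\<nu>_of[OF p]) simp
  interpret real_distribution "\<nu>_of p" by (rule rd)
  let ?m = "\<mu>_of p"
  have 2: "integrable (\<nu>_of p) (\<lambda>x. (x - ?m)\<^sup>2)"
    using fin by (intro integrableI_nonneg) (auto simp: \<sigma>2_of_def)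
  have "integrable (\<nu>_of p) (\<lambda>x. x - ?m)"
    by (rule square_integrable_imp_integrable[OF _ 2]) simp
  then have "integrable (\<nu>_of p) (\<lambda>x. (x - ?m) + ?m)" by (rule Bochner_Integration.integrable_add) simp
  then have 1: "integrable (\<nu>_of p) (\<lambda>x. x)" by simp
  have "integrable (\<nu>_of p) (\<lambda>x. (x - ?m)\<^sup>2 + (2 * ?m * x - ?m\<^sup>2))"
    by (intro Bochner_Integration.integrable_add[OF 2] Bochner_Integration.integrable_diff integrable_mult_right 1 integrable_const)
  also have "(\<lambda>x. (x - ?m)\<^sup>2 + (2 * ?m * x - ?m\<^sup>2)) = (\<lambda>x. x\<^sup>2)"
    by (simp add: fun_eq_iff power2_eq_square algebra_simps)
  finally show "sq_dist (\<nu>_of p)" using rd by (simp add: sq_dist_def)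
  show "var_of (\<nu>_of p) = enn2real (\<sigma>2_of p)"
    unfolding var_of_def \<sigma>2_of_def \<mu>_of_def[symmetric] by (rule integral_eq_nn_integral) auto
qed

lemma tail_var_nn:
  assumes "sq_dist N"
  shows "tail_var K N = enn2real (\<integral>\<^sup>+x. ennreal ((x - (LINT x|N. x))\<^sup>2 * indicator {x. K < \<bar>x - (LINT x|N. x)\<bar>} x) \<partial>N)"
proof -
  interpret real_distribution N using assms by (simp add: sq_dist_def)
  show ?thesis unfolding tail_var_def by (rule integral_eq_nn_integral) auto
qed

lemma tail_var_le_var_of:
  assumes "sq_dist N" shows "tail_var K N \<le> var_of N"
proof -
  interpret real_distribution N using assms by (simp add: sq_dist_def)
  have int: "integrable N (\<lambda>x. (x - (LINT x|N. x))\<^sup>2)" by (rule sq_dist_integrable[OF assms])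
  show ?thesis
    unfolding tail_var_def var_of_def
    by (intro integral_mono Bochner_Integration.integrable_bound[OF int]) (auto simp: indicator_def intro: int)
qed

context brw_random_environment
begin

lemma measurable_mean_offspring [measurable]: "(\<lambda>e. mean_offspring (\<eta> e)) \<in> borel_measurable \<Theta>"
  unfolding mean_offspring_def
  by (rule measurable_compose[OF \<eta>_subprob nn_integral_measurable_subprob_algebra])
     (rule measurable_compose[OF measurable_fst_offspring], simp)

lemma measurable_\<nu>_of [measurable]: "(\<lambda>e. \<nu>_of (\<eta> e)) \<in> \<Theta> \<rightarrow>\<^sub>M subprob_algebra borel"
proof (rule measurable_subprob_algebra)
  fix e assume e: "e \<in> space \<Theta>"
  show "subprob_space (\<nu>_of (\<eta> e))" by (rule subprob_space_\<nu>_of[OF \<eta>_sets[OF e]])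
  show "sets (\<nu>_of (\<eta> e)) = sets borel" by simp
next
  fix A :: "real set" assume A: "A \<in> sets borel"
  have [measurable]: "(\<lambda>e. \<integral>\<^sup>+z. (\<Sum>i<fst z. indicator A (snd z i)) \<partial>\<eta> e) \<in> borel_measurable \<Theta>"
    by (rule measurable_compose[OF \<eta>_subprob nn_integral_measurable_subprob_algebra[OF measurable_offspring_sum[OF A]]])
  have "(\<lambda>e. (\<integral>\<^sup>+z. (\<Sum>i<fst z. indicator A (snd z i)) \<partial>\<eta> e) / mean_offspring (\<eta> e)) \<in> borel_measurable \<Theta>"
    by measurable
  then show "(\<lambda>e. emeasure (\<nu>_of (\<eta> e)) A) \<in> borel_measurable \<Theta>"
    using A by (simp add: emeasure_\<nu>_of \<eta>_sets cong: measurable_cong)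
qed

lemma measurable_\<mu>_of [measurable]: "(\<lambda>e. \<mu>_of (\<eta> e)) \<in> borel_measurable \<Theta>"
  unfolding \<mu>_of_def by (rule measurable_compose[OF measurable_\<nu>_of integral_measurable_subprob_algebra]) simp

lemma measurable_\<sigma>2_of [measurable]: "(\<lambda>e. \<sigma>2_of (\<eta> e)) \<in> borel_measurable \<Theta>"
  unfolding \<sigma>2_of_def by (rule nn_integral_measurable_subprob_algebra2[OF _ measurable_\<nu>_of]) measurable

text \<open>The truncated variance as a nonnegative integral against the kernel, a form whose
  measurability in \<open>e\<close> is available; it agrees with \<open>tail_var\<close> on regular
  environments.\<close>

definition tail_env :: "real \<Rightarrow> 'e \<Rightarrow> real" where
  "tail_env K e = enn2real (\<integral>\<^sup>+x. ennreal ((x - \<mu>_of (\<eta> e))\<^sup>2 * indicator {x. K < \<bar>x - \<mu>_of (\<eta> e)\<bar>} x) \<partial>\<nu>_of (\<eta> e))"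

lemma measurable_tail_env [measurable]: "tail_env K \<in> borel_measurable \<Theta>"
  unfolding tail_env_def[abs_def]
proof (rule borel_measurable_enn2real, rule nn_integral_measurable_subprob_algebra2[OF _ measurable_\<nu>_of])
  have "(\<lambda>z. ennreal ((snd z - \<mu>_of (\<eta> (fst z)))\<^sup>2 * (if K < \<bar>snd z - \<mu>_of (\<eta> (fst z))\<bar> then 1 else 0))) \<in> borel_measurable (\<Theta> \<Otimes>\<^sub>M borel)"
    by measurable
  then show "(\<lambda>(e, x). ennreal ((x - \<mu>_of (\<eta> e))\<^sup>2 * indicator {x. K < \<bar>x - \<mu>_of (\<eta> e)\<bar>} x)) \<in> borel_measurable (\<Theta> \<Otimes>\<^sub>M borel)"
    by (simp add: indicator_def of_bool_def case_prod_beta')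
qed

lemma cmod_char_\<nu>_of_le_1:
  assumes "e \<in> space \<Theta>" shows "cmod (char (\<nu>_of (\<eta> e)) t) \<le> 1"
proof -
  interpret subprob_space "\<nu>_of (\<eta> e)" by (rule subprob_space_\<nu>_of[OF \<eta>_sets[OF assms]])
  have "cmod (char (\<nu>_of (\<eta> e)) t) \<le> (LINT x|\<nu>_of (\<eta> e). norm (iexp (t * x)))"
    unfolding char_def by (rule integral_norm_bound)
  also have "\<dots> = measure (\<nu>_of (\<eta> e)) UNIV" by simp
  also have "\<dots> \<le> 1" using subprob_measure_le_1 by simp
  finally show ?thesis .
qed

definition decay_env :: "real \<Rightarrow> 'e \<Rightarrow> real" where
  "decay_env R e = char_decay_rate R (\<nu>_of (\<eta> e))"

lemma measurable_decay_env [measurable]: "decay_env R \<in> borel_measurable \<Theta>"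
proof -
  have "(\<lambda>e. char (\<nu>_of (\<eta> e)) t) \<in> borel_measurable \<Theta>" for t
    unfolding char_def by (rule measurable_compose[OF measurable_\<nu>_of integral_measurable_subprob_algebra]) simp
  then have [measurable]: "(\<lambda>e. decay_ratio (\<nu>_of (\<eta> e)) t) \<in> borel_measurable \<Theta>" for t
    unfolding decay_ratio_def by measurable
  have "(\<lambda>e. INF t\<in>{0<..R} \<inter> \<rat>. decay_ratio (\<nu>_of (\<eta> e)) t) \<in> borel_measurable \<Theta>"
  proof (rule borel_measurable_cINF)
    show "countable ({0<..R} \<inter> \<rat>)" using countable_rat by blast
    fix e assume "e \<in> space \<Theta>"
    then show "bdd_below ((\<lambda>t. decay_ratio (\<nu>_of (\<eta> e)) t) ` ({0<..R} \<inter> \<rat>))"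
      by (intro bdd_belowI[of _ 0]) (auto simp: decay_ratio_def power_le_one cmod_char_\<nu>_of_le_1)
  qed measurable
  then show ?thesis unfolding decay_env_def[abs_def] char_decay_rate_def by measurable
qed

definition over_env :: "real \<Rightarrow> 'e \<Rightarrow> ennreal" where
  "over_env \<tau> e = (\<integral>\<^sup>+z. of_nat (fst z) / mean_offspring (\<eta> e) * of_bool (\<tau> < real (fst z)) \<partial>\<eta> e)"

lemma measurable_over_integrand:
  "(\<lambda>(e, z). of_nat (fst z) / mean_offspring (\<eta> e) * h (real (fst z))) \<in> borel_measurable (\<Theta> \<Otimes>\<^sub>M offspring_space)"
  for h :: "real \<Rightarrow> ennreal"
proof -
  have [measurable]: "(\<lambda>n. of_nat n :: ennreal) \<in> count_space UNIV \<rightarrow>\<^sub>M borel" "(\<lambda>n. h (real n)) \<in> count_space UNIV \<rightarrow>\<^sub>M borel"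
    by simp_all
  have [measurable]: "(\<lambda>x. fst (snd x)) \<in> \<Theta> \<Otimes>\<^sub>M offspring_space \<rightarrow>\<^sub>M count_space UNIV"
    by (rule measurable_compose[OF measurable_snd measurable_fst_offspring])
  have "(\<lambda>x. of_nat (fst (snd x)) / mean_offspring (\<eta> (fst x)) * h (real (fst (snd x)))) \<in> borel_measurable (\<Theta> \<Otimes>\<^sub>M offspring_space)"
    by measurable
  then show ?thesis by (simp add: case_prod_beta')
qed

lemma measurable_over_env [measurable]: "over_env \<tau> \<in> borel_measurable \<Theta>"
  unfolding over_env_def[abs_def]
  using measurable_over_integrand[of "\<lambda>x. of_bool (\<tau> < x)"]
  by (intro nn_integral_measurable_subprob_algebra2[OF _ \<eta>_subprob]) simp

lemma nn_integral_over_env: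
  "(\<integral>\<^sup>+x. over_env \<tau> (x j) \<partial>L) = (\<integral>\<^sup>+\<omega>. of_nat (fst (X [] \<omega>)) / mean_offspring (\<eta> (\<xi> 0 \<omega>)) * of_bool (\<tau> < real (fst (X [] \<omega>))) \<partial>M)"
proof -
  have "(\<integral>\<^sup>+x. over_env \<tau> (x j) \<partial>L) = (\<integral>\<^sup>+x. over_env \<tau> (x 0) \<partial>L)"
    using nn_integral_env_coordinate[OF measurable_over_env] by simp
  also have "\<dots> = (\<integral>\<^sup>+\<omega>. of_nat (fst (X [] \<omega>)) / mean_offspring (\<eta> (\<xi> 0 \<omega>)) * of_bool (\<tau> < real (fst (X [] \<omega>))) \<partial>M)"
    unfolding over_env_def
    using nn_integral_root[OF measurable_over_integrand[of "\<lambda>x. of_bool (\<tau> < x)"]] by simp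
  finally show ?thesis .
qed

end

section \<open>Almost sure properties of the environment\<close>

lemma eventually_le_imp_const_mult_le:
  fixes a b :: "nat \<Rightarrow> real"
  assumes ev: "\<forall>\<^sub>F n in sequentially. a n \<le> b n" and pos: "\<And>n. 0 < a n" "\<And>n. 0 < b n"
  obtains C where "0 < C" "\<And>n. C * a n \<le> b n"
proof -
  obtain n0 where n0: "\<And>n. n \<ge> n0 \<Longrightarrow> a n \<le> b n" using ev by (auto simp: eventually_sequentially)
  define C where "C = Min (insert 1 ((\<lambda>n. b n / a n) ` {..<n0}))"
  have "0 < C" unfolding C_def using pos by (subst Min_gr_iff) auto
  moreover have "C * a n \<le> b n" for n
  proof (cases "n < n0")
    case True
    then have "C \<le> b n / a n" unfolding C_def by (intro Min_le) auto
    then show ?thesis using pos(1)[of n] by (simp add: pos_le_divide_eq)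
  next
    case False
    have "C \<le> 1" unfolding C_def by (intro Min_le) auto
    then have "C * a n \<le> 1 * a n" using pos(1)[of n] by (intro mult_right_mono) auto
    then show ?thesis using n0[of n] False by simp
  qed
  ultimately show thesis by (rule that)
qed

lemma suminf_ennreal_le_imp:
  fixes f :: "nat \<Rightarrow> real"
  assumes f: "\<And>i. 0 \<le> f i" and le: "(\<Sum>i. ennreal (f i)) \<le> ennreal R" and R: "0 \<le> R"
  shows "summable f" "(\<Sum>i. f i) \<le> R"
proof -
  have "(\<Sum>i. ennreal (f i)) \<noteq> \<top>" using le by (auto simp: top_unique)
  then show s: "summable f" using f by (intro summable_suminf_not_top) auto
  have "ennreal (\<Sum>i. f i) \<le> ennreal R" using le suminf_ennreal2[OF f s] by simp
  then show "(\<Sum>i. f i) \<le> R" using R by simp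
qed

text \<open>About \<open>ln N / c\<close> indices \<open>j\<close> satisfy
  \<open>exp (c * j) < N\<close>, and each term is at most a power \<open>\<gamma>\<close> of that
  number. Here a logarithmic moment of order \<open>\<gamma> + 1\<close> becomes summability with a
  weight of order \<open>\<gamma>\<close>.\<close>

lemma sum_powr_log_plus_le:
  assumes c: "0 < c" and \<gamma>: "0 \<le> \<gamma>"
  obtains D where "0 < D"
    "\<And>N::nat. (\<Sum>j. ennreal (real (Suc j) powr \<gamma> * of_bool (exp (c * real j) < real N))) \<le> ennreal (D * log_plus (real N) powr (\<gamma> + 1))"
proof -
  \<comment> \<open>\<open>1 / c\<close> comes from the number of indices, and
    \<open>1 / ln 2\<close> absorbs the rounding error 1, since \<open>1 \<le> ln N / ln 2\<close>
    for \<open>N\<close> at least 2.\<close>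
  define D where "D = (1 / c + 1 / ln 2) powr (\<gamma> + 1)"
  have ln2: "0 < ln (2::real)" by simp
  have b: "0 < 1 / c + 1 / ln (2::real)" using c ln2 by (intro add_pos_pos) auto
  have "0 < D" using b by (simp add: D_def)
  moreover have "(\<Sum>j. ennreal (real (Suc j) powr \<gamma> * of_bool (exp (c * real j) < real N))) \<le> ennreal (D * log_plus (real N) powr (\<gamma> + 1))" for N :: nat
  proof (cases "2 \<le> N")
    \<comment> \<open>For \<open>N\<close> at most 1 no index counts, because
      \<open>exp (c * real j)\<close> is at least 1; this matches the value 0 of
      \<open>log_plus\<close>.\<close>
    case False
    have "\<not> exp (c * real j) < real N" for j
    proof -
      have "1 \<le> exp (c * real j)" using c by simp
      moreover have "real N \<le> 1" using False by simp
      ultimately show ?thesis by linarith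
    qed
    then show ?thesis by simp
  next
    case True
    let ?y = "ln (real N)"
    have y: "ln 2 \<le> ?y" using True by simp
    have lp: "log_plus (real N) = ?y" using y ln2 unfolding log_plus_def by linarith
    define J where "J = nat \<lceil>?y / c\<rceil>"
    have yc: "0 \<le> ?y / c" using y ln2 c by (intro divide_nonneg_pos) linarith+
    have J: "?y / c \<le> real J" "real J \<le> ?y / c + 1"
      unfolding J_def using yc by linarith+
    have zero: "j < J" if "exp (c * real j) < real N" for j
    proof -
      have "ln (exp (c * real j)) < ?y" using that by (subst ln_less_cancel_iff) (use True in auto)
      then have "real j < ?y / c" using c by (simp add: less_divide_eq mult.commute)
      then show ?thesis using J(1) by linarith
    qed
    have "(\<Sum>j. ennreal (real (Suc j) powr \<gamma> * of_bool (exp (c * real j) < real N))) = (\<Sum>j<J. ennreal (real (Suc j) powr \<gamma> * of_bool (exp (c * real j) < real N)))"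
      using zero by (intro suminf_finite) auto
    also have "\<dots> \<le> (\<Sum>j<J. ennreal (real J powr \<gamma>))"
      using \<gamma> by (intro sum_mono ennreal_leI) (auto simp: of_bool_def intro!: powr_mono2)
    also have "\<dots> = ennreal (real J * real J powr \<gamma>)" by (simp add: ennreal_mult ennreal_of_nat_eq_real_of_nat)
    also have "\<dots> \<le> ennreal (D * log_plus (real N) powr (\<gamma> + 1))"
    proof (rule ennreal_leI)
      have "1 \<le> ?y / ln 2" using y ln2 by (simp add: le_divide_eq)
      then have "real J \<le> ?y / c + ?y / ln 2" using J(2) by linarith
      then have "real J \<le> (1 / c + 1 / ln 2) * ?y" by (simp add: distrib_right)
      then have "real J powr (\<gamma> + 1) \<le> ((1 / c + 1 / ln 2) * ?y) powr (\<gamma> + 1)"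
        using \<gamma> by (intro powr_mono2) auto
      also have "\<dots> = D * ?y powr (\<gamma> + 1)" unfolding D_def using b y ln2 by (intro powr_mult) 
      finally show "real J * real J powr \<gamma> \<le> D * log_plus (real N) powr (\<gamma> + 1)"
        unfolding lp by (cases "J = 0") (simp_all add: powr_add mult.commute)
    qed
    finally show ?thesis .
  qed
  ultimately show thesis by (rule that)
qed

locale brw_local_limit = brw_random_environment +
  fixes \<beta> :: real
  assumes m0_pos_finite: "AE \<omega> in M. 0 < mean_offspring (\<eta> (\<xi> 0 \<omega>)) \<and> mean_offspring (\<eta> (\<xi> 0 \<omega>)) < \<infinity>"
    and log_m0_integrable: "integrable M (\<lambda>\<omega>. ln (enn2real (mean_offspring (\<eta> (\<xi> 0 \<omega>)))))"
    and supercritical: "0 < (\<integral>\<omega>. ln (enn2real (mean_offspring (\<eta> (\<xi> 0 \<omega>)))) \<partial>M)"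
    and nonlattice: "AE \<omega> in M. non_lattice (\<nu>_of (\<eta> (\<xi> 0 \<omega>)))"
    and sigma2_pos: "0 < (\<integral>\<^sup>+\<omega>. \<sigma>2_of (\<eta> (\<xi> 0 \<omega>)) \<partial>M)"
    and sigma2_finite: "(\<integral>\<^sup>+\<omega>. \<sigma>2_of (\<eta> (\<xi> 0 \<omega>)) \<partial>M) < \<infinity>"
    and beta: "\<beta> > 3 / 2"
    and N_log_N_beta: "(\<integral>\<^sup>+\<omega>. of_nat (fst (X [] \<omega>)) / mean_offspring (\<eta> (\<xi> 0 \<omega>))
                        * ennreal (log_plus (real (fst (X [] \<omega>))) powr \<beta>) \<partial>M) < \<infinity>"
begin

definition mean_real :: "'b \<Rightarrow> real" where "mean_real e = enn2real (mean_offspring (\<eta> e))"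

definition mean_prod :: "(nat \<Rightarrow> 'b) \<Rightarrow> nat \<Rightarrow> real" where "mean_prod x n = (\<Prod>i<n. mean_real (x i))"

text \<open>The products of means need growth with exponent \<open>3 * rate\<close>. Dividing by 6
  makes this half of the mean of \<open>ln\<close>, strictly below it, so the ergodic theorem yields
  the growth from some generation on.\<close>

definition rate :: real where "rate = (\<integral>\<omega>. ln (mean_real (\<xi> 0 \<omega>)) \<partial>M) / 6"

lemma rate_pos: "0 < rate"
  using supercritical by (simp add: rate_def mean_real_def)

lemma measurable_mean_real [measurable]: "mean_real \<in> borel_measurable \<Theta>"
  unfolding mean_real_def[abs_def] by measurable

definition regular_env :: "(nat \<Rightarrow> 'b) \<Rightarrow> bool" where
  "regular_env x \<longleftrightarrow> x \<in> space env \<and> (\<forall>j. 0 < mean_offspring (\<eta> (x j)) \<and> mean_offspring (\<eta> (x j)) < \<infinity> \<and> \<sigma>2_of (\<eta> (x j)) < \<infinity>)"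

lemma AE_sigma2_finite: "AE \<omega> in M. \<sigma>2_of (\<eta> (\<xi> 0 \<omega>)) < \<infinity>"
  using nn_integral_PInf_AE[of "\<lambda>\<omega>. \<sigma>2_of (\<eta> (\<xi> 0 \<omega>))" M] sigma2_finite measurable_compose[OF \<xi>_measurable measurable_\<sigma>2_of]
  by (auto simp: less_top)

lemma AE_regular_env: "AE x in L. regular_env x"
proof -
  have "AE x in L. \<forall>j. 0 < mean_offspring (\<eta> (x j)) \<and> mean_offspring (\<eta> (x j)) < \<infinity> \<and> \<sigma>2_of (\<eta> (x j)) < \<infinity>"
  proof (rule AE_env_coordinate[of "\<lambda>e. 0 < mean_offspring (\<eta> e) \<and> mean_offspring (\<eta> e) < \<infinity> \<and> \<sigma>2_of (\<eta> e) < \<infinity>"])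
    show "AE \<omega> in M. 0 < mean_offspring (\<eta> (\<xi> 0 \<omega>)) \<and> mean_offspring (\<eta> (\<xi> 0 \<omega>)) < \<infinity> \<and> \<sigma>2_of (\<eta> (\<xi> 0 \<omega>)) < \<infinity>"
      using m0_pos_finite AE_sigma2_finite by eventually_elim simp
  qed measurable
  then show ?thesis using AE_space by eventually_elim (auto simp: regular_env_def)
qed

lemma regular_env_quenched: "regular_env x \<Longrightarrow> quenched (\<lambda>j. \<eta> (x j))"
  by (rule quenched.intro) (simp_all add: regular_env_def \<eta>_sets \<eta>_prob space_env_D)

lemma regular_env_sq_dist:
  assumes "regular_env x"
  shows "sq_dist (\<nu>_of (\<eta> (x j)))" "var_of (\<nu>_of (\<eta> (x j))) = enn2real (\<sigma>2_of (\<eta> (x j)))"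
    "tail_var K (\<nu>_of (\<eta> (x j))) = tail_env K (x j)"
proof -
  show sq: "sq_dist (\<nu>_of (\<eta> (x j)))" and "var_of (\<nu>_of (\<eta> (x j))) = enn2real (\<sigma>2_of (\<eta> (x j)))"
  proof -
    have f: "0 < mean_offspring (\<eta> (x j))" "mean_offspring (\<eta> (x j)) < \<infinity>" "\<sigma>2_of (\<eta> (x j)) < \<infinity>" "x j \<in> space \<Theta>"
      using assms by (auto simp: regular_env_def intro: space_env_D)
    then show "sq_dist (\<nu>_of (\<eta> (x j)))" "var_of (\<nu>_of (\<eta> (x j))) = enn2real (\<sigma>2_of (\<eta> (x j)))"
      by (intro sq_dist_\<nu>_of \<eta>_sets; simp)+
  qed
  show "tail_var K (\<nu>_of (\<eta> (x j))) = tail_env K (x j)"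
    unfolding tail_var_nn[OF sq] tail_env_def \<mu>_of_def ..
qed

lemma regular_env_mean_pos: "regular_env x \<Longrightarrow> 0 < mean_real (x j)"
  by (auto simp: regular_env_def mean_real_def enn2real_positive_iff)

lemma AE_growth: "AE x in L. \<exists>C>0. \<forall>n. C * exp (3 * rate * real n) \<le> mean_prod x n"
proof -
  have [measurable]: "(\<lambda>e. ln (mean_real e)) \<in> borel_measurable \<Theta>" by measurable
  have int: "integrable L (\<lambda>x. ln (mean_real (x 0)))"
    using integrable_env_coordinate(1)[of "\<lambda>e. ln (mean_real e)"] log_m0_integrable by (simp add: mean_real_def)
  have lim: "(LINT x|L. ln (mean_real (x 0))) = 6 * rate"
    using integrable_env_coordinate(2)[of "\<lambda>e. ln (mean_real e)"] by (simp add: rate_def)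
  from E.birkhoff_liminf[OF int] AE_regular_env show ?thesis
  proof eventually_elim
    case (elim x)
    have "3 * rate < (LINT x|L. ln (mean_real (x 0)))" using lim rate_pos by simp
    then have "\<forall>\<^sub>F n in sequentially. 3 * rate * real n \<le> E.birkhoff (\<lambda>x. ln (mean_real (x 0))) n x" using elim(1) by blast
    then have "\<forall>\<^sub>F n in sequentially. exp (3 * rate * real n) \<le> mean_prod x n"
    proof eventually_elim
      case (elim n)
      have "mean_prod x n = exp (E.birkhoff (\<lambda>x. ln (mean_real (x 0))) n x)"
        using regular_env_mean_pos[OF \<open>regular_env x\<close>] by (simp add: mean_prod_def E.birkhoff_def E.shift_pow exp_sum)
      with elim show ?case by simp
    qed
    then obtain C where "0 < C" "\<And>n. C * exp (3 * rate * real n) \<le> mean_prod x n"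
      by (rule eventually_le_imp_const_mult_le) (use regular_env_mean_pos[OF \<open>regular_env x\<close>] in \<open>auto simp: mean_prod_def prod_pos\<close>)
    then show ?case by blast
  qed
qed

text \<open>The mean of the part of the offspring number cut off in generation \<open>j\<close>; by stationarity it is the same
  for every generation.\<close>

definition expected_over :: "nat \<Rightarrow> ennreal" where
  "expected_over j = (\<integral>\<^sup>+\<omega>. of_nat (fst (X [] \<omega>)) / mean_offspring (\<eta> (\<xi> 0 \<omega>)) * of_bool (exp (rate * real j) < real (fst (X [] \<omega>))) \<partial>M)"

lemma measurable_root:
  "(\<lambda>\<omega>. of_nat (fst (X [] \<omega>)) / mean_offspring (\<eta> (\<xi> 0 \<omega>)) * h (real (fst (X [] \<omega>)))) \<in> borel_measurable M"
  for h :: "real \<Rightarrow> ennreal"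
  using measurable_compose[OF measurable_Pair[OF \<xi>_measurable[of 0] X_measurable[of "[]"]] measurable_over_integrand[of h]] by simp

text \<open>Tonelli moves the sum over generations inside the expectation, where
  \<open>sum_powr_log_plus_le\<close> with exponent \<open>\<beta> - 1\<close> turns it into the
  moment of order \<open>\<beta>\<close>.\<close>

lemma sum_expected_over: "(\<Sum>j. ennreal (real (Suc j) powr (\<beta> - 1)) * expected_over j) < \<infinity>"
proof -
  let ?N = "\<lambda>\<omega>. fst (X [] \<omega>)" and ?m = "\<lambda>\<omega>. mean_offspring (\<eta> (\<xi> 0 \<omega>))"
  obtain D where D: "0 < D" "\<And>N::nat. (\<Sum>j. ennreal (real (Suc j) powr (\<beta> - 1) * of_bool (exp (rate * real j) < real N))) \<le> ennreal (D * log_plus (real N) powr ((\<beta> - 1) + 1))"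
  proof -
    have "0 \<le> \<beta> - 1" using beta by simp
    from sum_powr_log_plus_le[OF rate_pos this] show thesis using that by blast
  qed
  have "(\<Sum>j. ennreal (real (Suc j) powr (\<beta> - 1)) * expected_over j)
    = (\<Sum>j. \<integral>\<^sup>+\<omega>. ennreal (real (Suc j) powr (\<beta> - 1)) * (of_nat (?N \<omega>) / ?m \<omega> * of_bool (exp (rate * real j) < real (?N \<omega>))) \<partial>M)"
    unfolding expected_over_def using measurable_root[of "\<lambda>x. of_bool (exp (rate * real j) < x)" for j] by (simp add: nn_integral_cmult)
  also have "\<dots> = (\<integral>\<^sup>+\<omega>. (\<Sum>j. ennreal (real (Suc j) powr (\<beta> - 1)) * (of_nat (?N \<omega>) / ?m \<omega> * of_bool (exp (rate * real j) < real (?N \<omega>)))) \<partial>M)"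
    using measurable_root[of "\<lambda>x. of_bool (exp (rate * real j) < x)" for j] by (intro nn_integral_suminf[symmetric]) simp
  also have "\<dots> \<le> (\<integral>\<^sup>+\<omega>. ennreal D * (of_nat (?N \<omega>) / ?m \<omega> * ennreal (log_plus (real (?N \<omega>)) powr \<beta>)) \<partial>M)"
  proof (rule nn_integral_mono)
    fix \<omega>
    have "ennreal (real (Suc j) powr (\<beta> - 1)) * (of_nat (?N \<omega>) / ?m \<omega> * of_bool (exp (rate * real j) < real (?N \<omega>)))
      = of_nat (?N \<omega>) / ?m \<omega> * ennreal (real (Suc j) powr (\<beta> - 1) * of_bool (exp (rate * real j) < real (?N \<omega>)))" for j
      by (simp add: mult_ac of_bool_def)
    then have "(\<Sum>j. ennreal (real (Suc j) powr (\<beta> - 1)) * (of_nat (?N \<omega>) / ?m \<omega> * of_bool (exp (rate * real j) < real (?N \<omega>))))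
      = of_nat (?N \<omega>) / ?m \<omega> * (\<Sum>j. ennreal (real (Suc j) powr (\<beta> - 1) * of_bool (exp (rate * real j) < real (?N \<omega>))))"
      by (simp only: ennreal_suminf_cmult)
    also have "\<dots> \<le> of_nat (?N \<omega>) / ?m \<omega> * ennreal (D * log_plus (real (?N \<omega>)) powr \<beta>)"
      using D(2)[of "?N \<omega>"] by (intro mult_left_mono) auto
    also have "\<dots> = ennreal D * (of_nat (?N \<omega>) / ?m \<omega> * ennreal (log_plus (real (?N \<omega>)) powr \<beta>))"
      using D(1) by (simp add: ennreal_mult mult_ac)
    finally show "(\<Sum>j. ennreal (real (Suc j) powr (\<beta> - 1)) * (of_nat (?N \<omega>) / ?m \<omega> * of_bool (exp (rate * real j) < real (?N \<omega>))))
      \<le> ennreal D * (of_nat (?N \<omega>) / ?m \<omega> * ennreal (log_plus (real (?N \<omega>)) powr \<beta>))" .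
  qed
  also have "\<dots> = ennreal D * (\<integral>\<^sup>+\<omega>. of_nat (?N \<omega>) / ?m \<omega> * ennreal (log_plus (real (?N \<omega>)) powr \<beta>) \<partial>M)"
    using measurable_root[of "\<lambda>x. ennreal (log_plus x powr \<beta>)"] by (rule nn_integral_cmult)
  also have "\<dots> < \<infinity>" using N_log_N_beta by (simp add: ennreal_mult_less_top)
  finally show ?thesis .
qed

lemma nn_integral_over_env_rate: "(\<integral>\<^sup>+x. over_env (exp (rate * real i)) (x j) \<partial>L) = expected_over i"
  unfolding nn_integral_over_env expected_over_def ..

lemma measurable_coordinate_L: "f \<in> borel_measurable \<Theta> \<Longrightarrow> (\<lambda>x. f (x j)) \<in> borel_measurable L"
  by (simp add: measurable_cong_sets[OF sets_L refl])

lemma regular_env_mean_over: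
  assumes "regular_env x" shows "ennreal (quenched.mean_over (\<lambda>j. \<eta> (x j)) \<tau> j) = over_env \<tau> (x j)"
proof -
  interpret quenched "\<lambda>j. \<eta> (x j)" by (rule regular_env_quenched[OF assms])
  have a: "of_nat k / mean_offspring (\<eta> (x j)) = ennreal (real k / m j)" for k :: nat
    unfolding mean_eq using m_pos[of j] by (simp add: ennreal_of_nat_eq_real_of_nat divide_ennreal)
  have b: "ennreal (y * of_bool b) = ennreal y * of_bool b" for y b by (simp add: of_bool_def)
  show ?thesis unfolding mean_over_eq over_env_def a b ..
qed

lemma AE_over: "AE x in L. summable (\<lambda>j. real (Suc j) powr (\<beta> - 1) * quenched.mean_over (\<lambda>j. \<eta> (x j)) (exp (rate * real j)) j)"
proof -
  have "(\<integral>\<^sup>+x. (\<Sum>j. ennreal (real (Suc j) powr (\<beta> - 1)) * over_env (exp (rate * real j)) (x j)) \<partial>L)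
    = (\<Sum>j. ennreal (real (Suc j) powr (\<beta> - 1)) * expected_over j)"
    using measurable_coordinate_L[OF measurable_over_env]
    by (subst nn_integral_suminf) (simp_all add: nn_integral_cmult nn_integral_over_env_rate)
  with sum_expected_over have "AE x in L. (\<Sum>j. ennreal (real (Suc j) powr (\<beta> - 1)) * over_env (exp (rate * real j)) (x j)) \<noteq> \<infinity>"
    using measurable_coordinate_L[OF measurable_over_env] by (intro nn_integral_PInf_AE) auto
  then show ?thesis using AE_regular_env
  proof eventually_elim
    case (elim x)
    interpret quenched "\<lambda>j. \<eta> (x j)" by (rule regular_env_quenched[OF elim(2)])
    have "ennreal (real (Suc j) powr (\<beta> - 1)) * over_env (exp (rate * real j)) (x j) = ennreal (real (Suc j) powr (\<beta> - 1) * mean_over (exp (rate * real j)) j)" for j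
      unfolding regular_env_mean_over[OF elim(2), symmetric] by (simp add: ennreal_mult mean_over_nonneg)
    with elim(1) show ?case
      by (intro summable_suminf_not_top) (auto simp: mean_over_nonneg)
  qed
qed

lemma regular_env_growth:
  assumes x: "regular_env x" and C: "0 < C" "\<And>n. C * exp (3 * rate * real n) \<le> mean_prod x n"
    and s: "summable (\<lambda>j. real (Suc j) powr (\<beta> - 1) * quenched.mean_over (\<lambda>j. \<eta> (x j)) (exp (rate * real j)) j)"
  shows "quenched_growth (\<lambda>j. \<eta> (x j)) rate C"
proof -
  interpret quenched "\<lambda>j. \<eta> (x j)" by (rule regular_env_quenched[OF x])
  have P: "P n = mean_prod x n" for n by (simp add: P_def mean_prod_def m_def mean_real_def)
  show ?thesis
  proof (intro quenched_growth.intro quenched_axioms quenched_growth_axioms.intro rate_pos C(1))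
    show "C * exp (3 * rate * real n) \<le> P n" for n unfolding P by (rule C(2))
    show "summable (\<lambda>j. mean_over (exp (rate * real j)) j)"
    proof (rule summable_comparison_test'[OF s])
      fix j
      have "1 \<le> real (Suc j) powr (\<beta> - 1)" using beta by (intro ge_one_powr_ge_zero) auto
      then show "norm (mean_over (exp (rate * real j)) j) \<le> real (Suc j) powr (\<beta> - 1) * mean_over (exp (rate * real j)) j"
        using mult_right_mono[of 1 "real (Suc j) powr (\<beta> - 1)" "mean_over (exp (rate * real j)) j"] by (simp add: mean_over_nonneg)
    qed
  qed
qed

end

section \<open>Recurrence of favourable environments\<close>

context brw_local_limit
begin

text \<open>For an environment seen from a restart generation: the total mean of the families cut
  off when the truncation level starts at \<open>exp (rate * real q)\<close>. The delay
  \<open>q\<close> makes this small in mean, while \<open>roughness\<close>, the sum of the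
  fluctuation bounds, stays finite for every \<open>q\<close>.\<close>

definition excess :: "nat \<Rightarrow> (nat \<Rightarrow> 'b) \<Rightarrow> ennreal" where
  "excess q x = (\<Sum>i. over_env (exp (rate * real (i + q))) (x i))"

definition roughness :: "nat \<Rightarrow> (nat \<Rightarrow> 'b) \<Rightarrow> ennreal" where
  "roughness q x = (\<Sum>i. ennreal (sqrt (exp (rate * real (i + q)) / mean_prod x (Suc i))))"

lemma measurable_excess [measurable]: "excess q \<in> borel_measurable L"
  unfolding excess_def[abs_def] using measurable_coordinate_L[OF measurable_over_env] by (intro borel_measurable_suminf_order) simp

lemma measurable_mean_prod [measurable]: "(\<lambda>x. mean_prod x n) \<in> borel_measurable L"
  unfolding mean_prod_def using measurable_coordinate_L[OF measurable_mean_real] by measurable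

lemma measurable_roughness [measurable]: "roughness q \<in> borel_measurable L"
  unfolding roughness_def[abs_def] by measurable

text \<open>By stationarity the mean of \<open>excess q\<close> is the tail from \<open>q\<close> on
  of the convergent series of the \<open>expected_over j\<close>.\<close>

lemma excess_small:
  assumes e: "0 < e"
  obtains q where "(\<integral>\<^sup>+x. excess q x \<partial>L) < ennreal e"
proof -
  have E: "(\<integral>\<^sup>+x. excess q x \<partial>L) = (\<Sum>i. expected_over (i + q))" for q
    unfolding excess_def using measurable_coordinate_L[OF measurable_over_env]
    by (subst nn_integral_suminf) (simp_all add: nn_integral_over_env_rate del: of_nat_add)
  have "(\<Sum>j. expected_over j) \<le> (\<Sum>j. ennreal (real (Suc j) powr (\<beta> - 1)) * expected_over j)"
  proof (intro suminf_le allI)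
    fix j
    have "1 \<le> real (Suc j) powr (\<beta> - 1)" using beta by (intro ge_one_powr_ge_zero) auto
    then have "1 \<le> ennreal (real (Suc j) powr (\<beta> - 1))" by (metis ennreal_1 ennreal_leI)
    then show "expected_over j \<le> ennreal (real (Suc j) powr (\<beta> - 1)) * expected_over j" using mult_right_mono[of 1 _ "expected_over j"] by simp
  qed auto
  with sum_expected_over have fin: "(\<Sum>j. expected_over j) < \<top>" by (simp add: le_less_trans)
  have dfin: "expected_over j < \<top>" for j
  proof -
    have "expected_over j \<le> (\<Sum>j. expected_over j)" using sum_le_suminf[of expected_over "{j}"] by simp
    then show ?thesis using fin by (rule le_less_trans)
  qed
  define f where "f j = enn2real (expected_over j)" for j
  have df: "expected_over j = ennreal (f j)" for j using dfin[of j] by (simp add: f_def)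
  have f0: "0 \<le> f j" for j by (simp add: f_def)
  have sf: "summable f" using fin unfolding df by (intro summable_suminf_not_top) (auto simp: f0)
  obtain q where q: "norm (\<Sum>i. f (i + q)) < e" using suminf_exist_split[OF e sf] by blast
  have "(\<Sum>i. expected_over (i + q)) = ennreal (\<Sum>i. f (i + q))"
    unfolding df by (rule suminf_ennreal2) (use f0 sf in \<open>auto simp: summable_iff_shift\<close>)
  also have "\<dots> < ennreal e" using q e by (intro ennreal_lessI) auto
  finally show thesis using that[of q] E by simp
qed

lemma AE_roughness_finite: "AE x in L. roughness q x < \<top>"
  using AE_growth AE_over AE_regular_env
proof eventually_elim
  case (elim x)
  then obtain C where C: "0 < C" "\<And>n. C * exp (3 * rate * real n) \<le> mean_prod x n" by blast
  interpret quenched_growth "\<lambda>j. \<eta> (x j)" rate C by (rule regular_env_growth[OF elim(3) C elim(2)])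
  have P: "P n = mean_prod x n" for n by (simp add: P_def mean_prod_def m_def mean_real_def)
  have le: "sqrt (exp (rate * real (i + q)) / mean_prod x (Suc i)) \<le> sqrt (exp (rate * real q)) * ((1 / sqrt C) * exp (- rate) ^ i)" for i
  proof -
    have "sqrt (exp (rate * real (i + q)) / mean_prod x (Suc i)) = sqrt (exp (rate * real q)) * sqrt (exp (rate * real i) / P (Suc i))"
      unfolding P by (simp only: real_sqrt_mult[symmetric] of_nat_add distrib_left exp_add) (simp add: mult.commute)
    then show ?thesis using mult_left_mono[OF fluct_bound[of i], of "sqrt (exp (rate * real q))"] by simp
  qed
  have s: "summable (\<lambda>i. sqrt (exp (rate * real q)) * ((1 / sqrt C) * exp (- rate) ^ i))"
    using rate_pos by (intro summable_mult summable_geometric) simp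
  have "roughness q x \<le> (\<Sum>i. ennreal (sqrt (exp (rate * real q)) * ((1 / sqrt C) * exp (- rate) ^ i)))"
    unfolding roughness_def using le by (intro suminf_le ennreal_leI) auto
  also have "\<dots> = ennreal (\<Sum>i. sqrt (exp (rate * real q)) * ((1 / sqrt C) * exp (- rate) ^ i))"
    using C(1) by (intro suminf_ennreal2 s) auto
  also have "\<dots> < \<top>" by simp
  finally show ?case .
qed

text \<open>\<open>excess q\<close> has mean strictly below \<open>e\<close>, so it cannot be at
  least \<open>e\<close> almost everywhere; as \<open>roughness q\<close> is almost surely finite,
  some integer \<open>R\<close> bounds it on a set of positive measure where the excess is
  small.\<close>

lemma good_set_positive:
  assumes e: "0 < e"
  shows "\<exists>q (R::nat). 0 < measure L {x \<in> space L. excess q x \<le> ennreal e \<and> roughness q x \<le> ennreal (real R)}"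
proof -
  obtain q where q: "(\<integral>\<^sup>+x. excess q x \<partial>L) < ennreal e" by (rule excess_small[OF e])
  show ?thesis
  proof (rule ccontr)
    assume "\<not> ?thesis"
    then have 0: "measure L {x \<in> space L. excess q x \<le> ennreal e \<and> roughness q x \<le> ennreal (real R)} = 0" for R :: nat
      using measure_nonneg[of L] by (auto simp: not_less intro: antisym)
    have "AE x in L. \<forall>R::nat. \<not> (excess q x \<le> ennreal e \<and> roughness q x \<le> ennreal (real R))"
      unfolding AE_all_countable
    proof
      fix R :: nat
      have "{x \<in> space L. excess q x \<le> ennreal e \<and> roughness q x \<le> ennreal (real R)} \<in> sets L" by measurable
      from E.prob_eq_0[OF this] 0[of R] AE_space
      show "AE x in L. \<not> (excess q x \<le> ennreal e \<and> roughness q x \<le> ennreal (real R))"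
        by simp (elim AE_mp, auto)
    qed
    with AE_roughness_finite[of q] have "AE x in L. ennreal e \<le> excess q x"
    proof eventually_elim
      case (elim x)
      have "roughness q x = ennreal (enn2real (roughness q x))" using elim(1) by simp
      moreover obtain R :: nat where "enn2real (roughness q x) \<le> real R" using real_arch_simple by blast
      ultimately have "roughness q x \<le> ennreal (real R)" by (metis ennreal_leI)
      with elim(2) have "\<not> excess q x \<le> ennreal e" by blast
      then show ?case by simp
    qed
    then have "(\<integral>\<^sup>+x. ennreal e \<partial>L) \<le> (\<integral>\<^sup>+x. excess q x \<partial>L)" by (rule nn_integral_mono_AE)
    with q show False by (simp add: E.emeasure_space_1[simplified])
  qed
qed

lemma AE_recurrence: "AE x in L. \<forall>e>0. \<exists>q (R::nat). \<exists>\<^sub>\<infinity>k. excess q (\<lambda>i. x (k + i)) \<le> ennreal e \<and> roughness q (\<lambda>i. x (k + i)) \<le> ennreal (real R)"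
proof -
  have "AE x in L. \<exists>q (R::nat). \<exists>\<^sub>\<infinity>k. excess q (\<lambda>i. x (k + i)) \<le> ennreal (1 / real (Suc n)) \<and> roughness q (\<lambda>i. x (k + i)) \<le> ennreal (real R)" for n
  proof -
    obtain q R where pos: "0 < measure L {x \<in> space L. excess q x \<le> ennreal (1 / real (Suc n)) \<and> roughness q x \<le> ennreal (real (R::nat))}"
      using good_set_positive[of "1 / real (Suc n)"] by auto
    have "{x \<in> space L. excess q x \<le> ennreal (1 / real (Suc n)) \<and> roughness q x \<le> ennreal (real R)} \<in> sets L" by measurable
    from E.recurrence[OF this pos] show ?thesis
    proof eventually_elim
      case (elim x)
      then have "\<exists>\<^sub>\<infinity>k. excess q (\<lambda>i. x (k + i)) \<le> ennreal (1 / real (Suc n)) \<and> roughness q (\<lambda>i. x (k + i)) \<le> ennreal (real R)"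
        by (rule INFM_mono) (simp add: E.shift_pow)
      then show ?case by blast
    qed
  qed
  then have "AE x in L. \<forall>n. \<exists>q (R::nat). \<exists>\<^sub>\<infinity>k. excess q (\<lambda>i. x (k + i)) \<le> ennreal (1 / real (Suc n)) \<and> roughness q (\<lambda>i. x (k + i)) \<le> ennreal (real R)"
    by (simp add: AE_all_countable)
  then show ?thesis
  proof eventually_elim
    case (elim x)
    show ?case
    proof (intro allI impI)
      fix e :: real assume "0 < e"
      then obtain n where n: "inverse (real (Suc n)) < e" using reals_Archimedean by blast
      then have le: "ennreal (1 / real (Suc n)) \<le> ennreal e" by (intro ennreal_leI) (simp add: inverse_eq_divide)
      obtain q and R :: nat where "\<exists>\<^sub>\<infinity>k. excess q (\<lambda>i. x (k + i)) \<le> ennreal (1 / real (Suc n)) \<and> roughness q (\<lambda>i. x (k + i)) \<le> ennreal (real R)"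
        using elim by blast
      then have "\<exists>\<^sub>\<infinity>k. excess q (\<lambda>i. x (k + i)) \<le> ennreal e \<and> roughness q (\<lambda>i. x (k + i)) \<le> ennreal (real R)"
        by (rule INFM_mono) (use le order_trans in blast)
      then show "\<exists>q (R::nat). \<exists>\<^sub>\<infinity>k. excess q (\<lambda>i. x (k + i)) \<le> ennreal e \<and> roughness q (\<lambda>i. x (k + i)) \<le> ennreal (real R)"
        by blast
    qed
  qed
qed

lemma regular_env_survival:
  assumes x: "regular_env x"
    and rec: "\<forall>e>0. \<exists>q (R::nat). \<exists>\<^sub>\<infinity>k. excess q (\<lambda>i. x (k + i)) \<le> ennreal e \<and> roughness q (\<lambda>i. x (k + i)) \<le> ennreal (real R)"
  shows "AE t in quenched.Q (\<lambda>j. \<eta> (x j)). filterlim (\<lambda>n. card (particles t n)) at_top sequentially \<longrightarrow>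
     \<not> (\<lambda>n. quenched.W (\<lambda>j. \<eta> (x j)) n t) \<longlonglongrightarrow> 0"
proof -
  interpret quenched "\<lambda>j. \<eta> (x j)" by (rule regular_env_quenched[OF x])
  have P: "P n = mean_prod x n" for n by (simp add: P_def mean_prod_def m_def mean_real_def)
  show ?thesis
  proof (rule survival_positive)
    fix e :: real assume e: "0 < e"
    then obtain q and R :: nat where inf: "\<exists>\<^sub>\<infinity>k. excess q (\<lambda>i. x (k + i)) \<le> ennreal e \<and> roughness q (\<lambda>i. x (k + i)) \<le> ennreal (real R)"
      using rec by blast
    define \<tau> where "\<tau> i = exp (rate * real (i + q))" for i
    have "\<exists>\<^sub>\<infinity>k. summable (\<lambda>i. sqrt (\<tau> i * P k / P (Suc (k + i)))) \<and> (\<Sum>i. sqrt (\<tau> i * P k / P (Suc (k + i)))) \<le> real R \<and>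
      summable (\<lambda>i. mean_over (\<tau> i) (k + i)) \<and> (\<Sum>i. mean_over (\<tau> i) (k + i)) \<le> e"
      using inf
    proof (rule INFM_mono, elim conjE)
      fix k assume ex: "excess q (\<lambda>i. x (k + i)) \<le> ennreal e" and ro: "roughness q (\<lambda>i. x (k + i)) \<le> ennreal (real R)"
      \<comment> \<open>The mean product of the environment shifted by \<open>k\<close> is a
        quotient of the original ones, which makes its \<open>roughness\<close> the series required
        by \<open>survival_positive\<close>.\<close>
      have Pk: "mean_prod (\<lambda>i. x (k + i)) n = P (k + n) / P k" for n
      proof -
        have "P (k + n) = P k * mean_prod (\<lambda>i. x (k + i)) n"
          unfolding P by (induction n) (simp_all add: mean_prod_def)
        then show ?thesis using P_pos[of k] by simp
      qed
      have r: "(\<Sum>i. ennreal (sqrt (\<tau> i * P k / P (Suc (k + i))))) \<le> ennreal (real R)"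
        using ro unfolding roughness_def Pk \<tau>_def by simp
      have o: "(\<Sum>i. ennreal (mean_over (\<tau> i) (k + i))) \<le> ennreal e"
        using ex unfolding excess_def regular_env_mean_over[OF x] \<tau>_def .
      have "0 \<le> sqrt (\<tau> i * P k / P (Suc (k + i)))" for i
        using P_pos[of k] P_pos[of "Suc (k + i)"] by (simp add: \<tau>_def less_imp_le)
      from suminf_ennreal_le_imp[OF this r] suminf_ennreal_le_imp[OF mean_over_nonneg o] e
      show "summable (\<lambda>i. sqrt (\<tau> i * P k / P (Suc (k + i)))) \<and> (\<Sum>i. sqrt (\<tau> i * P k / P (Suc (k + i)))) \<le> real R \<and>
        summable (\<lambda>i. mean_over (\<tau> i) (k + i)) \<and> (\<Sum>i. mean_over (\<tau> i) (k + i)) \<le> e"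
        by simp
    qed
    moreover have "0 < \<tau> i" for i by (simp add: \<tau>_def)
    ultimately show "\<exists>\<tau> R. (\<forall>i. 0 < \<tau> i) \<and> (\<exists>\<^sub>\<infinity>k.
      summable (\<lambda>i. sqrt (\<tau> i * P k / P (Suc (k + i)))) \<and> (\<Sum>i. sqrt (\<tau> i * P k / P (Suc (k + i)))) \<le> R \<and>
      summable (\<lambda>i. mean_over (\<tau> i) (k + i)) \<and> (\<Sum>i. mean_over (\<tau> i) (k + i)) \<le> e)"
      by blast
  qed
qed

section \<open>Averages along the environment: variance, Lindeberg condition, decay of
  characteristic functions\<close>

definition s2 :: real where "s2 = (LINT x|L. enn2real (\<sigma>2_of (\<eta> (x 0))))"

lemma nn_integral_sigma2: "(\<integral>\<^sup>+x. ennreal (enn2real (\<sigma>2_of (\<eta> (x 0)))) \<partial>L) = (\<integral>\<^sup>+\<omega>. \<sigma>2_of (\<eta> (\<xi> 0 \<omega>)) \<partial>M)"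
proof -
  have "(\<integral>\<^sup>+x. ennreal (enn2real (\<sigma>2_of (\<eta> (x 0)))) \<partial>L) = (\<integral>\<^sup>+x. \<sigma>2_of (\<eta> (x 0)) \<partial>L)"
    by (rule nn_integral_cong_AE) (use AE_regular_env in \<open>eventually_elim, simp add: regular_env_def\<close>)
  then show ?thesis using nn_integral_env_coordinate[OF measurable_\<sigma>2_of] by simp
qed

lemma integrable_sigma2: "integrable L (\<lambda>x. enn2real (\<sigma>2_of (\<eta> (x 0))))"
proof (rule integrableI_nonneg)
  show "(\<lambda>x. enn2real (\<sigma>2_of (\<eta> (x 0)))) \<in> borel_measurable L"
    by (rule measurable_coordinate_L[of "\<lambda>e. enn2real (\<sigma>2_of (\<eta> e))"]) measurable
qed (use nn_integral_sigma2 sigma2_finite in auto)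

lemma s2_pos: "0 < s2"
proof -
  have "ennreal s2 = (\<integral>\<^sup>+\<omega>. \<sigma>2_of (\<eta> (\<xi> 0 \<omega>)) \<partial>M)"
    unfolding s2_def nn_integral_sigma2[symmetric] by (rule nn_integral_eq_integral[symmetric, OF integrable_sigma2]) simp
  with sigma2_pos have "0 < ennreal s2" by simp
  then show ?thesis by simp
qed

lemma integrable_tail_env: "integrable L (\<lambda>x. tail_env K (x 0))"
proof (rule Bochner_Integration.integrable_bound[OF integrable_sigma2])
  show "(\<lambda>x. tail_env K (x 0)) \<in> borel_measurable L" by (rule measurable_coordinate_L) measurable
  show "AE x in L. norm (tail_env K (x 0)) \<le> norm (enn2real (\<sigma>2_of (\<eta> (x 0))))"
    using AE_regular_env
  proof eventually_elim
    case (elim x)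
    show ?case using tail_var_le_var_of[OF regular_env_sq_dist(1)[OF elim], of K 0] tail_var_nonneg[of K "\<nu>_of (\<eta> (x 0))"]
      unfolding regular_env_sq_dist(2,3)[OF elim] by simp
  qed
qed

lemma tail_env_limit: "(\<lambda>n. LINT x|L. tail_env (real n) (x 0)) \<longlonglongrightarrow> 0"
proof -
  have "(\<lambda>n. LINT x|L. tail_env (real n) (x 0)) \<longlonglongrightarrow> (LINT x|L. 0)"
  proof (rule integral_dominated_convergence)
    show "integrable L (\<lambda>x. enn2real (\<sigma>2_of (\<eta> (x 0))))" by (rule integrable_sigma2)
    show "AE x in L. (\<lambda>n. tail_env (real n) (x 0)) \<longlonglongrightarrow> 0"
      using AE_regular_env
    proof eventually_elim
      case (elim x)
      show ?case using tail_var_tendsto_0[OF regular_env_sq_dist(1)[OF elim], of 0] unfolding regular_env_sq_dist(3)[OF elim] .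
    qed
    show "AE x in L. norm (tail_env (real n) (x 0)) \<le> enn2real (\<sigma>2_of (\<eta> (x 0)))" for n
      using AE_regular_env
    proof eventually_elim
      case (elim x)
      show ?case using tail_var_le_var_of[OF regular_env_sq_dist(1)[OF elim], of "real n" 0] tail_var_nonneg[of "real n" "\<nu>_of (\<eta> (x 0))"]
        unfolding regular_env_sq_dist(2,3)[OF elim] by simp
    qed
  qed (use borel_measurable_integrable[OF integrable_tail_env] in auto)
  then show ?thesis by simp
qed

lemma AE_decay_pos: "AE x in L. \<forall>j. 0 < decay_env (real (Suc n)) (x j)"
proof (rule AE_env_coordinate[of "\<lambda>e. 0 < decay_env (real (Suc n)) e"])
  show "AE \<omega> in M. 0 < decay_env (real (Suc n)) (\<xi> 0 \<omega>)"
    using m0_pos_finite AE_sigma2_finite nonlattice AE_space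
  proof eventually_elim
    case (elim \<omega>)
    have "\<xi> 0 \<omega> \<in> space \<Theta>" using elim(4) measurable_space[OF \<xi>_measurable] by blast
    then have "sq_dist (\<nu>_of (\<eta> (\<xi> 0 \<omega>)))"
      using elim(1,2) by (intro sq_dist_\<nu>_of \<eta>_sets) auto
    then show ?case unfolding decay_env_def by (rule char_decay_rate_pos[OF _ elim(3)]) simp
  qed
qed measurable

text \<open>The decay rate is almost surely positive and at most 1, so its mean exists and is
  positive; the ergodic theorem turns this into linear growth of the sums.\<close>

lemma AE_decay_avg: "AE x in L. \<exists>c>0. \<forall>\<^sub>F k in sequentially. c * real k \<le> (\<Sum>j<k. decay_env (real (Suc n)) (x j))"
proof -
  have meas: "(\<lambda>x. decay_env (real (Suc n)) (x 0)) \<in> borel_measurable L" by (rule measurable_coordinate_L) measurable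
  have int: "integrable L (\<lambda>x. decay_env (real (Suc n)) (x 0))"
  proof (rule E.integrable_const_bound[OF _ meas])
    show "AE x in L. norm (decay_env (real (Suc n)) (x 0)) \<le> 1"
      using AE_decay_pos[of n] by eventually_elim (auto simp: decay_env_def char_decay_rate_le_1 abs_of_pos)
  qed
  have pos: "0 < (LINT x|L. decay_env (real (Suc n)) (x 0))"
  proof (rule ccontr)
    assume not: "\<not> ?thesis"
    have ge: "AE x in L. 0 \<le> decay_env (real (Suc n)) (x 0)"
      using AE_decay_pos[of n] by eventually_elim (auto intro: less_imp_le)
    have "(LINT x|L. decay_env (real (Suc n)) (x 0)) = 0"
      using not integral_nonneg_AE[OF ge] by simp
    then have "AE x in L. decay_env (real (Suc n)) (x 0) = 0"
      using integral_nonneg_eq_0_iff_AE[OF int ge] by simp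
    with AE_decay_pos[of n] have "AE x in L. False"
    proof eventually_elim
      case (elim x)
      from elim(1) have "0 < decay_env (real (Suc n)) (x 0)" by blast
      with elim(2) show ?case by simp
    qed
    then show False by simp
  qed
  from E.birkhoff_liminf[OF int] show ?thesis
  proof eventually_elim
    case (elim x)
    let ?c = "(LINT x|L. decay_env (real (Suc n)) (x 0)) / 2"
    have "\<forall>\<^sub>F k in sequentially. ?c * real k \<le> E.birkhoff (\<lambda>x. decay_env (real (Suc n)) (x 0)) k x"
    proof -
      have "?c < (LINT x|L. decay_env (real (Suc n)) (x 0))" using pos by linarith
      with elim show ?thesis by blast
    qed
    then show ?case using pos by (intro exI[of _ ?c]) (simp add: E.birkhoff_def E.shift_pow)
  qed
qed

lemma AE_sq_dist_seq: "AE x in L. sq_dist_seq (\<lambda>j. \<nu>_of (\<eta> (x j))) (dyadic (\<beta> - 1)) s2"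
proof -
  have \<gamma>: "1 / 2 < \<beta> - 1" using beta by simp
  have "AE x in L. \<forall>n. (\<lambda>k. E.birkhoff (\<lambda>x. tail_env (real n) (x 0)) k x / real k) \<longlonglongrightarrow> (LINT x|L. tail_env (real n) (x 0))"
    unfolding AE_all_countable by (intro allI E.birkhoff_ergodic integrable_tail_env)
  moreover have "AE x in L. \<forall>n. \<exists>c>0. \<forall>\<^sub>F k in sequentially. c * real k \<le> (\<Sum>j<k. decay_env (real (Suc n)) (x j))"
    unfolding AE_all_countable by (intro allI AE_decay_avg)
  ultimately show ?thesis
    using AE_regular_env E.birkhoff_ergodic[OF integrable_sigma2]
  proof eventually_elim
    case (elim x)
    note sq = regular_env_sq_dist[OF elim(3)]
    show ?case
    proof (rule sq_dist_seq.intro)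
      show "sq_dist (\<nu>_of (\<eta> (x j)))" for j by (rule sq(1))
      show "dyadic (\<beta> - 1) n \<le> n" for n by (rule dyadic_le[OF \<gamma>])
      show "(\<lambda>n. real (dyadic (\<beta> - 1) n) / real n) \<longlonglongrightarrow> 0" by (rule dyadic_small[OF \<gamma>])
      show "0 < s2" by (rule s2_pos)
      show "(\<lambda>n. (\<Sum>j<n. var_of (\<nu>_of (\<eta> (x j)))) / real n) \<longlonglongrightarrow> s2"
        using elim(4) unfolding sq(2) s2_def by (simp add: E.birkhoff_def E.shift_pow)
    next
      fix e :: real assume e: "0 < e"
      have "\<forall>\<^sub>F n in sequentially. (LINT x|L. tail_env (real n) (x 0)) < e"
        using order_tendstoD(2)[OF tail_env_limit e] .
      then obtain n where n: "(LINT x|L. tail_env (real n) (x 0)) < e" by (auto simp: eventually_sequentially)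
      from elim(1) have "(\<lambda>k. E.birkhoff (\<lambda>x. tail_env (real n) (x 0)) k x / real k) \<longlonglongrightarrow> (LINT x|L. tail_env (real n) (x 0))" by blast
      from order_tendstoD(2)[OF this n] have "\<forall>\<^sub>F k in sequentially. (\<Sum>j<k. tail_var (real n) (\<nu>_of (\<eta> (x j)))) / real k \<le> e"
        unfolding sq(3) by eventually_elim (simp add: E.birkhoff_def E.shift_pow)
      then show "\<exists>K\<ge>0. \<forall>\<^sub>F k in sequentially. (\<Sum>j<k. tail_var K (\<nu>_of (\<eta> (x j)))) / real k \<le> e"
        by (intro exI[of _ "real n"]) simp
    next
      fix R :: real assume R: "0 < R"
      \<comment> \<open>A rate for a larger interval also serves \<open>R\<close>. Restricting to
        integer bounds leaves countably many averages and hence one null set; \<open>Suc n\<close>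
        keeps the bound positive.\<close>
      obtain n :: nat where n: "R \<le> real n" using real_arch_simple by blast
      obtain c where c: "0 < c" "\<forall>\<^sub>F k in sequentially. c * real k \<le> (\<Sum>j<k. decay_env (real (Suc n)) (x j))"
        using elim(2) by blast
      have rd: "real_distribution (\<nu>_of (\<eta> (x j)))" for j using sq(1) by (simp add: sq_dist_def)
      show "\<exists>w c. 0 < c \<and> (\<forall>j. 0 \<le> w j \<and> w j \<le> 1 \<and> (\<forall>t. \<bar>t\<bar> \<le> R \<longrightarrow> (cmod (char (\<nu>_of (\<eta> (x j))) t))\<^sup>2 \<le> 1 - w j * t\<^sup>2)) \<and>
         (\<forall>\<^sub>F n in sequentially. c * real n \<le> (\<Sum>j<n. w j))"
      proof (intro exI[of _ "\<lambda>j. decay_env (real (Suc n)) (x j)"] exI[of _ c] conjI c allI impI)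
        fix j
        show "0 \<le> decay_env (real (Suc n)) (x j)" "decay_env (real (Suc n)) (x j) \<le> 1"
          unfolding decay_env_def by (intro char_decay_rate_nonneg[OF rd] char_decay_rate_le_1; simp)+
        fix t :: real assume "\<bar>t\<bar> \<le> R"
        then show "(cmod (char (\<nu>_of (\<eta> (x j))) t))\<^sup>2 \<le> 1 - decay_env (real (Suc n)) (x j) * t\<^sup>2"
          unfolding decay_env_def using n by (intro char_decay_rate_bound[OF rd]) simp
      qed
    qed
  qed
qed

section \<open>The limit event and its joint measurability\<close>

definition limit_event :: "real \<Rightarrow> real \<Rightarrow> (nat \<Rightarrow> 'b) \<Rightarrow> (nat list \<Rightarrow> offspring) \<Rightarrow> bool" where
  "limit_event a b x t \<longleftrightarrow> (filterlim (\<lambda>n. Z t n UNIV) at_top sequentially \<longrightarrow>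
      (\<lambda>n. scaling \<eta> x n * (real (Z t n {a + centering \<eta> x n <..< b + centering \<eta> x n}) / real (Z t n UNIV)))
        \<longlonglongrightarrow> 1 / sqrt (2 * pi) * (b - a))"

text \<open>Three limits are combined: \<open>scaling\<close> over \<open>sqrt n\<close> tends to
  \<open>sqrt s2\<close>, the count scaled by \<open>sqrt n / P n\<close> tends to a multiple of the
  limit of \<open>W\<close>, and \<open>W\<close> itself tends to that limit. Survival makes the
  latter nonzero, so it cancels.\<close>

lemma quenched_limit_event:
  assumes ab: "a < b" and x: "regular_env x" and C: "0 < C" "\<And>n. C * exp (3 * rate * real n) \<le> mean_prod x n"
    and s: "summable (\<lambda>j. real (Suc j) powr (\<beta> - 1) * quenched.mean_over (\<lambda>j. \<eta> (x j)) (exp (rate * real j)) j)"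
    and rec: "\<forall>e>0. \<exists>q (R::nat). \<exists>\<^sub>\<infinity>k. excess q (\<lambda>i. x (k + i)) \<le> ennreal e \<and> roughness q (\<lambda>i. x (k + i)) \<le> ennreal (real R)"
    and llt: "sq_dist_seq (\<lambda>j. \<nu>_of (\<eta> (x j))) (dyadic (\<beta> - 1)) s2"
  shows "AE t in quenched_law \<eta> x. limit_event a b x t"
proof -
  interpret quenched_growth "\<lambda>j. \<eta> (x j)" rate C by (rule regular_env_growth[OF x C s])
  interpret quenched_llt "\<lambda>j. \<eta> (x j)" rate C s2 "\<beta> - 1"
    by (intro quenched_llt.intro quenched_growth_axioms quenched_llt_axioms.intro s llt) (use beta in simp)
  have Q: "quenched_law \<eta> x = Q" by (simp add: Q_def quenched_law_def)
  have center: "center n = centering \<eta> x n" for n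
    unfolding center_def centering_def L.mean_def \<mu>_of_def ..
  have scal: "(\<lambda>n. scaling \<eta> x n / sqrt (real n)) \<longlonglongrightarrow> sqrt s2"
    using tendsto_real_sqrt[OF L.var_avg] unfolding scaling_def regular_env_sq_dist(2)[OF x] by (simp only: real_sqrt_divide)
  show ?thesis
    unfolding Q using quenched_local_limit[OF ab] regular_env_survival[OF x rec]
  proof eventually_elim
    case (elim t)
    let ?A = "\<lambda>n. {a + centering \<eta> x n <..< b + centering \<eta> x n}"
    let ?w = "lim (\<lambda>n. W n t)"
    show ?case
      unfolding limit_event_def
    proof
      assume "filterlim (\<lambda>n. Z t n UNIV) at_top sequentially"
      then have surv: "filterlim (\<lambda>n. card (particles t n)) at_top sequentially" by (simp add: Z_def)
      have w: "(\<lambda>n. W n t) \<longlonglongrightarrow> ?w" using elim(1) by (simp add: convergent_LIMSEQ_iff)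
      have w0: "?w \<noteq> 0" using elim(2) surv w by auto
      have lim: "(\<lambda>n. sqrt (real n) * (real (Z t n (?A n)) / P n)) \<longlonglongrightarrow> (b - a) / (sqrt s2 * sqrt (2 * pi)) * ?w"
        using elim(1) unfolding center by (simp add: Z_def)
      have "(\<lambda>n. scaling \<eta> x n / sqrt (real n) * (sqrt (real n) * (real (Z t n (?A n)) / P n)) / W n t)
        \<longlonglongrightarrow> sqrt s2 * ((b - a) / (sqrt s2 * sqrt (2 * pi)) * ?w) / ?w"
        by (intro tendsto_divide tendsto_mult scal lim w w0)
      also have "sqrt s2 * ((b - a) / (sqrt s2 * sqrt (2 * pi)) * ?w) / ?w = 1 / sqrt (2 * pi) * (b - a)"
        using w0 s2_pos by simp
      finally show "(\<lambda>n. scaling \<eta> x n * (real (Z t n (?A n)) / real (Z t n UNIV))) \<longlonglongrightarrow> 1 / sqrt (2 * pi) * (b - a)"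
      proof (rule Lim_transform_eventually)
        show "\<forall>\<^sub>F n in sequentially. scaling \<eta> x n / sqrt (real n) * (sqrt (real n) * (real (Z t n (?A n)) / P n)) / W n t
          = scaling \<eta> x n * (real (Z t n (?A n)) / real (Z t n UNIV))"
          using eventually_gt_at_top[of 0]
        proof eventually_elim
          case (elim n)
          then show ?case using P_pos[of n] by (simp add: W_def Z_def)
        qed
      qed
    qed
  qed
qed

lemma measurable_tree_coord:
  "(\<lambda>z. fst (snd z u)) \<in> env \<Otimes>\<^sub>M tree_space \<rightarrow>\<^sub>M count_space UNIV"
  "(\<lambda>z. snd (snd z u) i) \<in> borel_measurable (env \<Otimes>\<^sub>M tree_space)"
proof -
  have "(\<lambda>z. snd z u) \<in> env \<Otimes>\<^sub>M tree_space \<rightarrow>\<^sub>M offspring_space" by measurable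
  from measurable_compose[OF this measurable_fst_offspring] measurable_compose[OF this measurable_snd_offspring]
  show "(\<lambda>z. fst (snd z u)) \<in> env \<Otimes>\<^sub>M tree_space \<rightarrow>\<^sub>M count_space UNIV"
    "(\<lambda>z. snd (snd z u) i) \<in> borel_measurable (env \<Otimes>\<^sub>M tree_space)" .
qed

lemma measurable_env_coord:
  "f \<in> borel_measurable \<Theta> \<Longrightarrow> (\<lambda>z. f (fst z j)) \<in> borel_measurable (env \<Otimes>\<^sub>M tree_space)"
proof -
  assume f: "f \<in> borel_measurable \<Theta>"
  have "(\<lambda>z. fst z j) \<in> env \<Otimes>\<^sub>M tree_space \<rightarrow>\<^sub>M \<Theta>" by measurable
  from measurable_compose[OF this f] show ?thesis .
qed

lemma measurable_Z_interval:
  assumes [measurable]: "lo \<in> borel_measurable (env \<Otimes>\<^sub>M tree_space)" "hi \<in> borel_measurable (env \<Otimes>\<^sub>M tree_space)"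
  shows "(\<lambda>z. real (Z (snd z) n {lo z<..<hi z})) \<in> borel_measurable (env \<Otimes>\<^sub>M tree_space)"
    "(\<lambda>z. real (Z (snd z) n UNIV)) \<in> borel_measurable (env \<Otimes>\<^sub>M tree_space)"
proof -
  have [measurable]: "Measurable.pred (env \<Otimes>\<^sub>M tree_space) (\<lambda>z. u \<in> particles (snd z) n)" for u
  proof -
    have [measurable]: "Measurable.pred (env \<Otimes>\<^sub>M tree_space) (\<lambda>z. c < fst (snd z v))" for c v
      by (rule measurable_compose[OF measurable_tree_coord(1)]) simp
    show ?thesis unfolding particles_iff by measurable
  qed
  have [measurable]: "(\<lambda>z. position (snd z) u) \<in> borel_measurable (env \<Otimes>\<^sub>M tree_space)" for u
    unfolding position_def by (intro borel_measurable_sum measurable_tree_coord(2))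
  have Z_sum: "real (Z t n {l<..<h}) = (\<Sum>u\<in>particles t n. if l < position t u \<and> position t u < h then 1 else 0)" for t l h
    unfolding Z_def by (simp add: sum.If_cases finite_particles Int_def)
  show "(\<lambda>z. real (Z (snd z) n {lo z<..<hi z})) \<in> borel_measurable (env \<Otimes>\<^sub>M tree_space)"
    unfolding Z_sum by (rule borel_measurable_LIMSEQ_metric[OF _ sum_list_box_tendsto]) measurable
  have Z_UNIV: "real (Z t n UNIV) = (\<Sum>u\<in>particles t n. 1)" for t by (simp add: Z_def)
  show "(\<lambda>z. real (Z (snd z) n UNIV)) \<in> borel_measurable (env \<Otimes>\<^sub>M tree_space)"
    unfolding Z_UNIV by (rule borel_measurable_LIMSEQ_metric[OF _ sum_list_box_tendsto]) measurable
qed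

text \<open>Both convergence statements are rewritten with quantifiers over naturals only, whose
  measurability is immediate.\<close>

lemma measurable_limit_event: "Measurable.pred (env \<Otimes>\<^sub>M tree_space) (\<lambda>(x, t). limit_event a b x t)"
proof -
  have [measurable]: "(\<lambda>z. centering \<eta> (fst z) n) \<in> borel_measurable (env \<Otimes>\<^sub>M tree_space)" for n
    unfolding centering_def by (intro borel_measurable_sum measurable_env_coord[OF measurable_\<mu>_of])
  have [measurable]: "(\<lambda>z. scaling \<eta> (fst z) n) \<in> borel_measurable (env \<Otimes>\<^sub>M tree_space)" for n
  proof -
    have "(\<lambda>e. enn2real (\<sigma>2_of (\<eta> e))) \<in> borel_measurable \<Theta>" by measurable
    then have [measurable]: "(\<lambda>z. enn2real (\<sigma>2_of (\<eta> (fst z j)))) \<in> borel_measurable (env \<Otimes>\<^sub>M tree_space)" for j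
      by (rule measurable_env_coord)
    show ?thesis unfolding scaling_def by measurable
  qed
  define f where "f n z = scaling \<eta> (fst z) n * (real (Z (snd z) n {a + centering \<eta> (fst z) n <..< b + centering \<eta> (fst z) n}) / real (Z (snd z) n UNIV))"
    for n and z :: "(nat \<Rightarrow> 'b) \<times> (nat list \<Rightarrow> offspring)"
  have [measurable]: "(\<lambda>z. real (Z (snd z) n UNIV)) \<in> borel_measurable (env \<Otimes>\<^sub>M tree_space)" for n
    by (rule measurable_Z_interval[of "\<lambda>_. 0" "\<lambda>_. 0"]) auto
  have [measurable]: "(\<lambda>z. real (Z (snd z) n {a + centering \<eta> (fst z) n <..< b + centering \<eta> (fst z) n})) \<in> borel_measurable (env \<Otimes>\<^sub>M tree_space)" for n
    by (rule measurable_Z_interval) measurable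
  have [measurable]: "f n \<in> borel_measurable (env \<Otimes>\<^sub>M tree_space)" for n
    unfolding f_def[abs_def] by measurable
  have eq: "(\<lambda>(x, t). limit_event a b x t) = (\<lambda>z. (\<forall>K. \<exists>n0. \<forall>n\<ge>n0. real K \<le> real (Z (snd z) n UNIV)) \<longrightarrow>
     (\<forall>r::nat. \<exists>n0. \<forall>n\<ge>n0. \<bar>f n z - 1 / sqrt (2 * pi) * (b - a)\<bar> < 1 / real (Suc r)))"
  proof (rule ext, clarify)
    fix x t
    have 1: "filterlim (\<lambda>n. Z t n UNIV) at_top sequentially \<longleftrightarrow> (\<forall>K. \<exists>n0. \<forall>n\<ge>n0. real K \<le> real (Z t n UNIV))"
      by (simp add: filterlim_at_top eventually_sequentially)
    have 2: "(\<lambda>n. f n (x, t)) \<longlonglongrightarrow> l \<longleftrightarrow> (\<forall>r::nat. \<exists>n0. \<forall>n\<ge>n0. \<bar>f n (x, t) - l\<bar> < 1 / real (Suc r))" for l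
      unfolding lim_sequentially dist_real_def
    proof safe
      fix r :: nat assume "\<forall>e>0. \<exists>no. \<forall>n\<ge>no. \<bar>f n (x, t) - l\<bar> < e"
      then show "\<exists>n0. \<forall>n\<ge>n0. \<bar>f n (x, t) - l\<bar> < 1 / real (Suc r)" by simp
    next
      fix e :: real assume *: "\<forall>r. \<exists>n0. \<forall>n\<ge>n0. \<bar>f n (x, t) - l\<bar> < 1 / real (Suc r)" and "0 < e"
      then obtain r where r: "inverse (real (Suc r)) < e" using reals_Archimedean by blast
      from * obtain n0 where "\<forall>n\<ge>n0. \<bar>f n (x, t) - l\<bar> < 1 / real (Suc r)" by blast
      with r show "\<exists>no. \<forall>n\<ge>no. \<bar>f n (x, t) - l\<bar> < e"
        by (intro exI[of _ n0]) (auto simp: inverse_eq_divide intro: less_trans)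
    qed
    show "limit_event a b x t \<longleftrightarrow> ((\<forall>K. \<exists>n0. \<forall>n\<ge>n0. real K \<le> real (Z (snd (x, t)) n UNIV)) \<longrightarrow>
      (\<forall>r::nat. \<exists>n0. \<forall>n\<ge>n0. \<bar>f n (x, t) - 1 / sqrt (2 * pi) * (b - a)\<bar> < 1 / real (Suc r)))"
      unfolding limit_event_def 1 2[symmetric] by (simp add: f_def)
  qed
  show ?thesis unfolding eq by measurable
qed

theorem annealed_local_limit:
  assumes ab: "a < b"
  shows "AE \<omega> in M. limit_event a b (\<lambda>n. \<xi> n \<omega>) (\<lambda>u. X u \<omega>)"
proof (rule AE_annealed[OF measurable_limit_event])
  show "AE x in L. AE t in quenched_law \<eta> x. limit_event a b x t"
    using AE_regular_env AE_growth AE_over AE_recurrence AE_sq_dist_seq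
  proof eventually_elim
    case (elim x)
    then obtain C where C: "0 < C" "\<And>n. C * exp (3 * rate * real n) \<le> mean_prod x n" by blast
    show ?case by (rule quenched_limit_event[OF ab elim(1) C elim(3,4,5)])
  qed
qed

end

theorem corollary10p5:
  fixes M :: "'w measure" and \<Theta> :: "'e measure"
    and \<eta> :: "'e \<Rightarrow> offspring measure"
    and \<xi> :: "nat \<Rightarrow> 'w \<Rightarrow> 'e" and X :: "nat list \<Rightarrow> 'w \<Rightarrow> offspring"
    and \<epsilon> \<beta> :: real
  assumes brw: "brw_random_environment M \<Theta> \<eta> \<xi> X"
    \<comment> \<open>\<open>\<E> log m\<^sub>0 \<in> (0,\<infinity>)\<close>; finiteness forces \<open>m\<^sub>0 \<in> (0,\<infinity>)\<close> almost surely\<close>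
    and m0_pos_finite: "AE \<omega> in M. 0 < mean_offspring (\<eta> (\<xi> 0 \<omega>)) \<and> mean_offspring (\<eta> (\<xi> 0 \<omega>)) < \<infinity>"
    and log_m0_integrable: "integrable M (\<lambda>\<omega>. ln (enn2real (mean_offspring (\<eta> (\<xi> 0 \<omega>)))))"
    and supercritical: "0 < (\<integral>\<omega>. ln (enn2real (mean_offspring (\<eta> (\<xi> 0 \<omega>)))) \<partial>M)"
    and N_log_N: "(\<integral>\<^sup>+\<omega>. of_nat (fst (X [] \<omega>)) / mean_offspring (\<eta> (\<xi> 0 \<omega>))
                        * ennreal (log_plus (real (fst (X [] \<omega>)))) \<partial>M) < \<infinity>"
    and nonlattice: "AE \<omega> in M. non_lattice (\<nu>_of (\<eta> (\<xi> 0 \<omega>)))"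
    and eps_pos: "\<epsilon> > 0"
    and mu_moment: "(\<integral>\<^sup>+\<omega>. ennreal (\<bar>\<mu>_of (\<eta> (\<xi> 0 \<omega>))\<bar> powr \<epsilon>) \<partial>M) < \<infinity>"
    and sigma2_pos: "0 < (\<integral>\<^sup>+\<omega>. \<sigma>2_of (\<eta> (\<xi> 0 \<omega>)) \<partial>M)"
    and sigma2_finite: "(\<integral>\<^sup>+\<omega>. \<sigma>2_of (\<eta> (\<xi> 0 \<omega>)) \<partial>M) < \<infinity>"
    and beta: "\<beta> > 3 / 2"
    and N_log_N_beta: "(\<integral>\<^sup>+\<omega>. of_nat (fst (X [] \<omega>)) / mean_offspring (\<eta> (\<xi> 0 \<omega>))
                        * ennreal (log_plus (real (fst (X [] \<omega>))) powr \<beta>) \<partial>M) < \<infinity>"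
  shows "\<forall>a b :: real. a < b \<longrightarrow>
    (AE \<omega> in M. filterlim (\<lambda>n. Z (\<lambda>u. X u \<omega>) n UNIV) at_top sequentially \<longrightarrow>
      (\<lambda>n. scaling \<eta> (\<lambda>i. \<xi> i \<omega>) n
           * (real (Z (\<lambda>u. X u \<omega>) n {a + centering \<eta> (\<lambda>i. \<xi> i \<omega>) n <..< b + centering \<eta> (\<lambda>i. \<xi> i \<omega>) n})
              / real (Z (\<lambda>u. X u \<omega>) n UNIV)))
        \<longlonglongrightarrow> 1 / sqrt (2 * pi) * (b - a))"
proof -
  interpret brw_random_environment M \<Theta> \<eta> \<xi> X by (rule brw)
  interpret brw_local_limit M \<Theta> \<eta> \<xi> X \<beta>
    by unfold_locales (rule m0_pos_finite log_m0_integrable supercritical nonlattice sigma2_pos sigma2_finite beta N_log_N_beta)+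
  show ?thesis
    using annealed_local_limit unfolding limit_event_def by blast
qed

end
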